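(* Let $p$ be a prime. For all $\alpha, \beta>0$ there exists $c>0$ such that the following holds. Let $A$ and $B$ be non-empty subsets of $\mathbb{Z}_p$ with $\alpha |B| \leq |A| \leq \alpha^{-1} |B|$ and $|A|+|B| \leq (1-\beta)p$. Then, for any integers $1 \leq c_1 \leq |A|$ and $1 \leq c_2 \leq |B|$ such that $c_1c_2 \geq c\max(|A|,|B|)$, there exist subsets $A' \subset A$ and $B' \subset B$ with $|A'|=c_1$ and $|B'|=c_2$ such that $|A'+B'| \geq |A|+|B|-1$.
   Context: $A+B=\{a+b: a\in A, b\in B\}$ denotes the sumset. The constant $c$ depends only on $\alpha$ and $\beta$ (not on $p$, $A$, $B$). *)

theory Defs
  imports Complex_Main "HOL-Number_Theory.Residues" "HOL-Algebra.AbelCoset"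
begin

end

theory Submission
  imports Defs "HOL-Library.FuncSet"
begin

text \<open>
  Write \<open>n\<close> for the larger of the two cardinalities and \<open>r(x)\<close> for the number of representations of \<open>x\<close>
  as a sum. By the second moment method, random subsets of sizes \<open>c\<^sub>1\<close> and \<open>c\<^sub>2\<close> already have sumset
  of size about \<open>(\<Sum>x. min t (r x)) / t\<close>, where \<open>t\<close> is a small multiple of \<open>n\<close>. So if the claim fails, this
  truncated sum exceeds Pollard's lower bound only by a small multiple of \<open>n\<close>, for which there
  must be structure: repeatedly intersecting one set with its translates preserves the extremality and yields
  a small set of shifts that almost preserve the other set \<open>Y\<close>. The shifts that move few
  elements of \<open>Y\<close> then grow as slowly as Cauchy-Davenport allows. A large Fourier coefficient of \<open>Y\<close>
  places them, after dilation, in a short interval, where a Freiman-type argument makes them an interval, and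
  hence \<open>Y\<close> is nearly an interval. The other set is then nearly an interval as well.

  For two near-intervals one constructs the subsets. A residue class of \<open>B\<close> modulo \<open>q\<close> with
  boundedly many elements from each residue class of \<open>A\<close> gives all of \<open>|A| + |B|\<close> up to \<open>q\<close>, as sums of
  integers without wrap-around, elements far from the intervals are
  handled by random sampling or by the end points of the intervals, and the remaining deficit is below the sizes
  \<open>c\<^sub>1\<close> and \<open>c\<^sub>2\<close>, so it is repaired by adding pairs of elements one at a time, as Cauchy-Davenport
  provides a new sum each time.
\<close>

section \<open>Representation counts and Pollard's theorem\<close>

text \<open>The obstacle is exactness. A random choice reaches only a proportion of the available
  sums, and adding pairs one at a time repairs a deficit of at most the smaller of
  \<open>c\<^sub>1\<close> and \<open>c\<^sub>2\<close>, which may be bounded. So sampling alone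
  settles only the pairs without structure, and near-intervals need a construction whose deficit is
  a small multiple of that smaller size. This dictates the modulus: with \<open>q\<close> about
  \<open>\<eta> * c1 / 100\<close>, boundedly many elements from each of \<open>q\<close> classes
  fit into \<open>c1\<close>, while one class of \<open>B\<close> has about \<open>n / q\<close>
  elements and fits into \<open>c2\<close> exactly because \<open>c1 * c2\<close> is a large
  multiple of \<open>n\<close>. The constants are nested: \<alpha> and \<beta> determine
  \<open>R\<close>, \<open>C\<close>, \<eta> and the tolerance \<epsilon> of the near-intervals;
  \<epsilon> determines the number of uncrossing steps. Each step doubles the error but shrinks the
  set by a fixed factor only, so the admissible initial error and truncation level are chosen after
  the number of steps, and the constant of the theorem after everything else.\<close>

declare sum_of_bool_eq [simp del]

lemma add_min_le: "a \<le> i \<Longrightarrow> i \<le> t \<Longrightarrow> a + min (t - i) b \<le> min t (a + b)" for a b i t :: nat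
  by (auto simp: min_def)

lemma card_of_bool_sum: "finite A \<Longrightarrow> card {a \<in> A. Q a} = (\<Sum>a\<in>A. of_bool (Q a))"
  by (simp add: sum.If_cases of_bool_def Int_def conj_commute)

locale zp =
  fixes p :: int
  assumes prime_p: "prime p"
begin

abbreviation G :: "int set" where "G \<equiv> {0..<p}"

text \<open>Encoded as a preimage rather than an image, so that intersections, differences and
  inclusions pass through a translation by unfolding alone. The shift may be any integer, not only a
  representative in \<open>G\<close>.\<close>

definition tr :: "int \<Rightarrow> int set \<Rightarrow> int set" where
  "tr s A = {x \<in> G. (x - s) mod p \<in> A}"

definition rr :: "int set \<Rightarrow> int set \<Rightarrow> int \<Rightarrow> nat" where
  "rr A B x = card {a \<in> A. (x - a) mod p \<in> B}"

definition sm :: "int set \<Rightarrow> int set \<Rightarrow> int set" where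
  "sm A B = (\<lambda>(a, b). (a + b) mod p) ` (A \<times> B)"

definition pol :: "nat \<Rightarrow> int set \<Rightarrow> int set \<Rightarrow> nat" where
  "pol t X Y = (\<Sum>x\<in>G. min t (rr X Y x))"

lemma p_gt1: "p > 1"
  using prime_p prime_gt_1_int by blast

lemma p_pos [simp]: "p > 0"
  using p_gt1 by simp

lemma mod_in_G [simp]: "x mod p \<in> G"
  by simp

lemma mod_G: "x \<in> G \<Longrightarrow> x mod p = x"
  by simp

lemma finite_sub_G: "A \<subseteq> G \<Longrightarrow> finite A"
  using finite_subset by blast

lemma bij_shift: "bij_betw (\<lambda>x. (x + s) mod p) G G"
  by (rule bij_betw_byWitness[where f' = "\<lambda>x. (x - s) mod p"]) (auto simp: mod_simps)

lemma bij_reflect: "bij_betw (\<lambda>x. (s - x) mod p) G G"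
  by (rule bij_betw_byWitness[where f' = "\<lambda>x. (s - x) mod p"]) (auto simp: mod_simps)

lemma sum_shift: "(\<Sum>x\<in>G. F ((x + s) mod p)) = (\<Sum>x\<in>G. F x)"
  using sum.reindex_bij_betw[OF bij_shift, of F s] by simp

lemma sum_shift_minus: "(\<Sum>x\<in>G. F ((x - s) mod p)) = (\<Sum>x\<in>G. F x)"
  using sum_shift[of F "- s"] by simp

lemma sum_reflect: "(\<Sum>x\<in>G. F ((s - x) mod p)) = (\<Sum>x\<in>G. F x)"
  using sum.reindex_bij_betw[OF bij_reflect, of F s] by simp

lemma card_G_sum: "A \<subseteq> G \<Longrightarrow> card A = (\<Sum>x\<in>G. of_bool (x \<in> A))"
proof -
  assume "A \<subseteq> G"
  then have "A = {x \<in> G. x \<in> A}" by blast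
  then show ?thesis using card_of_bool_sum[of G "\<lambda>x. x \<in> A"] by simp
qed

lemma tr_sub [simp]: "tr s A \<subseteq> G"
  by (auto simp: tr_def)

lemma finite_tr [simp]: "finite (tr s A)"
  using tr_sub finite_sub_G by blast

lemma card_tr: "A \<subseteq> G \<Longrightarrow> card (tr s A) = card A"
  unfolding card_G_sum[OF tr_sub] card_G_sum[of A] sum_shift_minus[of "\<lambda>x. of_bool (x \<in> A)" s, symmetric]
  by (intro sum.cong) (auto simp: tr_def)

lemma tr_tr: "tr s (tr t A) = tr (s + t) A"
  by (auto simp: tr_def mod_simps algebra_simps)

lemma tr_mod: "tr (s mod p) A = tr s A"
  by (auto simp: tr_def mod_simps)

lemma tr_0: "A \<subseteq> G \<Longrightarrow> tr 0 A = A"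
  by (auto simp: tr_def)

lemma tr_Int: "tr s (A \<inter> B) = tr s A \<inter> tr s B"
  and tr_Diff: "tr s (A - B) = tr s A - tr s B"
  by (auto simp: tr_def)

lemma tr_mono: "A \<subseteq> B \<Longrightarrow> tr s A \<subseteq> tr s B"
  by (auto simp: tr_def)

lemma mod_add_in_tr: "A \<subseteq> G \<Longrightarrow> a \<in> A \<Longrightarrow> (a + s) mod p \<in> tr s A"
  by (auto simp: tr_def mod_simps)

lemma rr_sum: "A \<subseteq> G \<Longrightarrow> rr A B x = (\<Sum>a\<in>A. of_bool ((x - a) mod p \<in> B))"
  unfolding rr_def by (rule card_of_bool_sum) (rule finite_sub_G)

lemma rr_le: "A \<subseteq> G \<Longrightarrow> rr A B x \<le> card A"
  unfolding rr_def by (rule card_mono) (auto dest: finite_sub_G)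

lemma rr_G_sum: "A \<subseteq> G \<Longrightarrow> rr A B x = (\<Sum>a\<in>G. of_bool (a \<in> A) * of_bool ((x - a) mod p \<in> B))"
proof -
  assume A: "A \<subseteq> G"
  have "(\<Sum>a\<in>G. of_bool (a \<in> A) * of_bool ((x - a) mod p \<in> B)) =
      (\<Sum>a\<in>A. of_bool (a \<in> A) * of_bool ((x - a) mod p \<in> B) :: nat)"
    by (rule sum.mono_neutral_right) (use A in auto)
  also have "\<dots> = rr A B x"
    by (simp add: rr_sum[OF A])
  finally show ?thesis by simp
qed

lemma rr_commute: "A \<subseteq> G \<Longrightarrow> B \<subseteq> G \<Longrightarrow> rr A B x = rr B A x"
proof -
  assume A: "A \<subseteq> G" and B: "B \<subseteq> G"
  have "rr A B x = (\<Sum>a\<in>G. of_bool ((x - a) mod p \<in> A) * of_bool ((x - (x - a) mod p) mod p \<in> B))"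
    unfolding rr_G_sum[OF A]
    by (rule sum_reflect[of "\<lambda>a. of_bool (a \<in> A) * of_bool ((x - a) mod p \<in> B)" x, symmetric])
  also have "\<dots> = (\<Sum>a\<in>G. of_bool (a \<in> B) * of_bool ((x - a) mod p \<in> A))"
    by (rule sum.cong) (auto simp: mod_simps)
  finally show ?thesis using rr_G_sum[OF B] by simp
qed

lemma rr_mono: "A \<subseteq> A' \<Longrightarrow> B \<subseteq> B' \<Longrightarrow> A' \<subseteq> G \<Longrightarrow> rr A B x \<le> rr A' B' x"
  unfolding rr_def by (rule card_mono) (auto dest: finite_sub_G)

lemma rr_mod [simp]: "rr A B (x mod p) = rr A B x"
  by (simp add: rr_def mod_simps)

lemma rr_Un_left: "A \<subseteq> G \<Longrightarrow> A' \<subseteq> G \<Longrightarrow> A \<inter> A' = {} \<Longrightarrow> rr (A \<union> A') B x = rr A B x + rr A' B x"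
  by (simp add: rr_sum sum.union_disjoint finite_sub_G)

lemma rr_Un_Int: "A \<subseteq> G \<Longrightarrow> A' \<subseteq> G \<Longrightarrow> rr (A \<union> A') B x + rr (A \<inter> A') B x = rr A B x + rr A' B x"
proof -
  assume A: "A \<subseteq> G" "A' \<subseteq> G"
  then have "A \<inter> A' \<subseteq> G" by auto
  then show ?thesis
    using A by (simp add: rr_sum sum.union_inter finite_sub_G)
qed

lemma rr_Un_right: "A \<subseteq> G \<Longrightarrow> B \<inter> B' = {} \<Longrightarrow> rr A (B \<union> B') x = rr A B x + rr A B' x"
  unfolding rr_sum sum.distrib[symmetric] by (rule sum.cong) auto

lemma rr_tr_left: "A \<subseteq> G \<Longrightarrow> rr (tr s A) B x = rr A B (x - s)"
proof -
  assume A: "A \<subseteq> G"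
  have "rr (tr s A) B x = (\<Sum>a\<in>G. of_bool ((a - s) mod p \<in> A) * of_bool ((x - a) mod p \<in> B))"
    unfolding rr_G_sum[OF tr_sub] by (intro sum.cong) (auto simp: tr_def)
  also have "\<dots> = (\<Sum>a\<in>G. (\<lambda>b. of_bool (b \<in> A) * of_bool ((x - s - b) mod p \<in> B)) ((a - s) mod p))"
    by (rule sum.cong) (auto simp: mod_simps)
  also have "\<dots> = rr A B (x - s)"
    by (subst sum_shift_minus) (rule rr_G_sum[OF A, symmetric])
  finally show ?thesis .
qed

lemma rr_tr_right: "A \<subseteq> G \<Longrightarrow> B \<subseteq> G \<Longrightarrow> rr A (tr s B) x = rr A B (x - s)"
  by (metis rr_commute rr_tr_left tr_sub)

lemma sum_rr: "A \<subseteq> G \<Longrightarrow> B \<subseteq> G \<Longrightarrow> (\<Sum>x\<in>G. rr A B x) = card A * card B"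
proof -
  assume A: "A \<subseteq> G" and B: "B \<subseteq> G"
  have "(\<Sum>x\<in>G. rr A B x) = (\<Sum>a\<in>A. \<Sum>x\<in>G. of_bool ((x - a) mod p \<in> B))"
    unfolding rr_sum[OF A] by (rule sum.swap)
  also have "\<dots> = (\<Sum>a\<in>A. card B)"
    by (rule sum.cong) (simp_all add: sum_shift_minus[of "\<lambda>x. of_bool (x \<in> B)"] card_G_sum[OF B])
  finally show ?thesis by simp
qed

lemma sum_rr_pairs:
  assumes A: "A \<subseteq> G" and B: "B \<subseteq> G" and W: "W \<subseteq> G"
  shows "(\<Sum>x\<in>W. rr A B x) = (\<Sum>a\<in>A. card (tr a B \<inter> W))"
proof -
  have "(\<Sum>x\<in>W. rr A B x) = (\<Sum>a\<in>A. \<Sum>x\<in>W. of_bool ((x - a) mod p \<in> B))"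
    unfolding rr_sum[OF A] by (rule sum.swap)
  also have "\<dots> = (\<Sum>a\<in>A. card (tr a B \<inter> W))"
  proof (rule sum.cong)
    fix a assume "a \<in> A"
    have "tr a B \<inter> W = {x \<in> W. (x - a) mod p \<in> B}"
      using W by (auto simp: tr_def)
    then show "(\<Sum>x\<in>W. of_bool ((x - a) mod p \<in> B)) = card (tr a B \<inter> W)"
      using card_of_bool_sum[OF finite_sub_G[OF W]] by simp
  qed simp
  finally show ?thesis .
qed

lemma sm_sub [simp]: "sm A B \<subseteq> G"
  by (auto simp: sm_def)

lemma finite_sm [simp]: "finite (sm A B)"
  using sm_sub finite_sub_G by blast

lemma sm_mono: "A \<subseteq> A' \<Longrightarrow> B \<subseteq> B' \<Longrightarrow> sm A B \<subseteq> sm A' B'"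
  by (auto simp: sm_def)

lemma sm_commute: "sm A B = sm B A"
  by (auto simp: sm_def image_iff add.commute) (metis add.commute)+

lemma sm_I: "a \<in> A \<Longrightarrow> b \<in> B \<Longrightarrow> (a + b) mod p \<in> sm A B"
  by (auto simp: sm_def)

lemma mem_sm_iff: "A \<subseteq> G \<Longrightarrow> B \<subseteq> G \<Longrightarrow> x \<in> sm A B \<longleftrightarrow> x \<in> G \<and> rr A B x > 0"
proof -
  assume A: "A \<subseteq> G" and B: "B \<subseteq> G"
  have "rr A B x > 0 \<longleftrightarrow> (\<exists>a\<in>A. (x - a) mod p \<in> B)"
    using finite_sub_G[OF A] by (auto simp: rr_def card_gt_0_iff)
  moreover have "x \<in> sm A B \<longleftrightarrow> x \<in> G \<and> (\<exists>a\<in>A. (x - a) mod p \<in> B)"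
  proof
    assume "x \<in> sm A B"
    then obtain a b where ab: "a \<in> A" "b \<in> B" "x = (a + b) mod p"
      by (auto simp: sm_def)
    then have "(x - a) mod p = b"
      using B by (auto simp: mod_simps)
    then show "x \<in> G \<and> (\<exists>a\<in>A. (x - a) mod p \<in> B)"
      using ab by (auto intro!: bexI[of _ a])
  next
    assume h: "x \<in> G \<and> (\<exists>a\<in>A. (x - a) mod p \<in> B)"
    then obtain a where a: "a \<in> A" "(x - a) mod p \<in> B" by auto
    have "(a + (x - a) mod p) mod p = x"
      using h by (auto simp: mod_simps)
    then show "x \<in> sm A B"
      using sm_I[OF a] by simp
  qed
  ultimately show ?thesis by simp
qed

lemma pol_1: "A \<subseteq> G \<Longrightarrow> B \<subseteq> G \<Longrightarrow> pol 1 A B = card (sm A B)"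
proof -
  assume A: "A \<subseteq> G" and B: "B \<subseteq> G"
  have "card (sm A B) = (\<Sum>x\<in>G. of_bool (x \<in> sm A B))"
    by (simp add: card_G_sum)
  also have "\<dots> = (\<Sum>x\<in>G. min 1 (rr A B x))"
    by (rule sum.cong) (auto simp: mem_sm_iff[OF A B])
  finally show ?thesis by (simp add: pol_def)
qed

section \<open>The e-transform, Pollard's theorem and the Cauchy-Davenport theorem\<close>

lemma ex_cong_mult:
  assumes "\<not> p dvd d"
  shows "\<exists>k::nat. (int k * d) mod p = z mod p"
proof -
  have "coprime d p"
    using assms prime_p by (metis coprime_commute prime_imp_coprime)
  then obtain e where e: "[d * e = 1] (mod p)"
    using cong_solve_coprime_int by blast
  define k where "k = nat ((e * z) mod p)"
  have "int k = (e * z) mod p" by (simp add: k_def)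
  then have "(int k * d) mod p = ((d * e) * z) mod p"
    by (simp add: mod_simps ac_simps)
  also have "\<dots> = z mod p"
    using e by (metis cong_def cong_scalar_right mult_1)
  finally show ?thesis by blast
qed

text \<open>A nonzero step generates a group of prime order, so following it from any element of
  \<open>X\<close> reaches every residue. Primality of \<open>p\<close> enters the combinatorial
  part through this fact.\<close>

lemma closed_shift_UNIV:
  assumes X: "X \<subseteq> G" "X \<noteq> {}" and d: "\<not> p dvd d"
    and closed: "\<And>x. x \<in> X \<Longrightarrow> (x + d) mod p \<in> X"
  shows "X = G"
proof -
  obtain x where x: "x \<in> X" using X by auto
  have k: "(x + int k * d) mod p \<in> X" for k :: nat
  proof (induction k)
    case 0
    then show ?case using x X by auto
  next
    case (Suc k)
    then have "((x + int k * d) mod p + d) mod p \<in> X" by (rule closed)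
    then show ?case by (simp add: mod_simps algebra_simps)
  qed
  have "g \<in> X" if g: "g \<in> G" for g
  proof -
    obtain k where "(int k * d) mod p = (g - x) mod p"
      using ex_cong_mult[OF d] by blast
    then have "(x + int k * d) mod p = (x + (g - x)) mod p"
      by (metis mod_add_right_eq)
    then show ?thesis using k[of k] g by simp
  qed
  then show ?thesis using X by auto
qed

lemma diff_not_dvd:
  assumes "x \<in> G" "y \<in> G" "x \<noteq> y"
  shows "\<not> p dvd x - y"
  using assms by (metis mod_G mod_eq_dvd_iff)

text \<open>If every translate of \<open>Y\<close> that meets \<open>X\<close> were contained in
  \<open>X\<close>, then \<open>X\<close> would be closed under the difference of two elements of
  \<open>Y\<close>, hence be the whole group. The translate obtained makes the e-transform in
  \<open>pollard\<close> a proper one: the intersection is nonempty and smaller than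
  \<open>Y\<close>.\<close>

lemma exists_partial_translate:
  assumes X: "X \<subseteq> G" "X \<noteq> {}" "X \<noteq> G" and Y: "Y \<subseteq> G" "card Y \<ge> 2"
  shows "\<exists>e. X \<inter> tr e Y \<noteq> {} \<and> \<not> tr e Y \<subseteq> X"
proof (rule ccontr)
  assume "\<not> ?thesis"
  then have h: "\<And>e. X \<inter> tr e Y \<noteq> {} \<Longrightarrow> tr e Y \<subseteq> X" by blast
  obtain y1 y2 where y: "y1 \<in> Y" "y2 \<in> Y" "y1 \<noteq> y2"
    using Y(2) by (metis card_2_iff' card_le_Suc0_iff_eq finite_sub_G Y(1) not_less_eq_eq numeral_2_eq_2)
  have "X = G"
  proof (rule closed_shift_UNIV[OF X(1,2)])
    show "\<not> p dvd y2 - y1" using y Y by (intro diff_not_dvd) auto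
    fix x assume x: "x \<in> X"
    have "(y1 + (x - y1)) mod p \<in> tr (x - y1) Y" by (rule mod_add_in_tr[OF Y(1) y(1)])
    then have "x \<in> tr (x - y1) Y" using x X by auto
    then have "tr (x - y1) Y \<subseteq> X" using h x by blast
    moreover have "(y2 + (x - y1)) mod p \<in> tr (x - y1) Y" by (rule mod_add_in_tr[OF Y(1) y(2)])
    ultimately have "(y2 + (x - y1)) mod p \<in> X" by blast
    then show "(x + (y2 - y1)) mod p \<in> X" by (simp add: algebra_simps)
  qed
  then show False using X by simp
qed

lemma pol_tr_right: "X \<subseteq> G \<Longrightarrow> Y \<subseteq> G \<Longrightarrow> pol t X (tr s Y) = pol t X Y"
proof -
  assume X: "X \<subseteq> G" and Y: "Y \<subseteq> G"
  have "pol t X (tr s Y) = (\<Sum>x\<in>G. min t (rr X Y ((x - s) mod p)))"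
    by (simp add: pol_def rr_tr_right X Y)
  then show ?thesis
    by (simp only: sum_shift_minus[of "\<lambda>x. min t (rr X Y x)"] pol_def)
qed

lemma pol_commute: "X \<subseteq> G \<Longrightarrow> Y \<subseteq> G \<Longrightarrow> pol t X Y = pol t Y X"
  by (simp add: pol_def rr_commute)

lemma pol_tr_left: "X \<subseteq> G \<Longrightarrow> Y \<subseteq> G \<Longrightarrow> pol t (tr s X) Y = pol t X Y"
  by (metis pol_commute pol_tr_right tr_sub)

text \<open>Dyson's e-transform on the level of representation counts. Cutting both sets along their
  intersection gives four blocks of pairs; exchanging the two summands in the block of the
  intersection with \<open>Y - X\<close> regroups them into the two products on the right.\<close>

lemma rr_dyson:
  assumes X: "X \<subseteq> G" and Y: "Y \<subseteq> G"
  shows "rr X Y x = rr (X \<union> Y) (X \<inter> Y) x + rr (X - Y) (Y - X) x"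
proof -
  define I where "I = X \<inter> Y"
  define X0 where "X0 = X - Y"
  define Y0 where "Y0 = Y - X"
  have s: "I \<subseteq> G" "X0 \<subseteq> G" "Y0 \<subseteq> G" using X Y by (auto simp: I_def X0_def Y0_def)
  have d: "I \<inter> X0 = {}" "I \<inter> Y0 = {}" "(I \<union> X0) \<inter> Y0 = {}" by (auto simp: I_def X0_def Y0_def)
  have e: "X = I \<union> X0" "Y = I \<union> Y0" "X \<union> Y = (I \<union> X0) \<union> Y0"
    by (auto simp: I_def X0_def Y0_def)
  have "rr X Y x = rr (I \<union> X0) (I \<union> Y0) x" by (simp only: e(1,2)[symmetric])
  also have "\<dots> = rr (I \<union> X0) I x + (rr I Y0 x + rr X0 Y0 x)"
    using s d by (simp add: rr_Un_right rr_Un_left)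
  also have "rr I Y0 x = rr Y0 I x" using s by (rule_tac rr_commute)
  also have "rr (I \<union> X0) I x + (rr Y0 I x + rr X0 Y0 x) = rr ((I \<union> X0) \<union> Y0) I x + rr X0 Y0 x"
    using s d by (subst rr_Un_left[of "I \<union> X0" Y0]) auto
  finally show ?thesis
    by (simp only: e(3) I_def[symmetric] X0_def[symmetric] Y0_def[symmetric])
qed

text \<open>Induction on \<open>card Y\<close> by the e-transform, with overlap \<open>i\<close>. If
  \<open>t \<le> i\<close>, the pair of union and intersection has the same total size and suffices
  on its own. If \<open>i < t\<close>, the counts of that pair never exceed \<open>i\<close>, so
  they enter untruncated, and the pair of differences is used at the remaining level
  \<open>t - i\<close>.\<close>

theorem pollard:
  assumes "X \<subseteq> G" "Y \<subseteq> G" "t \<le> card X" "t \<le> card Y" "int (card X + card Y) \<le> p + int t"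
  shows "t * (card X + card Y - t) \<le> pol t X Y"
  using assms
proof (induction "card Y" arbitrary: X Y t rule: less_induct)
  case less
  note X = less.prems(1) and Y = less.prems(2)
  note fX = finite_sub_G[OF X] and fY = finite_sub_G[OF Y]
  show ?case
  proof (cases "t = 0 \<or> t = card Y")
    case True
    then show ?thesis
    proof
      assume "t = card Y"
      have "rr X Y x \<le> card Y" for x
        using rr_le[OF Y] rr_commute[OF X Y] by simp
      then have "pol t X Y = (\<Sum>x\<in>G. rr X Y x)"
        unfolding pol_def by (intro sum.cong) (auto simp: \<open>t = card Y\<close> min_absorb2)
      then show ?thesis
        using sum_rr[OF X Y] \<open>t = card Y\<close> by (simp add: mult.commute)
    qed simp
  next
    case False
    then have t: "t > 0" "t < card Y" using less.prems by auto
    have "X \<noteq> {}" using t less.prems(3) by auto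
    moreover have "X \<noteq> G"
    proof
      assume "X = G"
      then have "int (card X) = p" using p_gt1 by simp
      then show False using less.prems(5) t by simp
    qed
    ultimately obtain e where e: "X \<inter> tr e Y \<noteq> {}" "\<not> tr e Y \<subseteq> X"
      using exists_partial_translate[OF X _ _ Y] t by fastforce
    define Z where "Z = tr e Y"
    have Z: "Z \<subseteq> G" "card Z = card Y" "X \<inter> Z \<noteq> {}" "\<not> Z \<subseteq> X"
      using e by (auto simp: Z_def card_tr[OF Y])
    have fZ: "finite Z" using Z finite_sub_G by blast
    define i where "i = card (X \<inter> Z)"
    have i0: "i > 0" using Z fX by (auto simp: i_def card_gt_0_iff)
    have iY: "i < card Y"
      unfolding i_def Z(2)[symmetric] by (rule psubset_card_mono[OF fZ]) (use Z in auto)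
    have cU: "card (X \<union> Z) + i = card X + card Y"
      using card_Un_Int[OF fX fZ] Z by (simp add: i_def)
    have cX: "card (X - Z) + i = card X"
      by (metis card_Int_Diff fX i_def add.commute)
    have cZ: "card (Z - X) + i = card Y"
      by (metis card_Int_Diff fZ Z(2) i_def Int_commute add.commute)
    have r: "rr X Z x = rr (X \<union> Z) (X \<inter> Z) x + rr (X - Z) (Z - X) x" for x
      by (rule rr_dyson[OF X Z(1)])
    have "t * (card X + card Y - t) \<le> pol t X Z"
    proof (cases "t \<le> i")
      case True
      have "t * (card (X \<union> Z) + card (X \<inter> Z) - t) \<le> pol t (X \<union> Z) (X \<inter> Z)"
      proof (rule less.hyps)
        show "card (X \<inter> Z) < card Y" using iY by (simp add: i_def)
        show "t \<le> card (X \<union> Z)" using True cU less.prems(3,4) iY by linarith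
        show "t \<le> card (X \<inter> Z)" using True by (simp add: i_def)
        show "int (card (X \<union> Z) + card (X \<inter> Z)) \<le> p + int t"
          using cU less.prems(5) by (simp add: i_def)
      qed (use X Z in auto)
      also have "pol t (X \<union> Z) (X \<inter> Z) \<le> pol t X Z"
        unfolding pol_def by (rule sum_mono) (simp add: r)
      finally show ?thesis using cU by (simp add: i_def)
    next
      case False
      then have ti: "i < t" by simp
      have IH: "(t - i) * (card (X - Z) + card (Z - X) - (t - i)) \<le> pol (t - i) (X - Z) (Z - X)"
      proof (rule less.hyps)
        show "card (Z - X) < card Y" using cZ i0 by linarith
        show "t - i \<le> card (X - Z)" using cX less.prems(3) by linarith
        show "t - i \<le> card (Z - X)" using cZ less.prems(4) by linarith
        show "int (card (X - Z) + card (Z - X)) \<le> p + int (t - i)"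
          using cX cZ less.prems(5) ti by linarith
      qed (use X Z in auto)
      have U: "X \<union> Z \<subseteq> G" "X \<inter> Z \<subseteq> G" using X Z by auto
      have "rr (X \<union> Z) (X \<inter> Z) x \<le> i" for x
        using rr_le[OF U(2)] rr_commute[OF U] by (simp add: i_def)
      then have m: "rr (X \<union> Z) (X \<inter> Z) x + min (t - i) (rr (X - Z) (Z - X) x) \<le> min t (rr X Z x)" for x
        using ti unfolding r by (intro add_min_le) auto
      have "(card X + card Y - i) * i + pol (t - i) (X - Z) (Z - X)
          = (\<Sum>x\<in>G. rr (X \<union> Z) (X \<inter> Z) x) + pol (t - i) (X - Z) (Z - X)"
        using sum_rr[OF U] cU[symmetric] by (simp add: i_def)
      also have "\<dots> = (\<Sum>x\<in>G. rr (X \<union> Z) (X \<inter> Z) x + min (t - i) (rr (X - Z) (Z - X) x))"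
        by (simp add: pol_def sum.distrib)
      also have "\<dots> \<le> pol t X Z"
        unfolding pol_def by (rule sum_mono) (rule m)
      finally have 1: "(card X + card Y - i) * i + pol (t - i) (X - Z) (Z - X) \<le> pol t X Z" .
      \<comment> \<open>Writing \<open>t\<close>, \<open>card X\<close> and \<open>card Y\<close> as
        sums removes the natural-number subtraction, and the bound becomes a polynomial
        identity.\<close>
      obtain s where s: "t = i + s" using ti less_imp_add_positive by blast
      obtain a where a: "card X = t + a" using less.prems(3) le_Suc_ex by blast
      obtain b where b: "card Y = t + b" using less.prems(4) le_Suc_ex by blast
      have xz: "card (X - Z) = s + a" "card (Z - X) = s + b"
        using cX cZ a b s by auto
      have "t * (card X + card Y - t) = (i + s) * (i + s + a + b)"
        unfolding a b s by (simp add: algebra_simps)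
      also have "\<dots> = (card X + card Y - i) * i + (t - i) * (card (X - Z) + card (Z - X) - (t - i))"
        unfolding xz unfolding a b s by (simp add: algebra_simps)
      also have "\<dots> \<le> (card X + card Y - i) * i + pol (t - i) (X - Z) (Z - X)"
        using IH by simp
      finally show ?thesis using 1 by simp
    qed
    then show ?thesis
      using pol_tr_right[OF X Y] by (simp add: Z_def)
  qed
qed

text \<open>Up to total size \<open>p + 1\<close> this is the case \<open>t = 1\<close> of
  \<open>pollard\<close>. Beyond that, \<open>X\<close> and \<open>x - Y\<close> are too large to be
  disjoint, so every \<open>x\<close> is a sum.\<close>

theorem cauchy_davenport:
  assumes X: "X \<subseteq> G" "X \<noteq> {}" and Y: "Y \<subseteq> G" "Y \<noteq> {}"
  shows "min p (int (card X + card Y) - 1) \<le> int (card (sm X Y))"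
proof (cases "int (card X + card Y) \<le> p + 1")
  case True
  have c: "1 \<le> card X" "1 \<le> card Y"
    using X Y by (simp_all add: Suc_le_eq card_gt_0_iff finite_sub_G)
  have "1 * (card X + card Y - 1) \<le> pol 1 X Y"
    by (rule pollard) (use X Y c True in auto)
  then show ?thesis using pol_1[OF X(1) Y(1)] c by linarith
next
  case False
  have "G \<subseteq> sm X Y"
  proof
    fix x assume x: "x \<in> G"
    define Y' where "Y' = {z \<in> G. (x - z) mod p \<in> Y}"
    have "card Y' = card Y"
    proof -
      have "card Y' = (\<Sum>z\<in>G. of_bool ((x - z) mod p \<in> Y))"
        unfolding Y'_def by (rule card_of_bool_sum) simp
      then show ?thesis
        by (simp only: sum_reflect[of "\<lambda>z. of_bool (z \<in> Y)" x] card_G_sum[OF Y(1)])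
    qed
    have Y': "Y' \<subseteq> G" by (auto simp: Y'_def)
    have "X \<inter> Y' \<noteq> {}"
    proof
      assume "X \<inter> Y' = {}"
      then have "card (X \<union> Y') = card X + card Y"
        using \<open>card Y' = card Y\<close> X Y' by (subst card_Un_disjoint) (simp_all add: finite_sub_G)
      moreover have "card (X \<union> Y') \<le> card G"
        by (rule card_mono) (use X Y' in auto)
      ultimately show False using False p_gt1 by simp
    qed
    then obtain a where "a \<in> X" "(x - a) mod p \<in> Y" by (auto simp: Y'_def)
    then have "(a + (x - a) mod p) mod p \<in> sm X Y" by (rule sm_I)
    then show "x \<in> sm X Y" using x by (simp add: mod_simps)
  qed
  then have "card G \<le> card (sm X Y)" by (rule card_mono[rotated]) simp
  then show ?thesis by simp
qed

end

section \<open>Random subsets with large sumset\<close>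

lemma sum_PiE_insert:
  assumes "n \<notin> S"
  shows "(\<Sum>g\<in>PiE (insert n S) (\<lambda>_. B). F g) = (\<Sum>b\<in>B. \<Sum>g\<in>PiE S (\<lambda>_. B). F (g(n := b)))"
proof -
  have "(\<Sum>g\<in>PiE (insert n S) (\<lambda>_. B). F g) = (\<Sum>(b, g)\<in>B \<times> PiE S (\<lambda>_. B). F (g(n := b)))"
    unfolding PiE_insert_eq
    by (subst sum.reindex[OF inj_combinator[OF assms]]) (auto intro!: sum.cong)
  then show ?thesis by (simp add: sum.cartesian_product)
qed

text \<open>Lagrange's identity: the sum of the squares over all pairs of indices is twice the gap
  in the Cauchy-Schwarz inequality.\<close>

lemma sum_mult_square_le:
  fixes f g :: "'a \<Rightarrow> real"
  shows "(\<Sum>i\<in>S. f i * g i)\<^sup>2 \<le> (\<Sum>i\<in>S. (f i)\<^sup>2) * (\<Sum>i\<in>S. (g i)\<^sup>2)"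
proof -
  have "0 \<le> (\<Sum>i\<in>S. \<Sum>j\<in>S. (f i * g j - f j * g i)\<^sup>2)"
    by (intro sum_nonneg) auto
  also have "\<dots> = (\<Sum>i\<in>S. \<Sum>j\<in>S. (f i)\<^sup>2 * (g j)\<^sup>2) + (\<Sum>i\<in>S. \<Sum>j\<in>S. (f j)\<^sup>2 * (g i)\<^sup>2)
      - 2 * (\<Sum>i\<in>S. \<Sum>j\<in>S. (f i * g i) * (f j * g j))"
    by (simp add: power2_diff power_mult_distrib sum.distrib sum_subtractf sum_distrib_left mult_ac)
  also have "(\<Sum>i\<in>S. \<Sum>j\<in>S. (f j)\<^sup>2 * (g i)\<^sup>2) = (\<Sum>i\<in>S. \<Sum>j\<in>S. (f i)\<^sup>2 * (g j)\<^sup>2)"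
    by (rule sum.swap)
  finally show ?thesis
    by (simp add: power2_eq_square sum_product)
qed

text \<open>The first two moments of a sum of weights along a uniformly random tuple, drawn with
  replacement. Totals over all tuples stand for expectations, and powers of \<open>card B\<close>
  are multiplied out, so that no division occurs and the induction can add one coordinate at a
  time.\<close>

lemma tuple_moments:
  fixes w :: "'b \<Rightarrow> real"
  assumes B: "finite B" and S: "finite S"
  defines "W1 \<equiv> \<Sum>b\<in>B. w b" and "W2 \<equiv> \<Sum>b\<in>B. (w b)\<^sup>2"
  shows "real (card B) * (\<Sum>g\<in>PiE S (\<lambda>_. B). \<Sum>j\<in>S. w (g j)) = real (card S) * real (card B) ^ card S * W1 \<and>
    real (card B) ^ 2 * (\<Sum>g\<in>PiE S (\<lambda>_. B). (\<Sum>j\<in>S. w (g j))\<^sup>2)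
      \<le> real (card B) ^ card S * (real (card S) * real (card B) * W2 + real (card S) ^ 2 * W1\<^sup>2)"
  using S
proof (induction S rule: finite_induct)
  case empty
  then show ?case by simp
next
  case (insert n S)
  define T where "T = PiE S (\<lambda>_. B)"
  define U where "U g = (\<Sum>j\<in>S. w (g j))" for g :: "'a \<Rightarrow> 'b"
  have cT: "real (card T) = real (card B) ^ card S"
    by (simp add: T_def card_PiE insert.hyps)
  have upd: "(\<Sum>j\<in>insert n S. w ((g(n := b)) j)) = w b + U g" for g b
    using insert.hyps by (auto simp: U_def intro!: sum.cong)
  have m1: "(\<Sum>g\<in>PiE (insert n S) (\<lambda>_. B). \<Sum>j\<in>insert n S. w (g j)) = real (card T) * W1 + real (card B) * (\<Sum>g\<in>T. U g)"
    unfolding sum_PiE_insert[OF insert.hyps(2)] upd T_def[symmetric]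
    by (simp add: sum.distrib W1_def sum_distrib_left)
  have sq: "(w b + U g)\<^sup>2 = (w b)\<^sup>2 + 2 * w b * U g + (U g)\<^sup>2" for b g
    by (simp add: power2_sum)
  have "(\<Sum>b\<in>B. \<Sum>g\<in>T. 2 * w b * U g) = 2 * W1 * (\<Sum>g\<in>T. U g)"
    by (simp add: W1_def sum_distrib_left sum_distrib_right mult.assoc) (rule sum.swap)
  then have m2: "(\<Sum>g\<in>PiE (insert n S) (\<lambda>_. B). (\<Sum>j\<in>insert n S. w (g j))\<^sup>2)
      = real (card T) * W2 + 2 * W1 * (\<Sum>g\<in>T. U g) + real (card B) * (\<Sum>g\<in>T. (U g)\<^sup>2)"
    unfolding sum_PiE_insert[OF insert.hyps(2)] upd T_def[symmetric] sq
    by (simp add: sum.distrib W2_def sum_distrib_left)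
  have IH1: "real (card B) * (\<Sum>g\<in>T. U g) = real (card S) * real (card B) ^ card S * W1"
    and IH2: "real (card B) ^ 2 * (\<Sum>g\<in>T. (U g)\<^sup>2)
      \<le> real (card B) ^ card S * (real (card S) * real (card B) * W2 + real (card S) ^ 2 * W1\<^sup>2)"
    using insert.IH by (simp_all add: T_def U_def)
  define b where "b = real (card B)"
  define k where "k = real (card S)"
  have W2: "W2 \<ge> 0" by (simp add: W2_def sum_nonneg)
  have b: "b \<ge> 0" by (simp add: b_def)
  have "b\<^sup>2 * (real (card T) * W2 + 2 * W1 * (\<Sum>g\<in>T. U g) + b * (\<Sum>g\<in>T. (U g)\<^sup>2))
      = b ^ card S * b\<^sup>2 * W2 + 2 * W1 * b * (b * (\<Sum>g\<in>T. U g)) + b * (b\<^sup>2 * (\<Sum>g\<in>T. (U g)\<^sup>2))"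
    unfolding cT b_def[symmetric] by (simp add: algebra_simps power2_eq_square)
  also have "\<dots> \<le> b ^ card S * b\<^sup>2 * W2 + 2 * W1 * b * (k * b ^ card S * W1)
      + b * (b ^ card S * (k * b * W2 + k ^ 2 * W1\<^sup>2))"
    using IH1 IH2 b unfolding b_def[symmetric] k_def[symmetric] by (simp add: mult_left_mono)
  also have "\<dots> = b ^ Suc (card S) * ((k + 1) * b * W2 + (k\<^sup>2 + 2 * k) * W1\<^sup>2)"
    by (simp add: algebra_simps power2_eq_square)
  also have "\<dots> \<le> b ^ Suc (card S) * ((k + 1) * b * W2 + (k + 1)\<^sup>2 * W1\<^sup>2)"
    by (intro mult_left_mono add_mono mult_right_mono) (auto simp: power2_eq_square algebra_simps b k_def)
  finally have f2: "b\<^sup>2 * (real (card T) * W2 + 2 * W1 * (\<Sum>g\<in>T. U g) + b * (\<Sum>g\<in>T. (U g)\<^sup>2))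
      \<le> b ^ Suc (card S) * ((k + 1) * b * W2 + (k + 1)\<^sup>2 * W1\<^sup>2)" .
  have f1: "b * (real (card T) * W1 + b * (\<Sum>g\<in>T. U g)) = (k + 1) * b ^ Suc (card S) * W1"
    using IH1 unfolding cT b_def[symmetric] k_def[symmetric] by (simp add: algebra_simps)
  have c: "card (insert n S) = Suc (card S)" "real (Suc (card S)) = k + 1"
    using insert.hyps by (simp_all add: k_def)
  show ?case
    unfolding m1 m2 c using f1 f2 by (simp add: b_def)
qed

context zp
begin

text \<open>Let \<open>N\<close> count the index pairs \<open>(i, j)\<close> with
  \<open>f i + g j = x\<close> modulo \<open>p\<close>. Its mean is \<open>m\<close> and its second
  moment at most \<open>m\<^sup>2 + 3 * m\<close>, so by Cauchy-Schwarz \<open>N\<close> is nonzero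
  for a proportion of at least \<open>m / (m + 3)\<close> of all pairs of tuples.\<close>

lemma cover_count:
  assumes A: "A \<subseteq> G" and B: "B \<subseteq> G" and x: "x \<in> G"
    and c1: "c1 \<le> card A" and c2: "c2 \<le> card B" and ne: "A \<noteq> {}" "B \<noteq> {}"
  defines "T1 \<equiv> PiE {..<c1} (\<lambda>_. A)" and "T2 \<equiv> PiE {..<c2} (\<lambda>_. B)"
  defines "m \<equiv> real c1 * real c2 * real (rr A B x) / (real (card A) * real (card B))"
  shows "m / (m + 3) * (real (card T1) * real (card T2))
    \<le> real (card {(f, g) \<in> T1 \<times> T2. x \<in> sm (f ` {..<c1}) (g ` {..<c2})})"
proof -
  define a where "a = real (card A)"
  define b where "b = real (card B)"
  define r where "r = real (rr A B x)"
  have fA: "finite A" and fB: "finite B" using A B finite_sub_G by auto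
  have ab: "a > 0" "b > 0" using ne fA fB by (auto simp: a_def b_def card_gt_0_iff)
  have cT: "real (card T1) = a ^ c1" "real (card T2) = b ^ c2"
    by (simp_all add: T1_def T2_def card_PiE a_def b_def)
  have fT: "finite T1" "finite T2" using fA fB by (auto simp: T1_def T2_def intro!: finite_PiE)
  define w where "w f y = (\<Sum>i<c1. of_bool ((f i + y) mod p = x) :: real)" for f :: "nat \<Rightarrow> int" and y
  define N where "N f g = (\<Sum>j<c2. w f (g j))" for f g
  define v where "v u = (of_bool ((x - u) mod p \<in> B) :: real)" for u
  have r_v: "(\<Sum>u\<in>A. v u) = r" "(\<Sum>u\<in>A. (v u)\<^sup>2) = r"
    unfolding v_def r_def rr_sum[OF A] by (auto simp: of_nat_sum intro!: sum.cong)
  have eqx: "(u + y) mod p = x \<longleftrightarrow> y = (x - u) mod p" if "y \<in> G" for u y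
  proof
    assume "(u + y) mod p = x"
    then have "(x - u) mod p = (u + y - u) mod p" by (metis mod_diff_left_eq)
    then show "y = (x - u) mod p" using that by simp
  next
    assume "y = (x - u) mod p"
    then show "(u + y) mod p = x" using x by (simp add: mod_simps)
  qed
  have W1: "(\<Sum>y\<in>B. w f y) = (\<Sum>i<c1. v (f i))" for f
  proof -
    have "(\<Sum>y\<in>B. w f y) = (\<Sum>i<c1. \<Sum>y\<in>B. of_bool ((f i + y) mod p = x))"
      unfolding w_def by (rule sum.swap)
    moreover have "(\<Sum>y\<in>B. of_bool ((u + y) mod p = x) :: real) = v u" for u
    proof -
      have "(\<Sum>y\<in>B. of_bool ((u + y) mod p = x) :: real) = (\<Sum>y\<in>B. if (x - u) mod p = y then 1 else 0)"
      proof (rule sum.cong)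
        fix y assume "y \<in> B"
        then have "(u + y) mod p = x \<longleftrightarrow> y = (x - u) mod p" using B by (intro eqx) auto
        then show "(of_bool ((u + y) mod p = x) :: real) = (if (x - u) mod p = y then 1 else 0)" by auto
      qed simp
      then show ?thesis using fB by (simp add: v_def)
    qed
    ultimately show ?thesis by simp
  qed
  define q where "q y u = (of_bool ((u + y) mod p = x) :: real)" for y u
  define iy where "iy y = (of_bool ((x - y) mod p \<in> A) :: real)" for y
  have q: "(\<Sum>u\<in>A. q y u) = iy y" "(\<Sum>u\<in>A. (q y u)\<^sup>2) = iy y" for y
  proof -
    have "(\<Sum>u\<in>A. q y u) = (\<Sum>u\<in>A. if (x - y) mod p = u then 1 else 0)"
    proof (rule sum.cong)
      fix u assume "u \<in> A"
      then have "(y + u) mod p = x \<longleftrightarrow> u = (x - y) mod p" using A by (intro eqx) auto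
      then show "q y u = (if (x - y) mod p = u then 1 else 0)" by (auto simp: q_def add.commute)
    qed simp
    then show 1: "(\<Sum>u\<in>A. q y u) = iy y" using fA by (simp add: iy_def)
    have "(\<Sum>u\<in>A. (q y u)\<^sup>2) = (\<Sum>u\<in>A. q y u)" by (rule sum.cong) (auto simp: q_def)
    then show "(\<Sum>u\<in>A. (q y u)\<^sup>2) = iy y" using 1 by simp
  qed
  have siy: "(\<Sum>y\<in>B. iy y) = r"
    unfolding iy_def r_def rr_commute[OF A B] rr_sum[OF B] by (simp add: of_nat_sum)
  have iy2: "(iy y)\<^sup>2 = iy y" for y by (simp add: iy_def)
  have first: "(\<Sum>f\<in>T1. \<Sum>g\<in>T2. N f g) = a ^ c1 * b ^ c2 * m"
  proof -
    have 1: "b * (\<Sum>g\<in>T2. N f g) = c2 * b ^ c2 * (\<Sum>i<c1. v (f i))" for f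
      using tuple_moments[OF fB, of "{..<c2}" "w f"] by (simp add: N_def T2_def b_def W1)
    have 2: "a * (\<Sum>f\<in>T1. \<Sum>i<c1. v (f i)) = c1 * a ^ c1 * r"
      using tuple_moments[OF fA, of "{..<c1}" v] by (simp add: T1_def a_def r_v)
    have "a * (b * (\<Sum>f\<in>T1. \<Sum>g\<in>T2. N f g)) = a * (\<Sum>f\<in>T1. b * (\<Sum>g\<in>T2. N f g))"
      by (simp add: sum_distrib_left)
    also have "\<dots> = c2 * b ^ c2 * (a * (\<Sum>f\<in>T1. \<Sum>i<c1. v (f i)))"
      unfolding 1 by (simp add: sum_distrib_left mult_ac)
    also have "\<dots> = c2 * b ^ c2 * (c1 * a ^ c1 * r)" unfolding 2 ..
    finally show ?thesis
      using ab unfolding m_def a_def[symmetric] b_def[symmetric] r_def[symmetric] by (simp add: field_simps)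
  qed
  have second: "(\<Sum>f\<in>T1. \<Sum>g\<in>T2. (N f g)\<^sup>2) \<le> a ^ c1 * b ^ c2 * (m\<^sup>2 + 3 * m)"
  proof -
    have 1: "b\<^sup>2 * (\<Sum>g\<in>T2. (N f g)\<^sup>2) \<le> b ^ c2 * (c2 * b * (\<Sum>y\<in>B. (w f y)\<^sup>2) + c2\<^sup>2 * (\<Sum>i<c1. v (f i))\<^sup>2)" for f
      using tuple_moments[OF fB, of "{..<c2}" "w f"] by (simp add: N_def T2_def b_def W1)
    have 2: "a\<^sup>2 * (\<Sum>f\<in>T1. (\<Sum>i<c1. v (f i))\<^sup>2) \<le> a ^ c1 * (c1 * a * r + c1\<^sup>2 * r\<^sup>2)"
      using tuple_moments[OF fA, of "{..<c1}" v] by (simp add: T1_def a_def r_v)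
    have wq: "w f y = (\<Sum>i<c1. q y (f i))" for f y by (simp add: w_def q_def)
    have 3: "a\<^sup>2 * (\<Sum>f\<in>T1. (w f y)\<^sup>2) \<le> a ^ c1 * (c1 * a + c1\<^sup>2) * iy y" for y
      using tuple_moments[OF fA, of "{..<c1}" "q y"]
      by (simp add: T1_def a_def q wq iy2 algebra_simps)
    have 4: "a\<^sup>2 * (\<Sum>f\<in>T1. \<Sum>y\<in>B. (w f y)\<^sup>2) \<le> a ^ c1 * (c1 * a + c1\<^sup>2) * r"
    proof -
      have "a\<^sup>2 * (\<Sum>f\<in>T1. \<Sum>y\<in>B. (w f y)\<^sup>2) = (\<Sum>y\<in>B. a\<^sup>2 * (\<Sum>f\<in>T1. (w f y)\<^sup>2))"
        by (subst sum.swap) (simp add: sum_distrib_left)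
      also have "\<dots> \<le> (\<Sum>y\<in>B. a ^ c1 * (c1 * a + c1\<^sup>2) * iy y)"
        by (rule sum_mono) (rule 3)
      also have "\<dots> = a ^ c1 * (c1 * a + c1\<^sup>2) * r"
        using siy by (simp add: sum_distrib_left[symmetric])
      finally show ?thesis .
    qed
    have "a\<^sup>2 * b\<^sup>2 * (\<Sum>f\<in>T1. \<Sum>g\<in>T2. (N f g)\<^sup>2) = a\<^sup>2 * (\<Sum>f\<in>T1. b\<^sup>2 * (\<Sum>g\<in>T2. (N f g)\<^sup>2))"
      by (simp add: sum_distrib_left mult_ac)
    also have "\<dots> \<le> a\<^sup>2 * (\<Sum>f\<in>T1. b ^ c2 * (c2 * b * (\<Sum>y\<in>B. (w f y)\<^sup>2) + c2\<^sup>2 * (\<Sum>i<c1. v (f i))\<^sup>2))"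
      by (intro mult_left_mono sum_mono 1) simp
    also have "\<dots> = b ^ c2 * (c2 * b * (a\<^sup>2 * (\<Sum>f\<in>T1. \<Sum>y\<in>B. (w f y)\<^sup>2)) + c2\<^sup>2 * (a\<^sup>2 * (\<Sum>f\<in>T1. (\<Sum>i<c1. v (f i))\<^sup>2)))"
      by (simp add: sum_distrib_left sum.distrib algebra_simps)
    also have "\<dots> \<le> b ^ c2 * (c2 * b * (a ^ c1 * (c1 * a + c1\<^sup>2) * r) + c2\<^sup>2 * (a ^ c1 * (c1 * a * r + c1\<^sup>2 * r\<^sup>2)))"
      by (intro mult_left_mono add_mono 4 2) (use ab in auto)
    also have "\<dots> = a ^ c1 * b ^ c2 * (c1 * c2 * r * (a * b + b * c1 + a * c2) + (c1 * c2 * r)\<^sup>2)"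
      by (simp add: algebra_simps power2_eq_square)
    \<comment> \<open>The three summands come from two index pairs that coincide, that share only
      \<open>j\<close>, or that share only \<open>i\<close>. The bounds \<open>c1 \<le> a\<close>
      and \<open>c2 \<le> b\<close> make each at most \<open>a * b\<close>, which is the origin of
      the 3 in \<open>m / (m + 3)\<close>.\<close>
    also have "\<dots> \<le> a ^ c1 * b ^ c2 * (c1 * c2 * r * (3 * a * b) + (c1 * c2 * r)\<^sup>2)"
    proof -
      have "b * c1 \<le> b * a" "a * c2 \<le> a * b"
        using c1 c2 ab by (auto simp: a_def b_def)
      then have "a * b + b * c1 + a * c2 \<le> 3 * a * b" by (simp add: mult.commute)
      then show ?thesis
        using ab by (intro mult_left_mono add_mono) (auto simp: r_def)
    qed
    also have "\<dots> = a\<^sup>2 * b\<^sup>2 * (a ^ c1 * b ^ c2 * (m\<^sup>2 + 3 * m))"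
      using ab unfolding m_def a_def[symmetric] b_def[symmetric] r_def[symmetric]
      by (simp add: field_simps power2_eq_square)
    finally show ?thesis
      using ab by simp
  qed
  define Q where "Q = {(f, g) \<in> T1 \<times> T2. x \<in> sm (f ` {..<c1}) (g ` {..<c2})}"
  have fQ: "finite Q" by (rule finite_subset[of _ "T1 \<times> T2"]) (auto simp: Q_def fT)
  have N0: "N f g = 0" if "f \<in> T1" "g \<in> T2" "(f, g) \<notin> Q" for f g
  proof (rule ccontr)
    assume "N f g \<noteq> 0"
    then obtain j where j: "j < c2" "w f (g j) \<noteq> 0" unfolding N_def by (metis lessThan_iff sum.neutral)
    have "\<exists>i<c1. (f i + g j) mod p = x"
    proof (rule ccontr)
      assume "\<not> ?thesis"
      then have "w f (g j) = 0" unfolding w_def by (intro sum.neutral) auto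
      then show False using j by simp
    qed
    then obtain i where i: "i < c1" "(f i + g j) mod p = x" by blast
    then have "x \<in> sm (f ` {..<c1}) (g ` {..<c2})"
      using sm_I[of "f i" "f ` {..<c1}" "g j" "g ` {..<c2}"] j by auto
    then show False using that by (auto simp: Q_def)
  qed
  have sub: "(\<Sum>f\<in>T1. \<Sum>g\<in>T2. F f g) = (\<Sum>z\<in>Q. F (fst z) (snd z))"
    if "\<And>f g. f \<in> T1 \<Longrightarrow> g \<in> T2 \<Longrightarrow> (f, g) \<notin> Q \<Longrightarrow> F f g = 0" for F :: "_ \<Rightarrow> _ \<Rightarrow> real"
  proof -
    have "(\<Sum>f\<in>T1. \<Sum>g\<in>T2. F f g) = (\<Sum>z\<in>T1 \<times> T2. F (fst z) (snd z))"
      by (simp add: sum.cartesian_product case_prod_beta)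
    also have "\<dots> = (\<Sum>z\<in>Q. F (fst z) (snd z))"
    proof (rule sum.mono_neutral_right)
      show "Q \<subseteq> T1 \<times> T2" by (auto simp: Q_def)
      show "\<forall>z\<in>T1 \<times> T2 - Q. F (fst z) (snd z) = 0" using that by auto
    qed (use fT in auto)
    finally show ?thesis .
  qed
  define D where "D = a ^ c1 * b ^ c2"
  have D: "D > 0" using ab by (simp add: D_def)
  have m0: "m \<ge> 0" by (simp add: m_def)
  have "(D * m)\<^sup>2 = (\<Sum>z\<in>Q. N (fst z) (snd z) * 1)\<^sup>2"
    using first sub[of N] N0 by (simp add: D_def)
  also have "\<dots> \<le> (\<Sum>z\<in>Q. (N (fst z) (snd z))\<^sup>2) * (\<Sum>z\<in>Q. 1\<^sup>2)"
    by (rule sum_mult_square_le)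
  also have "(\<Sum>z\<in>Q. (N (fst z) (snd z))\<^sup>2) = (\<Sum>f\<in>T1. \<Sum>g\<in>T2. (N f g)\<^sup>2)"
    using sub[of "\<lambda>f g. (N f g)\<^sup>2"] N0 by simp
  also have "\<dots> * (\<Sum>z\<in>Q. 1\<^sup>2) \<le> D * (m\<^sup>2 + 3 * m) * real (card Q)"
    using second by (simp add: D_def mult_right_mono)
  finally have fin: "(D * m)\<^sup>2 \<le> D * (m\<^sup>2 + 3 * m) * real (card Q)" .
  show ?thesis
  proof (cases "m = 0")
    case False
    then have mp: "m > 0" using m0 by simp
    have "(D * m) * (D * m) \<le> (D * m) * ((m + 3) * real (card Q))"
      using fin by (simp add: power2_eq_square algebra_simps)
    then have "D * m \<le> (m + 3) * real (card Q)"
      using mp D by simp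
    then have "m / (m + 3) * D \<le> real (card Q)"
      using mp by (simp add: field_simps)
    then show ?thesis by (simp add: cT D_def Q_def)
  qed simp
qed

text \<open>Some pair of tuples does at least as well as the average. Tuples may repeat elements, so
  the two images have at most the prescribed sizes; they are filled up later.\<close>

lemma random_subsets:
  assumes A: "A \<subseteq> G" and B: "B \<subseteq> G" and W: "W \<subseteq> G"
    and c1: "c1 \<le> card A" and c2: "c2 \<le> card B" and ne: "A \<noteq> {}" "B \<noteq> {}"
  defines "m \<equiv> \<lambda>x. real c1 * real c2 * real (rr A B x) / (real (card A) * real (card B))"
  shows "\<exists>A' B'. A' \<subseteq> A \<and> B' \<subseteq> B \<and> card A' \<le> c1 \<and> card B' \<le> c2 \<and>
    (\<Sum>x\<in>W. m x / (m x + 3)) \<le> real (card (sm A' B' \<inter> W))"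
proof -
  define T1 where "T1 = PiE {..<c1} (\<lambda>_. A)"
  define T2 where "T2 = PiE {..<c2} (\<lambda>_. B)"
  have fA: "finite A" and fB: "finite B" and fW: "finite W" using A B W finite_sub_G by auto
  have fT: "finite T1" "finite T2" using fA fB by (auto simp: T1_def T2_def intro!: finite_PiE)
  have ab: "card A > 0" "card B > 0" using ne fA fB by (auto simp: card_gt_0_iff)
  have cT: "card T1 > 0" "card T2 > 0" using ab by (auto simp: T1_def T2_def card_PiE)
  define S where "S z = sm (fst z ` {..<c1}) (snd z ` {..<c2})" for z :: "(nat \<Rightarrow> int) \<times> (nat \<Rightarrow> int)"
  define V where "V = (\<Sum>x\<in>W. m x / (m x + 3))"
  have "V * (real (card T1) * real (card T2)) = (\<Sum>x\<in>W. m x / (m x + 3) * (real (card T1) * real (card T2)))"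
    unfolding V_def by (rule sum_distrib_right)
  also have "\<dots> \<le> (\<Sum>x\<in>W. real (card {z \<in> T1 \<times> T2. x \<in> S z}))"
  proof (rule sum_mono)
    fix x assume "x \<in> W"
    then have "x \<in> G" using W by auto
    have "{z \<in> T1 \<times> T2. x \<in> S z} = {(f, g) \<in> T1 \<times> T2. x \<in> sm (f ` {..<c1}) (g ` {..<c2})}"
      by (auto simp: S_def)
    then show "m x / (m x + 3) * (real (card T1) * real (card T2)) \<le> real (card {z \<in> T1 \<times> T2. x \<in> S z})"
      using cover_count[OF A B \<open>x \<in> G\<close> c1 c2 ne] by (simp add: T1_def T2_def m_def)
  qed
  also have "\<dots> = (\<Sum>x\<in>W. \<Sum>z\<in>T1 \<times> T2. of_bool (x \<in> S z))"
    using fT by (simp add: card_of_bool_sum of_nat_sum)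
  also have "\<dots> = (\<Sum>z\<in>T1 \<times> T2. real (card {x \<in> W. x \<in> S z}))"
    unfolding card_of_bool_sum[OF fW] of_nat_sum of_nat_of_bool by (rule sum.swap)
  finally have le: "V * real (card (T1 \<times> T2)) \<le> (\<Sum>z\<in>T1 \<times> T2. real (card {x \<in> W. x \<in> S z}))"
    by (simp add: card_cartesian_product)
  have "\<exists>z\<in>T1 \<times> T2. V \<le> real (card {x \<in> W. x \<in> S z})"
  proof (rule ccontr)
    assume "\<not> ?thesis"
    then have "(\<Sum>z\<in>T1 \<times> T2. real (card {x \<in> W. x \<in> S z})) < (\<Sum>z\<in>T1 \<times> T2. V)"
      using fT cT by (intro sum_strict_mono) (auto simp: not_le)
    then show False using le by (simp add: mult.commute)
  qed
  then obtain f g where fg: "f \<in> T1" "g \<in> T2" "V \<le> real (card {x \<in> W. x \<in> S (f, g)})" by auto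
  have "{x \<in> W. x \<in> S (f, g)} = sm (f ` {..<c1}) (g ` {..<c2}) \<inter> W" by (auto simp: S_def)
  moreover have "f ` {..<c1} \<subseteq> A" "g ` {..<c2} \<subseteq> B" using fg by (auto simp: T1_def T2_def PiE_iff)
  moreover have "card (f ` {..<c1}) \<le> c1" "card (g ` {..<c2}) \<le> c2"
    using card_image_le[of "{..<c1}" f] card_image_le[of "{..<c2}" g] by auto
  ultimately show ?thesis using fg(3) unfolding V_def by metis
qed

text \<open>The covering proportion is increasing and concave in the number of representations.
  Below \<open>t\<close> it is therefore at least the fraction \<open>r / t\<close> of its value at
  \<open>t\<close>, and above \<open>t\<close> it is at least that value. This is how the truncated
  sum of \<open>pollard\<close> enters.\<close>

lemma random_subsets_truncated:
  fixes t :: real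
  assumes A: "A \<subseteq> G" and B: "B \<subseteq> G" and W: "W \<subseteq> G"
    and c1: "c1 \<le> card A" and c2: "c2 \<le> card B" and ne: "A \<noteq> {}" "B \<noteq> {}" and t: "t > 0"
  defines "m \<equiv> real c1 * real c2 * t / (real (card A) * real (card B))"
  shows "\<exists>A' B'. A' \<subseteq> A \<and> B' \<subseteq> B \<and> card A' \<le> c1 \<and> card B' \<le> c2 \<and>
    m / (m + 3) * ((\<Sum>x\<in>W. min t (real (rr A B x))) / t) \<le> real (card (sm A' B' \<inter> W))"
proof -
  define k where "k = real c1 * real c2 / (real (card A) * real (card B))"
  have k0: "k \<ge> 0" by (simp add: k_def)
  have pt: "k * t / (k * t + 3) * (min t r / t) \<le> k * r / (k * r + 3)" if r: "r \<ge> 0" for r :: real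
  proof (cases "r \<le> t")
    case True
    have "k * t / (k * t + 3) * (min t r / t) = k * r / (k * t + 3)" using True t by (simp add: field_simps)
    also have "\<dots> \<le> k * r / (k * r + 3)"
      using True k0 r by (intro divide_left_mono) (auto simp: mult_left_mono add_nonneg_pos intro!: mult_pos_pos)
    finally show ?thesis .
  next
    case False
    then have "k * t \<le> k * r" using k0 by (simp add: mult_left_mono)
    moreover have "k * t \<ge> 0" using k0 t by simp
    ultimately have "k * t / (k * t + 3) \<le> k * r / (k * r + 3)" by (simp add: field_simps)
    then show ?thesis using False t by simp
  qed
  have "m / (m + 3) * ((\<Sum>x\<in>W. min t (real (rr A B x))) / t)
      = (\<Sum>x\<in>W. k * t / (k * t + 3) * (min t (real (rr A B x)) / t))"
    by (simp add: m_def k_def sum_distrib_left sum_divide_distrib)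
  also have "\<dots> \<le> (\<Sum>x\<in>W. k * real (rr A B x) / (k * real (rr A B x) + 3))"
    by (rule sum_mono) (rule pt, simp)
  finally have le: "m / (m + 3) * ((\<Sum>x\<in>W. min t (real (rr A B x))) / t)
      \<le> (\<Sum>x\<in>W. k * real (rr A B x) / (k * real (rr A B x) + 3))" .
  obtain A' B' where "A' \<subseteq> A" "B' \<subseteq> B" "card A' \<le> c1" "card B' \<le> c2"
    "(\<Sum>x\<in>W. k * real (rr A B x) / (k * real (rr A B x) + 3)) \<le> real (card (sm A' B' \<inter> W))"
    using random_subsets[OF A B W c1 c2 ne] by (auto simp: k_def)
  then show ?thesis using le by (meson order_trans)
qed

end

section \<open>Uncrossing a set against its translates\<close>

text \<open>Concavity of truncation: \<open>u\<close> and \<open>i\<close> have the same sum as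
  \<open>r\<close> and \<open>r'\<close> but lie further apart.\<close>

lemma min_concave: "u + i = r + r' \<Longrightarrow> i \<le> r \<Longrightarrow> i \<le> r' \<Longrightarrow> min t u + min t i \<le> min t r + min t r'"
  for u i r r' t :: nat
  by (auto simp: min_def)

text \<open>
  By Cauchy-Schwarz, a set of size \<open>\<kappa>n\<close> extremal for \<open>Y\<close> meets one of its non-trivial translates in at least
  \<open>\<kappa>\<^sup>2n/24\<close> elements; this is the loss in one uncrossing step.
\<close>

fun kap :: "real \<Rightarrow> nat \<Rightarrow> real" where
  "kap \<alpha> 0 = \<alpha>"
| "kap \<alpha> (Suc j) = (kap \<alpha> j)\<^sup>2 / 24"

lemma kap_bounds: "0 < \<alpha> \<Longrightarrow> \<alpha> \<le> 1 \<Longrightarrow> 0 < kap \<alpha> j \<and> kap \<alpha> j \<le> 1"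
proof (induction j)
  case (Suc j)
  then have "(kap \<alpha> j)\<^sup>2 \<le> 1" by (simp add: power_le_one)
  then show ?case using Suc by simp
qed simp

lemma kap_Suc_le: "0 < \<alpha> \<Longrightarrow> \<alpha> \<le> 1 \<Longrightarrow> kap \<alpha> (Suc j) \<le> kap \<alpha> j"
  using kap_bounds[of \<alpha> j] mult_left_mono[of "kap \<alpha> j" 1 "kap \<alpha> j"] by (simp add: power2_eq_square)

context zp
begin

text \<open>The cost of a shift: the number of elements it fails to preserve; \<open>rho\<close> is
  the complementary overlap. As a function of the shift, the cost is symmetric and subadditive, so
  it behaves like a seminorm on the group whose balls carry the structure of
  \<open>Y\<close>.\<close>

definition dd :: "int set \<Rightarrow> int \<Rightarrow> nat" where
  "dd Y s = card (Y - tr s Y)"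

definition rho :: "int set \<Rightarrow> int \<Rightarrow> nat" where
  "rho Y s = card (Y \<inter> tr s Y)"

lemma dd_rho: "Y \<subseteq> G \<Longrightarrow> dd Y s + rho Y s = card Y"
  unfolding dd_def rho_def by (metis card_Int_Diff finite_sub_G add.commute)

lemma dd_mod [simp]: "dd Y (s mod p) = dd Y s"
  by (simp add: dd_def tr_mod)

lemma rho_mod [simp]: "rho Y (s mod p) = rho Y s"
  by (simp add: rho_def tr_mod)

lemma dd_0: "Y \<subseteq> G \<Longrightarrow> dd Y 0 = 0"
  by (simp add: dd_def tr_0)

text \<open>Triangle inequality: an element of \<open>Y\<close> outside the doubly shifted copy is
  either outside the copy shifted by \<open>s\<close>, or lost between that copy and the doubly
  shifted one.\<close>

lemma dd_add:
  assumes Y: "Y \<subseteq> G"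
  shows "dd Y (s + s') \<le> dd Y s + dd Y s'"
proof -
  have "Y - tr (s + s') Y \<subseteq> (Y - tr s Y) \<union> tr s (Y - tr s' Y)"
    by (auto simp: tr_Diff tr_tr)
  then have "dd Y (s + s') \<le> card ((Y - tr s Y) \<union> tr s (Y - tr s' Y))"
    unfolding dd_def by (rule card_mono[rotated]) (use Y finite_sub_G in auto)
  also have "\<dots> \<le> card (Y - tr s Y) + card (tr s (Y - tr s' Y))"
    by (rule card_Un_le)
  also have "card (tr s (Y - tr s' Y)) = dd Y s'"
    unfolding dd_def by (rule card_tr) (use Y in auto)
  finally show ?thesis by (simp add: dd_def)
qed

lemma rho_minus:
  assumes Y: "Y \<subseteq> G"
  shows "rho Y (- s) = rho Y s"
proof -
  have "tr s (Y \<inter> tr (- s) Y) = Y \<inter> tr s Y"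
    using Y by (auto simp: tr_Int tr_tr tr_0)
  then show ?thesis
    unfolding rho_def using card_tr[of "Y \<inter> tr (- s) Y" s] Y by (simp add: le_infI1)
qed

lemma dd_minus: "Y \<subseteq> G \<Longrightarrow> dd Y (- s) = dd Y s"
  using dd_rho[of Y s] dd_rho[of Y "- s"] rho_minus[of Y s] by simp

lemma rho_sum: "Y \<subseteq> G \<Longrightarrow> rho Y s = (\<Sum>x\<in>Y. of_bool ((x - s) mod p \<in> Y))"
proof -
  assume Y: "Y \<subseteq> G"
  have "Y \<inter> tr s Y = {x \<in> Y. (x - s) mod p \<in> Y}" using Y by (auto simp: tr_def)
  then show ?thesis unfolding rho_def using card_of_bool_sum[OF finite_sub_G[OF Y]] by simp
qed

lemma sum_rho:
  assumes Y: "Y \<subseteq> G"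
  shows "(\<Sum>s\<in>G. rho Y s) = card Y ^ 2"
proof -
  have "(\<Sum>s\<in>G. rho Y s) = (\<Sum>x\<in>Y. \<Sum>s\<in>G. of_bool ((x - s) mod p \<in> Y))"
    unfolding rho_sum[OF Y] by (rule sum.swap)
  also have "\<dots> = (\<Sum>x\<in>Y. card Y)"
    by (rule sum.cong) (simp_all add: sum_reflect[of "\<lambda>z. of_bool (z \<in> Y)"] card_G_sum[OF Y])
  finally show ?thesis by (simp add: power2_eq_square)
qed

lemma card_tr_Int_tr:
  assumes Y: "Y \<subseteq> G"
  shows "card (tr a Y \<inter> tr b Y) = rho Y (b - a)"
proof -
  have "tr a (Y \<inter> tr (b - a) Y) = tr a Y \<inter> tr b Y"
    by (simp add: tr_Int tr_tr)
  then show ?thesis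
    unfolding rho_def using card_tr[of "Y \<inter> tr (b - a) Y" a] Y by auto
qed

lemma card_tr_Diff_tr:
  assumes Y: "Y \<subseteq> G"
  shows "card (tr a Y - tr b Y) = dd Y (b - a)"
proof -
  have "tr a (Y - tr (b - a) Y) = tr a Y - tr b Y"
    by (simp add: tr_Diff tr_tr)
  then show ?thesis
    unfolding dd_def using card_tr[of "Y - tr (b - a) Y" a] Y by auto
qed

text \<open>Both sides count the solutions of \<open>a + b = a' + b'\<close>, the additive energy of
  the pair; on the right they are sorted by the common difference \<open>s\<close>.\<close>

lemma sum_rr_square:
  assumes X: "X \<subseteq> G" and Y: "Y \<subseteq> G"
  shows "(\<Sum>x\<in>G. (rr X Y x)\<^sup>2) = (\<Sum>s\<in>G. rho X s * rho Y s)"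
proof -
  define I where "I x a = (of_bool ((x - a) mod p \<in> Y) :: nat)" for x a
  have "(\<Sum>x\<in>G. (rr X Y x)\<^sup>2) = (\<Sum>x\<in>G. \<Sum>a\<in>X. \<Sum>b\<in>X. I x a * I x b)"
    by (simp add: rr_sum[OF X] I_def power2_eq_square sum_product)
  also have "\<dots> = (\<Sum>a\<in>X. \<Sum>b\<in>X. \<Sum>x\<in>G. I x a * I x b)"
    by (subst sum.swap) (simp add: sum.swap[of _ G])
  also have "\<dots> = (\<Sum>a\<in>X. \<Sum>b\<in>X. rho Y ((b - a) mod p))"
  proof (intro sum.cong refl)
    fix a b
    have "card (tr a Y \<inter> tr b Y) = (\<Sum>x\<in>G. of_bool (x \<in> tr a Y \<inter> tr b Y))"
      by (rule card_G_sum) (rule le_infI1[OF tr_sub])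
    also have "\<dots> = (\<Sum>x\<in>G. I x a * I x b)"
      by (rule sum.cong) (auto simp: I_def tr_def)
    finally show "(\<Sum>x\<in>G. I x a * I x b) = rho Y ((b - a) mod p)"
      by (simp add: card_tr_Int_tr[OF Y])
  qed
  also have "\<dots> = (\<Sum>b\<in>X. \<Sum>a\<in>X. rho Y ((b - a) mod p))" by (rule sum.swap)
  also have "\<dots> = (\<Sum>b\<in>X. \<Sum>s\<in>G. of_bool ((b - s) mod p \<in> X) * rho Y s)"
  proof (rule sum.cong[OF refl])
    fix b
    have "(\<Sum>a\<in>X. rho Y ((b - a) mod p)) = (\<Sum>a\<in>G. of_bool (a \<in> X) * rho Y ((b - a) mod p))"
      by (rule sum.mono_neutral_cong_left) (use X in auto)
    also have "\<dots> = (\<Sum>s\<in>G. of_bool ((b - s) mod p \<in> X) * rho Y ((b - (b - s) mod p) mod p))"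
      by (rule sum_reflect[of "\<lambda>a. of_bool (a \<in> X) * rho Y ((b - a) mod p)" b, symmetric])
    also have "\<dots> = (\<Sum>s\<in>G. of_bool ((b - s) mod p \<in> X) * rho Y s)"
      by (rule sum.cong) (auto simp: mod_simps simp del: rho_mod)
    finally show "(\<Sum>a\<in>X. rho Y ((b - a) mod p)) = (\<Sum>s\<in>G. of_bool ((b - s) mod p \<in> X) * rho Y s)" .
  qed
  also have "\<dots> = (\<Sum>s\<in>G. rho X s * rho Y s)"
    by (subst sum.swap) (simp add: rho_sum[OF X] sum_distrib_right)
  finally show ?thesis .
qed

text \<open>For each \<open>x\<close> the count is modular in the first set, by
  \<open>rr_Un_Int\<close>, so a concave truncation makes it submodular. Applied to a set and its
  translate, this is the inequality that uncrosses them.\<close>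

lemma pol_submodular:
  assumes X: "X \<subseteq> G" and X': "X' \<subseteq> G"
  shows "pol t (X \<union> X') Y + pol t (X \<inter> X') Y \<le> pol t X Y + pol t X' Y"
  unfolding pol_def sum.distrib[symmetric]
proof (rule sum_mono)
  fix x
  show "min t (rr (X \<union> X') Y x) + min t (rr (X \<inter> X') Y x) \<le> min t (rr X Y x) + min t (rr X' Y x)"
    by (rule min_concave) (use X X' in \<open>auto intro: rr_Un_Int rr_mono\<close>)
qed

lemma card_popular: "t * card {x \<in> G. t \<le> rr X Y x} \<le> pol t X Y"
proof -
  have "t * card {x \<in> G. t \<le> rr X Y x} = (\<Sum>x\<in>{x \<in> G. t \<le> rr X Y x}. min t (rr X Y x))"
    by (simp add: min_absorb1)
  also have "\<dots> \<le> pol t X Y"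
    unfolding pol_def by (rule sum_mono2) auto
  finally show ?thesis .
qed

lemma sum_unpopular: "(\<Sum>x\<in>{x \<in> G. rr X Y x < t}. rr X Y x) \<le> pol t X Y"
proof -
  have "(\<Sum>x\<in>{x \<in> G. rr X Y x < t}. rr X Y x) = (\<Sum>x\<in>{x \<in> G. rr X Y x < t}. min t (rr X Y x))"
    by (rule sum.cong) auto
  also have "\<dots> \<le> pol t X Y"
    unfolding pol_def by (rule sum_mono2) auto
  finally show ?thesis .
qed

text \<open>The unpopular sums carry at most half of all representations, so at most
  \<open>3 * card Y\<close> popular ones carry the other half, and Cauchy-Schwarz bounds the
  additive energy from below. By \<open>sum_rr_square\<close> that energy is a sum over shifts, of
  which the zero shift provides too little.\<close>

lemma exists_large_shift:
  assumes X: "X \<subseteq> G" and Y: "Y \<subseteq> G" and pol: "pol t X Y \<le> 3 * card Y * t"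
    and Y0: "card Y > 0"
    and t: "6 * t \<le> card X" "t > 0" and m: "card X \<ge> 24"
  shows "\<exists>s\<in>G. s \<noteq> 0 \<and> card X ^ 2 \<le> 24 * card Y * rho X s"
proof (rule ccontr)
  assume "\<not> ?thesis"
  then have small: "24 * card Y * rho X s < card X ^ 2" if "s \<in> G" "s \<noteq> 0" for s
    using that by (auto simp: not_le)
  define m where "m = real (card X)"
  define n where "n = real (card Y)"
  define r where "r x = real (rr X Y x)" for x
  define S where "S = {x \<in> G. t \<le> rr X Y x}"
  have m24: "m \<ge> 24" using m by (simp add: m_def)
  have n0: "n > 0" using Y0 by (simp add: n_def)
  have "t * card S \<le> 3 * card Y * t" using order_trans[OF card_popular pol] by (simp only: S_def)
  then have cS: "real (card S) \<le> 3 * n" using t by (simp add: n_def mult.commute)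
  have "(\<Sum>x\<in>G. r x) = m * n"
    using sum_rr[OF X Y] by (simp add: r_def m_def n_def flip: of_nat_sum of_nat_mult)
  moreover have "(\<Sum>x\<in>G. r x) = (\<Sum>x\<in>S. r x) + (\<Sum>x\<in>{x \<in> G. rr X Y x < t}. r x)"
  proof -
    have "sum r (S \<union> {x \<in> G. rr X Y x < t}) = sum r S + sum r {x \<in> G. rr X Y x < t}"
      by (rule sum.union_disjoint) (auto simp: S_def intro: finite_subset[of _ G])
    moreover have "S \<union> {x \<in> G. rr X Y x < t} = G" by (auto simp: S_def)
    ultimately show ?thesis by simp
  qed
  moreover have "(\<Sum>x\<in>{x \<in> G. rr X Y x < t}. r x) \<le> m * n / 2"
  proof -
    have "(\<Sum>x\<in>{x \<in> G. rr X Y x < t}. r x) \<le> real (3 * card Y * t)"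
      using order_trans[OF sum_unpopular pol] unfolding r_def of_nat_sum[symmetric] of_nat_le_iff .
    also have "\<dots> = 3 * n * real t" by (simp add: n_def)
    also have "\<dots> \<le> 3 * n * (m / 6)" using t n0 by (intro mult_left_mono) (auto simp: m_def)
    finally show ?thesis by simp
  qed
  ultimately have SS: "m * n / 2 \<le> (\<Sum>x\<in>S. r x)" by linarith
  have "(m * n / 2)\<^sup>2 \<le> (\<Sum>x\<in>S. r x * 1)\<^sup>2"
    using SS m24 n0 by (intro power_mono) auto
  also have "\<dots> \<le> (\<Sum>x\<in>S. (r x)\<^sup>2) * (\<Sum>x\<in>S. 1\<^sup>2)" by (rule sum_mult_square_le)
  also have "\<dots> \<le> (\<Sum>x\<in>G. (r x)\<^sup>2) * (3 * n)"
    using cS by (intro mult_mono sum_mono2) (auto simp: S_def intro!: sum_nonneg)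
  finally have "n * (m\<^sup>2 * n / 12) \<le> n * (\<Sum>x\<in>G. (r x)\<^sup>2)"
    by (simp add: power2_eq_square field_simps)
  then have q: "m\<^sup>2 * n / 12 \<le> (\<Sum>x\<in>G. (r x)\<^sup>2)" using n0 by simp
  have "(\<Sum>x\<in>G. (r x)\<^sup>2) = real (\<Sum>s\<in>G. rho X s * rho Y s)"
    using sum_rr_square[OF X Y] by (simp add: r_def flip: of_nat_sum of_nat_power)
  also have "\<dots> = real (rho X 0 * rho Y 0) + (\<Sum>s\<in>G - {0}. real (rho X s) * real (rho Y s))"
    by (subst sum.remove[of _ 0]) (use p_gt1 in auto)
  also have "\<dots> \<le> m * n + (\<Sum>s\<in>G - {0}. (m\<^sup>2 / (24 * n)) * real (rho Y s))"
  proof (intro add_mono sum_mono mult_right_mono)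
    show "real (rho X 0 * rho Y 0) \<le> m * n"
      using dd_rho[OF X, of 0] dd_rho[OF Y, of 0] dd_0[OF X] dd_0[OF Y] by (simp add: m_def n_def)
    fix s assume s: "s \<in> G - {0}"
    then have "real (24 * card Y * rho X s) < real (card X ^ 2)" using small of_nat_less_iff by blast
    then show "real (rho X s) \<le> m\<^sup>2 / (24 * n)" using n0 by (simp add: field_simps m_def n_def)
  qed simp
  also have "(\<Sum>s\<in>G - {0}. (m\<^sup>2 / (24 * n)) * real (rho Y s)) = (m\<^sup>2 / (24 * n)) * (n\<^sup>2 - n)"
  proof -
    have "(\<Sum>s\<in>G. real (rho Y s)) = n\<^sup>2"
      using sum_rho[OF Y] by (simp add: n_def flip: of_nat_sum of_nat_power)
    moreover have "(\<Sum>s\<in>G. real (rho Y s)) = real (rho Y 0) + (\<Sum>s\<in>G - {0}. real (rho Y s))"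
      by (subst sum.remove[of _ 0]) (use p_gt1 in auto)
    moreover have "real (rho Y 0) = n"
      using dd_rho[OF Y, of 0] dd_0[OF Y] by (simp add: n_def)
    ultimately have "(\<Sum>s\<in>G - {0}. real (rho Y s)) = n\<^sup>2 - n" by linarith
    then show ?thesis by (simp only: sum_distrib_left[symmetric])
  qed
  \<comment> \<open>If all nonzero shifts had small overlap, they could supply only half of the
    lower bound \<open>m\<^sup>2 * n / 12\<close>, since 24 is twice 12. The zero shift adds
    \<open>m * n\<close>, which for \<open>24 \<le> m\<close> does not exceed the other
    half.\<close>
  finally have "m\<^sup>2 * n / 12 \<le> m * n + (m\<^sup>2 / (24 * n)) * (n\<^sup>2 - n)" using q by simp
  moreover have "(m\<^sup>2 / (24 * n)) * (n\<^sup>2 - n) = m\<^sup>2 * (n - 1) / 24"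
    using n0 by (simp add: power2_eq_square field_simps)
  ultimately have "m\<^sup>2 * n / 12 \<le> m * n + m\<^sup>2 * (n - 1) / 24" by linarith
  then have "m * m * n \<le> 24 * (m * n) - m * m" by (simp add: power2_eq_square field_simps)
  then have "m * m * n \<le> m * (24 * n - m)" by (simp add: algebra_simps)
  then have "m * n \<le> 24 * n - m" using m24 by (simp add: mult.assoc)
  moreover have "24 * n \<le> m * n" using m24 n0 by simp
  ultimately show False using m24 by linarith
qed

text \<open>Take a shift whose overlap with \<open>X\<close> is neither tiny nor almost full. By
  submodularity the union and the intersection together have little excess, and
  \<open>pollard\<close> bounds the union from below, so the intersection is again extremal, with
  error \<open>2 * e + t\<close>. The hypothesis on \<open>2 * card X + card Y\<close> is what
  \<open>pollard\<close> requires for the union.\<close>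

lemma uncross_step:
  assumes X: "X \<subseteq> G" and Y: "Y \<subseteq> G" and le: "card X \<le> card Y" and pp: "int (2 * card X + card Y) \<le> p"
    and pol: "pol t X Y \<le> t * (card X + card Y + e)" and e: "e \<le> card Y"
    and t: "6 * t \<le> card X" "t > 0" and m: "card X \<ge> 24"
  shows "\<exists>X'. X' \<subseteq> G \<and> card X ^ 2 \<le> 24 * card Y * card X' \<and> 4 * card X' \<le> 3 * card X \<and>
    pol t X' Y \<le> t * (card X' + card Y + (2 * e + t))"
proof -
  have "t * (card X + card Y + e) \<le> t * (3 * card Y)" using le e by (intro mult_left_mono) auto
  then have "pol t X Y \<le> 3 * card Y * t" using order_trans[OF pol] by (simp only: mult_ac)
  then obtain s0 where s0: "s0 \<in> G" "s0 \<noteq> 0" "card X ^ 2 \<le> 24 * card Y * rho X s0"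
    using exists_large_shift[OF X Y _ _ t m] le m by force
  \<comment> \<open>If \<open>s0\<close> preserves more than three quarters of \<open>X\<close>, it
    is replaced by its first multiple that preserves at most three quarters. By subadditivity of
    \<open>dd\<close> this multiple loses at most two quarters, so it still preserves half of
    \<open>X\<close>.\<close>
  have "\<exists>s. card X ^ 2 \<le> 24 * card Y * rho X s \<and> 4 * rho X s \<le> 3 * card X"
  proof (cases "4 * rho X s0 \<le> 3 * card X")
    case True
    then show ?thesis using s0 by blast
  next
    case False
    have nd: "\<not> p dvd s0" using s0 diff_not_dvd[of s0 0] p_gt1 by auto
    \<comment> \<open>The multiples of \<open>s0\<close> run through the whole group, where the mean
      overlap is \<open>card X ^ 2 / p\<close>. This is at most a third of \<open>card X\<close>,
      because \<open>3 * card X \<le> p\<close>.\<close>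
    have ex: "\<exists>j::nat. 4 * rho X (int j * s0) \<le> 3 * card X"
    proof (rule ccontr)
      assume "\<not> ?thesis"
      then have all: "4 * rho X (int j * s0) > 3 * card X" for j :: nat by (auto simp: not_le)
      have big: "4 * rho X s \<ge> 3 * card X" if "s \<in> G" for s
      proof -
        obtain j where "(int j * s0) mod p = s mod p" using ex_cong_mult[OF nd] by blast
        then show ?thesis using all[of j] by (metis rho_mod less_imp_le)
      qed
      have "(\<Sum>s\<in>G. 3 * card X) \<le> (\<Sum>s\<in>G. 4 * rho X s)" by (rule sum_mono) (rule big)
      also have "\<dots> = 4 * card X ^ 2" using sum_rho[OF X] by (simp add: sum_distrib_left[symmetric])
      finally have "3 * (nat p * card X) \<le> 4 * (card X * card X)" by (simp add: power2_eq_square mult_ac)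
      then have "3 * nat p \<le> 4 * card X" using m by simp
      then show False using pp le m by linarith
    qed
    define j where "j = (LEAST j::nat. 4 * rho X (int j * s0) \<le> 3 * card X)"
    have j: "4 * rho X (int j * s0) \<le> 3 * card X" unfolding j_def by (rule LeastI_ex[OF ex])
    have "j \<noteq> 0"
    proof
      assume "j = 0"
      then have "4 * card X \<le> 3 * card X" using j dd_rho[OF X, of 0] dd_0[OF X] by simp
      then show False using m by simp
    qed
    then obtain i where i: "j = Suc i" using not0_implies_Suc by blast
    have "\<not> 4 * rho X (int i * s0) \<le> 3 * card X"
      using not_less_Least[of i "\<lambda>j. 4 * rho X (int j * s0) \<le> 3 * card X"] i by (simp add: j_def)
    moreover have "dd X (int j * s0) \<le> dd X (int i * s0) + dd X s0"
      using dd_add[OF X, of "int i * s0" s0] i by (simp add: algebra_simps)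
    ultimately have "card X \<le> 2 * rho X (int j * s0)"
      using False dd_rho[OF X, of s0] dd_rho[OF X, of "int i * s0"] dd_rho[OF X, of "int j * s0"] by linarith
    then have "card X * card X \<le> card Y * (2 * rho X (int j * s0))" using le by (intro mult_mono) auto
    then have "card X ^ 2 \<le> 24 * card Y * rho X (int j * s0)" unfolding power2_eq_square by linarith
    then show ?thesis using j by blast
  qed
  then obtain s where s: "card X ^ 2 \<le> 24 * card Y * rho X s" "4 * rho X s \<le> 3 * card X" by blast
  define Z where "Z = tr s X"
  have Z: "Z \<subseteq> G" "card Z = card X" by (simp_all add: Z_def card_tr[OF X])
  have cI: "card (X \<inter> Z) = rho X s" by (simp add: rho_def Z_def)
  have cU: "card (X \<union> Z) + rho X s = 2 * card X"
    using card_Un_Int[of X Z] X Z cI finite_sub_G by simp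
  have rl: "rho X s \<le> card X" using dd_rho[OF X, of s] by linarith
  have "t * (card (X \<union> Z) + card Y - t) \<le> pol t (X \<union> Z) Y"
    by (rule pollard) (use X Y Z t le pp cU rl in auto)
  moreover have "pol t (X \<union> Z) Y + pol t (X \<inter> Z) Y \<le> 2 * pol t X Y"
    using pol_submodular[OF X Z(1), of t Y] pol_tr_left[OF X Y, of t s] by (simp add: Z_def)
  ultimately have "t * (card (X \<union> Z) + card Y - t) + pol t (X \<inter> Z) Y \<le> 2 * (t * (card X + card Y + e))"
    using pol by linarith
  moreover have "2 * (t * (card X + card Y + e)) = t * (card (X \<union> Z) + card Y - t) + t * (rho X s + card Y + (2 * e + t))"
  proof -
    have "2 * (card X + card Y + e) = (card (X \<union> Z) + card Y - t) + (rho X s + card Y + (2 * e + t))"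
    proof -
      have "t \<le> card (X \<union> Z) + card Y" using t le by simp
      then obtain v where v: "card (X \<union> Z) + card Y = t + v" using le_Suc_ex by blast
      have "2 * (card X + card Y + e) = v + (rho X s + card Y + (2 * e + t))" using cU v by (simp add: algebra_simps)
      then show ?thesis using v by simp
    qed
    then show ?thesis by (metis add_mult_distrib2 mult.left_commute)
  qed
  ultimately have "pol t (X \<inter> Z) Y \<le> t * (rho X s + card Y + (2 * e + t))" by linarith
  then show ?thesis using s cI X by (intro exI[of _ "X \<inter> Z"]) auto
qed

text \<open>One step turns \<open>e\<close> into \<open>2 * e + t\<close>, so \<open>e + t\<close>
  exactly doubles and is the quantity to follow. The factor \<open>3 / 4\<close> bounds the size
  from above and \<open>kap\<close> from below.\<close>

lemma uncross_iter:
  fixes \<alpha> :: real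
  assumes \<alpha>: "0 < \<alpha>" "\<alpha> \<le> 1" and X: "X \<subseteq> G" and Y: "Y \<subseteq> G" and le: "card X \<le> card Y"
    and pp: "int (2 * card X + card Y) \<le> p"
    and Xl: "\<alpha> * card Y \<le> card X" and pol: "pol t X Y \<le> t * (card X + card Y + e)"
    and t: "t > 0"
  shows "6 * real t \<le> kap \<alpha> j * card Y \<Longrightarrow> 24 \<le> kap \<alpha> j * card Y \<Longrightarrow> 2 ^ j * (e + t) \<le> card Y \<Longrightarrow>
    \<exists>X' e'. X' \<subseteq> G \<and> kap \<alpha> j * card Y \<le> card X' \<and> card X' \<le> (3/4) ^ j * card Y \<and> card X' \<le> card X \<and>
      e' + t \<le> 2 ^ j * (e + t) \<and> pol t X' Y \<le> t * (card X' + card Y + e')"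
proof (induction j)
  case 0
  then show ?case using X Xl le pol by auto
next
  case (Suc j)
  have kle: "kap \<alpha> (Suc j) * card Y \<le> kap \<alpha> j * card Y"
    using kap_Suc_le[OF \<alpha>] by (intro mult_right_mono) auto
  have kpos: "kap \<alpha> j > 0" using kap_bounds[OF \<alpha>] by blast
  have "2 ^ j * (e + t) \<le> card Y" using Suc.prems(3) by simp
  then obtain X' e' where X': "X' \<subseteq> G" "kap \<alpha> j * card Y \<le> card X'" "card X' \<le> (3/4) ^ j * card Y" "card X' \<le> card X"
    "e' + t \<le> 2 ^ j * (e + t)" "pol t X' Y \<le> t * (card X' + card Y + e')"
    using Suc.IH Suc.prems kle by (meson order_trans)
  have "\<exists>X''. X'' \<subseteq> G \<and> card X' ^ 2 \<le> 24 * card Y * card X'' \<and> 4 * card X'' \<le> 3 * card X' \<and>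
    pol t X'' Y \<le> t * (card X'' + card Y + (2 * e' + t))"
  proof (rule uncross_step)
    show "card X' \<le> card Y" "int (2 * card X' + card Y) \<le> p" using X'(4) le pp by auto
    show "e' \<le> card Y" using X'(5) \<open>2 ^ j * (e + t) \<le> card Y\<close> by linarith
    have "6 * real t \<le> real (card X')" using Suc.prems(1) kle X'(2) by linarith
    then show "6 * t \<le> card X'" by linarith
    have "24 \<le> real (card X')" using Suc.prems(2) kle X'(2) by linarith
    then show "24 \<le> card X'" by linarith
  qed (use X' Y t in auto)
  then obtain X'' where X'': "X'' \<subseteq> G" "card X' ^ 2 \<le> 24 * card Y * card X''" "4 * card X'' \<le> 3 * card X'"
    "pol t X'' Y \<le> t * (card X'' + card Y + (2 * e' + t))" by blast
  have Y0: "real (card Y) > 0" using Suc.prems(2) kpos by (cases "card Y = 0") auto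
  have "(kap \<alpha> j * card Y)\<^sup>2 \<le> (real (card X'))\<^sup>2" using X'(2) kpos by (intro power_mono) auto
  also have "\<dots> = real (card X' ^ 2)" by simp
  also have "\<dots> \<le> real (24 * card Y * card X'')" using X''(2) of_nat_le_iff by blast
  also have "\<dots> = 24 * real (card Y) * card X''" by simp
  finally have "real (card Y) * ((kap \<alpha> j)\<^sup>2 * card Y) \<le> real (card Y) * (24 * card X'')"
    by (simp add: power2_eq_square mult_ac)
  then have "(kap \<alpha> j)\<^sup>2 * card Y \<le> 24 * card X''" using Y0 by simp
  then have "kap \<alpha> (Suc j) * card Y \<le> card X''" by simp
  moreover have "real (card X'') \<le> (3/4) ^ Suc j * card Y" using X''(3) X'(3) by simp
  moreover have "card X'' \<le> card X" using X''(3) X'(4) by linarith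
  moreover have "(2 * e' + t) + t \<le> 2 ^ Suc j * (e + t)" using X'(5) by simp
  ultimately show ?case using X''(1,4) by blast
qed

end

section \<open>Sets of small shifts\<close>

context zp
begin

text \<open>Let \<open>S\<close> be the set of popular sums, of size at most about
  \<open>card X + card Y\<close>. On average the translates of \<open>Y\<close> by elements of
  \<open>X\<close> lie almost inside \<open>S\<close>, and two translates that do so differ in at
  most about \<open>card X\<close> elements, which is the cost of the shift between them. The three
  tolerances \<theta> come from the size of \<open>S\<close> and from each of the two
  translates.\<close>

lemma small_shifts:
  fixes \<theta> :: real
  assumes X: "X \<subseteq> G" and Y: "Y \<subseteq> G" and le: "card X \<le> card Y" and t: "t > 0" and \<theta>: "\<theta> > 0" and X0: "card X > 0"
    and pol: "pol t X Y \<le> t * (card X + card Y + e)" and e: "e \<le> card Y" "real e \<le> \<theta> * card X"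
    and small: "3 * real (card Y) * real t \<le> \<theta>\<^sup>2 * (real (card X))\<^sup>2"
  shows "\<exists>X0. X0 \<subseteq> X \<and> (1 - \<theta>) * card X \<le> card X0 \<and>
    (\<forall>a\<in>X0. \<forall>a'\<in>X0. real (dd Y (a' - a)) \<le> (1 + 3 * \<theta>) * card X)"
proof -
  define m where "m = real (card X)"
  define n where "n = real (card Y)"
  define S where "S = {x \<in> G. t \<le> rr X Y x}"
  have m0: "m > 0" using X0 by (simp add: m_def)
  have fX: "finite X" and fS: "finite S" using X finite_sub_G by (auto simp: S_def intro: finite_subset[of _ G])
  have "t * card S \<le> t * (card X + card Y + e)"
    using order_trans[OF card_popular pol] by (simp only: S_def)
  then have "card S \<le> card X + card Y + e" using t by simp
  then have cS: "real (card S) \<le> m + n + \<theta> * m" using e by (simp add: m_def n_def)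
  have GS: "G - S = {x \<in> G. rr X Y x < t}" by (auto simp: S_def)
  have sub: "tr a Y \<inter> (G - S) = tr a Y - S" for a using tr_sub by blast
  have "(\<Sum>a\<in>X. card (tr a Y - S)) = (\<Sum>x\<in>G - S. rr X Y x)"
    using sum_rr_pairs[OF X Y, of "G - S"] by (simp add: sub)
  also have "\<dots> \<le> t * (card X + card Y + e)"
    using order_trans[OF sum_unpopular pol] by (simp only: GS)
  also have "\<dots> \<le> t * (3 * card Y)" using le e by (intro mult_left_mono) auto
  finally have "real (\<Sum>a\<in>X. card (tr a Y - S)) \<le> real (t * (3 * card Y))" by (simp only: of_nat_le_iff)
  then have tot: "(\<Sum>a\<in>X. real (card (tr a Y - S))) \<le> \<theta>\<^sup>2 * m\<^sup>2"
    using small by (simp add: m_def mult_ac)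
  define X0 where "X0 = {a \<in> X. real (card (tr a Y - S)) \<le> \<theta> * m}"
  have "real (card (X - X0)) * (\<theta> * m) = (\<Sum>a\<in>X - X0. \<theta> * m)" by simp
  also have "\<dots> \<le> (\<Sum>a\<in>X - X0. real (card (tr a Y - S)))"
    by (rule sum_mono) (auto simp: X0_def)
  also have "\<dots> \<le> (\<Sum>a\<in>X. real (card (tr a Y - S)))"
    by (rule sum_mono2) (use fX in auto)
  finally have "real (card (X - X0)) * (\<theta> * m) \<le> (\<theta> * m) * (\<theta> * m)"
    using tot by (simp add: power2_eq_square mult_ac)
  then have "real (card (X - X0)) \<le> \<theta> * m" using \<theta> m0 by simp
  moreover have "card (X - X0) + card X0 = card X"
    using card_Diff_subset[of X0 X] fX by (metis (no_types, lifting) X0_def card_mono finite_subset le_add_diff_inverse2 mem_Collect_eq subsetI)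
  ultimately have c0: "(1 - \<theta>) * m \<le> card X0" by (simp add: m_def algebra_simps)
  have "real (dd Y (a' - a)) \<le> (1 + 3 * \<theta>) * m" if a: "a \<in> X0" "a' \<in> X0" for a a'
  proof -
    have h: "real (card (tr a Y - S)) \<le> \<theta> * m" "real (card (tr a' Y - S)) \<le> \<theta> * m"
      using a by (auto simp: X0_def)
    have "card (tr a' Y - S) + card (S \<inter> tr a' Y) = card Y"
      using card_Int_Diff[of "tr a' Y" S] card_tr[OF Y, of a'] by (simp add: Int_commute)
    moreover have "card (S - tr a' Y) + card (S \<inter> tr a' Y) = card S"
      using card_Int_Diff[OF fS, of "tr a' Y"] by simp
    ultimately have 1: "real (card (S - tr a' Y)) = card S - (n - real (card (tr a' Y - S)))"
      by (simp add: n_def)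
    have "dd Y (a' - a) = card (tr a Y - tr a' Y)" by (simp add: card_tr_Diff_tr[OF Y])
    also have "\<dots> \<le> card ((tr a Y - S) \<union> (S - tr a' Y))"
      by (rule card_mono) (use fS in auto)
    also have "\<dots> \<le> card (tr a Y - S) + card (S - tr a' Y)" by (rule card_Un_le)
    finally have "real (dd Y (a' - a)) \<le> real (card (tr a Y - S)) + real (card (S - tr a' Y))" by simp
    then show ?thesis using 1 h cS by (simp add: algebra_simps)
  qed
  then show ?thesis using c0 unfolding m_def by (intro exI[of _ X0]) (auto simp: X0_def)
qed

text \<open>For an interval, the ball of a small radius \<open>y\<close> is \<open>{-y..y}\<close>
  modulo \<open>p\<close> and has \<open>2 * y + 1\<close> elements. The bounds on the balls of
  \<open>Y\<close> express that they grow at the same rate of two per unit of radius.\<close>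

definition ball :: "int set \<Rightarrow> nat \<Rightarrow> int set" where
  "ball Y y = {s \<in> G. dd Y s \<le> y}"

lemma ball_sub [simp]: "ball Y y \<subseteq> G"
  by (auto simp: ball_def)

lemma finite_ball [simp]: "finite (ball Y y)"
  using ball_sub finite_sub_G by blast

lemma ball_mono: "y \<le> y' \<Longrightarrow> card (ball Y y) \<le> card (ball Y y')"
  by (rule card_mono[OF finite_ball]) (auto simp: ball_def)

lemma zero_in_ball: "Y \<subseteq> G \<Longrightarrow> 0 \<in> ball Y y"
  using p_gt1 by (simp add: ball_def dd_0)

text \<open>Differences of elements of \<open>X0\<close> cost at most \<open>u\<close>, so adding
  \<open>X0\<close> and then subtracting it leads from one ball into the next. Cauchy-Davenport is
  applied once for each, whence the gain \<open>2 * card X0 - 2\<close>.\<close>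

lemma ball_grow:
  assumes Y: "Y \<subseteq> G" and X0: "X0 \<subseteq> G" "X0 \<noteq> {}"
    and u: "\<And>a a'. a \<in> X0 \<Longrightarrow> a' \<in> X0 \<Longrightarrow> dd Y (a' - a) \<le> u"
  shows "min p (int (card (ball Y y)) + 2 * int (card X0) - 2) \<le> int (card (ball Y (y + u)))"
proof -
  define N where "N = (\<lambda>a. (0 - a) mod p) ` X0"
  have "inj_on (\<lambda>a. (0 - a) mod p) G" using bij_reflect[of 0] bij_betw_def by blast
  then have cN: "card N = card X0" unfolding N_def using X0 by (intro card_image) (auto intro: inj_on_subset)
  have N: "N \<subseteq> G" "N \<noteq> {}" using X0 by (auto simp: N_def)
  have b: "ball Y y \<noteq> {}" using zero_in_ball[OF Y] by auto
  define S where "S = sm (ball Y y) X0"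
  have S: "S \<subseteq> G" by (simp add: S_def)
  have S0: "S \<noteq> {}" using b X0 by (auto simp: S_def sm_def)
  have 1: "min p (int (card (ball Y y) + card X0) - 1) \<le> int (card S)"
    unfolding S_def by (rule cauchy_davenport) (use b X0 in auto)
  have 2: "min p (int (card S + card N) - 1) \<le> int (card (sm S N))"
    by (rule cauchy_davenport) (use S S0 N in auto)
  have "sm S N \<subseteq> ball Y (y + u)"
  proof
    fix z assume "z \<in> sm S N"
    then obtain s a a' where z: "s \<in> ball Y y" "a \<in> X0" "a' \<in> X0" "z = ((s + a) mod p + (0 - a') mod p) mod p"
      by (auto simp: sm_def S_def N_def)
    have "z = (s + a + (0 - a')) mod p" by (simp only: z(4) mod_add_eq)
    then have "z = (s + (a - a')) mod p" by (simp add: algebra_simps)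
    then have "dd Y z = dd Y (s + (a - a'))" "z \<in> G" by simp_all
    moreover have "dd Y (s + (a - a')) \<le> dd Y s + dd Y (a - a')" by (rule dd_add[OF Y])
    moreover have "dd Y s \<le> y" using z by (simp add: ball_def)
    ultimately show "z \<in> ball Y (y + u)" using u[OF z(3,2)] by (simp add: ball_def)
  qed
  then have "card (sm S N) \<le> card (ball Y (y + u))" by (rule card_mono[rotated]) simp
  moreover have "card X0 \<ge> 1" using X0 finite_sub_G by (auto simp: Suc_le_eq card_gt_0_iff)
  ultimately show ?thesis using 1 2 cN by linarith
qed

lemma ball_grow_iter:
  assumes Y: "Y \<subseteq> G" and X0: "X0 \<subseteq> G" "X0 \<noteq> {}"
    and u: "\<And>a a'. a \<in> X0 \<Longrightarrow> a' \<in> X0 \<Longrightarrow> dd Y (a' - a) \<le> u"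
  shows "min p (int (card (ball Y y)) + int j * (2 * int (card X0) - 2)) \<le> int (card (ball Y (y + j * u)))"
proof (induction j)
  case (Suc j)
  define W where "W = 2 * int (card X0) - 2"
  have "card X0 \<ge> 1" using X0 finite_sub_G by (auto simp: Suc_le_eq card_gt_0_iff)
  then have c: "W \<ge> 0" by (simp add: W_def)
  have "min p (int (card (ball Y (y + j * u))) + 2 * int (card X0) - 2) \<le> int (card (ball Y (y + j * u + u)))"
    by (rule ball_grow[OF Y X0 u])
  then have "min p (int (card (ball Y (y + j * u))) + W) \<le> int (card (ball Y (y + Suc j * u)))"
    by (simp add: W_def ac_simps)
  moreover have "int (Suc j) * W = int j * W + W" by (simp add: algebra_simps)
  moreover have "min p (int (card (ball Y y)) + int j * W) \<le> int (card (ball Y (y + j * u)))"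
    using Suc by (simp add: W_def)
  ultimately have "min p (int (card (ball Y y)) + int (Suc j) * W) \<le> int (card (ball Y (y + Suc j * u)))"
    using c by linarith
  then show ?case by (simp only: W_def)
qed simp

lemma dd_compl: "Y \<subseteq> G \<Longrightarrow> dd (G - Y) s = dd Y s"
proof -
  assume Y: "Y \<subseteq> G"
  have "(G - Y) - tr s (G - Y) = tr s Y - tr 0 Y"
    using Y by (auto simp: tr_def)
  then have "dd (G - Y) s = dd Y (0 - s)" unfolding dd_def[of "G - Y"] using card_tr_Diff_tr[OF Y] by simp
  then show ?thesis using dd_minus[OF Y] by simp
qed

text \<open>After exchanging the sums, a shift of cost \<open>d\<close> is counted
  \<open>N - d\<close> times, which is its overlap, and the overlaps add up to the square of the
  size. A set and its complement have the same costs, so either of the two sizes may serve as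
  \<open>N\<close>.\<close>

lemma sum_card_ball:
  assumes Y: "Y \<subseteq> G" and N: "N = card Y \<or> N = card (G - Y)"
  shows "(\<Sum>y<N. card (ball Y y)) = N\<^sup>2"
proof -
  obtain Z where Z: "Z \<subseteq> G" "N = card Z" "\<And>s. dd Z s = dd Y s"
    using N Y dd_compl[OF Y] by (metis Diff_subset)
  have "(\<Sum>y<N. card (ball Y y)) = (\<Sum>y<N. \<Sum>s\<in>G. of_bool (dd Y s \<le> y))"
    unfolding ball_def by (simp only: card_of_bool_sum[of G] finite_atLeastLessThan_int)
  also have "\<dots> = (\<Sum>s\<in>G. \<Sum>y<N. of_bool (dd Y s \<le> y))" by (rule sum.swap)
  also have "\<dots> = (\<Sum>s\<in>G. rho Z s)"
  proof (rule sum.cong)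
    fix s
    have "(\<Sum>y<N. of_bool (dd Y s \<le> y)) = card {y \<in> {..<N}. dd Y s \<le> y}"
      by (simp only: card_of_bool_sum finite_lessThan)
    also have "{y \<in> {..<N}. dd Y s \<le> y} = {dd Y s..<N}" by auto
    finally show "(\<Sum>y<N. of_bool (dd Y s \<le> y)) = rho Z s"
      using dd_rho[OF Z(1), of s] Z by simp
  qed simp
  also have "\<dots> = N\<^sup>2" using sum_rho[OF Z(1)] Z by simp
  finally show ?thesis .
qed

text \<open>
  Since the sum of the ball sizes is known exactly, a ball that is too large at one radius would, growing at the
  guaranteed rate, overshoot this sum.
\<close>

lemma ball_bounds:
  fixes \<tau> :: real
  assumes Y: "Y \<subseteq> G" and X0: "X0 \<subseteq> G" "X0 \<noteq> {}"
    and u: "\<And>a a'. a \<in> X0 \<Longrightarrow> a' \<in> X0 \<Longrightarrow> dd Y (a' - a) \<le> u"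
    and N: "N = card Y \<or> N = card (G - Y)" "2 * int N \<le> p" and u1: "u \<ge> 1"
    and w: "2 * real u * (1 - \<tau>) \<le> 2 * real (card X0) - 2" and \<tau>: "0 \<le> \<tau>" "\<tau> \<le> 1" "\<tau> * N \<le> u"
  shows "y < N \<Longrightarrow> 2 * real y - 4 * real u \<le> card (ball Y y)"
    and "4 * y0 \<le> N \<Longrightarrow> 22 * u \<le> N \<Longrightarrow> real (card (ball Y y0)) \<le> 2 * real y0 + 11 * real u"
proof -
  \<comment> \<open>Growth between two radii, unless the whole group is reached. Rounding the radius
    down to a multiple of \<open>u\<close> loses \<open>2 * u\<close>, and the slack \<tau> loses
    another \<open>2 * u\<close>.\<close>
  have step: "min (real_of_int p) (card (ball Y z) + 2 * (real y - real z) - 4 * real u) \<le> card (ball Y y)"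
    if "z \<le> y" "y < N" for y z
  proof (cases "y - z < u")
    case True
    then have "y \<le> z + u" by linarith
    then have "real y - real z \<le> real u" by linarith
    then have "card (ball Y z) + 2 * (real y - real z) - 4 * real u \<le> card (ball Y z)"
      by (simp add: algebra_simps)
    also have "\<dots> \<le> card (ball Y y)" using ball_mono[OF that(1)] by simp
    finally show ?thesis by linarith
  next
    case False
    define j where "j = (y - z) div u"
    have j: "z + j * u \<le> y" using that by (simp add: j_def) (metis add_le_imp_le_diff div_times_less_eq_dividend le_add_diff_inverse nat_add_left_cancel_le)
    have "y - z < (j + 1) * u" using u1 by (simp add: j_def dividend_less_div_times)
    then have "real (y - z) < real ((j + 1) * u)" by (simp only: of_nat_less_iff)
    then have jr: "real y - real z - real u \<le> real j * real u" using that by (simp add: algebra_simps)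
    have "min p (int (card (ball Y z)) + int j * (2 * int (card X0) - 2)) \<le> int (card (ball Y (z + j * u)))"
      by (rule ball_grow_iter[OF Y X0 u])
    also have "\<dots> \<le> int (card (ball Y y))" using ball_mono[OF j] by simp
    finally have "real_of_int (min p (int (card (ball Y z)) + int j * (2 * int (card X0) - 2))) \<le> card (ball Y y)"
      by linarith
    then have 1: "min (real_of_int p) (card (ball Y z) + real j * (2 * real (card X0) - 2)) \<le> card (ball Y y)"
      by (simp add: of_int_min)
    have "2 * (real y - real z) - 4 * real u \<le> 2 * (1 - \<tau>) * (real y - real z - real u)"
    proof -
      have "\<tau> * (real y - real z - real u) \<le> \<tau> * N" using that \<tau> by (intro mult_left_mono) auto
      then show ?thesis using \<tau>(3) by (simp add: algebra_simps)
    qed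
    also have "\<dots> \<le> 2 * (1 - \<tau>) * (real j * real u)" using jr \<tau> by (intro mult_left_mono) auto
    also have "\<dots> = real j * (2 * real u * (1 - \<tau>))" by (simp add: mult_ac)
    also have "\<dots> \<le> real j * (2 * real (card X0) - 2)" using w by (intro mult_left_mono) auto
    finally show ?thesis using 1 by linarith
  qed
  have pN: "real_of_int p \<ge> 2 * real N" using N(2) by linarith
  have lower: "2 * real y - 4 * real u \<le> card (ball Y y)" if "y < N" for y
    using step[of 0 y] that pN by (auto simp: min_def split: if_splits)
  then show "y < N \<Longrightarrow> 2 * real y - 4 * real u \<le> card (ball Y y)" .
  show "real (card (ball Y y0)) \<le> 2 * real y0 + 11 * real u" if y0: "4 * y0 \<le> N" and uN: "22 * u \<le> N"
  proof (rule ccontr)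
    assume "\<not> ?thesis"
    then have b: "real (card (ball Y y0)) > 2 * real y0 + 11 * real u" by simp
    have N0: "N > 0" using uN u1 by linarith
    \<comment> \<open>An oversized ball at \<open>y0\<close> passes its excess \<open>11 * u\<close>
      on to all radii in \<open>K\<close>. Stopping \<open>4 * u\<close> before \<open>N\<close>
      keeps the bounds below \<open>p\<close>, and \<open>K\<close> still contains at least half of
      the radii, so the excess outweighs the loss of \<open>4 * u\<close> at every radius.\<close>
    define K where "K = {y0..<N - 4 * u}"
    have pt: "2 * real y - 4 * real u + (if y \<in> K then 11 * real u else 0) \<le> card (ball Y y)" if "y < N" for y
    proof (cases "y \<in> K")
      case True
      then have "y + 4 * u < N" by (auto simp: K_def)
      then have "2 * real y + 8 * real u < 2 * real N" by linarith
      then have "2 * real y + 7 * real u \<le> real_of_int p" using pN by linarith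
      then show ?thesis using step[of y0 y] True that b by (auto simp: K_def min_def split: if_splits)
    next
      case False
      then show ?thesis using lower[OF that] by simp
    qed
    have "real N * real N - real N - 4 * real u * N + 11 * real u * card K = (\<Sum>y<N. 2 * real y - 4 * real u + (if y \<in> K then 11 * real u else 0))"
    proof -
      have "(\<Sum>y<N. 2 * real y) = real N * real N - real N"
        by (induction N) (auto simp: algebra_simps)
      moreover have "(\<Sum>y<N. if y \<in> K then 11 * real u else 0) = 11 * real u * card K"
      proof -
        have "{..<N} \<inter> K = K" by (auto simp: K_def)
        then show ?thesis by (simp add: sum.If_cases)
      qed
      ultimately show ?thesis by (simp add: sum.distrib sum_subtractf mult_ac)
    qed
    also have "\<dots> \<le> (\<Sum>y<N. real (card (ball Y y)))" by (rule sum_mono) (use pt in auto)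
    also have "\<dots> = real N * real N"
      using sum_card_ball[OF Y N(1)] by (simp add: power2_eq_square flip: of_nat_sum of_nat_mult)
    finally have 1: "11 * real u * card K \<le> real N + 4 * real u * N" by simp
    have "real (card K) = real N - 4 * real u - real y0" using y0 uN by (simp add: K_def of_nat_diff)
    then have "real (card K) \<ge> real N / 2" using y0 uN by linarith
    then have "11 * real u * (real N / 2) \<le> 11 * real u * card K" by (intro mult_left_mono) auto
    then have "real u * N * (3/2) \<le> real N" using 1 by (simp add: algebra_simps)
    moreover have "real N \<le> real u * N" using mult_right_mono[of 1 "real u" "real N"] u1 by simp
    ultimately show False using N0 by linarith
  qed
qed

end

section \<open>Dilations and a large Fourier coefficient\<close>

context zp
begin

definition dil :: "int \<Rightarrow> int set \<Rightarrow> int set" where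
  "dil k A = (\<lambda>x. (k * x) mod p) ` A"

lemma ex_inverse:
  assumes "\<not> p dvd k"
  shows "\<exists>l. \<not> p dvd l \<and> (k * l) mod p = 1"
proof -
  obtain l :: nat where "(int l * k) mod p = 1 mod p" using ex_cong_mult[OF assms] by blast
  then have "(k * int l) mod p = 1" using p_gt1 by (simp add: mult.commute)
  moreover from this have "\<not> p dvd int l" using p_gt1 by (metis dvd_mult mod_0_imp_dvd dvd_imp_mod_0 zero_neq_one)
  ultimately show ?thesis by blast
qed

lemma mult_inverse_mod: "(k * l) mod p = 1 \<Longrightarrow> (k * (l * x)) mod p = x mod p"
  by (metis mod_mult_left_eq mult.assoc mult_1)

lemma mem_dil:
  assumes kl: "(k * l) mod p = 1" and A: "A \<subseteq> G"
  shows "x \<in> dil k A \<longleftrightarrow> x \<in> G \<and> (l * x) mod p \<in> A"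
proof
  assume "x \<in> dil k A"
  then obtain a where a: "a \<in> A" "x = (k * a) mod p" by (auto simp: dil_def)
  have "(l * x) mod p = (k * (l * a)) mod p" using a(2) by (simp add: mod_simps ac_simps)
  also have "\<dots> = a" using mult_inverse_mod[OF kl] a(1) A by auto
  finally show "x \<in> G \<and> (l * x) mod p \<in> A" using a by auto
next
  assume h: "x \<in> G \<and> (l * x) mod p \<in> A"
  have "(k * ((l * x) mod p)) mod p = (k * (l * x)) mod p" by (simp add: mod_simps)
  also have "\<dots> = x" using mult_inverse_mod[OF kl] h by simp
  finally show "x \<in> dil k A" using h by (force simp: dil_def)
qed

lemma dil_sub [simp]: "dil k A \<subseteq> G"
  by (auto simp: dil_def)

lemma inj_dil:
  assumes "\<not> p dvd k"
  shows "inj_on (\<lambda>x. (k * x) mod p) G"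
proof -
  obtain l where kl: "(k * l) mod p = 1" using ex_inverse[OF assms] by blast
  show ?thesis
  proof (rule inj_on_inverseI[where g = "\<lambda>x. (l * x) mod p"])
    fix x assume x: "x \<in> G"
    have "(l * ((k * x) mod p)) mod p = (k * (l * x)) mod p" by (simp add: mod_simps ac_simps)
    then show "(l * ((k * x) mod p)) mod p = x" using mult_inverse_mod[OF kl] x by simp
  qed
qed

lemma card_dil: "\<not> p dvd k \<Longrightarrow> A \<subseteq> G \<Longrightarrow> card (dil k A) = card A"
  unfolding dil_def by (intro card_image inj_on_subset[OF inj_dil])

lemma dil_dil: "dil k (dil l A) = dil (k * l) A"
  by (auto simp: dil_def image_image mod_simps mult.assoc)

lemma dil_Diff: "\<not> p dvd k \<Longrightarrow> A \<subseteq> G \<Longrightarrow> B \<subseteq> G \<Longrightarrow> dil k (A - B) = dil k A - dil k B"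
  unfolding dil_def by (rule inj_on_image_set_diff[OF inj_dil]) auto

lemma tr_dil:
  assumes k: "\<not> p dvd k" and A: "A \<subseteq> G"
  shows "tr (k * s) (dil k A) = dil k (tr s A)"
proof -
  obtain l where kl: "(k * l) mod p = 1" using ex_inverse[OF k] by blast
  have "(l * ((x - k * s) mod p)) mod p = ((l * x) mod p - s) mod p" for x
  proof -
    have "(l * ((x - k * s) mod p)) mod p = (l * x - k * (l * s)) mod p" by (simp add: mod_simps algebra_simps)
    also have "\<dots> = (l * x - (k * (l * s)) mod p) mod p" by (simp add: mod_simps)
    also have "\<dots> = (l * x - s) mod p" unfolding mult_inverse_mod[OF kl] by (simp add: mod_simps)
    finally show ?thesis by (simp add: mod_simps)
  qed
  note * = this
  show ?thesis
  proof (rule Set.set_eqI)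
    fix x
    have "x \<in> tr (k * s) (dil k A) \<longleftrightarrow> x \<in> G \<and> (l * ((x - k * s) mod p)) mod p \<in> A"
      by (simp add: tr_def mem_dil[OF kl A])
    also have "\<dots> \<longleftrightarrow> x \<in> G \<and> (l * x) mod p \<in> tr s A"
      unfolding * by (simp add: tr_def)
    also have "\<dots> \<longleftrightarrow> x \<in> dil k (tr s A)" by (rule mem_dil[OF kl tr_sub, symmetric])
    finally show "x \<in> tr (k * s) (dil k A) \<longleftrightarrow> x \<in> dil k (tr s A)" .
  qed
qed

lemma dd_dil:
  assumes k: "\<not> p dvd k" and A: "A \<subseteq> G"
  shows "dd (dil k A) (k * s) = dd A s"
proof -
  have "dil k A - tr (k * s) (dil k A) = dil k (A - tr s A)"
    by (simp add: tr_dil[OF k A] dil_Diff[OF k A])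
  then show ?thesis
    unfolding dd_def using card_dil[OF k, of "A - tr s A"] A by auto
qed

lemma sm_dil:
  assumes "A \<subseteq> G" "B \<subseteq> G"
  shows "sm (dil k A) (dil k B) = dil k (sm A B)"
proof -
  have "((k * a) mod p + (k * b) mod p) mod p = (k * ((a + b) mod p)) mod p" for a b
    by (simp add: mod_simps algebra_simps)
  then show ?thesis unfolding sm_def dil_def by (auto simp: image_iff; blast)
qed

section \<open>Additive characters, Parseval's identity and Fourier coefficients of sets\<close>

definition ee :: "int \<Rightarrow> complex" where
  "ee x = cis (2 * pi * real_of_int x / real_of_int p)"

lemma ee_add: "ee (x + y) = ee x * ee y"
  by (simp add: ee_def cis_mult add_divide_distrib[symmetric] distrib_left)

lemma norm_ee [simp]: "cmod (ee x) = 1"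
  by (simp add: ee_def)

lemma ee_mult_p: "ee (p * k) = 1"
proof -
  have "2 * pi * real_of_int (p * k) / real_of_int p = 2 * pi * real_of_int k"
    using p_gt1 by simp
  then show ?thesis by (simp add: ee_def cis_multiple_2pi)
qed

lemma ee_0 [simp]: "ee 0 = 1"
  by (simp add: ee_def)

lemma ee_mod: "ee (x mod p) = ee x"
proof -
  have "ee x = ee (p * (x div p) + x mod p)" by simp
  then show ?thesis unfolding ee_add ee_mult_p by simp
qed

lemma ee_cong: "x mod p = y mod p \<Longrightarrow> ee x = ee y"
  by (metis ee_mod)

lemma ee_eq_1: "ee x = 1 \<Longrightarrow> p dvd x"
proof -
  assume "ee x = 1"
  then have "cos (2 * pi * real_of_int x / real_of_int p) = 1" by (simp add: ee_def complex_eq_iff)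
  then obtain n :: int where "2 * pi * real_of_int x / real_of_int p = real_of_int n * 2 * pi"
    using cos_one_2pi_int by auto
  then have "real_of_int x = real_of_int (n * p)" using p_gt1 by (simp add: field_simps)
  then have "x = n * p" by linarith
  then show ?thesis by simp
qed

lemma cnj_ee: "cnj (ee x) = ee (- x)"
  by (simp add: ee_def cis_cnj)

text \<open>Orthogonality of characters: shifting the summation variable multiplies the sum by
  \<open>ee x\<close>, which is not 1 unless \<open>p\<close> divides \<open>x\<close>.\<close>

lemma sum_ee: "(\<Sum>\<xi>\<in>G. ee (x * \<xi>)) = (if p dvd x then of_int p else 0)"
proof (cases "p dvd x")
  case True
  have "ee (x * \<xi>) = 1" for \<xi> using True ee_mult_p by (metis dvd_def mult.assoc)
  then show ?thesis using True p_gt1 by simp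
next
  case False
  define S where "S = (\<Sum>\<xi>\<in>G. ee (x * \<xi>))"
  have "S = (\<Sum>\<xi>\<in>G. ee (x * ((\<xi> + 1) mod p)))"
    unfolding S_def by (rule sum_shift[of "\<lambda>\<xi>. ee (x * \<xi>)" 1, symmetric])
  also have "\<dots> = (\<Sum>\<xi>\<in>G. ee (x * \<xi>) * ee x)"
  proof (rule sum.cong)
    fix \<xi>
    have "ee (x * ((\<xi> + 1) mod p)) = ee (x * \<xi> + x)" by (rule ee_cong) (simp add: mod_simps algebra_simps)
    then show "ee (x * ((\<xi> + 1) mod p)) = ee (x * \<xi>) * ee x" by (simp add: ee_add)
  qed simp
  also have "\<dots> = S * ee x" by (simp add: S_def sum_distrib_right)
  finally have "S * (1 - ee x) = 0" by (simp add: algebra_simps)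
  moreover have "ee x \<noteq> 1" using False ee_eq_1 by blast
  ultimately show ?thesis using False by (simp add: S_def)
qed

lemma parseval:
  fixes f :: "int \<Rightarrow> real"
  shows "(\<Sum>\<xi>\<in>G. (cmod (\<Sum>x\<in>G. of_real (f x) * ee (x * \<xi>)))\<^sup>2) = of_int p * (\<Sum>x\<in>G. (f x)\<^sup>2)"
proof -
  have "complex_of_real (\<Sum>\<xi>\<in>G. (cmod (\<Sum>x\<in>G. of_real (f x) * ee (x * \<xi>)))\<^sup>2)
      = (\<Sum>\<xi>\<in>G. (\<Sum>x\<in>G. of_real (f x) * ee (x * \<xi>)) * cnj (\<Sum>y\<in>G. of_real (f y) * ee (y * \<xi>)))"
    unfolding of_real_sum complex_norm_square by simp
  also have "\<dots> = (\<Sum>\<xi>\<in>G. \<Sum>x\<in>G. \<Sum>y\<in>G. of_real (f x * f y) * ee ((x - y) * \<xi>))"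
  proof (rule sum.cong[OF refl])
    fix \<xi>
    have e: "ee ((x - y) * \<xi>) = ee (x * \<xi>) * ee (- (y * \<xi>))" for x y
      unfolding ee_add[symmetric] by (simp add: algebra_simps)
    show "(\<Sum>x\<in>G. of_real (f x) * ee (x * \<xi>)) * cnj (\<Sum>y\<in>G. of_real (f y) * ee (y * \<xi>))
        = (\<Sum>x\<in>G. \<Sum>y\<in>G. of_real (f x * f y) * ee ((x - y) * \<xi>))"
      unfolding cnj_sum sum_product e by (simp add: cnj_ee mult_ac)
  qed
  also have "\<dots> = (\<Sum>x\<in>G. \<Sum>\<xi>\<in>G. \<Sum>y\<in>G. of_real (f x * f y) * ee ((x - y) * \<xi>))" by (rule sum.swap)
  also have "\<dots> = (\<Sum>x\<in>G. \<Sum>y\<in>G. \<Sum>\<xi>\<in>G. of_real (f x * f y) * ee ((x - y) * \<xi>))"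
    by (rule sum.cong[OF refl]) (rule sum.swap)
  also have "\<dots> = (\<Sum>x\<in>G. \<Sum>y\<in>G. if x = y then of_int p * of_real ((f x)\<^sup>2) else 0)"
  proof (rule sum.cong[OF refl], rule sum.cong[OF refl])
    fix x y assume "x \<in> G" "y \<in> G"
    then have "p dvd x - y \<longleftrightarrow> x = y" using diff_not_dvd by auto
    then show "(\<Sum>\<xi>\<in>G. of_real (f x * f y) * ee ((x - y) * \<xi>)) = (if x = y then of_int p * of_real ((f x)\<^sup>2) else 0)"
      unfolding sum_distrib_left[symmetric] sum_ee by (simp add: power2_eq_square)
  qed
  also have "\<dots> = complex_of_real (of_int p * (\<Sum>x\<in>G. (f x)\<^sup>2))"
    by (simp add: sum_distrib_left)
  finally show ?thesis by (simp only: of_real_eq_iff)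
qed

definition hat :: "int set \<Rightarrow> int \<Rightarrow> complex" where
  "hat Y \<xi> = (\<Sum>y\<in>Y. ee (y * \<xi>))"

lemma hat_G: "Y \<subseteq> G \<Longrightarrow> hat Y \<xi> = (\<Sum>x\<in>G. of_real (of_bool (x \<in> Y)) * ee (x * \<xi>))"
  unfolding hat_def by (rule sum.mono_neutral_cong_left) auto

lemma hat_0: "hat Y 0 = of_nat (card Y)"
  by (simp add: hat_def)

lemma parseval_set: "Y \<subseteq> G \<Longrightarrow> (\<Sum>\<xi>\<in>G. (cmod (hat Y \<xi>))\<^sup>2) = of_int p * card Y"
proof -
  assume Y: "Y \<subseteq> G"
  have "real (card Y) = (\<Sum>x\<in>G. (of_bool (x \<in> Y))\<^sup>2)"
    unfolding card_G_sum[OF Y] of_nat_sum by (rule sum.cong) auto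
  then show ?thesis using parseval[of "\<lambda>x. of_bool (x \<in> Y)"] by (simp add: hat_G[OF Y])
qed

text \<open>The function \<open>f s\<close> is the indicator of \<open>Y\<close> minus that of its
  translate. Its transform is a multiple of \<open>hat Y\<close>, while its norms are given by the
  cost of the shift; this is the bridge between Fourier coefficients and \<open>dd\<close>.\<close>

lemma hat_diff:
  assumes Y: "Y \<subseteq> G"
  defines "f \<equiv> \<lambda>s x. (of_bool (x \<in> Y) - of_bool (x \<in> tr s Y) :: real)"
  shows "hat Y \<xi> * (1 - ee (s * \<xi>)) = (\<Sum>x\<in>G. of_real (f s x) * ee (x * \<xi>))"
    and "(\<Sum>x\<in>G. (f s x)\<^sup>2) = 2 * dd Y s" and "(\<Sum>x\<in>G. \<bar>f s x\<bar>) = 2 * dd Y s"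
proof -
  have "(\<Sum>x\<in>G. of_real (of_bool (x \<in> tr s Y)) * ee (x * \<xi>))
      = (\<Sum>x\<in>G. (\<lambda>z. of_real (of_bool (z \<in> Y)) * (ee (s * \<xi>) * ee (z * \<xi>))) ((x - s) mod p))"
  proof (rule sum.cong[OF refl])
    fix x assume x: "x \<in> G"
    have "ee (x * \<xi>) = ee (s * \<xi> + ((x - s) mod p) * \<xi>)"
    proof (rule ee_cong)
      have "(s * \<xi> + ((x - s) mod p) * \<xi>) mod p = (s * \<xi> + (x - s) * \<xi>) mod p"
        by (metis mod_add_right_eq mod_mult_left_eq)
      also have "s * \<xi> + (x - s) * \<xi> = x * \<xi>" by (simp add: algebra_simps)
      finally show "(x * \<xi>) mod p = (s * \<xi> + ((x - s) mod p) * \<xi>) mod p" by simp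
    qed
    then show "of_real (of_bool (x \<in> tr s Y)) * ee (x * \<xi>)
        = (\<lambda>z. of_real (of_bool (z \<in> Y)) * (ee (s * \<xi>) * ee (z * \<xi>))) ((x - s) mod p)"
      using x by (simp add: ee_add tr_def)
  qed
  also have "\<dots> = (\<Sum>x\<in>G. of_real (of_bool (x \<in> Y)) * (ee (s * \<xi>) * ee (x * \<xi>)))"
    by (rule sum_shift_minus)
  also have "\<dots> = hat Y \<xi> * ee (s * \<xi>)"
    unfolding hat_G[OF Y] sum_distrib_right by (simp add: mult_ac)
  finally show "hat Y \<xi> * (1 - ee (s * \<xi>)) = (\<Sum>x\<in>G. of_real (f s x) * ee (x * \<xi>))"
    unfolding f_def by (simp add: left_diff_distrib sum_subtractf hat_G[OF Y] right_diff_distrib)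
  have c: "card (tr s Y - Y) = dd Y s"
    using card_tr_Diff_tr[OF Y, of s 0] tr_0[OF Y] dd_minus[OF Y, of s] by simp
  have s: "(\<Sum>x\<in>G. of_bool (x \<in> Y - tr s Y) + of_bool (x \<in> tr s Y - Y) :: nat) = 2 * dd Y s"
  proof -
    have "(\<Sum>x\<in>G. of_bool (x \<in> Y - tr s Y)) = card (Y - tr s Y)"
      by (rule card_G_sum[symmetric]) (use Y in auto)
    moreover have "(\<Sum>x\<in>G. of_bool (x \<in> tr s Y - Y)) = card (tr s Y - Y)"
      by (rule card_G_sum[symmetric]) (use tr_sub in blast)
    ultimately show ?thesis using c by (simp only: sum.distrib dd_def[symmetric])
  qed
  have "(\<Sum>x\<in>G. (f s x)\<^sup>2) = (\<Sum>x\<in>G. real (of_bool (x \<in> Y - tr s Y) + of_bool (x \<in> tr s Y - Y)))"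
    by (rule sum.cong) (auto simp: f_def)
  also have "\<dots> = real (2 * dd Y s)" unfolding of_nat_sum[symmetric] s ..
  finally show "(\<Sum>x\<in>G. (f s x)\<^sup>2) = 2 * dd Y s" by simp
  have "(\<Sum>x\<in>G. \<bar>f s x\<bar>) = (\<Sum>x\<in>G. real (of_bool (x \<in> Y - tr s Y) + of_bool (x \<in> tr s Y - Y)))"
    by (rule sum.cong) (auto simp: f_def)
  also have "\<dots> = real (2 * dd Y s)" unfolding of_nat_sum[symmetric] s ..
  finally show "(\<Sum>x\<in>G. \<bar>f s x\<bar>) = 2 * dd Y s" by simp
qed

lemma hat_diff_norm:
  assumes Y: "Y \<subseteq> G"
  shows "cmod (hat Y \<xi>) * cmod (1 - ee (s * \<xi>)) \<le> 2 * dd Y s"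
proof -
  have "cmod (hat Y \<xi>) * cmod (1 - ee (s * \<xi>))
      = cmod (\<Sum>x\<in>G. of_real (of_bool (x \<in> Y) - of_bool (x \<in> tr s Y) :: real) * ee (x * \<xi>))"
    unfolding norm_mult[symmetric] hat_diff(1)[OF Y] ..
  also have "\<dots> \<le> (\<Sum>x\<in>G. \<bar>of_bool (x \<in> Y) - of_bool (x \<in> tr s Y) :: real\<bar>)"
    by (rule order_trans[OF norm_sum]) (simp only: norm_mult norm_of_real norm_ee mult_1_right order_refl)
  finally show ?thesis using hat_diff(3)[OF Y, of s] by simp
qed

lemma hat_diff_square:
  assumes Y: "Y \<subseteq> G"
  shows "(\<Sum>\<xi>\<in>G. (cmod (hat Y \<xi>))\<^sup>2 * (cmod (1 - ee (s * \<xi>)))\<^sup>2) = 2 * real_of_int p * real (dd Y s)"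
  using parseval[of "\<lambda>x. of_bool (x \<in> Y) - of_bool (x \<in> tr s Y)"] hat_diff(2)[OF Y, of s]
  unfolding hat_diff(1)[OF Y, symmetric] norm_mult power_mult_distrib by simp

lemma norm_1_minus_ee: "(cmod (1 - ee x))\<^sup>2 = 2 - 2 * Re (ee x)"
proof -
  have "(cmod (1 - ee x))\<^sup>2 = (1 - Re (ee x))\<^sup>2 + (Im (ee x))\<^sup>2" by (simp add: cmod_power2)
  moreover have "(Re (ee x))\<^sup>2 + (Im (ee x))\<^sup>2 = 1" using cmod_power2[of "ee x"] by simp
  ultimately show ?thesis by (simp add: power2_diff)
qed

text \<open>Shifts in the ball of radius \<open>N div 4\<close> are cheap, so the terms of
  \<open>hat_diff_square\<close> have a small sum over this ball \<open>S\<close>. When the factor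
  \<open>cmod (1 - ee (s * \<xi>))\<close> is squared out, the main term must be cancelled by the
  sum of \<open>(cmod (hat Y \<xi>))\<^sup>2 * cmod (hat S \<xi>)\<close> over nonzero frequencies.
  If all those coefficients of \<open>Y\<close> were small, one of them could be pulled out, and
  Cauchy-Schwarz with Parseval for the remaining product would contradict the size of
  \<open>S\<close>.\<close>

lemma large_coefficient:
  fixes a :: real
  assumes Y: "Y \<subseteq> G" and N: "N = card Y \<or> N = card (G - Y)" "2 * int N \<le> p" "N > 0"
    and a: "0 < a" "a \<le> 1" "a * card Y \<le> N" and S: "real N / 8 \<le> card (ball Y (N div 4))"
  shows "\<exists>\<xi>\<in>G - {0}. a\<^sup>2 * card Y / 12 \<le> cmod (hat Y \<xi>)"
proof (rule ccontr)
  assume "\<not> ?thesis"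
  then have small: "\<And>\<xi>. \<xi> \<in> G - {0} \<Longrightarrow> cmod (hat Y \<xi>) \<le> a\<^sup>2 * card Y / 12" by force
  define P where "P = real_of_int p"
  define n where "n = real (card Y)"
  define S where "S = ball Y (N div 4)"
  define k where "k = real (card S)"
  define M where "M = a\<^sup>2 * n / 12"
  have SG: "S \<subseteq> G" by (simp add: S_def)
  have P0: "P > 0" by (simp add: P_def)
  have cc: "card Y + card (G - Y) = nat p"
    using card_Un_disjoint[of Y "G - Y"] finite_sub_G[OF Y] Y by (simp add: Un_absorb1)
  then have cG: "real (card (G - Y)) = P - n" using p_gt1 by (simp add: P_def n_def)
  have NP: "real N \<le> P / 2" using N(2) by (simp add: P_def)
  \<comment> \<open>The product of a size and its complementary size does not see which of the two
    sets \<open>N\<close> refers to, so the condition \<open>2 * N \<le> p\<close> can be used for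
    \<open>Y\<close> itself.\<close>
  have nN: "n * (P - n) = N * (P - N)" using N(1) cG by (auto simp: n_def)
  have "real N * (P / 2) \<le> N * (P - N)" using NP by (intro mult_left_mono) auto
  then have nP: "N * P / 2 \<le> n * (P - n)" using nN by simp
  have n0: "n > 0"
  proof (rule ccontr)
    assume "\<not> n > 0" then have "n = 0" by (simp add: n_def)
    moreover have "real N * P > 0" using N(3) P0 by simp
    ultimately show False using nP by simp
  qed
  have dS: "real (dd Y s) \<le> N / 4" if "s \<in> S" for s
  proof -
    have "dd Y s \<le> N div 4" using that by (simp add: S_def ball_def)
    then show ?thesis by linarith
  qed
  have "(\<Sum>s\<in>S. \<Sum>\<xi>\<in>G. (cmod (hat Y \<xi>))\<^sup>2 * (cmod (1 - ee (s * \<xi>)))\<^sup>2) \<le> (\<Sum>s\<in>S. 2 * P * (N / 4))"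
  proof (rule sum_mono)
    fix s assume "s \<in> S"
    then show "(\<Sum>\<xi>\<in>G. (cmod (hat Y \<xi>))\<^sup>2 * (cmod (1 - ee (s * \<xi>)))\<^sup>2) \<le> 2 * P * (N / 4)"
      unfolding hat_diff_square[OF Y] P_def[symmetric] using dS[of s] P0 by (intro mult_left_mono) auto
  qed
  also have "\<dots> = k * P * N / 2" by (simp add: k_def)
  also have "(\<Sum>s\<in>S. \<Sum>\<xi>\<in>G. (cmod (hat Y \<xi>))\<^sup>2 * (cmod (1 - ee (s * \<xi>)))\<^sup>2)
      = (\<Sum>\<xi>\<in>G. (cmod (hat Y \<xi>))\<^sup>2 * (2 * k - 2 * Re (hat S \<xi>)))"
  proof (subst sum.swap, rule sum.cong[OF refl])
    fix \<xi>
    show "(\<Sum>s\<in>S. (cmod (hat Y \<xi>))\<^sup>2 * (cmod (1 - ee (s * \<xi>)))\<^sup>2) = (cmod (hat Y \<xi>))\<^sup>2 * (2 * k - 2 * Re (hat S \<xi>))"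
      unfolding sum_distrib_left[symmetric] norm_1_minus_ee
      by (simp add: sum_subtractf sum_distrib_left[symmetric] hat_def k_def)
  qed
  finally have up: "(\<Sum>\<xi>\<in>G. (cmod (hat Y \<xi>))\<^sup>2 * (2 * k - 2 * Re (hat S \<xi>))) \<le> k * P * N / 2" .
  have "(\<Sum>\<xi>\<in>G - {0}. (cmod (hat Y \<xi>))\<^sup>2 * (2 * k - 2 * cmod (hat S \<xi>)))
      \<le> (\<Sum>\<xi>\<in>G. (cmod (hat Y \<xi>))\<^sup>2 * (2 * k - 2 * Re (hat S \<xi>)))"
  proof -
    have "(\<Sum>\<xi>\<in>G. (cmod (hat Y \<xi>))\<^sup>2 * (2 * k - 2 * Re (hat S \<xi>)))
        = (\<Sum>\<xi>\<in>G - {0}. (cmod (hat Y \<xi>))\<^sup>2 * (2 * k - 2 * Re (hat S \<xi>)))"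
      by (subst sum.remove[of _ 0]) (use p_gt1 in \<open>auto simp: hat_0 k_def\<close>)
    moreover have "(\<Sum>\<xi>\<in>G - {0}. (cmod (hat Y \<xi>))\<^sup>2 * (2 * k - 2 * cmod (hat S \<xi>)))
        \<le> (\<Sum>\<xi>\<in>G - {0}. (cmod (hat Y \<xi>))\<^sup>2 * (2 * k - 2 * Re (hat S \<xi>)))"
      using complex_Re_le_cmod by (intro sum_mono mult_left_mono) auto
    ultimately show ?thesis by simp
  qed
  then have 1: "(\<Sum>\<xi>\<in>G - {0}. (cmod (hat Y \<xi>))\<^sup>2 * (2 * k - 2 * cmod (hat S \<xi>))) \<le> k * P * N / 2" using up by linarith
  have "(\<Sum>\<xi>\<in>G - {0}. (cmod (hat Y \<xi>))\<^sup>2) = P * n - n\<^sup>2"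
  proof -
    have "(\<Sum>\<xi>\<in>G. (cmod (hat Y \<xi>))\<^sup>2) = n\<^sup>2 + (\<Sum>\<xi>\<in>G - {0}. (cmod (hat Y \<xi>))\<^sup>2)"
      by (subst sum.remove[of _ 0]) (use p_gt1 in \<open>auto simp: hat_0 n_def\<close>)
    then show ?thesis using parseval_set[OF Y] by (simp add: P_def n_def)
  qed
  moreover have "(\<Sum>\<xi>\<in>G - {0}. (cmod (hat Y \<xi>))\<^sup>2 * (2 * k - 2 * cmod (hat S \<xi>)))
      = 2 * k * (\<Sum>\<xi>\<in>G - {0}. (cmod (hat Y \<xi>))\<^sup>2) - 2 * (\<Sum>\<xi>\<in>G - {0}. (cmod (hat Y \<xi>))\<^sup>2 * cmod (hat S \<xi>))"
    by (simp add: right_diff_distrib sum_subtractf sum_distrib_left mult_ac)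
  ultimately have "2 * k * (P * n - n\<^sup>2) - 2 * (\<Sum>\<xi>\<in>G - {0}. (cmod (hat Y \<xi>))\<^sup>2 * cmod (hat S \<xi>)) \<le> k * P * N / 2"
    using 1 by simp
  moreover have "2 * k * (P * n - n\<^sup>2) = 2 * (k * (P * n - n\<^sup>2))" by simp
  ultimately have 2: "k * (P * n - n\<^sup>2) - k * P * N / 4 \<le> (\<Sum>\<xi>\<in>G - {0}. (cmod (hat Y \<xi>))\<^sup>2 * cmod (hat S \<xi>))"
    by linarith
  have "k * (N * P / 2) \<le> k * (n * (P - n))" using nP by (intro mult_left_mono) (auto simp: k_def)
  then have "k * P * N / 4 \<le> k * (P * n - n\<^sup>2) - k * P * N / 4" by (simp add: power2_eq_square algebra_simps)
  also note 2
  also have "(\<Sum>\<xi>\<in>G - {0}. (cmod (hat Y \<xi>))\<^sup>2 * cmod (hat S \<xi>))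
      \<le> (\<Sum>\<xi>\<in>G - {0}. M * (cmod (hat Y \<xi>) * cmod (hat S \<xi>)))"
    unfolding power2_eq_square mult.assoc using small
    by (intro sum_mono mult_right_mono) (auto simp: M_def n_def)
  also have "\<dots> \<le> M * (\<Sum>\<xi>\<in>G. cmod (hat Y \<xi>) * cmod (hat S \<xi>))"
    unfolding sum_distrib_left[symmetric] using n0
    by (intro mult_left_mono sum_mono2) (auto simp: M_def)
  finally have 3: "k * P * N / 4 \<le> M * (\<Sum>\<xi>\<in>G. cmod (hat Y \<xi>) * cmod (hat S \<xi>))" .
  have cs: "(\<Sum>\<xi>\<in>G. cmod (hat Y \<xi>) * cmod (hat S \<xi>))\<^sup>2 \<le> (P * n) * (P * k)"
    using sum_mult_square_le[of "\<lambda>\<xi>. cmod (hat Y \<xi>)" "\<lambda>\<xi>. cmod (hat S \<xi>)" G] parseval_set[OF Y] parseval_set[OF SG]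
    by (simp add: P_def n_def k_def)
  have "(k * P * N / 4)\<^sup>2 \<le> (M * (\<Sum>\<xi>\<in>G. cmod (hat Y \<xi>) * cmod (hat S \<xi>)))\<^sup>2"
    using 3 P0 by (intro power_mono) (auto simp: k_def)
  also have "\<dots> \<le> M\<^sup>2 * ((P * n) * (P * k))"
    unfolding power_mult_distrib using cs by (intro mult_left_mono) auto
  finally have 4: "(k * P\<^sup>2) * (k * N\<^sup>2 / 16) \<le> (k * P\<^sup>2) * (M\<^sup>2 * n)"
    by (simp add: power2_eq_square algebra_simps)
  have k: "k \<ge> N / 8" using S by (simp add: k_def S_def)
  have k0: "k > 0" using k N(3) by (meson divide_pos_pos less_le_trans of_nat_0_less_iff zero_less_numeral)
  have "k * N\<^sup>2 / 16 \<le> M\<^sup>2 * n" using 4 k0 P0 by simp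
  moreover have "(N / 8) * N\<^sup>2 \<le> k * N\<^sup>2" using k by (intro mult_right_mono) auto
  ultimately have 5: "real N ^ 3 / 128 \<le> M\<^sup>2 * n" by (simp add: power2_eq_square power3_eq_cube)
  have "(a * n) ^ 3 \<le> real N ^ 3" using a n0 by (intro power_mono) (auto simp: n_def)
  \<comment> \<open>The contradiction is that 144 exceeds 128: the first is the square of the 12 in
    the coefficient bound, the second the product of the 8 in the size of the ball and of the square
    of 4 from its radius.\<close>
  then have "(a * n) ^ 3 / 128 \<le> a ^ 4 * n ^ 3 / 144"
    using 5 by (simp add: M_def power_mult_distrib field_simps power2_eq_square power3_eq_cube numeral_eq_Suc)
  also have "\<dots> \<le> a ^ 3 * n ^ 3 / 144"
    using a n0 by (intro divide_right_mono mult_right_mono power_decreasing) auto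
  finally have "(a * n) ^ 3 * 144 \<le> (a * n) ^ 3 * 128" by (simp add: power_mult_distrib)
  moreover have "(a * n) ^ 3 > 0" using a n0 by simp
  ultimately show False by simp
qed

text \<open>At an eighth of the circle the distance from 1 is \<open>sqrt (2 - sqrt 2)\<close>,
  about 0.765, so a distance of at most 0.7 confines \<open>x\<close> to a smaller arc. An eighth on
  either side leaves room for sums of two such elements to remain distinct modulo
  \<open>p\<close>.\<close>

lemma ee_near_1:
  assumes "cmod (1 - ee x) \<le> 7 / 10"
  shows "\<exists>z. 8 * \<bar>z\<bar> < p \<and> x mod p = z mod p"
proof -
  define z where "z = (if 2 * (x mod p) \<le> p then x mod p else x mod p - p)"
  have zx: "x mod p = z mod p" by (simp add: z_def)
  have zb: "2 * \<bar>z\<bar> \<le> p"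
  proof -
    obtain r where r: "r = x mod p" "0 \<le> r" "r < p" by simp
    show ?thesis unfolding z_def r(1)[symmetric] using r(2,3) by (auto simp: abs_if)
  qed
  have "8 * \<bar>z\<bar> < p"
  proof (rule ccontr)
    assume "\<not> ?thesis"
    then have z8: "p \<le> 8 * \<bar>z\<bar>" by simp
    define P where "P = real_of_int p"
    define w where "w = real_of_int \<bar>z\<bar>"
    have P0: "P > 0" by (simp add: P_def)
    have wb: "P \<le> 8 * w" "2 * w \<le> P" using z8 zb by (simp_all add: P_def w_def)
    have "Re (ee x) = Re (ee z)" using ee_cong[OF zx] by simp
    also have "\<dots> = cos (2 * pi * w / P)"
      by (cases "z \<ge> 0") (simp_all add: ee_def P_def w_def)
    also have "\<dots> \<le> cos (pi / 4)"
    proof (rule cos_monotone_0_pi_le)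
      have "pi * P \<le> pi * (8 * w)" using wb by (intro mult_left_mono) auto
      then show "pi / 4 \<le> 2 * pi * w / P" using P0 by (simp add: field_simps)
      have "pi * (2 * w) \<le> pi * P" using wb by (intro mult_left_mono) auto
      then show "2 * pi * w / P \<le> pi" using P0 by (simp add: field_simps)
    qed simp
    finally have r: "Re (ee x) \<le> sqrt 2 / 2" by (simp add: cos_45)
    have "sqrt 2 \<le> 1.5" by (rule real_le_lsqrt) (auto simp: power2_eq_square)
    then have "(cmod (1 - ee x))\<^sup>2 \<ge> 0.5" using r norm_1_minus_ee[of x] by simp
    moreover have "(cmod (1 - ee x))\<^sup>2 \<le> (7/10)\<^sup>2" using assms by (intro power_mono) auto
    ultimately show False by (simp add: power2_eq_square)
  qed
  then show ?thesis using zx by blast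
qed

text \<open>By \<open>hat_diff_norm\<close> a shift that is cheap compared with a Fourier
  coefficient has its character close to 1 at that frequency. Dilating by \<xi> turns this into
  nearness to 0.\<close>

lemma ball_in_arc:
  assumes Y: "Y \<subseteq> G" and \<xi>: "\<xi> \<in> G - {0}" and M: "2 * real y \<le> 7 / 10 * cmod (hat Y \<xi>)" "cmod (hat Y \<xi>) > 0"
    and s: "dd (dil \<xi> Y) s \<le> y"
  shows "\<exists>z. 8 * \<bar>z\<bar> < p \<and> s mod p = z mod p"
proof -
  have nd: "\<not> p dvd \<xi>" using \<xi> diff_not_dvd[of \<xi> 0] p_gt1 by auto
  then obtain l where l: "(\<xi> * l) mod p = 1" using ex_inverse by blast
  have sl: "(\<xi> * (l * s)) mod p = s mod p" by (rule mult_inverse_mod[OF l])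
  have "dd Y (l * s) = dd (dil \<xi> Y) (\<xi> * (l * s))" by (rule dd_dil[OF nd Y, symmetric])
  also have "\<dots> = dd (dil \<xi> Y) s" by (metis dd_mod sl)
  finally have "cmod (hat Y \<xi>) * cmod (1 - ee ((l * s) * \<xi>)) \<le> 2 * real y"
    using hat_diff_norm[OF Y, of \<xi> "l * s"] s by linarith
  then have "cmod (hat Y \<xi>) * cmod (1 - ee ((l * s) * \<xi>)) \<le> cmod (hat Y \<xi>) * (7/10)" using M by linarith
  then have "cmod (1 - ee ((l * s) * \<xi>)) \<le> 7/10" using M(2) by simp
  then obtain z where "8 * \<bar>z\<bar> < p" "((l * s) * \<xi>) mod p = z mod p" using ee_near_1 by blast
  then show ?thesis using sl by (metis mult.commute)
qed

end

section \<open>From small shifts to near-intervals\<close>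

lemma mod_eq_imp_eq:
  fixes a b L :: int
  assumes "a mod L = b mod L" "\<bar>a - b\<bar> < L"
  shows "a = b"
proof -
  have "L dvd a - b" using assms(1) mod_eq_dvd_iff by blast
  then show ?thesis using assms(2) zdvd_not_zless[of "\<bar>a - b\<bar>" L] by force
qed

lemma inj_on_add_mod: "inj_on (\<lambda>v. (x + v) mod L) {0..<L}" for x L :: int
proof (rule inj_onI)
  fix v w assume h: "v \<in> {0..<L}" "w \<in> {0..<L}" "(x + v) mod L = (x + w) mod L"
  have "x + v = x + w" by (rule mod_eq_imp_eq[OF h(3)]) (use h in auto)
  then show "v = w" by simp
qed

lemma inj_on_diff_mod: "inj_on (\<lambda>v. (x - v) mod L) {0..<L}" for x L :: int
proof (rule inj_onI)
  fix v w assume h: "v \<in> {0..<L}" "w \<in> {0..<L}" "(x - v) mod L = (x - w) mod L"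
  have "x - v = x - w" by (rule mod_eq_imp_eq[OF h(3)]) (use h in auto)
  then show "v = w" by simp
qed

lemma Int_nonempty_card:
  assumes "finite C" "A \<subseteq> C" "B \<subseteq> C" "card C < card A + card B"
  shows "A \<inter> B \<noteq> {}"
proof
  assume "A \<inter> B = {}"
  then have "card A + card B = card (A \<union> B)"
    using assms finite_subset by (metis card_Un_disjoint)
  also have "\<dots> \<le> card C" using assms by (intro card_mono) auto
  finally show False using assms(4) by simp
qed

lemma card_Int_lower:
  assumes "finite C" "A \<subseteq> C" "B \<subseteq> C"
  shows "card A + card B \<le> card C + card (A \<inter> B)"
proof -
  have "finite A" "finite B" using assms finite_subset by auto
  then have "card A + card B = card (A \<union> B) + card (A \<inter> B)" by (rule card_Un_Int)
  also have "card (A \<union> B) \<le> card C" using assms by (intro card_mono) auto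
  finally show ?thesis by simp
qed

lemma int_subgroup_multiples:
  fixes H :: "int set"
  assumes diff: "\<And>x y. x \<in> H \<Longrightarrow> y \<in> H \<Longrightarrow> x - y \<in> H" and L: "L \<in> H" "L > 0"
  shows "\<exists>d>0. \<forall>z. z \<in> H \<longleftrightarrow> d dvd z"
proof -
  have zero: "0 \<in> H" using diff[OF L(1) L(1)] by simp
  have neg: "- x \<in> H" if "x \<in> H" for x using diff[OF zero that] by simp
  have add: "x + y \<in> H" if "x \<in> H" "y \<in> H" for x y using diff[OF that(1) neg[OF that(2)]] by simp
  have nmul: "int k * x \<in> H" if "x \<in> H" for k x
    by (induction k) (auto simp: zero algebra_simps intro: add that)
  have mul: "k * x \<in> H" if "x \<in> H" for k x
  proof (cases "k \<ge> 0")
    case True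
    then show ?thesis using nmul[OF that, of "nat k"] by simp
  next
    case False
    then show ?thesis using neg[OF nmul[OF that, of "nat (- k)"]] by simp
  qed
  define n where "n = (LEAST d::nat. d > 0 \<and> int d \<in> H)"
  have ex: "\<exists>d::nat. d > 0 \<and> int d \<in> H" using L by (intro exI[of _ "nat L"]) auto
  have n: "n > 0" "int n \<in> H" using LeastI_ex[OF ex] by (simp_all add: n_def)
  have "int n dvd z" if z: "z \<in> H" for z
  proof (rule ccontr)
    assume "\<not> int n dvd z"
    then have nz: "z mod int n \<noteq> 0" by (simp add: dvd_eq_mod_eq_0)
    have "z mod int n = z - (z div int n) * int n" by (simp add: minus_div_mult_eq_mod)
    then have "z mod int n \<in> H" using diff[OF z mul[OF n(2)]] by metis
    moreover have "0 < z mod int n" "z mod int n < int n" using nz n(1)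
      by (metis of_nat_0_less_iff pos_mod_sign order_le_less) (simp add: n(1))
    ultimately have "nat (z mod int n) > 0 \<and> int (nat (z mod int n)) \<in> H" by simp
    then have "n \<le> nat (z mod int n)" unfolding n_def by (rule Least_le)
    then show False using \<open>z mod int n < int n\<close> \<open>0 < z mod int n\<close> by linarith
  qed
  moreover have "z \<in> H" if "int n dvd z" for z
    using that mul[OF n(2)] by (metis dvd_def mult.commute)
  ultimately show ?thesis using n(1) by (intro exI[of _ "int n"]) auto
qed

text \<open>
  Reduce modulo the largest element: a subset of a cyclic group with doubling below \<open>3/2\<close> has a subgroup as its
  difference set.
\<close>

lemma small_doubling_int:
  fixes A :: "int set" and L :: int
  assumes fA: "finite A" and zero: "0 \<in> A" and L: "L \<in> A" "L > 0" and bd: "\<And>a. a \<in> A \<Longrightarrow> 0 \<le> a \<and> a \<le> L"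
  defines "AA \<equiv> (\<lambda>(a, b). a + b) ` (A \<times> A)"
  assumes dbl: "2 * card AA + 3 < 5 * card A"
  shows "\<exists>d>0. (\<forall>a\<in>A. d dvd a) \<and> L div d \<le> int (card AA) - int (card A)"
proof -
  define X where "X = A - {L}"
  have X: "X \<subseteq> {0..<L}" using bd by (force simp: X_def)
  have fX: "finite X" using fA by (simp add: X_def)
  have cX: "card A = card X + 1" using L fA card_Suc_Diff1[of A L] by (simp add: X_def)
  have X0: "0 \<in> X" using zero L by (simp add: X_def)
  have AX: "a mod L \<in> X" if "a \<in> A" for a
  proof (cases "a = L")
    case False
    then have "a \<in> X" using that by (simp add: X_def)
    then show ?thesis using X by auto
  qed (simp add: X0)
  define XX where "XX = (\<lambda>(x, y). (x + y) mod L) ` (X \<times> X)"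
  have fXX: "finite XX" using fX by (simp add: XX_def)
  have XXI: "(x + y) mod L \<in> XX" if "x \<in> X" "y \<in> X" for x y using that by (auto simp: XX_def)
  have XsubXX: "X \<subseteq> XX"
  proof
    fix x assume x: "x \<in> X"
    then have "(x + 0) mod L \<in> XX" using XXI X0 by blast
    then show "x \<in> XX" using x X by auto
  qed
  have fAA: "finite AA" using fA by (simp add: AA_def)
  \<comment> \<open>\<open>BB\<close> consists of \<open>2 * card A - 1\<close> sums whose residues
    all lie in \<open>X\<close>. Each residue in \<open>XX - X\<close> requires a further sum, which
    yields \<open>card XX \<le> card AA - card A\<close>.\<close>
  define BB where "BB = A \<union> (\<lambda>a. a + L) ` A"
  have BBsub: "BB \<subseteq> AA"
  proof
    fix b assume "b \<in> BB"
    then have "b \<in> A \<or> (\<exists>a\<in>A. b = a + L)" by (auto simp: BB_def)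
    then have "\<exists>x\<in>A. \<exists>y\<in>A. b = x + y" using zero L(1) by force
    then show "b \<in> AA" by (auto simp: AA_def)
  qed
  have cBB: "card BB + 1 = 2 * card A"
  proof -
    have "A \<inter> (\<lambda>a. a + L) ` A = {L}"
    proof
      show "A \<inter> (\<lambda>a. a + L) ` A \<subseteq> {L}"
      proof
        fix b assume "b \<in> A \<inter> (\<lambda>a. a + L) ` A"
        then obtain a where "b \<in> A" "a \<in> A" "b = a + L" by blast
        then show "b \<in> {L}" using bd[of b] bd[of a] by simp
      qed
      show "{L} \<subseteq> A \<inter> (\<lambda>a. a + L) ` A" using L zero by force
    qed
    moreover have "card ((\<lambda>a. a + L) ` A) = card A" by (rule card_image) (simp add: inj_on_def)
    ultimately show ?thesis
      using card_Un_Int[of A "(\<lambda>a. a + L) ` A"] fA by (simp add: BB_def)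
  qed
  have BBmod: "b mod L \<in> X" if "b \<in> BB" for b
    using that AX by (auto simp: BB_def)
  have "\<exists>g. \<forall>c\<in>XX - X. g c \<in> AA \<and> g c mod L = c"
  proof (rule bchoice, rule ballI)
    fix c assume "c \<in> XX - X"
    then obtain x y where xy: "x \<in> X" "y \<in> X" "c = (x + y) mod L" by (auto simp: XX_def)
    then have "x + y \<in> AA" by (auto simp: AA_def X_def)
    then show "\<exists>z. z \<in> AA \<and> z mod L = c" using xy by auto
  qed
  then obtain g where g: "\<And>c. c \<in> XX - X \<Longrightarrow> g c \<in> AA \<and> g c mod L = c" by blast
  have "inj_on g (XX - X)" by (rule inj_onI) (metis g)
  then have cg: "card (g ` (XX - X)) = card (XX - X)" by (rule card_image)
  have "BB \<inter> g ` (XX - X) = {}"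
  proof -
    have "g c \<notin> BB" if "c \<in> XX - X" for c using g[OF that] BBmod[of "g c"] that by auto
    then show ?thesis by blast
  qed
  then have "card BB + card (XX - X) = card (BB \<union> g ` (XX - X))"
    using cg fAA BBsub fXX by (subst card_Un_disjoint) (auto intro: finite_subset)
  also have "\<dots> \<le> card AA" using fAA BBsub g by (intro card_mono) auto
  finally have "card BB + card (XX - X) \<le> card AA" .
  moreover have "card (XX - X) + card X = card XX"
    using card_Diff_subset[OF fX XsubXX] card_mono[OF fXX XsubXX] by simp
  ultimately have cXX: "card XX + card A \<le> card AA" using cBB cX by linarith
  have small: "2 * card XX < 3 * card X" using cXX dbl cX by linarith
  have Xpos: "card X > 0" using X0 fX by (auto simp: card_gt_0_iff)
  \<comment> \<open>A difference \<open>z\<close> of \<open>X\<close> arises from two translates of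
    \<open>X\<close> inside \<open>XX\<close>. As \<open>XX\<close> is smaller than
    \<open>3/2\<close> times \<open>X\<close>, these overlap in more than half of \<open>X\<close>.
    Two such majorities of \<open>X\<close> meet, so the set \<open>H\<close> of differences is
    closed under subtraction.\<close>
  define V where "V z = {v \<in> X. (v + z) mod L \<in> X}" for z
  define H where "H = {z. \<exists>x\<in>X. \<exists>y\<in>X. (x - y) mod L = z mod L}"
  have Vbig: "card X < 2 * card (V z)" if zH: "z \<in> H" for z
  proof -
    obtain x y where xy: "x \<in> X" "y \<in> X" "(x - y) mod L = z mod L" using zH by (auto simp: H_def)
    define T where "T w = (\<lambda>v. (w + v) mod L) ` X" for w
    have cT: "card (T w) = card X" for w
      unfolding T_def by (rule card_image) (rule inj_on_subset[OF inj_on_add_mod X])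
    have TXX: "T w \<subseteq> XX" if "w \<in> X" for w using that XXI by (auto simp: T_def)
    define Q where "Q = {v \<in> X. (x + v) mod L \<in> T y}"
    have "(\<lambda>v. (x + v) mod L) ` Q = T x \<inter> T y" by (auto simp: Q_def T_def)
    moreover have "card ((\<lambda>v. (x + v) mod L) ` Q) = card Q"
      by (rule card_image) (rule inj_on_subset[OF inj_on_add_mod], use X in \<open>auto simp: Q_def\<close>)
    ultimately have "card Q = card (T x \<inter> T y)" by simp
    moreover have "card (T x) + card (T y) \<le> card XX + card (T x \<inter> T y)"
      by (rule card_Int_lower[OF fXX TXX TXX]) (use xy in auto)
    moreover have "Q \<subseteq> V z"
    proof
      fix v assume "v \<in> Q"
      then obtain v' where v: "v \<in> X" "v' \<in> X" "(x + v) mod L = (y + v') mod L" by (auto simp: Q_def T_def)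
      have "(v + z) mod L = (v + (x - y)) mod L" using xy(3) by (metis mod_add_right_eq)
      also have "\<dots> = ((x + v) - y) mod L" by (simp add: algebra_simps)
      also have "\<dots> = ((y + v') - y) mod L" using v(3) by (metis mod_diff_left_eq)
      also have "\<dots> = v'" using v(2) X by auto
      finally show "v \<in> V z" using v by (simp add: V_def)
    qed
    then have "card Q \<le> card (V z)" using fX by (intro card_mono) (auto simp: V_def)
    ultimately show ?thesis using cT[of x] cT[of y] small by linarith
  qed
  have Hdiff: "z1 - z2 \<in> H" if "z1 \<in> H" "z2 \<in> H" for z1 z2
  proof -
    have "V z1 \<inter> V z2 \<noteq> {}"
      by (rule Int_nonempty_card[OF fX]) (use Vbig[OF that(1)] Vbig[OF that(2)] in \<open>auto simp: V_def\<close>)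
    then obtain v where "(v + z1) mod L \<in> X" "(v + z2) mod L \<in> X" by (auto simp: V_def)
    moreover have "((v + z1) mod L - (v + z2) mod L) mod L = (z1 - z2) mod L" by (simp add: mod_simps)
    ultimately show ?thesis unfolding H_def by blast
  qed
  have LH: "L \<in> H" unfolding H_def using X0 by (auto intro!: bexI[of _ 0])
  obtain d where d: "d > 0" "\<And>z. z \<in> H \<longleftrightarrow> d dvd z"
    using int_subgroup_multiples[OF Hdiff LH L(2)] by blast
  have AH: "d dvd a" if "a \<in> A" for a
  proof -
    have "(a mod L - 0) mod L = a mod L" by simp
    then have "a \<in> H" using AX[OF that] X0 unfolding H_def by blast
    then show ?thesis using d by simp
  qed
  obtain q where q: "L = d * q" using AH[OF L(1)] by (auto simp: dvd_def)
  have q0: "q > 0" using q L(2) d(1) by (simp add: zero_less_mult_iff)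
  \<comment> \<open>Representatives of the group \<open>H\<close> modulo \<open>L\<close>. Each of
    its \<open>q\<close> elements is a difference of more than \<open>card X / 2\<close> pairs,
    hence \<open>q < 2 * card X\<close>. Therefore \<open>X\<close> meets \<open>h - X\<close>
    inside the group for every \<open>h\<close>, and all of the group lies in
    \<open>XX\<close>.\<close>
  define Hq where "Hq = (\<lambda>i. d * i) ` {0..<q}"
  have cHq: "card Hq = nat q" unfolding Hq_def using d(1) by (subst card_image) (auto simp: inj_on_def)
  have memHq: "z \<in> Hq" if z: "d dvd z" "z \<in> {0..<L}" for z
  proof -
    obtain i where "z = d * i" using z(1) by (auto simp: dvd_def)
    then have "i \<in> {0..<q}" using z(2) d(1) q by (auto simp: zero_le_mult_iff)
    then show ?thesis using \<open>z = d * i\<close> by (auto simp: Hq_def)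
  qed
  have fHq: "finite Hq" by (simp add: Hq_def)
  have HqL: "Hq \<subseteq> {0..<L}"
  proof
    fix z assume "z \<in> Hq"
    then obtain i where "i \<in> {0..<q}" "z = d * i" unfolding Hq_def by blast
    then show "z \<in> {0..<L}" using d(1) q by (auto intro: mult_nonneg_nonneg mult_strict_left_mono)
  qed
  have HqH: "h \<in> H" if "h \<in> Hq" for h unfolding d(2) using that by (auto simp: Hq_def)
  have "nat q * card X < 2 * card X * card X"
  proof -
    have "nat q * card X = (\<Sum>h\<in>Hq. card X)" using cHq by simp
    also have "\<dots> < (\<Sum>h\<in>Hq. 2 * card (V h))"
    proof (rule sum_strict_mono)
      show "Hq \<noteq> {}" using q0 by (auto simp: Hq_def)
    qed (use fHq Vbig HqH in auto)
    also have "\<dots> = 2 * (\<Sum>h\<in>Hq. \<Sum>v\<in>X. of_bool ((v + h) mod L \<in> X))"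
      unfolding V_def by (simp add: sum_distrib_left card_of_bool_sum[OF fX])
    also have "(\<Sum>h\<in>Hq. \<Sum>v\<in>X. of_bool ((v + h) mod L \<in> X)) = (\<Sum>v\<in>X. \<Sum>h\<in>Hq. of_bool ((v + h) mod L \<in> X))"
      by (rule sum.swap)
    also have "(\<Sum>v\<in>X. \<Sum>h\<in>Hq. of_bool ((v + h) mod L \<in> X)) \<le> (\<Sum>v\<in>X. card X)"
    proof (rule sum_mono)
      fix v
      have "(\<Sum>h\<in>Hq. of_bool ((v + h) mod L \<in> X)) = card {h \<in> Hq. (v + h) mod L \<in> X}"
        by (rule card_of_bool_sum[OF fHq, symmetric])
      also have "\<dots> = card ((\<lambda>h. (v + h) mod L) ` {h \<in> Hq. (v + h) mod L \<in> X})"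
        by (rule card_image[symmetric], rule inj_on_subset[OF inj_on_add_mod]) (use HqL in auto)
      also have "\<dots> \<le> card X" by (rule card_mono[OF fX]) auto
      finally show "(\<Sum>h\<in>Hq. of_bool ((v + h) mod L \<in> X)) \<le> card X" .
    qed
    finally show ?thesis by simp
  qed
  then have q2: "nat q < 2 * card X" by simp
  have XHq: "X \<subseteq> Hq" using memHq AH X by (auto simp: X_def)
  have "Hq \<subseteq> XX"
  proof
    fix h assume h: "h \<in> Hq"
    define R where "R = (\<lambda>v. (h - v) mod L) ` X"
    have "card R = card X" unfolding R_def by (rule card_image) (rule inj_on_subset[OF inj_on_diff_mod X])
    moreover have "R \<subseteq> Hq"
    proof
      fix r assume "r \<in> R"
      then obtain v where v: "v \<in> X" "r = (h - v) mod L" by (auto simp: R_def)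
      have "d dvd h - v" using h v XHq by (auto simp: Hq_def)
      then have "d dvd r" unfolding v(2) using q by (simp add: dvd_mod)
      then show "r \<in> Hq" using memHq v(2) L(2) by auto
    qed
    ultimately have "X \<inter> R \<noteq> {}" by (intro Int_nonempty_card[OF fHq XHq]) (use q2 cHq in auto)
    then obtain v where v: "v \<in> X" "(h - v) mod L \<in> X" by (auto simp: R_def)
    have "((h - v) mod L + v) mod L = h" using h HqL by (auto simp: mod_simps)
    then show "h \<in> XX" using XXI[OF v(2,1)] by simp
  qed
  then have "nat q \<le> card XX" using card_mono[OF fXX] cHq by metis
  moreover have "L div d = q" using q d(1) by simp
  ultimately have "L div d \<le> int (card AA) - int (card A)" using cXX q0 by linarith
  then show ?thesis using d(1) AH by blast
qed

context zp
begin

text \<open>The ball of radius \<open>y1\<close> lifts to a set \<open>M\<close> of integers around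
  0, and the sums of \<open>M\<close> inject into the ball of radius \<open>2 * y1\<close>. The two
  size bounds keep the doubling of \<open>M\<close> near 2, so by \<open>small_doubling_int\<close>
  it fills most of a short arithmetic progression with difference \<open>d\<close>. Short multiples
  of \<open>d\<close> are then differences of two elements of \<open>M\<close>.\<close>

lemma ball_interval:
  assumes Y: "Y \<subseteq> G"
    and arc: "\<And>s. dd Y s \<le> 2 * y1 \<Longrightarrow> \<exists>z. 8 * \<bar>z\<bar> < p \<and> s mod p = z mod p"
    and lower: "2 * real y1 - 4 * real u \<le> card (ball Y y1)"
    and upper: "real (card (ball Y (2 * y1))) \<le> 4 * real y1 + 11 * real u"
    and u: "u \<ge> 1" "30 * u \<le> y1"
  shows "\<exists>k. \<not> p dvd k \<and> (\<forall>w. 0 \<le> w \<and> w \<le> 2 * int y1 - 25 * int u \<longrightarrow> dd (dil k Y) w \<le> 2 * y1)"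
proof -
  define M where "M = {z. 8 * \<bar>z\<bar> < p \<and> dd Y z \<le> y1}"
  have fM: "finite M" by (rule finite_subset[of _ "{-p..p}"]) (auto simp: M_def)
  have M0: "0 \<in> M" by (simp add: M_def dd_0[OF Y])
  have Mneg: "- z \<in> M" if "z \<in> M" for z using that by (simp add: M_def dd_minus[OF Y])
  have "ball Y y1 \<subseteq> (\<lambda>z. z mod p) ` M"
  proof
    fix s assume s: "s \<in> ball Y y1"
    then have "dd Y s \<le> 2 * y1" by (simp add: ball_def)
    then obtain z where z: "8 * \<bar>z\<bar> < p" "s mod p = z mod p" using arc by blast
    have "dd Y z = dd Y s" using dd_mod[of Y z] dd_mod[of Y s] z(2) by simp
    moreover have "dd Y s \<le> y1" "s mod p = s" using s by (simp_all add: ball_def)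
    ultimately have "z \<in> M" "s = z mod p" using z by (simp_all add: M_def)
    then show "s \<in> (\<lambda>z. z mod p) ` M" by blast
  qed
  then have "card (ball Y y1) \<le> card M" using fM by (metis card_image_le card_mono finite_imageI le_trans)
  then have cM: "2 * real y1 - 4 * real u \<le> card M" using lower by linarith
  define MM where "MM = (\<lambda>(a, b). a + b) ` (M \<times> M)"
  have "inj_on (\<lambda>z. z mod p) MM"
  proof (rule inj_onI)
    fix a b assume h: "a \<in> MM" "b \<in> MM" "a mod p = b mod p"
    show "a = b" by (rule mod_eq_imp_eq[OF h(3)]) (use h in \<open>auto simp: MM_def M_def\<close>)
  qed
  then have "card MM = card ((\<lambda>z. z mod p) ` MM)" by (rule card_image[symmetric])
  also have "\<dots> \<le> card (ball Y (2 * y1))"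
  proof (rule card_mono[OF finite_ball], rule subsetI)
    fix s assume "s \<in> (\<lambda>z. z mod p) ` MM"
    then obtain a b where ab: "a \<in> M" "b \<in> M" "s = (a + b) mod p" by (auto simp: MM_def)
    then have "dd Y s \<le> dd Y a + dd Y b" using dd_add[OF Y, of a b] by simp
    then show "s \<in> ball Y (2 * y1)" using ab by (auto simp: ball_def M_def)
  qed
  finally have cMM: "real (card MM) \<le> 4 * real y1 + 11 * real u" using upper by linarith
  have ur: "real u \<ge> 1" "30 * real u \<le> real y1" using u by linarith+
  define \<mu> where "\<mu> = Max M"
  have \<mu>M: "\<mu> \<in> M" using fM M0 by (auto simp: \<mu>_def intro: Max_in)
  have \<mu>b: "z \<le> \<mu>" if "z \<in> M" for z using fM that by (simp add: \<mu>_def)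
  have \<mu>b': "- \<mu> \<le> z" if "z \<in> M" for z using \<mu>b[OF Mneg[OF that]] by simp
  have "\<mu> \<noteq> 0"
  proof
    assume "\<mu> = 0"
    then have "M \<subseteq> {0}" using \<mu>b \<mu>b' by force
    then have "card M \<le> 1" using card_mono[of "{0::int}" M] by simp
    then have "real (card M) \<le> 1" by simp
    then show False using cM ur by linarith
  qed
  then have \<mu>0: "\<mu> > 0" using \<mu>b[OF M0] by simp
  define A where "A = (\<lambda>z. z + \<mu>) ` M"
  have cA: "card A = card M" unfolding A_def by (rule card_image) (simp add: inj_on_def)
  have AA: "(\<lambda>(a, b). a + b) ` (A \<times> A) = (\<lambda>z. z + 2 * \<mu>) ` MM"
    by (force simp: A_def MM_def image_iff)
  have cAA: "card ((\<lambda>(a, b). a + b) ` (A \<times> A)) = card MM"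
    unfolding AA by (rule card_image) (simp add: inj_on_def)
  have "\<exists>d>0. (\<forall>a\<in>A. d dvd a) \<and> (2 * \<mu>) div d \<le> int (card ((\<lambda>(a, b). a + b) ` (A \<times> A))) - int (card A)"
  proof (rule small_doubling_int)
    show "finite A" using fM by (simp add: A_def)
    have "- \<mu> + \<mu> \<in> A" unfolding A_def using Mneg[OF \<mu>M] by (rule imageI)
    then show "0 \<in> A" by simp
    have "\<mu> + \<mu> \<in> A" unfolding A_def using \<mu>M by (rule imageI)
    then show "2 * \<mu> \<in> A" by simp
    show "2 * \<mu> > 0" using \<mu>0 by simp
    show "0 \<le> a \<and> a \<le> 2 * \<mu>" if "a \<in> A" for a using that \<mu>b \<mu>b' by (force simp: A_def)
    have "2 * real (card MM) + 3 < 5 * real (card M)" using cM cMM ur by linarith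
    then have "2 * card MM + 3 < 5 * card M" by linarith
    then show "2 * card ((\<lambda>(a, b). a + b) ` (A \<times> A)) + 3 < 5 * card A" unfolding cAA cA .
  qed
  then obtain d where d: "d > 0" "\<And>a. a \<in> A \<Longrightarrow> d dvd a" "(2 * \<mu>) div d \<le> int (card MM) - int (card M)"
    unfolding cAA cA by blast
  have d\<mu>: "d dvd \<mu>" using d(2)[of "0 + \<mu>"] M0 by (auto simp: A_def)
  have dM: "d dvd z" if "z \<in> M" for z
    using d(2)[of "z + \<mu>"] that d\<mu> by (auto simp: A_def dvd_add_left_iff)
  obtain l where l: "\<mu> = d * l" using d\<mu> by (auto simp: dvd_def)
  have "(2 * \<mu>) div d = 2 * l" using l d(1) by simp
  then have ql: "2 * l \<le> int (card MM) - int (card M)" using d(3) by simp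
  define M' where "M' = (\<lambda>z. z div d) ` M"
  have "inj_on (\<lambda>z. z div d) M" by (rule inj_onI) (metis dM dvd_div_eq_iff)
  then have cM': "card M' = card M" unfolding M'_def by (rule card_image)
  have M'l: "M' \<subseteq> {- l..l}"
  proof
    fix w assume "w \<in> M'"
    then obtain z where z: "z \<in> M" "w = z div d" by (auto simp: M'_def)
    then have "z = d * w" using dM by auto
    then have "d * w \<le> d * l" "d * (- l) \<le> d * w" using \<mu>b[OF z(1)] \<mu>b'[OF z(1)] l by auto
    then have "w \<le> l" "- l \<le> w" using d(1) by (simp_all only: mult_le_cancel_left_pos)
    then show "w \<in> {- l..l}" by simp
  qed
  have M'M: "d * w \<in> M" if "w \<in> M'" for w using that dM by (auto simp: M'_def)
  \<comment> \<open>\<open>M'\<close> and its shift by \<open>w\<close> both lie in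
    \<open>{- l..l + w}\<close> and are together too large to be disjoint, so \<open>w\<close> is a
    difference of two elements of \<open>M'\<close>. The margin \<open>25 * u\<close> pays for the
    errors of both ball sizes: \<open>11 * u\<close> above and three times \<open>4 * u\<close>
    below.\<close>
  have main: "dd Y (d * w) \<le> 2 * y1" if w: "0 \<le> w" "w \<le> 2 * int y1 - 25 * int u" for w
  proof -
    have "M' \<inter> (\<lambda>z. z + w) ` M' \<noteq> {}"
    proof (rule Int_nonempty_card[of "{- l..l + w}"])
      show "M' \<subseteq> {- l..l + w}" "(\<lambda>z. z + w) ` M' \<subseteq> {- l..l + w}" using M'l w by force+
      have c: "card ((\<lambda>z. z + w) ` M') = card M" using cM' by (subst card_image) (auto simp: inj_on_def)
      have "l \<ge> 0" using l \<mu>0 d(1) by (simp add: zero_less_mult_iff)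
      then have "int (card {- l..l + w}) = 2 * l + w + 1" using w by simp
      moreover have "real_of_int (2 * l) \<le> real (card MM) - real (card M)" using ql by linarith
      moreover have "real_of_int w \<le> 2 * real y1 - 25 * real u" using w(2) by linarith
      ultimately have "real (card {- l..l + w}) < 2 * real (card M)" using cM cMM ur by linarith
      then have "card {- l..l + w} < 2 * card M" by linarith
      then show "card {- l..l + w} < card M' + card ((\<lambda>z. z + w) ` M')" using c cM' by simp
    qed simp
    then obtain w1 w2 where ww: "w1 \<in> M'" "w2 \<in> M'" "w1 = w2 + w" by auto
    then have "d * w = d * w1 + - (d * w2)" by (simp add: algebra_simps)
    then have "dd Y (d * w) \<le> dd Y (d * w1) + dd Y (d * w2)"
      using dd_add[OF Y, of "d * w1" "- (d * w2)"] dd_minus[OF Y] by simp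
    then show ?thesis using M'M[OF ww(1)] M'M[OF ww(2)] by (simp add: M_def)
  qed
  have "d \<le> \<mu>" using d\<mu> \<mu>0 by (simp add: zdvd_imp_le)
  moreover have "8 * \<bar>\<mu>\<bar> < p" using \<mu>M by (simp add: M_def)
  ultimately have "d < p" by linarith
  then have "\<not> p dvd d" using d(1) by (simp add: zdvd_not_zless)
  \<comment> \<open>Dilating by the inverse of \<open>d\<close> turns the progression of cheap
    shifts into an interval of cheap shifts.\<close>
  then obtain k where k: "\<not> p dvd k" "(d * k) mod p = 1" using ex_inverse by blast
  have kd: "(k * d) mod p = 1" using k(2) by (simp add: mult.commute)
  have "dd (dil k Y) w = dd Y (d * w)" for w
  proof -
    have "dd (dil k Y) w = dd (dil k Y) (k * (d * w))"
      using mult_inverse_mod[OF kd, of w] by (metis dd_mod)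
    then show ?thesis by (simp add: dd_dil[OF k(1) Y])
  qed
  then show ?thesis using main k(1) by (intro exI[of _ k]) auto
qed


section \<open>A set for which all short shifts are as cheap as for an interval\<close>

lemma up_step_exists:
  fixes Z :: "int set" and y :: int
  assumes "x \<in> Z" "c \<notin> Z" "x = c + y * int k" "y > 0"
  shows "\<exists>w\<in>Z. w - y \<notin> Z \<and> c < w \<and> w \<le> x \<and> c + y \<le> w \<and> w mod y = x mod y"
  using assms
proof (induction k arbitrary: x)
  case 0
  then show ?case by simp
next
  case (Suc k)
  have x: "x = c + y + y * int k" using Suc.prems(3) by (simp add: algebra_simps)
  have yk: "y * int k \<ge> 0" using Suc.prems(4) by simp
  show ?case
  proof (cases "x - y \<in> Z")
    case True
    then obtain w where w: "w \<in> Z" "w - y \<notin> Z" "c < w" "w \<le> x - y" "c + y \<le> w" "w mod y = (x - y) mod y"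
      using Suc.IH[OF True Suc.prems(2) _ Suc.prems(4)] x by auto
    then show ?thesis using Suc.prems(4) by (intro bexI[of _ w]) auto
  next
    case False
    moreover have "c < x" "c + y \<le> x" using x yk Suc.prems(4) by linarith+
    ultimately show ?thesis using Suc.prems(1) by (intro bexI[of _ x] conjI) simp_all
  qed
qed

lemma card_residue_count:
  fixes a y :: int
  assumes y: "y > 0" and R: "R \<subseteq> {0..<y}" and N: "N \<ge> 0"
  shows "int (card {c \<in> {a..<a + N}. c mod y \<in> R}) \<le> int (card R) * (N div y + 1)"
proof -
  define f where "f c = (c mod y, (c - a) div y)" for c
  define S where "S = {c \<in> {a..<a + N}. c mod y \<in> R}"
  have inj: "inj_on f S"
  proof (rule inj_onI)
    fix c d assume cd: "c \<in> S" "d \<in> S" "f c = f d"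
    have m: "c mod y = d mod y" and q: "(c - a) div y = (d - a) div y" using cd(3) by (auto simp: f_def)
    have e: "(c - a) mod y = (d - a) mod y" using m by (metis mod_diff_left_eq)
    have "c - a = d - a" using q e by (metis mult_div_mod_eq)
    then show "c = d" by simp
  qed
  have "f ` S \<subseteq> R \<times> {0..N div y}"
  proof
    fix z assume "z \<in> f ` S"
    then obtain c where c: "c \<in> S" "z = f c" by auto
    have "0 \<le> c - a" "c - a \<le> N" using c by (auto simp: S_def)
    then have "0 \<le> (c - a) div y" "(c - a) div y \<le> N div y" using y by (simp_all add: zdiv_mono1 pos_imp_zdiv_nonneg_iff)
    then show "z \<in> R \<times> {0..N div y}" using c by (auto simp: f_def S_def)
  qed
  moreover have fR: "finite (R \<times> {0..N div y})" using R finite_subset by blast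
  ultimately have "card (f ` S) \<le> card (R \<times> {0..N div y})" by (rule card_mono[rotated])
  then have "card S \<le> card R * card {0..N div y}" using card_image[OF inj] by (simp add: card_cartesian_product)
  then have "int (card S) \<le> int (card R) * int (card {0..N div y})" by (metis of_nat_le_iff of_nat_mult)
  moreover have "int (card {0..N div y}) = N div y + 1" using N y by (simp add: pos_imp_zdiv_nonneg_iff)
  ultimately show ?thesis by (simp add: S_def)
qed

lemma dd_tr: "Y \<subseteq> G \<Longrightarrow> dd (tr a Y) s = dd Y s"
proof -
  assume Y: "Y \<subseteq> G"
  have "tr s (tr a Y) = tr a (tr s Y)" by (simp add: tr_tr add.commute)
  then have "tr a Y - tr s (tr a Y) = tr a (Y - tr s Y)" by (simp add: tr_Diff)
  then show ?thesis unfolding dd_def using card_tr[of "Y - tr s Y" a] Y by auto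
qed

text \<open>Both sides count the pairs of an element and a shift below \<open>y\<close> that leads
  out of the set. Bounds on the cost of shifts thereby control how full the windows behind the
  elements are on average.\<close>

lemma sum_window_missing:
  assumes Z: "Z \<subseteq> G"
  shows "(\<Sum>b\<in>Z. card {z \<in> {0..<y}. (b + int z) mod p \<notin> Z}) = (\<Sum>z<y. dd Z (int z))"
proof -
  have "(\<Sum>b\<in>Z. card {z \<in> {0..<y}. (b + int z) mod p \<notin> Z}) = (\<Sum>b\<in>Z. \<Sum>z<y. of_bool ((b + int z) mod p \<notin> Z))"
    by (simp only: atLeast0LessThan card_of_bool_sum[OF finite_lessThan])
  also have "\<dots> = (\<Sum>z<y. \<Sum>b\<in>Z. of_bool ((b + int z) mod p \<notin> Z))" by (rule sum.swap)
  also have "\<dots> = (\<Sum>z<y. dd Z (int z))"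
  proof (rule sum.cong[OF refl])
    fix z
    have "(\<Sum>b\<in>Z. of_bool ((b + int z) mod p \<notin> Z)) = card {b \<in> Z. (b + int z) mod p \<notin> Z}"
      by (rule card_of_bool_sum[symmetric]) (rule finite_sub_G[OF Z])
    also have "{b \<in> Z. (b + int z) mod p \<notin> Z} = Z - tr (- int z) Z" using Z by (auto simp: tr_def)
    finally show "(\<Sum>b\<in>Z. of_bool ((b + int z) mod p \<notin> Z)) = dd Z (int z)"
      using dd_minus[OF Z] by (simp add: dd_def)
  qed
  finally show ?thesis .
qed

text \<open>For most elements the window of length \<open>y\<close> behind them is almost full;
  \<open>J\<close> spans from the first to the last such element. Along the residue classes modulo
  \<open>y\<close>, the entries into the set number at most the cost of the shift \<open>y\<close>,
  hence about one per class. A class that starts outside at the cut and is met by the windows at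
  both ends of \<open>J\<close> cannot leave the set in between without entering it a second time,
  so \<open>J\<close> has few holes.\<close>

lemma near_interval:
  fixes \<theta> \<epsilon> :: real and y :: nat
  assumes Y: "Y \<subseteq> G" and y: "y \<ge> 1" and \<theta>: "0 < \<theta>" "\<theta> \<le> 1" and \<epsilon>: "0 \<le> \<epsilon>" "\<epsilon> \<le> \<theta>"
    and d: "\<And>z::nat. z \<le> y \<Longrightarrow> real (dd Y (int z)) \<le> (1 + \<epsilon>) * y"
    and pY: "2 * real y \<le> \<theta> * (real_of_int p - card Y)" and nY: "3 * real y < \<theta> * card Y"
  shows "\<exists>s N. 0 \<le> N \<and> N \<le> p \<and> real (card (tr s Y - {0..<N})) \<le> 3 * real y / \<theta> \<and>
    (1 - 6 * \<theta>) * real_of_int N \<le> card Y + 6 * \<theta> * y"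
proof -
  define n where "n = real (card Y)"
  have y0: "real y > 0" using y by simp
  have sumd: "(\<Sum>z<y. real (dd Y (int z))) \<le> (1 + \<epsilon>) * y * y"
  proof -
    have "(\<Sum>z<y. real (dd Y (int z))) \<le> (\<Sum>z<y. (1 + \<epsilon>) * y)" by (rule sum_mono) (use d in auto)
    then show ?thesis by (simp add: mult_ac)
  qed
  have e2: "(1 + \<epsilon>) * y * y \<le> 2 * real y * real y"
    using \<epsilon> \<theta> by (intro mult_right_mono) auto
  have pn: "real_of_int p - n > 0"
  proof -
    have "0 < \<theta> * (real_of_int p - n)" using pY y0 unfolding n_def by linarith
    then show ?thesis using \<theta>(1) by (simp add: zero_less_mult_iff)
  qed
  have nle: "n \<le> real_of_int p" using pn by simp
  have yp: "int y \<le> p"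
  proof -
    have "\<theta> * (real_of_int p - n) \<le> real_of_int p - n" using mult_right_mono[of \<theta> 1 "real_of_int p - n"] \<theta> pn by simp
    moreover have "n \<ge> 0" by (simp add: n_def)
    ultimately have "real y \<le> real_of_int p" using pY y0 unfolding n_def by linarith
    then show ?thesis by linarith
  qed
  \<comment> \<open>a window that is almost free of elements of the set, at which the circle is cut\<close>
  have "\<exists>x0\<in>G - Y. real (card {z \<in> {0..<y}. (x0 + int z) mod p \<in> Y}) \<le> \<theta> * y"
  proof (rule ccontr)
    assume neg: "\<not> ?thesis"
    have cG: "real (card (G - Y)) = real_of_int p - n"
    proof -
      have "card (G - Y) = card G - card Y" by (rule card_Diff_subset[OF finite_sub_G[OF Y] Y])
      moreover have "card Y \<le> card G" using Y by (intro card_mono) auto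
      ultimately show ?thesis using p_gt1 by (simp add: n_def of_nat_diff)
    qed
    have GY: "G - Y \<subseteq> G" by auto
    have "{z \<in> {0..<y}. (b + int z) mod p \<notin> G - Y} = {z \<in> {0..<y}. (b + int z) mod p \<in> Y}" for b
      using Y by auto
    then have "(\<Sum>b\<in>G - Y. real (card {z \<in> {0..<y}. (b + int z) mod p \<in> Y})) = (\<Sum>z<y. real (dd Y (int z)))"
      using sum_window_missing[OF GY, of y] by (simp add: dd_compl[OF Y] flip: of_nat_sum)
    moreover have "(\<Sum>b\<in>G - Y. \<theta> * y) < (\<Sum>b\<in>G - Y. real (card {z \<in> {0..<y}. (b + int z) mod p \<in> Y}))"
    proof (rule sum_strict_mono)
      have "card (G - Y) \<noteq> 0" using cG pn by linarith
      then show "G - Y \<noteq> {}" by auto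
    qed (use neg in \<open>auto simp: not_le\<close>)
    moreover have "(\<Sum>b\<in>G - Y. \<theta> * y) = \<theta> * (real_of_int p - n) * y" by (simp add: cG mult_ac)
    ultimately have "\<theta> * (real_of_int p - n) * y < 2 * real y * real y" using sumd e2 by linarith
    then have "\<theta> * (real_of_int p - n) < 2 * real y" using y0 by simp
    then show False using pY by (simp add: n_def)
  qed
  then obtain x0 where x0: "x0 \<in> G - Y" "real (card {z \<in> {0..<y}. (x0 + int z) mod p \<in> Y}) \<le> \<theta> * y" by blast
  define Z where "Z = tr (- x0) Y"
  have Z: "Z \<subseteq> G" and cZ: "real (card Z) = n" by (simp_all add: Z_def card_tr[OF Y] n_def)
  have fZ: "finite Z" using Z finite_sub_G by blast
  have dZ: "dd Z s = dd Y s" for s by (simp add: Z_def dd_tr[OF Y])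
  have memZ: "x \<in> Z \<longleftrightarrow> (x0 + x) mod p \<in> Y" if "x \<in> G" for x using that by (simp add: Z_def tr_def add.commute)
  define yi where "yi = int y"
  have yi: "yi > 0" "yi \<le> p" using y yp by (auto simp: yi_def)
  have win: "real (card (Z \<inter> {0..<yi})) \<le> \<theta> * y"
  proof -
    have "Z \<inter> {0..<yi} = int ` {z \<in> {0..<y}. (x0 + int z) mod p \<in> Y}"
    proof (intro equalityI subsetI)
      fix x assume x: "x \<in> Z \<inter> {0..<yi}"
      then have "x = int (nat x)" "nat x < y" by (auto simp: yi_def)
      moreover have "x \<in> G" using x Z by auto
      ultimately show "x \<in> int ` {z \<in> {0..<y}. (x0 + int z) mod p \<in> Y}"
        using x memZ[of x] by (intro image_eqI[of _ _ "nat x"]) auto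
    next
      fix x assume "x \<in> int ` {z \<in> {0..<y}. (x0 + int z) mod p \<in> Y}"
      then show "x \<in> Z \<inter> {0..<yi}" using memZ yi by (auto simp: yi_def)
    qed
    then have "card (Z \<inter> {0..<yi}) \<le> card {z \<in> {0..<y}. (x0 + int z) mod p \<in> Y}" using card_image_le[of "{z \<in> {0..<y}. (x0 + int z) mod p \<in> Y}" int] by simp
    then show ?thesis using x0(2) by linarith
  qed
  \<comment> \<open>At most \<open>y\<close> elements are too close to the cut. By averaging the
    costs of the shifts below \<open>y\<close>, at most \<open>2 * y / \<theta>\<close> have a
    window with more than \<open>\<theta> * y\<close> missing elements.\<close>
  define Gd where "Gd = {b \<in> Z. b + yi \<le> p \<and> real (card ({b..<b + yi} - Z)) \<le> \<theta> * y}"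
  have cGd: "real (card (Z - Gd)) \<le> 3 * real y / \<theta>"
  proof -
    define B1 where "B1 = {b \<in> Z. b + yi > p}"
    define B2 where "B2 = {b \<in> Z. \<theta> * y < real (card {z \<in> {0..<y}. (b + int z) mod p \<notin> Z})}"
    have "Z - Gd \<subseteq> B1 \<union> B2"
    proof
      fix b assume b: "b \<in> Z - Gd"
      show "b \<in> B1 \<union> B2"
      proof (cases "b + yi > p")
        case False
        then have byp: "b + yi \<le> p" by simp
        then have c: "\<theta> * y < real (card ({b..<b + yi} - Z))" using b by (auto simp: Gd_def not_le)
        have bG: "b \<in> G" using b Z by auto
        have "{b..<b + yi} - Z \<subseteq> (\<lambda>z. b + int z) ` {z \<in> {0..<y}. (b + int z) mod p \<notin> Z}"
        proof
          fix x assume x: "x \<in> {b..<b + yi} - Z"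
          then have "x = b + int (nat (x - b))" "nat (x - b) < y" "x mod p = x" using bG byp by (auto simp: yi_def)
          then show "x \<in> (\<lambda>z. b + int z) ` {z \<in> {0..<y}. (b + int z) mod p \<notin> Z}"
            using x by (intro image_eqI[of _ _ "nat (x - b)"]) auto
        qed
        then have "card ({b..<b + yi} - Z) \<le> card {z \<in> {0..<y}. (b + int z) mod p \<notin> Z}"
          by (rule surj_card_le[rotated]) simp
        then show ?thesis using c b by (auto simp: B2_def)
      qed (use b in \<open>auto simp: B1_def\<close>)
    qed
    moreover have "card B1 \<le> y"
    proof -
      have "B1 \<subseteq> {p - yi..<p}" using Z by (auto simp: B1_def)
      then have "card B1 \<le> card {p - yi..<p}" by (intro card_mono) auto
      then show ?thesis by (simp add: yi_def)
    qed
    moreover have "real (card B2) \<le> 2 * y / \<theta>"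
    proof -
      have "real (card B2) * (\<theta> * y) = (\<Sum>b\<in>B2. \<theta> * y)" by simp
      also have "\<dots> \<le> (\<Sum>b\<in>B2. real (card {z \<in> {0..<y}. (b + int z) mod p \<notin> Z}))"
        by (rule sum_mono) (auto simp: B2_def)
      also have "\<dots> \<le> (\<Sum>b\<in>Z. real (card {z \<in> {0..<y}. (b + int z) mod p \<notin> Z}))"
        by (rule sum_mono2) (use fZ in \<open>auto simp: B2_def\<close>)
      also have "\<dots> = (\<Sum>z<y. real (dd Y (int z)))"
        using sum_window_missing[OF Z, of y] by (simp add: dZ flip: of_nat_sum)
      finally have "(real (card B2) * \<theta>) * y \<le> (2 * real y) * real y" using sumd e2 by (simp add: mult_ac)
      then have "real (card B2) * \<theta> \<le> 2 * real y" using y0 by (simp only: mult_le_cancel_right_pos)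
      then show ?thesis using \<theta>(1) by (simp add: field_simps)
    qed
    moreover have "finite (B1 \<union> B2)" using fZ by (auto simp: B1_def B2_def)
    ultimately have "real (card (Z - Gd)) \<le> y + 2 * y / \<theta>"
      using card_mono[of "B1 \<union> B2" "Z - Gd"] card_Un_le[of B1 B2] by linarith
    moreover have "real y \<le> y / \<theta>" using \<theta> y0 by (simp add: field_simps)
    moreover have "3 * real y / \<theta> = y / \<theta> + 2 * y / \<theta>" by (simp add: add_divide_distrib[symmetric])
    ultimately show ?thesis by linarith
  qed
  have "Gd \<noteq> {}"
  proof
    assume "Gd = {}"
    then have "n \<le> 3 * real y / \<theta>" using cGd cZ by simp
    then show False using nY \<theta>(1) by (simp add: n_def field_simps)
  qed
  have GdZ: "Gd \<subseteq> Z" by (auto simp: Gd_def)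
  then have fGd: "finite Gd" using fZ finite_subset by blast
  define lo where "lo = Min Gd"
  define hi where "hi = Max Gd"
  have lohi: "lo \<in> Gd" "hi \<in> Gd" "lo \<le> hi" "\<And>b. b \<in> Gd \<Longrightarrow> lo \<le> b \<and> b \<le> hi"
    using fGd \<open>Gd \<noteq> {}\<close> by (auto simp: lo_def hi_def)
  have lo0: "lo \<ge> 0" using lohi(1) GdZ Z by auto
  have hip: "hi + yi \<le> p" using lohi(2) by (auto simp: Gd_def)
  define J where "J = {lo..<hi + yi}"
  \<comment> \<open>The entries into \<open>Z\<close> along the class \<open>j\<close>: each is an
    element of \<open>Z\<close> whose predecessor at distance \<open>y\<close> is missing, so all of
    them together are bounded by the cost of the shift \<open>y\<close>.\<close>
  define up where "up j = {x \<in> Z. x mod yi = j \<and> x \<ge> yi \<and> x - yi \<notin> Z}" for j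
  have fup: "finite (up j)" for j using fZ by (auto simp: up_def)
  have sup: "(\<Sum>j\<in>{0..<yi}. real (card (up j))) \<le> (1 + \<epsilon>) * y"
  proof -
    have "(\<Sum>j\<in>{0..<yi}. card (up j)) = card (\<Union>j\<in>{0..<yi}. up j)"
      by (rule card_UN_disjoint[symmetric]) (use fup in \<open>auto simp: up_def\<close>)
    also have "\<dots> \<le> card (Z - tr yi Z)"
    proof (rule card_mono)
      show "(\<Union>j\<in>{0..<yi}. up j) \<subseteq> Z - tr yi Z" using Z yi by (auto simp: up_def tr_def)
    qed (use fZ in auto)
    also have "\<dots> = dd Y (int y)" using dZ[of yi] by (simp add: dd_def[of Z] yi_def)
    finally have "real (\<Sum>j\<in>{0..<yi}. card (up j)) \<le> real (dd Y (int y))" by (simp only: of_nat_le_iff)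
    then show ?thesis using d[of y] by simp
  qed
  define Out where "Out = {j \<in> {0..<yi}. j \<notin> Z}"
  have cOut: "(1 - \<theta>) * y \<le> card Out"
  proof -
    have "card Out + card (Z \<inter> {0..<yi}) = y"
    proof -
      have "Out = {0..<yi} - Z" by (auto simp: Out_def)
      then show ?thesis using card_Int_Diff[of "{0..<yi}" Z] by (simp add: Int_commute yi_def)
    qed
    then have "real (card Out) + real (card (Z \<inter> {0..<yi})) = y" by (simp flip: of_nat_add)
    then show ?thesis using win by (simp add: algebra_simps)
  qed
  define Hit where "Hit b = (\<lambda>x. x mod yi) ` ({b..<b + yi} \<inter> Z)" for b
  have cHit: "(1 - \<theta>) * y \<le> card (Hit b)" if b: "b \<in> Gd" for b
  proof -
    have "inj_on (\<lambda>x. x mod yi) ({b..<b + yi} \<inter> Z)"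
    proof (rule inj_onI)
      fix u v assume h: "u \<in> {b..<b + yi} \<inter> Z" "v \<in> {b..<b + yi} \<inter> Z" "u mod yi = v mod yi"
      show "u = v" by (rule mod_eq_imp_eq[OF h(3)]) (use h in auto)
    qed
    then have "card (Hit b) = card ({b..<b + yi} \<inter> Z)" unfolding Hit_def by (rule card_image)
    moreover have "card ({b..<b + yi} \<inter> Z) + card ({b..<b + yi} - Z) = y"
      using card_Int_Diff[of "{b..<b + yi}" Z] by (simp add: yi_def)
    ultimately have "real (card (Hit b)) + real (card ({b..<b + yi} - Z)) = y" by (simp flip: of_nat_add)
    moreover have "real (card ({b..<b + yi} - Z)) \<le> \<theta> * y" using b by (simp add: Gd_def)
    ultimately show ?thesis by (simp add: algebra_simps)
  qed
  have HitI: "Hit b \<subseteq> {0..<yi}" for b using yi by (auto simp: Hit_def)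
  have OutI: "Out \<subseteq> {0..<yi}" by (auto simp: Out_def)
  have Iy: "real (card (A \<inter> B)) \<ge> real (card A) + real (card B) - y" if "A \<subseteq> {0..<yi}" "B \<subseteq> {0..<yi}" for A B
    using card_Int_lower[OF _ that] by (simp add: yi_def)
  define OH where "OH = Out \<inter> Hit lo"
  have cOH: "(1 - 2 * \<theta>) * y \<le> card OH"
    using Iy[OF OutI HitI[of lo]] cOut cHit[OF lohi(1)] by (simp add: OH_def algebra_simps)
  have chain: "\<exists>w\<in>up (x mod yi). c < w \<and> w \<le> x"
    if xc: "x \<in> Z" "c \<notin> Z" "0 \<le> c" "c < x" "x mod yi = c mod yi" for x c
  proof -
    have "yi dvd x - c" using xc(5) mod_eq_dvd_iff by blast
    then obtain k where k: "x - c = yi * k" by (auto simp: dvd_def)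
    have "k \<ge> 0" using k xc(4) yi by (metis diff_gt_0_iff_gt less_imp_le zero_less_mult_pos)
    then have "x = c + yi * int (nat k)" using k by simp
    then obtain w where "w \<in> Z" "w - yi \<notin> Z" "c < w" "w \<le> x" "c + yi \<le> w" "w mod yi = x mod yi"
      using up_step_exists[OF xc(1,2) _ yi(1)] by blast
    then show ?thesis using xc(3) by (intro bexI[of _ w]) (auto simp: up_def)
  qed
  have up1: "card (up j) \<ge> 1" if jOH: "j \<in> OH" for j
  proof -
    obtain x where x: "x \<in> Z" "x mod yi = j" "x \<ge> lo" using jOH by (auto simp: OH_def Hit_def)
    have j: "0 \<le> j" "j < yi" "j \<notin> Z" using jOH by (auto simp: OH_def Out_def)
    have "0 \<le> x" using x lo0 by simp
    then have "j \<le> x" using x(2) by (metis zmod_le_nonneg_dividend)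
    then have "j < x" using x(1) j(3) by (metis order_le_less)
    then have "\<exists>w\<in>up (x mod yi). j < w \<and> w \<le> x" using x j by (intro chain) auto
    then have "up j \<noteq> {}" using x(2) by auto
    then show ?thesis using fup by (simp add: Suc_le_eq card_gt_0_iff)
  qed
  \<comment> \<open>Each class in \<open>OH\<close> has an entry, \<open>OH\<close> contains nearly
    all classes, and all entries number at most \<open>(1 + \<epsilon>) * y\<close>. Only few
    classes are left with a second entry.\<close>
  define Bad where "Bad = {j \<in> OH. card (up j) \<ge> 2}"
  have OHI: "OH \<subseteq> {0..<yi}" using OutI by (auto simp: OH_def)
  have fOH: "finite OH" using OHI finite_subset by blast
  have cBad: "real (card Bad) \<le> (\<epsilon> + 2 * \<theta>) * y"
  proof -
    have "real (card OH) + real (card Bad) = (\<Sum>j\<in>OH. 1 + of_bool (card (up j) \<ge> 2))"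
      using card_of_bool_sum[OF fOH, of "\<lambda>j. card (up j) \<ge> 2"] by (simp add: sum.distrib Bad_def of_nat_sum)
    also have "\<dots> \<le> (\<Sum>j\<in>OH. real (card (up j)))"
    proof (rule sum_mono)
      fix j assume "j \<in> OH"
      then show "1 + of_bool (2 \<le> card (up j)) \<le> real (card (up j))" using up1[of j] by auto
    qed
    also have "\<dots> \<le> (\<Sum>j\<in>{0..<yi}. real (card (up j)))" by (rule sum_mono2) (use OHI in auto)
    finally show ?thesis using sup cOH by (simp add: algebra_simps)
  qed
  define GR where "GR = (OH - Bad) \<inter> Hit hi"
  have cGR: "(1 - 6 * \<theta>) * y \<le> card GR"
  proof -
    have "card (OH - Bad) + card Bad = card OH"
      using card_Int_Diff[OF fOH, of Bad] by (simp add: Bad_def Int_absorb1 Int_def)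
    then have "real (card (OH - Bad)) = real (card OH) - real (card Bad)" by linarith
    then have "real (card GR) \<ge> (1 - 2 * \<theta>) * y - (\<epsilon> + 2 * \<theta>) * y + (1 - \<theta>) * y - y"
      using Iy[of "OH - Bad" "Hit hi"] OHI HitI[of hi] cOH cBad cHit[OF lohi(2)] unfolding GR_def by fastforce
    moreover have "\<epsilon> * y \<le> \<theta> * y" using \<epsilon> by (intro mult_right_mono) auto
    ultimately show ?thesis by (simp add: algebra_simps)
  qed
  \<comment> \<open>A hole \<open>c\<close> in such a class forces two entries, one up to its
    element in the first window and one between \<open>c\<close> and its element in the last
    window.\<close>
  have inJ: "c \<in> Z" if c: "c \<in> J" "c mod yi \<in> GR" for c
  proof (rule ccontr)
    assume cZ: "c \<notin> Z"
    define j where "j = c mod yi"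
    have jG: "j \<in> OH" "j \<notin> Bad" "j \<in> Hit hi" "j \<in> Hit lo" using c(2) by (auto simp: GR_def j_def OH_def)
    obtain xa where xa: "xa \<in> Z" "lo \<le> xa" "xa < lo + yi" "xa mod yi = j" using jG(4) by (auto simp: Hit_def)
    obtain xb where xb: "xb \<in> Z" "hi \<le> xb" "xb < hi + yi" "xb mod yi = j" using jG(3) by (auto simp: Hit_def)
    have cb: "lo \<le> c" "c < hi + yi" using c(1) by (auto simp: J_def)
    have ca: "c \<ge> xa"
    proof (rule ccontr)
      assume ncx: "\<not> ?thesis"
      have "xa mod yi = c mod yi" using xa(4) by (simp only: j_def)
      moreover have "\<bar>xa - c\<bar> < yi" using xa(2,3) cb ncx by linarith
      ultimately have "xa = c" by (rule mod_eq_imp_eq)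
      then show False using ncx by simp
    qed
    have cbb: "c \<le> xb"
    proof (rule ccontr)
      assume ncx: "\<not> ?thesis"
      have "xb mod yi = c mod yi" using xb(4) by (simp only: j_def)
      moreover have "\<bar>xb - c\<bar> < yi" using xb(2,3) cb ncx by linarith
      ultimately have "xb = c" by (rule mod_eq_imp_eq)
      then show False using ncx by simp
    qed
    have ne: "xa < c" "c < xb" using ca cbb cZ xa(1) xb(1) by (metis order_le_less)+
    have j: "0 \<le> j" "j < yi" "j \<notin> Z" using jG(1) by (auto simp: OH_def Out_def)
    have "j \<le> xa" using xa lo0 by (metis zmod_le_nonneg_dividend order_trans)
    then have "j < xa" using xa(1) j(3) by (metis order_le_less)
    then have "\<exists>w\<in>up (xa mod yi). j < w \<and> w \<le> xa" using xa j by (intro chain) auto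
    then obtain w1 where w1: "w1 \<in> up j" "w1 \<le> xa" using xa(4) by auto
    have "\<exists>w\<in>up (xb mod yi). c < w \<and> w \<le> xb" using xb cb lo0 ne cZ by (intro chain) (auto simp: j_def)
    then obtain w2 where w2: "w2 \<in> up j" "c < w2" using xb(4) by auto
    have "w1 \<noteq> w2" using w1 w2 ne by simp
    then have "card {w1, w2} = 2" by simp
    then have "2 \<le> card (up j)" using card_mono[OF fup, of "{w1, w2}" j] w1 w2 by simp
    then show False using jG by (simp add: Bad_def)
  qed
  define N where "N = hi + yi - lo"
  have N: "0 \<le> N" "N \<le> p" "lo + N \<le> p" using lohi(3) yi lo0 hip by (auto simp: N_def)
  have JN: "J = {lo..<lo + N}" by (simp add: J_def N_def)
  have holes: "real (card (J - Z)) \<le> 6 * \<theta> * (N + y)"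
  proof -
    define R where "R = {0..<yi} - GR"
    have GRI: "GR \<subseteq> {0..<yi}" using OHI by (auto simp: GR_def)
    have "card R + card GR = y"
      using card_Int_Diff[of "{0..<yi}" GR] GRI by (simp add: R_def Int_absorb1 yi_def)
    then have "real (card R) = real y - real (card GR)" by linarith
    then have cR: "real (card R) \<le> 6 * \<theta> * y" using cGR by (simp add: algebra_simps)
    have "J - Z \<subseteq> {c \<in> {lo..<lo + N}. c mod yi \<in> R}"
      using inJ yi by (auto simp: JN R_def)
    then have "card (J - Z) \<le> card {c \<in> {lo..<lo + N}. c mod yi \<in> R}"
      by (rule card_mono[rotated]) (rule finite_subset[of _ "{lo..<lo + N}"], auto)
    moreover have "int (card {c \<in> {lo..<lo + N}. c mod yi \<in> R}) \<le> int (card R) * (N div yi + 1)"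
      by (rule card_residue_count) (use yi N in \<open>auto simp: R_def\<close>)
    ultimately have "int (card (J - Z)) \<le> int (card R) * (N div yi + 1)" by linarith
    then have "real (card (J - Z)) \<le> real (card R) * real_of_int (N div yi + 1)"
      by (metis of_int_le_iff of_int_mult of_int_of_nat_eq)
    also have "\<dots> \<le> (6 * \<theta> * y) * (N / y + 1)"
    proof (rule mult_mono[OF cR])
      have "real_of_int (N div yi) \<le> real_of_int N / real_of_int yi" by (rule real_of_int_div4)
      then show "real_of_int (N div yi + 1) \<le> N / y + 1" by (simp add: yi_def)
      show "0 \<le> real_of_int (N div yi + 1)" using N yi by (simp add: pos_imp_zdiv_nonneg_iff)
    qed (use \<theta> in auto)
    also have "\<dots> = 6 * \<theta> * (N + y)" using y0 by (simp add: field_simps)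
    finally show ?thesis .
  qed
  have "real_of_int N = real (card J)" using N by (simp add: JN)
  also have "\<dots> \<le> real (card (J - Z)) + real (card Z)"
  proof -
    have "card J \<le> card ((J - Z) \<union> Z)" by (rule card_mono) (auto simp: fZ J_def)
    also have "\<dots> \<le> card (J - Z) + card Z" by (rule card_Un_le)
    finally show ?thesis by (simp flip: of_nat_add)
  qed
  finally have NN: "(1 - 6 * \<theta>) * N \<le> n + 6 * \<theta> * y" using holes cZ by (simp add: algebra_simps)
  have "tr (- lo) Z - {0..<N} = tr (- lo) (Z - J)"
  proof (rule Set.set_eqI)
    fix x
    have "x \<in> {0..<N} \<longleftrightarrow> (x + lo) mod p \<in> J" if x: "x \<in> G"
    proof (cases "x + lo < p")
      case True
      then have "(x + lo) mod p = x + lo" using x lo0 by simp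
      then show ?thesis using x by (auto simp: JN)
    next
      case False
      have "lo < p" using hip yi lohi(3) by linarith
      then have "(x + lo - p) mod p = x + lo - p" using x False by (intro mod_pos_pos_trivial) auto
      then have "(x + lo) mod p = x + lo - p" using minus_mod_self2[of "x + lo" p] by (simp only:)
      then show ?thesis using x False N by (auto simp: JN)
    qed
    then show "x \<in> tr (- lo) Z - {0..<N} \<longleftrightarrow> x \<in> tr (- lo) (Z - J)" by (auto simp: tr_def)
  qed
  then have "card (tr (- lo) Z - {0..<N}) = card (Z - J)" using card_tr[of "Z - J" "- lo"] Z by auto
  also have "\<dots> \<le> card (Z - Gd)"
  proof (rule card_mono)
    have "Gd \<subseteq> J" using lohi(4) yi by (auto simp: J_def) fastforce
    then show "Z - J \<subseteq> Z - Gd" by blast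
  qed (use fZ in auto)
  finally have "real (card (tr (- lo) Z - {0..<N})) \<le> 3 * real y / \<theta>" using cGd by linarith
  moreover have "tr (- lo) Z = tr (- lo + - x0) Y" by (simp add: Z_def tr_tr)
  ultimately show ?thesis using N NN unfolding n_def by (intro exI[of _ "- lo + - x0"] exI[of _ N]) auto
qed

end

section \<open>Structure of pairs with few popular sums\<close>

context zp
begin

text \<open>An unpopular sum provides a translate of \<open>A\<close> that almost avoids the
  interval \<open>J\<close> around \<open>B\<close>, and with it a place to cut the circle. Let a
  window of the length of \<open>J\<close> slide along. Positions where it contains many elements
  are popular sums, so there are at most about \<open>card A + card B\<close> of them. At any other
  position, the part of \<open>A\<close> on one side of the window must be small. Between the last
  position with a small left part and the first later one with a small right part everything is
  popular, which bounds the length of the interval containing nearly all of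
  \<open>A\<close>.\<close>

lemma other_interval:
  fixes \<epsilon> n :: real and N :: int
  assumes A: "A \<subseteq> G" and B: "B \<subseteq> G" and N: "0 \<le> N" "N \<le> p"
    and BJ: "real (card (B - {0..<N})) \<le> \<epsilon> * n" "real_of_int N \<le> card B + \<epsilon> * n"
    and pol: "real (pol t A B) \<le> real t * (card A + card B + \<epsilon> * n)" and t: "t > 0" "real t \<le> \<epsilon> * n"
    and sizes: "20 * \<epsilon> * n \<le> card A" "20 * \<epsilon> * n \<le> card B" "card A + card B + \<epsilon> * n < real_of_int p"
    and \<epsilon>n: "\<epsilon> * n \<ge> 1"
  shows "\<exists>s N'. 0 \<le> N' \<and> N' \<le> p \<and> real (card (tr s A - {0..<N'})) \<le> 14 * \<epsilon> * n \<and>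
    real_of_int N' \<le> card A + 3 * \<epsilon> * n"
proof -
  define h where "h = \<epsilon> * n"
  have h1: "h \<ge> 1" using \<epsilon>n by (simp add: h_def)
  have th: "real t \<le> h" using t by (simp add: h_def)
  define J where "J = {0..<N}"
  have JG: "J \<subseteq> G" using N by (auto simp: J_def)
  have fB: "finite B" and fA: "finite A" using A B finite_sub_G by auto
  have fJ: "finite J" by (simp add: J_def)
  define B0 where "B0 = B \<inter> J"
  have B0: "B0 \<subseteq> G" "B0 \<subseteq> B" using B by (auto simp: B0_def)
  have cB: "card B0 + card (B - J) = card B" using card_Int_Diff[OF fB, of J] by (simp add: B0_def)
  have cB0: "real (card B0) \<ge> card B - h" using cB BJ(1) by (simp add: J_def h_def)
  have cJ: "real (card J) = real_of_int N" using N by (simp add: J_def)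
  have "card B0 + card (J - B) = card J" using card_Int_Diff[OF fJ, of B] by (simp add: B0_def Int_commute)
  then have "real (card B0) + real (card (J - B)) = real_of_int N" using cJ by linarith
  then have cJB: "real (card (J - B)) \<le> 2 * h" using cB0 BJ(2) by (simp add: h_def)
  have rrJ: "real (rr C J x) \<le> real (rr C B x) + 2 * h" if C: "C \<subseteq> G" for C x
  proof -
    have fC: "finite C" using C finite_sub_G by blast
    have "rr C J x \<le> card ({a \<in> C. (x - a) mod p \<in> B} \<union> {a \<in> C. (x - a) mod p \<in> J - B})"
      unfolding rr_def by (rule card_mono) (use fC in auto)
    also have "\<dots> \<le> rr C B x + rr C (J - B) x" unfolding rr_def by (rule card_Un_le)
    also have "rr C (J - B) x = rr (J - B) C x" using C JG by (intro rr_commute) auto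
    also have "\<dots> \<le> card (J - B)" by (rule rr_le) (use JG in auto)
    finally have "real (rr C J x) \<le> real (rr C B x) + real (card (J - B))" by simp
    then show ?thesis using cJB by linarith
  qed
  have popular: "real (card {x \<in> G. t \<le> rr C B x}) \<le> card A + card B + h" if "pol t C B = pol t A B" for C
  proof -
    have "t * card {x \<in> G. t \<le> rr C B x} \<le> pol t A B" using card_popular[of t C B] that by simp
    then have "real t * real (card {x \<in> G. t \<le> rr C B x}) \<le> real (pol t A B)" by (metis of_nat_le_iff of_nat_mult)
    also have "\<dots> \<le> real t * (card A + card B + h)" using pol by (simp add: h_def)
    finally show ?thesis using t(1) by simp
  qed
  have "\<exists>x0\<in>G. rr A B x0 < t"
  proof (rule ccontr)
    assume "\<not> ?thesis"
    then have "{x \<in> G. t \<le> rr A B x} = G" by (auto simp: not_less)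
    then show False using popular[of A] sizes(3) p_gt1 by (simp add: h_def)
  qed
  then obtain x0 where x0: "x0 \<in> G" "rr A B x0 < t" by blast
  \<comment> \<open>After this translation the unpopular sum \<open>x0\<close> becomes
    \<open>N - 1\<close>. Since \<open>N - 1 - a\<close> lies in \<open>J\<close> whenever
    \<open>a\<close> does, the elements of \<open>A1\<close> in \<open>J\<close> are among its
    representations and therefore few.\<close>
  define A1 where "A1 = tr (N - 1 - x0) A"
  have A1: "A1 \<subseteq> G" and cA1: "card A1 = card A" by (simp_all add: A1_def card_tr[OF A])
  have fA1: "finite A1" using A1 finite_sub_G by blast
  have polA1: "pol t A1 B = pol t A B" by (simp add: A1_def pol_tr_left[OF A B])
  have "A1 \<inter> J \<subseteq> {a \<in> A1. (N - 1 - a) mod p \<in> J}"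
  proof
    fix a assume a: "a \<in> A1 \<inter> J"
    then have "0 \<le> N - 1 - a" "N - 1 - a < p" using N by (auto simp: J_def)
    then have "(N - 1 - a) mod p = N - 1 - a" by simp
    then show "a \<in> {a \<in> A1. (N - 1 - a) mod p \<in> J}" using a by (auto simp: J_def)
  qed
  then have "card (A1 \<inter> J) \<le> rr A1 J (N - 1)" unfolding rr_def using fA1 by (intro card_mono) auto
  also have "rr A1 J (N - 1) = rr A J x0" unfolding A1_def rr_tr_left[OF A] by simp
  finally have cA1J: "real (card (A1 \<inter> J)) \<le> 3 * h" using rrJ[OF A, of x0] x0(2) th by linarith
  define A' where "A' = A1 - J"
  have fA': "finite A'" using fA1 by (simp add: A'_def)
  have A'r: "N \<le> a \<and> a < p" if "a \<in> A'" for a using that A1 by (auto simp: A'_def J_def)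
  have cA': "real (card A') \<ge> card A - 3 * h"
  proof -
    have "card (A1 \<inter> J) + card A' = card A" using card_Int_Diff[OF fA1, of J] cA1 by (simp add: A'_def)
    then show ?thesis using cA1J by linarith
  qed
  define W where "W x = card (A' \<inter> {x - N<..x})" for x
  define Rg where "Rg = {N..<p + N}"
  \<comment> \<open>Passing from \<open>J\<close> to \<open>B\<close> costs at most
    \<open>2 * h\<close> representations, and the remaining \<open>2 * h\<close> exceed the level
    \<open>t\<close>.\<close>
  define T where "T = {x \<in> Rg. 4 * h \<le> W x}"
  have cT: "real (card T) \<le> card A + card B + h"
  proof -
    have "inj_on (\<lambda>x. x mod p) T"
    proof (rule inj_onI)
      fix x y assume h: "x \<in> T" "y \<in> T" "x mod p = y mod p"
      show "x = y" by (rule mod_eq_imp_eq[OF h(3)]) (use h in \<open>auto simp: T_def Rg_def\<close>)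
    qed
    then have "card T = card ((\<lambda>x. x mod p) ` T)" by (rule card_image[symmetric])
    also have "\<dots> \<le> card {x \<in> G. t \<le> rr A1 B x}"
    proof (rule card_mono)
      show "finite {x \<in> G. t \<le> rr A1 B x}" by (rule finite_subset[of _ G]) auto
      show "(\<lambda>x. x mod p) ` T \<subseteq> {x \<in> G. t \<le> rr A1 B x}"
      proof
        fix z assume "z \<in> (\<lambda>x. x mod p) ` T"
        then obtain x where x: "x \<in> T" "z = x mod p" by auto
        have "W x \<le> rr A1 J x"
          unfolding W_def rr_def
        proof (rule card_mono)
          show "A' \<inter> {x - N<..x} \<subseteq> {a \<in> A1. (x - a) mod p \<in> J}"
          proof
            fix a assume a: "a \<in> A' \<inter> {x - N<..x}"
            then have "0 \<le> x - a" "x - a < p" using N by auto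
            then have "(x - a) mod p = x - a" by simp
            then show "a \<in> {a \<in> A1. (x - a) mod p \<in> J}" using a by (auto simp: J_def A'_def)
          qed
        qed (use fA1 in auto)
        then have "4 * h \<le> rr A1 J x" using x by (simp add: T_def)
        then have "real t \<le> rr A1 B x" using rrJ[OF A1, of x] th h1 by linarith
        then show "z \<in> {x \<in> G. t \<le> rr A1 B x}" using x by auto
      qed
    qed
    finally show ?thesis using popular[OF polA1] by linarith
  qed
  define AL where "AL x = {a \<in> A'. a \<le> x - N}" for x
  define AR where "AR x = {a \<in> A'. a > x}" for x
  \<comment> \<open>If both sides kept at least \<open>t\<close> elements, their sumsets with
    \<open>B0\<close> would be disjoint, because the window between them has the length of
    \<open>J\<close>. Applying \<open>pollard\<close> to each would count the size of
    \<open>B0\<close> twice, which is more than the upper bound for \<open>pol t A B\<close>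
    allows.\<close>
  have split: "card (AL x) < t \<or> card (AR x) < t" if x: "x \<in> Rg - T" for x
  proof (rule ccontr)
    assume "\<not> ?thesis"
    then have big: "t \<le> card (AL x)" "t \<le> card (AR x)" by auto
    have sub: "AL x \<subseteq> G" "AR x \<subseteq> G" "AL x \<subseteq> A1" "AR x \<subseteq> A1" using A1 by (auto simp: AL_def AR_def A'_def)
    have tB0: "t \<le> card B0"
    proof -
      have "real t \<le> card B0" using cB0 sizes(2) th h1 by (simp add: h_def)
      then show ?thesis by simp
    qed
    have cle: "card (AL x) \<le> card A" "card (AR x) \<le> card A" "card B0 \<le> card B"
      using sub cA1 fA1 B0 fB by (metis card_mono)+
    have pl: "int (card A + card B) \<le> p" using sizes(3) h1 by (simp add: h_def)
    have "t * (card (AL x) + card B0 - t) \<le> pol t (AL x) B0"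
      by (rule pollard) (use sub B0 big tB0 cle pl in auto)
    moreover have "t * (card (AR x) + card B0 - t) \<le> pol t (AR x) B0"
      by (rule pollard) (use sub B0 big tB0 cle pl in auto)
    moreover have "pol t (AL x) B0 + pol t (AR x) B0 \<le> pol t A1 B"
      unfolding pol_def sum.distrib[symmetric]
    proof (rule sum_mono)
      fix z assume z: "z \<in> G"
      have l: "rr (AL x) B0 z \<le> rr A1 B z" "rr (AR x) B0 z \<le> rr A1 B z" using sub B0 A1 by (auto intro: rr_mono)
      have "rr (AL x) B0 z = 0 \<or> rr (AR x) B0 z = 0"
      proof (rule ccontr)
        assume "\<not> ?thesis"
        then have "z \<in> sm (AL x) B0" "z \<in> sm (AR x) B0" using mem_sm_iff sub B0 z by auto
        then obtain a b a' b' where ab: "a \<in> AL x" "b \<in> B0" "a' \<in> AR x" "b' \<in> B0" "(a + b) mod p = (a' + b') mod p"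
          by (auto simp: sm_def)
        have r: "N \<le> a" "a \<le> x - N" "0 \<le> b" "b < N" "x < a'" "a' < p" "0 \<le> b'" "b' < N"
          using ab A'r by (auto simp: AL_def AR_def B0_def J_def)
        have "a + b = a' + b'" by (rule mod_eq_imp_eq[OF ab(5)]) (use r N in linarith)
        then show False using r by linarith
      qed
      then show "min t (rr (AL x) B0 z) + min t (rr (AR x) B0 z) \<le> min t (rr A1 B z)"
        using l by (auto simp: min_def)
    qed
    ultimately have "t * (card (AL x) + card B0 - t) + t * (card (AR x) + card B0 - t) \<le> pol t A B"
      using polA1 by linarith
    then have "real (t * (card (AL x) + card B0 - t) + t * (card (AR x) + card B0 - t)) \<le> real (pol t A B)"
      by (simp only: of_nat_le_iff)
    then have "real t * (real (card (AL x)) + card B0 - t) + real t * (real (card (AR x)) + card B0 - t) \<le> pol t A B"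
      using big tB0 by (simp add: of_nat_diff)
    also have "\<dots> \<le> real t * (card A + card B + h)" using pol by (simp add: h_def)
    finally have "real t * (real (card (AL x)) + real (card (AR x)) + 2 * real (card B0) - 2 * real t) \<le> real t * (card A + card B + h)"
      by (simp add: algebra_simps)
    then have 1: "real (card (AL x)) + real (card (AR x)) + 2 * real (card B0) - 2 * real t \<le> card A + card B + h"
      using t(1) by simp
    have "A' = (AL x \<union> (A' \<inter> {x - N<..x})) \<union> AR x" by (auto simp: AL_def AR_def)
    then have "card A' \<le> card (AL x) + W x + card (AR x)"
      unfolding W_def by (metis card_Un_le add_le_mono1 le_trans)
    then have "real (card A') \<le> real (card (AL x)) + real (W x) + real (card (AR x))" by linarith
    moreover have "real (W x) < 4 * h" using x by (auto simp: T_def)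
    ultimately show False using 1 cA' cB0 sizes(2) th h1 by (simp add: h_def)
  qed
  have fRg: "finite Rg" by (simp add: Rg_def)
  have N1: "N \<ge> 1"
  proof -
    have "real (card B0) > 0" using cB0 sizes(2) h1 by (simp add: h_def)
    then have "B0 \<noteq> {}" by auto
    then show ?thesis by (auto simp: B0_def J_def)
  qed
  define LL where "LL = {x \<in> Rg - T. card (AL x) < t}"
  have "N \<in> LL"
  proof -
    have "A' \<inter> {N - N<..N} \<subseteq> {N}" using A'r by force
    then have "W N \<le> 1" unfolding W_def using card_mono[of "{N}"] by fastforce
    then have "\<not> 4 * h \<le> W N" using h1 by linarith
    moreover have "AL N = {}" using A'r N1 by (force simp: AL_def)
    ultimately show ?thesis using t(1) by (auto simp: LL_def T_def Rg_def)
  qed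
  have fLL: "finite LL" using fRg by (auto simp: LL_def)
  define xL where "xL = Max LL"
  have xL: "xL \<in> LL" "\<And>x. x \<in> LL \<Longrightarrow> x \<le> xL"
    using Max_in[OF fLL] Max_ge[OF fLL] \<open>N \<in> LL\<close> unfolding xL_def by blast+
  define e where "e = p + N - 1"
  have eT: "e \<in> Rg - T"
  proof -
    have "A' \<inter> {e - N<..e} = {}" using A'r by (force simp: e_def)
    then have "W e = 0" by (simp add: W_def)
    then show ?thesis using h1 by (auto simp: T_def Rg_def e_def)
  qed
  have eR: "AR e = {}" using A'r N1 by (force simp: AR_def e_def)
  have "AL e = A'" using A'r by (force simp: AL_def e_def)
  then have "\<not> card (AL e) < t" using cA' sizes(1) th h1 by (simp add: h_def)
  then have eL: "e \<notin> LL" by (simp add: LL_def)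
  have xLe: "xL < e"
  proof -
    have "xL \<le> e" using xL(1) by (auto simp: LL_def Rg_def e_def)
    then show ?thesis using eL xL(1) by (metis order_le_less)
  qed
  define RS where "RS = {x \<in> Rg - T. x > xL \<and> card (AR x) < t}"
  have "e \<in> RS" using eT eR xLe t(1) by (simp add: RS_def)
  have fRS: "finite RS" using fRg by (auto simp: RS_def)
  define xR where "xR = Min RS"
  have xR: "xR \<in> RS" "\<And>x. x \<in> RS \<Longrightarrow> xR \<le> x"
    using Min_in[OF fRS] Min_le[OF fRS] \<open>e \<in> RS\<close> unfolding xR_def by blast+
  have mid: "{xL<..<xR} \<subseteq> T"
  proof
    fix x assume x: "x \<in> {xL<..<xR}"
    show "x \<in> T"
    proof (rule ccontr)
      assume "x \<notin> T"
      moreover have "x \<in> Rg" using x xL(1) xR(1) by (auto simp: LL_def RS_def Rg_def)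
      ultimately have "card (AL x) < t \<or> card (AR x) < t" "x \<in> Rg - T" using split by auto
      then have "x \<in> LL \<or> x \<in> RS" using x by (auto simp: LL_def RS_def)
      then show False using xL(2) xR(2) x by force
    qed
  qed
  have fT: "finite T" using fRg by (auto simp: T_def)
  have "card {xL<..<xR} \<le> card T" by (rule card_mono[OF fT mid])
  moreover have lr: "xL < xR" using xR(1) by (simp add: RS_def)
  ultimately have "real_of_int (xR - xL - 1) \<le> real (card T)" by simp
  then have len: "real_of_int (xR - xL) \<le> card A + card B + h + 1" using cT by simp
  \<comment> \<open>The length of the interval \<open>{xL<..xR - N}\<close>, with 0 in case it is
    empty.\<close>
  define N' where "N' = max 0 (xR - N - xL)"
  have Nlow: "real_of_int N \<ge> card B - h"
    using cB0 \<open>real (card B0) + real (card (J - B)) = real_of_int N\<close> by linarith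
  have N'up: "real_of_int N' \<le> card A + 3 * h"
    using len Nlow h1 by (simp add: N'_def max_def)
  define I where "I = {xL<..xR - N}"
  have "A1 - I \<subseteq> (A1 \<inter> J) \<union> (AL xL \<union> (A' \<inter> {xL - N<..xL})) \<union> ((A' \<inter> {xR - N<..xR}) \<union> AR xR)"
    by (auto simp: I_def A'_def AL_def AR_def)
  then have "card (A1 - I) \<le> card ((A1 \<inter> J) \<union> (AL xL \<union> (A' \<inter> {xL - N<..xL})) \<union> ((A' \<inter> {xR - N<..xR}) \<union> AR xR))"
    by (rule card_mono[rotated]) (use fA1 fA' in \<open>auto simp: AL_def AR_def\<close>)
  also have "\<dots> \<le> card (A1 \<inter> J) + (card (AL xL) + W xL) + (W xR + card (AR xR))"
    unfolding W_def by (intro order_trans[OF card_Un_le] add_mono card_Un_le order_refl)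
  finally have "real (card (A1 - I)) \<le> real (card (A1 \<inter> J)) + (real (card (AL xL)) + real (W xL)) + (real (W xR) + real (card (AR xR)))"
    by linarith
  moreover have "real (W xL) < 4 * h" "real (W xR) < 4 * h" "card (AL xL) < t" "card (AR xR) < t"
    using xL(1) xR(1) by (auto simp: LL_def RS_def T_def)
  ultimately have out: "real (card (A1 - I)) \<le> 14 * h" using cA1J th h1 by linarith
  define s where "s = - (xL + 1)"
  have "tr s A1 - {0..<N'} \<subseteq> tr s (A1 - I)"
  proof
    fix x assume x: "x \<in> tr s A1 - {0..<N'}"
    define y where "y = (x - s) mod p"
    have xy: "x \<in> G" "y \<in> A1" using x by (auto simp: tr_def y_def)
    have "y \<notin> I"
    proof
      assume yI: "y \<in> I"
      then have "0 \<le> y + s" "y + s < N'" by (auto simp: I_def s_def N'_def)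
      moreover have "N' \<le> p" using xL(1) xR(1) N by (auto simp: N'_def LL_def RS_def Rg_def)
      ultimately have "(y + s) mod p = y + s" by simp
      moreover have "(y + s) mod p = x" using xy by (simp add: y_def mod_simps)
      ultimately show False using x \<open>0 \<le> y + s\<close> \<open>y + s < N'\<close> by auto
    qed
    then show "x \<in> tr s (A1 - I)" using xy by (simp add: tr_def y_def)
  qed
  then have "card (tr s A1 - {0..<N'}) \<le> card (tr s (A1 - I))" by (rule card_mono[rotated]) simp
  also have "\<dots> = card (A1 - I)" by (rule card_tr) (use A1 in auto)
  finally have "real (card (tr s A1 - {0..<N'})) \<le> 14 * h" using out by linarith
  moreover have "tr s A1 = tr (s + (N - 1 - x0)) A" by (simp add: A1_def tr_tr)
  moreover have "0 \<le> N'" "N' \<le> p" using xL(1) xR(1) N by (auto simp: N'_def LL_def RS_def Rg_def)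
  ultimately show ?thesis using N'up unfolding h_def by (intro exI[of _ "s + (N - 1 - x0)"] exI[of _ N']) auto
qed

text \<open>\<theta> is the tolerance passed to \<open>near_interval\<close>, and
  \<open>\<eta>1\<close> the radius of the balls relative to \<open>card Y\<close>. The number
  \<open>j\<close> is so large that the uncrossed set, and with it the step \<open>u\<close>, is
  negligible against \<theta> times that radius. \<delta> comes last: \<open>2 ^ j\<close> undoes
  the doubling of the error, and the fourth power of \<kappa> is what \<open>small_shifts\<close>
  asks for when its tolerance is \<open>\<kappa> / 8\<close> and its set may be as small as
  \<open>\<kappa> * card Y\<close>.\<close>

lemma structure_explicit:
  fixes \<alpha> \<epsilon> :: real and j :: nat
  assumes \<alpha>: "0 < \<alpha>" "\<alpha> \<le> 1" and \<epsilon>: "0 < \<epsilon>" "\<epsilon> \<le> 1 / 2"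
  defines "\<theta> \<equiv> \<epsilon> / 40"
  defines "\<eta>1 \<equiv> \<alpha>\<^sup>2 * \<epsilon> * \<theta> / 100"
  defines "\<kappa> \<equiv> kap \<alpha> j"
  defines "\<delta> \<equiv> \<kappa> ^ 4 / (400 * 2 ^ j)"
  assumes j: "(3 / 4) ^ j \<le> \<theta> * \<eta>1 / 200"
    and X: "X \<subseteq> G" and Y: "Y \<subseteq> G" and le: "card X \<le> card Y" and pp: "int (2 * card X + card Y) \<le> p"
    and Xl: "\<alpha> * card Y \<le> card X" and pol: "pol t X Y \<le> t * (card X + card Y + e)"
    and t: "t > 0" "real t \<le> \<delta> * card Y" and e: "real e \<le> \<delta> * card Y"
    and n0: "24 / \<kappa>\<^sup>2 + 2 / \<eta>1 \<le> card Y"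
  shows "\<exists>k s N. \<not> p dvd k \<and> 0 \<le> N \<and> N \<le> p \<and> real (card (tr s (dil k Y) - {0..<N})) \<le> \<epsilon> * card Y \<and>
    real_of_int N \<le> (1 + \<epsilon>) * card Y"
proof -
  define n where "n = real (card Y)"
  have \<theta>: "0 < \<theta>" "\<theta> \<le> 1 / 80" using \<epsilon> by (auto simp: \<theta>_def)
  have \<alpha>2: "0 < \<alpha>\<^sup>2" "\<alpha>\<^sup>2 \<le> \<alpha>" "\<alpha>\<^sup>2 \<le> 1" using \<alpha> by (auto simp: power2_eq_square mult_le_one intro: mult_left_le)
  have ae: "\<alpha>\<^sup>2 * \<epsilon> \<le> \<alpha>\<^sup>2 * 1" using \<epsilon> \<alpha>2 by (intro mult_left_mono) auto
  have \<eta>0: "0 < \<eta>1" using \<alpha>2 \<epsilon> \<theta> by (simp add: \<eta>1_def)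
  have \<eta>a: "\<eta>1 \<le> \<alpha>\<^sup>2 * \<theta> / 100"
    unfolding \<eta>1_def using ae \<theta> by (intro divide_right_mono mult_right_mono) auto
  have \<eta>b: "\<eta>1 \<le> \<epsilon> * \<theta> / 100"
    unfolding \<eta>1_def using mult_right_mono[of "\<alpha>\<^sup>2" 1 "\<epsilon> * \<theta>"] \<alpha>2 \<epsilon> \<theta> by (simp add: mult.assoc)
  have \<theta>a: "\<alpha>\<^sup>2 * \<theta> \<le> \<alpha>\<^sup>2 / 80" using \<theta> \<alpha>2 mult_left_mono[of \<theta> "1/80" "\<alpha>\<^sup>2"] by simp
  have \<eta>c: "\<eta>1 \<le> \<alpha>\<^sup>2 / 8000" using \<eta>a \<theta>a by simp
  have \<kappa>: "0 < \<kappa>" "\<kappa> \<le> 1" using kap_bounds[OF \<alpha>] by (auto simp: \<kappa>_def)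
  have \<kappa>2: "\<kappa>\<^sup>2 \<le> \<kappa>" "0 < \<kappa>\<^sup>2" using \<kappa> by (auto simp: power2_eq_square intro: mult_left_le)
  have \<kappa>4: "\<kappa> ^ 4 = \<kappa>\<^sup>2 * \<kappa>\<^sup>2" by (simp add: numeral_eq_Suc)
  have "\<kappa>\<^sup>2 * \<kappa>\<^sup>2 \<le> \<kappa>\<^sup>2 * 1" using \<kappa> \<kappa>2 by (intro mult_left_mono) auto
  then have \<kappa>4l: "\<kappa> ^ 4 \<le> \<kappa>\<^sup>2" unfolding \<kappa>4 by (simp only: mult_1_right)
  have "24 / \<kappa>\<^sup>2 \<ge> 0" "2 / \<eta>1 \<ge> 0" using \<eta>0 by simp_all
  then have n24: "24 / \<kappa>\<^sup>2 \<le> n" and n\<eta>: "2 / \<eta>1 \<le> n" using n0 unfolding n_def by linarith+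
  have n24': "24 \<le> \<kappa>\<^sup>2 * n" using n24 \<kappa>2 by (simp add: field_simps)
  have n0': "n > 0" using n24 \<kappa>2 by (meson divide_pos_pos less_le_trans zero_less_numeral)
  have \<kappa>n: "24 \<le> \<kappa> * n" using n24' mult_right_mono[OF \<kappa>2(1), of n] n0' by linarith
  have n\<eta>': "2 \<le> \<eta>1 * n" using n\<eta> \<eta>0 by (simp add: field_simps)
  have pow: "(1::real) \<le> 2 ^ j" by simp
  have \<delta>a: "\<delta> \<le> \<kappa> ^ 4 / 400"
    unfolding \<delta>_def using \<kappa> by (intro divide_left_mono) auto
  have "\<delta> * n \<le> \<kappa> ^ 4 / 400 * n" using \<delta>a n0' by (intro mult_right_mono) auto
  then have t1: "real t \<le> \<kappa> ^ 4 / 400 * n" using t(2) unfolding n_def by linarith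
  have et: "2 ^ j * (real e + real t) \<le> \<kappa> ^ 4 / 200 * n"
  proof -
    have "real e + real t \<le> 2 * \<delta> * n" using t(2) e by (simp add: n_def)
    then have "2 ^ j * (real e + real t) \<le> 2 ^ j * (2 * \<delta> * n)" by (intro mult_left_mono) auto
    also have "\<dots> = \<kappa> ^ 4 / 200 * n" by (simp add: \<delta>_def)
    finally show ?thesis .
  qed
  have k4n: "\<kappa> ^ 4 * n \<le> \<kappa> * n" "\<kappa> ^ 4 * n \<le> \<kappa>\<^sup>2 * n" "\<kappa> * n \<le> n"
    using \<kappa>4l \<kappa>2 \<kappa> n0' by (auto intro!: mult_right_mono)
  have etn: "real (2 ^ j * (e + t)) \<le> \<kappa> ^ 4 / 200 * n" using et by simp
  have "\<exists>X' e'. X' \<subseteq> G \<and> kap \<alpha> j * card Y \<le> card X' \<and> card X' \<le> (3/4) ^ j * card Y \<and> card X' \<le> card X \<and>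
      e' + t \<le> 2 ^ j * (e + t) \<and> pol t X' Y \<le> t * (card X' + card Y + e')"
  proof (rule uncross_iter[OF \<alpha> X Y le pp Xl pol t(1)])
    show "6 * real t \<le> kap \<alpha> j * card Y" using t1 k4n(1) n0' unfolding \<kappa>_def[symmetric] n_def[symmetric] by linarith
    show "24 \<le> kap \<alpha> j * card Y" using \<kappa>n unfolding \<kappa>_def n_def .
    have "real (2 ^ j * (e + t)) \<le> n" using etn k4n n0' by linarith
    then show "2 ^ j * (e + t) \<le> card Y" unfolding n_def of_nat_le_iff .
  qed
  then obtain X' e' where X': "X' \<subseteq> G" "\<kappa> * n \<le> card X'" "card X' \<le> (3/4) ^ j * n" "card X' \<le> card X"
      "e' + t \<le> 2 ^ j * (e + t)" "pol t X' Y \<le> t * (card X' + card Y + e')"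
    unfolding \<kappa>_def n_def by blast
  define m where "m = real (card X')"
  have m24: "m \<ge> 24" using X'(2) \<kappa>n by (simp add: m_def)
  have mk: "\<kappa> * n \<le> m" using X'(2) by (simp add: m_def)
  have mup: "m \<le> \<theta> * \<eta>1 / 200 * n"
    using X'(3) mult_right_mono[OF j less_imp_le[OF n0']] unfolding m_def by linarith
  define \<tau> where "\<tau> = \<kappa> / 8"
  have \<tau>: "\<tau> > 0" "\<tau> \<le> 1/8" using \<kappa> by (auto simp: \<tau>_def)
  have e': "real e' \<le> \<kappa> ^ 4 / 200 * n"
  proof -
    have "e' \<le> 2 ^ j * (e + t)" using X'(5) by simp
    then have "real e' \<le> real (2 ^ j * (e + t))" by (simp only: of_nat_le_iff)
    then show ?thesis using etn by linarith
  qed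
  have "\<exists>X0. X0 \<subseteq> X' \<and> (1 - \<tau>) * card X' \<le> card X0 \<and>
    (\<forall>a\<in>X0. \<forall>a'\<in>X0. real (dd Y (a' - a)) \<le> (1 + 3 * \<tau>) * card X')"
  proof (rule small_shifts[OF X'(1) Y _ t(1) \<tau>(1) _ X'(6)])
    show "card X' \<le> card Y" using X'(4) le by simp
    show "card X' > 0" using m24 by (simp add: m_def)
    have "real e' \<le> n" using e' k4n n0' by linarith
    then show "e' \<le> card Y" unfolding n_def of_nat_le_iff .
    have "\<kappa>\<^sup>2 * n \<le> \<kappa> * m" using mult_left_mono[OF mk, of \<kappa>] \<kappa> by (simp add: power2_eq_square mult.assoc)
    moreover have "\<kappa> ^ 4 / 200 * n = (\<kappa> ^ 4 * n) / 200" "\<kappa> / 8 * m = (\<kappa> * m) / 8" by simp_all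
    moreover have "\<kappa> * m \<ge> 0" using \<kappa> m24 by simp
    ultimately show "real e' \<le> \<tau> * card X'" using e' k4n(2) unfolding \<tau>_def m_def[symmetric] by linarith
    have "3 * n * real t \<le> 3 * n * (\<kappa> ^ 4 / 400 * n)" using t1 n0' by (intro mult_left_mono) auto
    also have "\<dots> \<le> \<kappa>\<^sup>2 / 64 * (\<kappa> * n)\<^sup>2" using \<kappa>4 \<kappa> n0' by (simp add: power2_eq_square)
    also have "\<dots> \<le> \<tau>\<^sup>2 * m\<^sup>2" unfolding \<tau>_def power_divide using mk \<kappa> n0' by (intro mult_mono power_mono) auto
    finally show "3 * real (card Y) * real t \<le> \<tau>\<^sup>2 * (real (card X'))\<^sup>2" by (simp add: m_def n_def)
  qed
  then obtain X0 where X0: "X0 \<subseteq> X'" "(1 - \<tau>) * m \<le> card X0"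
    "\<And>a a'. a \<in> X0 \<Longrightarrow> a' \<in> X0 \<Longrightarrow> real (dd Y (a' - a)) \<le> (1 + 3 * \<tau>) * m"
    unfolding m_def by blast
  define u where "u = nat \<lceil>(1 + 3 * \<tau>) * m\<rceil>"
  have um: "real u \<ge> (1 + 3 * \<tau>) * m" "real u \<le> (1 + 3 * \<tau>) * m + 1"
  proof -
    have "0 \<le> (1 + 3 * \<tau>) * m" using m24 \<tau> by simp
    then have "real u = real_of_int \<lceil>(1 + 3 * \<tau>) * m\<rceil>" by (simp add: u_def)
    then show "real u \<ge> (1 + 3 * \<tau>) * m" "real u \<le> (1 + 3 * \<tau>) * m + 1"
      using le_of_int_ceiling of_int_ceiling_le_add_one by metis+
  qed
  have um': "real u \<ge> m + 3 * (\<tau> * m)" "real u \<le> m + 3 * (\<tau> * m) + 1" using um by (simp_all add: algebra_simps)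
  have X0m: "m - \<tau> * m \<le> card X0" using X0(2) by (simp add: algebra_simps)
  have tm: "\<tau> * m \<le> m / 8" "\<tau> * m > 0" using \<tau> m24 mult_right_mono[of \<tau> "1/8" m] by auto
  have u2: "real u \<le> 2 * m" "real u \<ge> m" using um' tm m24 by linarith+
  have u1: "u \<ge> 1" using u2 m24 by linarith
  have dX0: "dd Y (a' - a) \<le> u" if "a \<in> X0" "a' \<in> X0" for a a'
  proof -
    have "real (dd Y (a' - a)) \<le> real u" using X0(3)[OF that] um by linarith
    then show ?thesis by simp
  qed
  have X0G: "X0 \<subseteq> G" using X0 X' by auto
  have X0ne: "X0 \<noteq> {}"
  proof
    assume "X0 = {}"
    then have "real (card X0) = 0" by simp
    then show False using X0m tm m24 by linarith
  qed
  have cGY: "real (card (G - Y)) = real_of_int p - n"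
  proof -
    have "card (G - Y) = card G - card Y" by (rule card_Diff_subset[OF finite_sub_G[OF Y] Y])
    moreover have "card Y \<le> card G" using Y by (intro card_mono) auto
    ultimately show ?thesis using p_gt1 by (simp add: n_def of_nat_diff)
  qed
  have pn: "real_of_int p - n \<ge> 2 * \<alpha> * n"
  proof -
    have "real_of_int (int (2 * card X + card Y)) \<le> real_of_int p" using pp by (simp only: of_int_le_iff)
    then show ?thesis using Xl by (simp add: n_def)
  qed
  define M where "M = min (card Y) (card (G - Y))"
  have M: "M = card Y \<or> M = card (G - Y)" by (auto simp: M_def)
  have Mr: "real M = min n (real_of_int p - n)" using cGY by (simp add: M_def n_def of_nat_min)
  have M2: "2 * int M \<le> p" using Mr by linarith
  have Ma: "\<alpha> * n \<le> M" 
  proof -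
    have "\<alpha> * n \<le> n" "0 \<le> \<alpha> * n" using \<alpha> n0' mult_right_mono[of \<alpha> 1 n] by auto
    moreover have "2 * \<alpha> * n = 2 * (\<alpha> * n)" by simp
    ultimately show ?thesis using Mr pn by linarith
  qed
  have Mn: "real M \<le> n" using Mr by simp
  define y1 where "y1 = nat \<lfloor>\<eta>1 * n\<rfloor>"
  have y1: "real y1 \<le> \<eta>1 * n" "real y1 \<ge> \<eta>1 * n / 2"
  proof -
    have "real y1 = real_of_int \<lfloor>\<eta>1 * n\<rfloor>" using n\<eta>' by (simp add: y1_def)
    then show "real y1 \<le> \<eta>1 * n" "real y1 \<ge> \<eta>1 * n / 2" using n\<eta>' by linarith+
  qed
  have u\<theta>: "50 * real u \<le> \<theta> * y1"
  proof -
    have "50 * real u \<le> 100 * (\<theta> * \<eta>1 / 200 * n)" using u2(1) mup by linarith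
    also have "\<dots> = \<theta> * (\<eta>1 * n / 2)" by simp
    also have "\<dots> \<le> \<theta> * y1" using y1(2) \<theta> by (intro mult_left_mono) auto
    finally show ?thesis .
  qed
  have \<theta>y: "\<theta> * y1 \<le> y1 / 80" using mult_right_mono[OF \<theta>(2), of "real y1"] by simp
  have u30: "30 * u \<le> y1" using u\<theta> \<theta>y by linarith
  have a2n: "\<alpha>\<^sup>2 * n \<le> \<alpha> * n" using \<alpha>2(2) n0' by (intro mult_right_mono) auto
  have y1M: "8000 * real y1 \<le> \<alpha>\<^sup>2 * n" using y1(1) mult_right_mono[OF \<eta>c less_imp_le[OF n0']] by simp
  have y8: "8000 * y1 \<le> M" using y1M a2n Ma by linarith
  have uM: "22 * u \<le> M" using u30 y8 by linarith
  have w: "2 * real u * (1 - \<kappa>) \<le> 2 * real (card X0) - 2"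
  proof -
    have "\<kappa> * u \<ge> \<kappa> * m" using u2(2) \<kappa> by (intro mult_left_mono) auto
    moreover have "\<kappa> * m \<ge> 24"
    proof -
      have "\<kappa> * (\<kappa> * n) \<le> \<kappa> * m" using mk \<kappa> by (intro mult_left_mono) auto
      then show ?thesis using n24' by (simp add: power2_eq_square)
    qed
    moreover have "\<tau> * m = \<kappa> * m / 8" by (simp add: \<tau>_def)
    moreover have "2 * real u * (1 - \<kappa>) = 2 * real u - 2 * (\<kappa> * u)" by (simp add: algebra_simps)
    ultimately show ?thesis using um'(2) X0m by linarith
  qed
  have \<kappa>M: "\<kappa> * M \<le> u" using mult_left_mono[OF Mn, of \<kappa>] \<kappa> mk u2(2) by linarith
  note bb = ball_bounds[OF Y X0G X0ne dX0 M M2 u1 w less_imp_le[OF \<kappa>(1)] \<kappa>(2) \<kappa>M]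
  have M0: "M > 0" using uM u1 by linarith
  have lowS: "real M / 8 \<le> card (ball Y (M div 4))"
  proof -
    have "2 * real (M div 4) - 4 * real u \<le> card (ball Y (M div 4))" using bb(1)[of "M div 4"] M0 by simp
    moreover have "real M \<le> 4 * real (M div 4) + 3" by linarith
    moreover have "8000 * 30 * real u \<le> M" using u30 y8 by linarith
    moreover have "real u \<ge> 1" using u1 by simp
    ultimately show ?thesis by linarith
  qed
  have "\<exists>\<xi>\<in>G - {0}. \<alpha>\<^sup>2 * card Y / 12 \<le> cmod (hat Y \<xi>)"
    by (rule large_coefficient[OF Y M M2 M0 \<alpha> _ lowS]) (use Ma in \<open>simp add: n_def\<close>)
  then obtain \<xi> where \<xi>: "\<xi> \<in> G - {0}" "\<alpha>\<^sup>2 * n / 12 \<le> cmod (hat Y \<xi>)" unfolding n_def by blast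
  have nd: "\<not> p dvd \<xi>" using \<xi> diff_not_dvd[of \<xi> 0] p_gt1 by auto
  define Y1 where "Y1 = dil \<xi> Y"
  have Y1: "Y1 \<subseteq> G" by (simp add: Y1_def)
  have cball: "card (ball Y1 z) = card (ball Y z)" for z
  proof -
    obtain l where l: "(\<xi> * l) mod p = 1" using ex_inverse[OF nd] by blast
    have "ball Y1 z = dil \<xi> (ball Y z)"
    proof (rule Set.set_eqI)
      fix x
      have "dd Y1 x = dd Y (l * x)"
        using dd_dil[OF nd Y, of "l * x"] mult_inverse_mod[OF l, of x] by (metis Y1_def dd_mod)
      then show "x \<in> ball Y1 z \<longleftrightarrow> x \<in> dil \<xi> (ball Y z)"
        unfolding mem_dil[OF l ball_sub] by (auto simp: ball_def)
    qed
    then show ?thesis using card_dil[OF nd, of "ball Y z"] by simp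
  qed
  have "\<exists>k. \<not> p dvd k \<and> (\<forall>w. 0 \<le> w \<and> w \<le> 2 * int y1 - 25 * int u \<longrightarrow> dd (dil k Y1) w \<le> 2 * y1)"
  proof (rule ball_interval[OF Y1 _ _ _ u1 u30])
    have an: "\<alpha>\<^sup>2 * n > 0" using \<alpha>2 n0' by simp
    show "\<exists>z. 8 * \<bar>z\<bar> < p \<and> s mod p = z mod p" if "dd Y1 s \<le> 2 * y1" for s
    proof (rule ball_in_arc[OF Y \<xi>(1)])
      have "real (2 * y1) = 2 * real y1" by simp
      then show "2 * real (2 * y1) \<le> 7 / 10 * cmod (hat Y \<xi>)" using \<xi>(2) y1M an by linarith
      show "0 < cmod (hat Y \<xi>)" using \<xi>(2) an by linarith
    qed (use that in \<open>simp add: Y1_def\<close>)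
    show "2 * real y1 - 4 * real u \<le> card (ball Y1 y1)" 
    proof -
      have "y1 < M" using y8 u1 u30 by linarith
      then show ?thesis unfolding cball using bb(1)[of y1] by simp
    qed
    have "4 * (2 * y1) \<le> M" using y8 by linarith
    then have "real (card (ball Y (2 * y1))) \<le> 2 * real (2 * y1) + 11 * real u" using uM bb(2)[of "2 * y1"] by simp
    then show "real (card (ball Y1 (2 * y1))) \<le> 4 * real y1 + 11 * real u" unfolding cball by simp
  qed
  then obtain k where k: "\<not> p dvd k" "\<And>w. 0 \<le> w \<Longrightarrow> w \<le> 2 * int y1 - 25 * int u \<Longrightarrow> dd (dil k Y1) w \<le> 2 * y1"
    by blast
  define Y2 where "Y2 = dil (k * \<xi>) Y"
  have kx: "\<not> p dvd k * \<xi>" using k(1) nd prime_p by (simp add: prime_dvd_mult_iff)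
  have Y2: "Y2 \<subseteq> G" "Y2 = dil k Y1" "card Y2 = card Y"
    by (simp_all add: Y2_def Y1_def dil_dil card_dil[OF kx Y])
  \<comment> \<open>All shifts up to \<open>y\<close> cost at most \<open>2 * y1\<close>, which
    exceeds \<open>y\<close> by \<open>25 * u\<close> only, a fraction \<theta> of \<open>y\<close>.
    For an interval the shift by \<open>y\<close> costs \<open>y\<close>, so this is the hypothesis
    of \<open>near_interval\<close> with tolerance \<theta>.\<close>
  define y where "y = 2 * y1 - 25 * u"
  have yr: "real y = 2 * real y1 - 25 * real u" using u30 by (simp add: y_def of_nat_diff)
  have y1pos: "real y1 > 0" using u30 u1 by simp
  have yge: "real y \<ge> 3/2 * real y1" using yr u\<theta> \<theta>y y1pos by linarith
  have \<theta>yy: "25 * real u \<le> \<theta> * y"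
  proof -
    have "\<theta> * (3/2 * real y1) \<le> \<theta> * y" using yge \<theta> by (intro mult_left_mono) auto
    moreover have "\<theta> * (3/2 * real y1) = 3/2 * (\<theta> * y1)" by simp
    ultimately show ?thesis using u\<theta> of_nat_0_le_iff[of u, where 'a = real] by linarith
  qed
  have y\<eta>: "real y \<le> 2 * (\<eta>1 * n)" using yr y1(1) of_nat_0_le_iff[of u, where 'a = real] by linarith
  have \<theta>n: "\<theta> * n > 0" using \<theta> n0' by simp
  have "\<exists>s N. 0 \<le> N \<and> N \<le> p \<and> real (card (tr s Y2 - {0..<N})) \<le> 3 * real y / \<theta> \<and>
    (1 - 6 * \<theta>) * real_of_int N \<le> card Y2 + 6 * \<theta> * y"
  proof (rule near_interval[OF Y2(1)])
    show "y \<ge> 1" using yge y1pos by linarith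
    show "0 < \<theta>" "\<theta> \<le> 1" "0 \<le> \<theta>" "\<theta> \<le> \<theta>" using \<theta> by auto
    show "real (dd Y2 (int z)) \<le> (1 + \<theta>) * y" if "z \<le> y" for z :: nat
    proof -
      have "int z \<le> 2 * int y1 - 25 * int u" using that u30 by (simp add: y_def)
      then have "dd Y2 (int z) \<le> 2 * y1" unfolding Y2(2) by (intro k(2)) auto
      then have "real (dd Y2 (int z)) \<le> 2 * real y1" by linarith
      then show ?thesis using yr \<theta>yy by (simp add: algebra_simps)
    qed
    have "\<eta>1 * n \<le> \<alpha>\<^sup>2 * \<theta> / 100 * n" using \<eta>a n0' by (intro mult_right_mono) auto
    moreover have "\<alpha>\<^sup>2 * (\<theta> * n) \<le> \<alpha> * (\<theta> * n)" "\<alpha>\<^sup>2 * (\<theta> * n) \<le> 1 * (\<theta> * n)" using \<alpha>2 \<theta>n by (intro mult_right_mono; simp)+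
    ultimately have yb: "50 * real y \<le> \<alpha> * (\<theta> * n)" "50 * real y \<le> \<theta> * n" using y\<eta> by (simp_all add: mult_ac)
    have "\<theta> * (2 * \<alpha> * n) \<le> \<theta> * (real_of_int p - n)" using pn \<theta> by (intro mult_left_mono) auto
    moreover have "\<theta> * (2 * \<alpha> * n) = 2 * (\<alpha> * (\<theta> * n))" by simp
    ultimately show "2 * real y \<le> \<theta> * (real_of_int p - card Y2)"
      using yb of_nat_0_le_iff[of y, where 'a = real] unfolding Y2(3) n_def[symmetric] by linarith
    show "3 * real y < \<theta> * card Y2" using yb \<theta>n Y2(3) by (simp add: n_def)
  qed
  then obtain s N where sN: "0 \<le> N" "N \<le> p" "real (card (tr s Y2 - {0..<N})) \<le> 3 * real y / \<theta>"
    "(1 - 6 * \<theta>) * real_of_int N \<le> n + 6 * \<theta> * y" unfolding Y2(3) n_def by blast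
  have yf: "50 * real y \<le> \<epsilon> * \<theta> * n" using y\<eta> mult_right_mono[OF \<eta>b less_imp_le[OF n0']] by simp
  have "3 * real y / \<theta> \<le> \<epsilon> * n"
  proof -
    have "3 * real y \<le> (\<epsilon> * n) * \<theta>" using yf by (simp add: mult_ac)
    then show ?thesis using \<theta> by (simp add: divide_le_eq)
  qed
  moreover have "real_of_int N \<le> (1 + \<epsilon>) * n"
  proof -
    have "\<epsilon> * \<theta> * n \<le> 1 * n" using \<epsilon> \<theta> n0' by (intro mult_right_mono mult_le_one) auto
    then have yn: "real y \<le> n" using yf by linarith
    have "6 * \<theta> * y \<le> 6 * \<theta> * n" using yn \<theta> by (intro mult_left_mono) auto
    then have 1: "(1 - 6 * \<theta>) * real_of_int N \<le> (1 + 6 * \<theta>) * n" using sN(4) by (simp add: algebra_simps)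
    have "1 + 6 * \<theta> \<le> (1 - 6 * \<theta>) * (1 + \<epsilon>)"
    proof -
      have "\<epsilon> * \<epsilon> \<le> \<epsilon> * (1/2)" using \<epsilon> by (intro mult_left_mono) auto
      moreover have "(1 - 6 * \<theta>) * (1 + \<epsilon>) = 1 + 34/40 * \<epsilon> - 6/40 * (\<epsilon> * \<epsilon>)"
        by (simp add: \<theta>_def field_simps)
      moreover have "6 * \<theta> = 6/40 * \<epsilon>" by (simp add: \<theta>_def)
      ultimately show ?thesis using \<epsilon> by linarith
    qed
    then have "(1 + 6 * \<theta>) * n \<le> (1 - 6 * \<theta>) * (1 + \<epsilon>) * n" using n0' by (intro mult_right_mono) auto
    then have "(1 - 6 * \<theta>) * real_of_int N \<le> (1 - 6 * \<theta>) * ((1 + \<epsilon>) * n)" using 1 by (simp add: mult.assoc)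
    then show ?thesis using \<theta> by (subst (asm) mult_le_cancel_left_pos) auto
  qed
  ultimately show ?thesis using kx sN unfolding Y2_def n_def
    by (intro exI[of _ "k * \<xi>"] exI[of _ s] exI[of _ N]) auto
qed

end

section \<open>Sumsets of integers with few translates\<close>

text \<open>The sumset in the integers. It agrees with \<open>sm\<close> as long as no sum wraps
  around, which is the situation for the parts of the sets inside the two intervals.\<close>

definition isum :: "int set \<Rightarrow> int set \<Rightarrow> int set" where
  "isum A B = (\<lambda>(a, b). a + b) ` (A \<times> B)"

lemma isumI: "a \<in> A \<Longrightarrow> b \<in> B \<Longrightarrow> a + b \<in> isum A B"
  by (auto simp: isum_def)

lemma isumE: "x \<in> isum A B \<Longrightarrow> (\<And>a b. a \<in> A \<Longrightarrow> b \<in> B \<Longrightarrow> x = a + b \<Longrightarrow> P) \<Longrightarrow> P"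
  by (auto simp: isum_def)

lemma finite_isum: "finite A \<Longrightarrow> finite B \<Longrightarrow> finite (isum A B)"
  by (simp add: isum_def)

lemma card_shift: "card ((\<lambda>x. x + c) ` S) = card S" for c :: int
  by (rule card_image) (simp add: inj_on_def)

lemma ex_le_average:
  fixes g :: "'a \<Rightarrow> nat"
  assumes "finite V" "V \<noteq> {}"
  shows "\<exists>a\<in>V. card V * g a \<le> (\<Sum>a\<in>V. g a)"
proof (rule ccontr)
  assume "\<not> ?thesis"
  then have h: "(\<Sum>a\<in>V. g a) < card V * g a" if "a \<in> V" for a using that by (auto simp: not_le)
  have "(\<Sum>a\<in>V. \<Sum>a\<in>V. g a) < (\<Sum>a\<in>V. card V * g a)" using assms h by (intro sum_strict_mono) auto
  then show False by (simp add: sum_distrib_left)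
qed

lemma ex_ge_average:
  fixes g :: "'a \<Rightarrow> nat"
  assumes "finite V" "V \<noteq> {}"
  shows "\<exists>a\<in>V. (\<Sum>a\<in>V. g a) \<le> card V * g a"
proof (rule ccontr)
  assume "\<not> ?thesis"
  then have h: "card V * g a < (\<Sum>a\<in>V. g a)" if "a \<in> V" for a using that by (auto simp: not_le)
  have "(\<Sum>a\<in>V. card V * g a) < (\<Sum>a\<in>V. \<Sum>a\<in>V. g a)" using assms h by (intro sum_strict_mono) auto
  then show False by (simp add: sum_distrib_left)
qed

text \<open>Modulo \<open>L = e1 - e0\<close>, the translates by the two ends already give one extra
  element per residue class met by \<open>F\<close>, above the maximum of that class. If these
  classes are fewer than \<open>card E - 1\<close>, the elements of \<open>E\<close> other than
  \<open>e1\<close> are distinct modulo \<open>L\<close>, and averaging over them finds a third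
  translate that puts enough elements into new classes. The average suffices because
  \<open>card E - 1 \<le> card F\<close>.\<close>

lemma three_translates:
  assumes fE: "finite E" and fF: "finite F" and e: "e0 \<in> E" "e1 \<in> E" "e0 < e1"
    and bd: "\<And>e. e \<in> E \<Longrightarrow> e0 \<le> e \<and> e \<le> e1" and le: "card E \<le> card F + 1"
  shows "\<exists>b\<in>E. card F + card E \<le> card (isum F {e0, e1, b}) + 1"
proof -
  define L where "L = e1 - e0"
  have L: "L > 0" using e by (simp add: L_def)
  define v where "v = card (E - {e1})"
  have cE: "card E = v + 1" using card_Suc_Diff1[OF fE e(2)] by (simp add: v_def)
  define Fm where "Fm = (\<lambda>f. f mod L) ` F"
  have fFm: "finite Fm" using fF by (simp add: Fm_def)
  define mx where "mx c = Max {f \<in> F. f mod L = c}" for c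
  have mx: "mx c \<in> F \<and> mx c mod L = c \<and> mx c + L \<notin> F" if "c \<in> Fm" for c
  proof -
    have fin: "finite {f \<in> F. f mod L = c}" using fF by simp
    have ne: "{f \<in> F. f mod L = c} \<noteq> {}" using that by (auto simp: Fm_def)
    have 1: "mx c \<in> {f \<in> F. f mod L = c}" unfolding mx_def by (rule Max_in[OF fin ne])
    have "mx c + L \<notin> F"
    proof
      assume "mx c + L \<in> F"
      then have "mx c + L \<in> {f \<in> F. f mod L = c}" using 1 by simp
      then have "mx c + L \<le> mx c" unfolding mx_def by (rule Max_ge[OF fin])
      then show False using L by simp
    qed
    then show ?thesis using 1 by simp
  qed
  define U where "U = (\<lambda>f. f + e0) ` F \<union> (\<lambda>c. mx c + e1) ` Fm"
  have injm: "inj_on (\<lambda>c. mx c + e1) Fm" by (rule inj_onI) (metis add_right_cancel mx)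
  have dis: "(\<lambda>f. f + e0) ` F \<inter> (\<lambda>c. mx c + e1) ` Fm = {}"
  proof (rule ccontr)
    assume "\<not> ?thesis"
    then obtain f c where fc: "f \<in> F" "c \<in> Fm" "f + e0 = mx c + e1" by auto
    then have "f = mx c + L" by (simp add: L_def)
    then show False using fc mx by auto
  qed
  have cU: "card U = card F + card Fm"
    unfolding U_def using fF fFm dis card_image[OF injm]
    by (subst card_Un_disjoint) (auto simp: card_shift)
  have Usub: "U \<subseteq> isum F {e0, e1, b}" for b using mx by (auto simp: U_def intro!: isumI)
  have Umod: "(x - e0) mod L \<in> Fm" if "x \<in> U" for x
  proof -
    from that consider f where "f \<in> F" "x = f + e0" | c where "c \<in> Fm" "x = mx c + e1" by (auto simp: U_def)
    then show ?thesis
    proof cases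
      case 1 then show ?thesis by (auto simp: Fm_def)
    next
      case 2
      then have "x - e0 = mx c + L" by (simp add: L_def)
      then have "(x - e0) mod L = mx c mod L" by (simp only: mod_add_self2)
      then show ?thesis using 2 mx[of c] by simp
    qed
  qed
  have fI: "finite (isum F {e0, e1, b})" for b using fF by (simp add: finite_isum)
  show ?thesis
  proof (cases "v \<le> card Fm")
    case True
    have "card U \<le> card (isum F {e0, e1, e0})" by (rule card_mono[OF fI Usub])
    then show ?thesis using True cU cE e(1) by (intro bexI[of _ e0]) auto
  next
    case False
    define E' where "E' = E - {e1}"
    have E': "finite E'" "E' \<noteq> {}" using fE e by (auto simp: E'_def)
    define N where "N b = card {f \<in> F. (f + b - e0) mod L \<notin> Fm}" for b
    have "card F * (v - card Fm) \<le> (\<Sum>f\<in>F. card {b \<in> E'. (f + b - e0) mod L \<notin> Fm})"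
    proof -
      have "v - card Fm \<le> card {b \<in> E'. (f + b - e0) mod L \<notin> Fm}" for f
      proof -
        have inj: "inj_on (\<lambda>b. (f + b - e0) mod L) E'"
        proof (rule inj_onI)
          fix b c assume h: "b \<in> E'" "c \<in> E'" "(f + b - e0) mod L = (f + c - e0) mod L"
          have r: "e0 \<le> b" "b < e1" "e0 \<le> c" "c < e1" using h bd by (force simp: E'_def)+
          have "f + b - e0 = f + c - e0" by (rule mod_eq_imp_eq[OF h(3)]) (use r in \<open>simp add: L_def\<close>)
          then show "b = c" by simp
        qed
        have "card {b \<in> E'. (f + b - e0) mod L \<in> Fm} = card ((\<lambda>b. (f + b - e0) mod L) ` {b \<in> E'. (f + b - e0) mod L \<in> Fm})"
          by (rule card_image[symmetric], rule inj_on_subset[OF inj]) auto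
        also have "\<dots> \<le> card Fm" by (rule card_mono[OF fFm]) auto
        finally have "card {b \<in> E'. (f + b - e0) mod L \<in> Fm} \<le> card Fm" .
        moreover have "card E' = card {b \<in> E'. (f + b - e0) mod L \<in> Fm} + card {b \<in> E'. (f + b - e0) mod L \<notin> Fm}"
          using E' by (subst card_Un_disjoint[symmetric]) (auto intro: arg_cong[where f = card])
        ultimately show ?thesis by (simp add: v_def E'_def)
      qed
      then have "(\<Sum>f\<in>F. v - card Fm) \<le> (\<Sum>f\<in>F. card {b \<in> E'. (f + b - e0) mod L \<notin> Fm})" by (intro sum_mono)
      then show ?thesis by simp
    qed
    also have "\<dots> = (\<Sum>b\<in>E'. N b)"
      unfolding N_def card_of_bool_sum[OF E'(1)] card_of_bool_sum[OF fF] by (rule sum.swap)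
    finally have s: "card F * (v - card Fm) \<le> (\<Sum>b\<in>E'. N b)" .
    obtain b where b: "b \<in> E'" "(\<Sum>b\<in>E'. N b) \<le> card E' * N b" using ex_ge_average[OF E'] by blast
    have vE: "card E' = v" by (simp add: v_def E'_def)
    have "v * (v - card Fm) \<le> card F * (v - card Fm)" using le cE by (intro mult_right_mono) auto
    then have "v * (v - card Fm) \<le> v * N b" using order_trans[OF s b(2)] vE by (metis order_trans)
    then have Nb: "v - card Fm \<le> N b" using False by simp
    define Q where "Q = (\<lambda>f. f + b) ` {f \<in> F. (f + b - e0) mod L \<notin> Fm}"
    have "card Q = N b" unfolding Q_def N_def by (rule card_shift)
    moreover have "U \<inter> Q = {}" using Umod by (auto simp: Q_def)
    moreover have "Q \<subseteq> isum F {e0, e1, b}" by (auto simp: Q_def intro!: isumI)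
    ultimately have "card U + N b \<le> card (isum F {e0, e1, b})"
      using Usub[of b] fI[of b] by (metis Un_least card_Un_disjoint card_mono finite_subset)
    moreover have "b \<in> E" using b by (simp add: E'_def)
    ultimately show ?thesis using Nb cU cE False by (intro bexI[of _ b]) auto
  qed
qed

section \<open>Sums with intervals, and with sets that nearly fill an interval\<close>

lemma isum_interval_lower:
  assumes "finite X" "X \<noteq> {}" "l \<ge> 0"
  shows "int (card X) + l \<le> int (card (isum X {0..l}))"
proof -
  define M where "M = Max X"
  have M: "M \<in> X" "\<And>x. x \<in> X \<Longrightarrow> x \<le> M" using assms by (auto simp: M_def)
  have "X \<union> {M<..M + l} \<subseteq> isum X {0..l}"
  proof
    fix x assume "x \<in> X \<union> {M<..M + l}"
    then show "x \<in> isum X {0..l}"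
    proof
      assume "x \<in> X"
      then show ?thesis using isumI[of x X 0 "{0..l}"] assms by simp
    next
      assume "x \<in> {M<..M + l}"
      then show ?thesis using isumI[of M X "x - M" "{0..l}"] M by simp
    qed
  qed
  moreover have "card (X \<union> {M<..M + l}) = card X + nat l"
    using assms M by (subst card_Un_disjoint) (auto dest: M(2))
  ultimately have "card X + nat l \<le> card (isum X {0..l})"
    using card_mono[OF finite_isum[OF assms(1), of "{0..l}"]] by (metis finite_atLeastAtMost_int)
  then show ?thesis using assms by linarith
qed

text \<open>If the sumset is not the full range, an uncovered point separates \<open>E\<close> into
  two parts with disjoint sumsets, each of which gains \<open>l\<close>. If it is the full range,
  the additional gain is the number of holes of \<open>E\<close>.\<close>

lemma isum_interval_gap:
  assumes fE: "finite E" and E: "0 \<in> E" "L \<in> E" "\<And>e. e \<in> E \<Longrightarrow> 0 \<le> e \<and> e \<le> L" and l: "l \<ge> 0"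
  shows "int (card E) + l + min (L + 1 - int (card E)) l \<le> int (card (isum E {0..l}))"
proof (cases "{0..L + l} \<subseteq> isum E {0..l}")
  case True
  then have "card {0..L + l} \<le> card (isum E {0..l})" using fE by (intro card_mono finite_isum) auto
  moreover have "0 \<le> L" using E by blast
  ultimately show ?thesis using l by simp
next
  case False
  then obtain x where x: "0 \<le> x" "x \<le> L + l" "x \<notin> isum E {0..l}" by (meson atLeastAtMost_iff subsetI)
  define E1 where "E1 = {e \<in> E. e \<le> x}"
  define E2 where "E2 = {e \<in> E. e > x}"
  have n1: "e + l < x" if "e \<in> E1" for e
  proof (rule ccontr)
    assume "\<not> ?thesis"
    then show False using that x isumI[of e E "x - e" "{0..l}"] by (auto simp: E1_def)
  qed
  have "0 \<in> E1" using E x by (simp add: E1_def)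
  have "L \<in> E2"
  proof (rule ccontr)
    assume "L \<notin> E2"
    then have "L \<in> E1" using E by (auto simp: E1_def E2_def)
    then show False using n1[of L] x by simp
  qed
  have c1: "int (card E1) + l \<le> int (card (isum E1 {0..l}))"
    using fE \<open>0 \<in> E1\<close> l by (intro isum_interval_lower) (auto simp: E1_def)
  have c2: "int (card E2) + l \<le> int (card (isum E2 {0..l}))"
    using fE \<open>L \<in> E2\<close> l by (intro isum_interval_lower) (auto simp: E2_def)
  have dis: "isum E1 {0..l} \<inter> isum E2 {0..l} = {}"
    using n1 by (force elim!: isumE simp: E2_def)
  have sub: "isum E1 {0..l} \<union> isum E2 {0..l} \<subseteq> isum E {0..l}" by (auto simp: isum_def E1_def E2_def)
  have f: "finite (isum E1 {0..l})" "finite (isum E2 {0..l})" "finite (isum E {0..l})"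
    using fE by (auto intro!: finite_isum simp: E1_def E2_def)
  have "card (isum E1 {0..l}) + card (isum E2 {0..l}) \<le> card (isum E {0..l})"
    using card_Un_disjoint[OF f(1,2) dis] card_mono[OF f(3) sub] by simp
  moreover have "card E = card E1 + card E2"
    using fE by (subst card_Un_disjoint[symmetric]) (auto simp: E1_def E2_def intro: arg_cong[where f = card])
  ultimately show ?thesis using c1 c2 by linarith
qed

text \<open>The case where \<open>E\<close> has many holes. A net with one element of
  \<open>E\<close> per block of length \<sigma> can replace \<open>E\<close> once the interval is
  shortened by \<open>2 * \<sigma>\<close>. The holes of \<open>E\<close> gain
  \<open>3 * \<sigma>\<close> by \<open>isum_interval_gap\<close>, and the \<sigma> left over pays
  for the holes of \<open>F\<close>, each of which hurts at most \<open>C\<close>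
  translates.\<close>

lemma net_translates:
  fixes \<sigma> l L C :: int
  assumes fE: "finite E" and E: "0 \<in> E" "L \<in> E" "\<And>e. e \<in> E \<Longrightarrow> 0 \<le> e \<and> e \<le> L"
    and F: "F \<subseteq> {0..l}" and \<sigma>: "\<sigma> > 0" "100 * \<sigma> \<le> l" and hE: "3 * \<sigma> \<le> L + 1 - int (card E)"
    and C: "L div \<sigma> + 1 \<le> C" "C * (l + 1 - int (card F)) \<le> \<sigma>"
  shows "\<exists>E''\<subseteq>E. int (card E'') \<le> C \<and> int (card E) + l \<le> int (card (isum F E''))"
proof -
  define pick where "pick i = (SOME e. e \<in> E \<and> e div \<sigma> = i)" for i
  define I where "I = (\<lambda>e. e div \<sigma>) ` E"
  have pick: "pick i \<in> E \<and> pick i div \<sigma> = i" if "i \<in> I" for i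
  proof -
    have "\<exists>e. e \<in> E \<and> e div \<sigma> = i" using that by (auto simp: I_def)
    then show ?thesis unfolding pick_def by (rule someI_ex)
  qed
  define S where "S = pick ` I"
  have fF: "finite F" using F finite_subset by blast
  have SE: "S \<subseteq> E" using pick by (auto simp: S_def)
  have fS: "finite S" using SE fE finite_subset by blast
  have IL: "I \<subseteq> {0..L div \<sigma>}" using E(3) \<sigma> by (auto simp: I_def zdiv_mono1 pos_imp_zdiv_nonneg_iff)
  have L0: "L \<ge> 0" using E by blast
  have "card S \<le> card I" unfolding S_def by (rule card_image_le) (use IL finite_subset in blast)
  also have "\<dots> \<le> card {0..L div \<sigma>}" using IL by (intro card_mono) auto
  finally have "card S \<le> nat (L div \<sigma> + 1)" by simp
  moreover have "L div \<sigma> \<ge> 0" using L0 \<sigma> by (simp add: pos_imp_zdiv_nonneg_iff)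
  ultimately have cS: "int (card S) \<le> L div \<sigma> + 1" by linarith
  define l' where "l' = l - 2 * \<sigma>"
  have "(\<lambda>x. x + \<sigma>) ` isum E {0..l'} \<subseteq> isum S {0..l}"
  proof
    fix x assume "x \<in> (\<lambda>x. x + \<sigma>) ` isum E {0..l'}"
    then obtain e z where ez: "e \<in> E" "0 \<le> z" "z \<le> l'" "x = e + z + \<sigma>" by (auto simp: isum_def)
    define s where "s = pick (e div \<sigma>)"
    have s: "s \<in> S" "s div \<sigma> = e div \<sigma>" using pick[of "e div \<sigma>"] ez(1) by (auto simp: S_def I_def s_def)
    have "e = \<sigma> * (e div \<sigma>) + e mod \<sigma>" "s = \<sigma> * (e div \<sigma>) + s mod \<sigma>"
      using mult_div_mod_eq[of \<sigma> e] mult_div_mod_eq[of \<sigma> s] s(2) by simp_all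
    moreover have "0 \<le> e mod \<sigma>" "e mod \<sigma> < \<sigma>" "0 \<le> s mod \<sigma>" "s mod \<sigma> < \<sigma>" using \<sigma> by simp_all
    ultimately have "\<bar>e - s\<bar> < \<sigma>" by linarith
    then have "x - s \<in> {0..l}" using ez by (auto simp: l'_def)
    then show "x \<in> isum S {0..l}" using isumI[OF s(1), of "x - s"] by simp
  qed
  then have "card ((\<lambda>x. x + \<sigma>) ` isum E {0..l'}) \<le> card (isum S {0..l})" using fS by (intro card_mono finite_isum) auto
  then have "card (isum E {0..l'}) \<le> card (isum S {0..l})" by (simp only: card_shift)
  moreover have "int (card E) + l' + min (L + 1 - int (card E)) l' \<le> int (card (isum E {0..l'}))"
    using \<sigma> by (intro isum_interval_gap[OF fE E]) (auto simp: l'_def)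
  ultimately have low: "int (card E) + l + \<sigma> \<le> int (card (isum S {0..l}))" using hE \<sigma> by (simp add: l'_def)
  define h where "h = card ({0..l} - F)"
  have hh: "int h = l + 1 - int (card F)"
    using card_Diff_subset[OF fF F] card_mono[OF _ F] \<sigma> by (simp add: h_def of_nat_diff)
  have "isum S {0..l} \<subseteq> isum F S \<union> (\<Union>s\<in>S. (\<lambda>y. y + s) ` ({0..l} - F))"
  proof
    fix x assume "x \<in> isum S {0..l}"
    then obtain s y where sy: "s \<in> S" "y \<in> {0..l}" "x = s + y" by (auto simp: isum_def)
    show "x \<in> isum F S \<union> (\<Union>s\<in>S. (\<lambda>y. y + s) ` ({0..l} - F))"
    proof (cases "y \<in> F")
      case True
      then show ?thesis using isumI[OF True sy(1)] sy(3) by (simp add: add.commute)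
    next
      case False
      then have "x \<in> (\<lambda>y. y + s) ` ({0..l} - F)" using sy by (intro image_eqI[of _ _ y]) auto
      then show ?thesis using sy(1) by blast
    qed
  qed
  then have "card (isum S {0..l}) \<le> card (isum F S \<union> (\<Union>s\<in>S. (\<lambda>y. y + s) ` ({0..l} - F)))"
    using fS fF by (intro card_mono) (auto intro!: finite_isum)
  also have "\<dots> \<le> card (isum F S) + card (\<Union>s\<in>S. (\<lambda>y. y + s) ` ({0..l} - F))" by (rule card_Un_le)
  also have "card (\<Union>s\<in>S. (\<lambda>y. y + s) ` ({0..l} - F)) \<le> (\<Sum>s\<in>S. card ((\<lambda>y. y + s) ` ({0..l} - F)))"
    by (rule card_UN_le[OF fS])
  also have "\<dots> = card S * h" by (simp add: card_shift h_def)
  finally have "int (card (isum S {0..l})) \<le> int (card (isum F S)) + int (card S) * int h" by (simp flip: of_nat_mult of_nat_add)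
  moreover have "int (card S) * int h \<le> C * int h" using cS C(1) by (intro mult_right_mono) auto
  ultimately have "int (card E) + l \<le> int (card (isum F S))" using low C(2) hh by simp
  then show ?thesis using SE cS C(1) by (intro exI[of _ S]) auto
qed

text \<open>The case where \<open>E\<close> has few holes. Near the ends of the range, the
  translates by 0 and \<open>L\<close> lose only the holes in the end parts of \<open>F\<close>.
  Each inner segment of length \<sigma> gets a first translate that loses central holes only, and a
  second one, chosen by averaging over at least \<open>3 * \<sigma>\<close> elements of
  \<open>E\<close>, that leaves at most the proportion \<open>card H / (3 * \<sigma>)\<close> of
  this loss. The condition on \<open>C\<close> makes the total over all segments at most the number
  of central holes, so no more sums are lost than \<open>F\<close> has holes.\<close>

lemma dense_translates:
  fixes \<sigma> l L C :: int
  assumes fE: "finite E" and E: "0 \<in> E" "L \<in> E" "\<And>e. e \<in> E \<Longrightarrow> 0 \<le> e \<and> e \<le> L"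
    and F: "F \<subseteq> {0..l}" and \<sigma>: "\<sigma> > 0" "100 * \<sigma> \<le> l" "6 * \<sigma> \<le> L" and hE: "L + 1 - int (card E) < 3 * \<sigma>"
    and C: "(L + l) div \<sigma> + 1 \<le> C" "C * (l + 1 - int (card F)) \<le> \<sigma>"
  shows "\<exists>E''\<subseteq>E. int (card E'') \<le> 2 + 2 * C \<and> L + int (card F) \<le> int (card (isum F E''))"
proof -
  have fF: "finite F" using F finite_subset by blast
  define H where "H = {0..l} - F"
  have fH: "finite H" by (simp add: H_def)
  have hH: "int (card H) = l + 1 - int (card F)"
    using card_Diff_subset[OF fF F] card_mono[OF _ F] \<sigma> by (simp add: H_def of_nat_diff)
  define T where "T = 20 * \<sigma>"
  define Hl where "Hl = {y \<in> H. y < T}"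
  define Hc where "Hc = {y \<in> H. T \<le> y \<and> y \<le> l - T}"
  define Hr where "Hr = {y \<in> H. l - T < y}"
  have cH: "card Hl + card Hc + card Hr = card H"
  proof -
    have "H = Hl \<union> Hc \<union> Hr" using \<sigma> by (auto simp: Hl_def Hc_def Hr_def T_def)
    moreover have "card (Hl \<union> Hc \<union> Hr) = card Hl + card Hc + card Hr"
      using fH \<sigma> by (subst card_Un_disjoint, auto simp: Hl_def Hc_def Hr_def T_def)+
    ultimately show ?thesis by simp
  qed
  have win: "3 * \<sigma> \<le> int (card (E \<inter> {a..b}))" if ab: "0 \<le> a" "b \<le> L" "6 * \<sigma> \<le> b - a" for a b
  proof -
    have EL: "E \<subseteq> {0..L}" using E(3) by auto
    have "card E \<le> card ((E \<inter> {a..b}) \<union> ({0..L} - {a..b}))" using EL fE by (intro card_mono) auto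
    also have "\<dots> \<le> card (E \<inter> {a..b}) + card ({0..L} - {a..b})" by (rule card_Un_le)
    also have "card ({0..L} - {a..b}) = card {0..L} - card {a..b}" using ab by (intro card_Diff_subset) auto
    finally have "int (card E) \<le> int (card (E \<inter> {a..b})) + (L + 1 - (b - a + 1))" using ab \<sigma> by (simp add: of_nat_diff)
    then show ?thesis using hE ab by linarith
  qed
  define Z where "Z i = {x. (x - T) div \<sigma> = i \<and> T \<le> x \<and> x \<le> L + l - T}" for i
  define I where "I = {0..(L + l) div \<sigma>}"
  have seg: "\<exists>a1\<in>E. \<exists>a2\<in>E. 3 * \<sigma> * int (card {x \<in> Z i. x - a1 \<notin> F \<and> x - a2 \<notin> F}) \<le> int (card Hc) * int (card H)" if "i \<in> I" for i
  proof (cases "Z i = {}")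
    case True
    then show ?thesis using E(1) by (intro bexI[of _ 0]) auto
  next
    case False
    define z where "z = T + i * \<sigma>"
    have Zz: "z \<le> x" "x < z + \<sigma>" "x \<le> L + l - T" if "x \<in> Z i" for x
    proof -
      have "x - T = \<sigma> * i + (x - T) mod \<sigma>" using that mult_div_mod_eq[of \<sigma> "x - T"] by (simp add: Z_def)
      moreover have "0 \<le> (x - T) mod \<sigma>" "(x - T) mod \<sigma> < \<sigma>" using \<sigma> by simp_all
      ultimately show "z \<le> x" "x < z + \<sigma>" by (simp_all add: z_def mult.commute)
      show "x \<le> L + l - T" using that by (simp add: Z_def)
    qed
    have i0: "i \<ge> 0" using \<open>i \<in> I\<close> by (simp add: I_def)
    then have zT: "z \<ge> T" using \<sigma> by (simp add: z_def)
    have zu: "z \<le> L + l - T" using False Zz by fastforce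
    \<comment> \<open>A segment close to an end is served by the translate by 0 or by
      \<open>L\<close>. Otherwise \<open>E\<close> has elements in the long range of translations
      that put the segment into the middle of \<open>{0..l}\<close>.\<close>
    have "\<exists>a1\<in>E. \<forall>x\<in>Z i. T \<le> x - a1 \<and> x - a1 \<le> l - T"
    proof -
      consider "z + \<sigma> - l + T \<le> 0" | "L \<le> z - T" | "z + \<sigma> - l + T > 0" "z - T < L" by linarith
      then show ?thesis
      proof cases
        case 1
        show ?thesis
        proof (intro bexI[OF _ E(1)] ballI)
          fix x assume "x \<in> Z i"
          then show "T \<le> x - 0 \<and> x - 0 \<le> l - T" using Zz[of x] zT 1 by linarith
        qed
      next
        case 2
        show ?thesis
        proof (intro bexI[OF _ E(2)] ballI)
          fix x assume "x \<in> Z i"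
          then show "T \<le> x - L \<and> x - L \<le> l - T" using Zz[of x] 2 by linarith
        qed
      next
        case 3
        have "3 * \<sigma> \<le> int (card (E \<inter> {z + \<sigma> - l + T..z - T}))" using 3 \<sigma> by (intro win) (auto simp: T_def)
        then have "E \<inter> {z + \<sigma> - l + T..z - T} \<noteq> {}" using \<sigma> by auto
        then obtain a where a: "a \<in> E" "z + \<sigma> - l + T \<le> a" "a \<le> z - T" by auto
        show ?thesis
        proof (intro bexI[OF _ a(1)] ballI)
          fix x assume "x \<in> Z i"
          then show "T \<le> x - a \<and> x - a \<le> l - T" using Zz[of x] a by linarith
        qed
      qed
    qed
    then obtain a1 where a1: "a1 \<in> E" "\<And>x. x \<in> Z i \<Longrightarrow> T \<le> x - a1 \<and> x - a1 \<le> l - T" by blast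
    define Q where "Q = {x \<in> Z i. x - a1 \<notin> F}"
    have "(\<lambda>x. x - a1) ` Q \<subseteq> Hc" using a1(2) \<sigma> by (force simp: Q_def Hc_def H_def T_def)
    then have fQc: "finite Q \<and> card Q \<le> card Hc"
    proof -
      assume s: "(\<lambda>x. x - a1) ` Q \<subseteq> Hc"
      have inj: "inj_on (\<lambda>x. x - a1) Q" by (simp add: inj_on_def)
      have fHc: "finite Hc" using fH by (simp add: Hc_def)
      then have "finite Q" using finite_subset[OF s] finite_imageD[OF _ inj] by blast
      then show ?thesis using card_mono[OF fHc s] card_image[OF inj] by simp
    qed
    define V where "V = E \<inter> {max 0 (z + \<sigma> - l)..min z L}"
    have "3 * \<sigma> \<le> int (card V)" unfolding V_def using zT zu \<sigma> by (intro win) (auto simp: T_def)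
    then have V: "finite V" "V \<noteq> {}" using fE \<sigma> by (auto simp: V_def)
    define g where "g a = card {x \<in> Q. x - a \<notin> F}" for a
    obtain a2 where a2: "a2 \<in> V" "card V * g a2 \<le> (\<Sum>a\<in>V. g a)" using ex_le_average[OF V] by blast
    have "(\<Sum>a\<in>V. g a) = (\<Sum>x\<in>Q. card {a \<in> V. x - a \<notin> F})"
      unfolding g_def card_of_bool_sum[OF V(1)] card_of_bool_sum[OF conjunct1[OF fQc]] by (rule sum.swap)
    also have "\<dots> \<le> (\<Sum>x\<in>Q. card H)"
    proof (rule sum_mono)
      fix x assume "x \<in> Q"
      then have x: "x \<in> Z i" by (simp add: Q_def)
      have "card {a \<in> V. x - a \<notin> F} = card ((\<lambda>a. x - a) ` {a \<in> V. x - a \<notin> F})"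
        by (rule card_image[symmetric]) (simp add: inj_on_def)
      also have "\<dots> \<le> card H"
      proof (rule card_mono[OF fH], rule subsetI)
        fix y assume "y \<in> (\<lambda>a. x - a) ` {a \<in> V. x - a \<notin> F}"
        then obtain a where a: "a \<in> V" "y = x - a" "y \<notin> F" by auto
        then show "y \<in> H" using Zz[OF x] by (auto simp: V_def H_def)
      qed
      finally show "card {a \<in> V. x - a \<notin> F} \<le> card H" .
    qed
    also have "\<dots> = card Q * card H" by simp
    also have "\<dots> \<le> card Hc * card H" using fQc by (intro mult_right_mono) auto
    finally have "card V * g a2 \<le> card Hc * card H" using a2(2) by linarith
    then have "int (card V) * int (g a2) \<le> int (card Hc) * int (card H)" by (metis of_nat_le_iff of_nat_mult)
    moreover have "3 * \<sigma> * int (g a2) \<le> int (card V) * int (g a2)"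
      using \<open>3 * \<sigma> \<le> int (card V)\<close> by (intro mult_right_mono) auto
    moreover have "{x \<in> Z i. x - a1 \<notin> F \<and> x - a2 \<notin> F} = {x \<in> Q. x - a2 \<notin> F}" by (auto simp: Q_def)
    ultimately have "3 * \<sigma> * int (card {x \<in> Z i. x - a1 \<notin> F \<and> x - a2 \<notin> F}) \<le> int (card Hc) * int (card H)"
      by (simp add: g_def)
    moreover have "a2 \<in> E" using a2 by (simp add: V_def)
    ultimately show ?thesis using a1(1) by blast
  qed
  have "\<exists>f1. \<forall>i\<in>I. f1 i \<in> E \<and> (\<exists>a2\<in>E. 3 * \<sigma> * int (card {x \<in> Z i. x - f1 i \<notin> F \<and> x - a2 \<notin> F}) \<le> int (card Hc) * int (card H))"
    by (rule bchoice) (use seg in blast)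
  then obtain f1 where f1: "\<forall>i\<in>I. f1 i \<in> E \<and> (\<exists>a2\<in>E. 3 * \<sigma> * int (card {x \<in> Z i. x - f1 i \<notin> F \<and> x - a2 \<notin> F}) \<le> int (card Hc) * int (card H))"
    by blast
  have "\<exists>f2. \<forall>i\<in>I. f2 i \<in> E \<and> 3 * \<sigma> * int (card {x \<in> Z i. x - f1 i \<notin> F \<and> x - f2 i \<notin> F}) \<le> int (card Hc) * int (card H)"
    by (rule bchoice) (use f1 in blast)
  then obtain f2 where f12: "\<And>i. i \<in> I \<Longrightarrow> f1 i \<in> E \<and> f2 i \<in> E \<and>
      3 * \<sigma> * int (card {x \<in> Z i. x - f1 i \<notin> F \<and> x - f2 i \<notin> F}) \<le> int (card Hc) * int (card H)"
    using f1 by blast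
  define E'' where "E'' = {0, L} \<union> (f1 ` I \<union> f2 ` I)"
  have E''E: "E'' \<subseteq> E" using E f12 by (auto simp: E''_def)
  have fE'': "finite E''" using E''E fE finite_subset by blast
  have Ll: "L \<ge> 0" "l \<ge> 0" using \<sigma> by auto
  have cI: "int (card I) \<le> C" using C(1) Ll \<sigma> by (simp add: I_def pos_imp_zdiv_nonneg_iff)
  have fI: "finite I" by (simp add: I_def)
  have "card E'' \<le> card {0, L} + (card (f1 ` I) + card (f2 ` I))"
    unfolding E''_def by (intro order_trans[OF card_Un_le] add_mono card_Un_le order_refl)
  also have "\<dots> \<le> 2 + (card I + card I)"
    using card_image_le[OF fI, of f1] card_image_le[OF fI, of f2] card_insert_le_m1[of 2 "{L}" 0] by simp
  finally have cE'': "int (card E'') \<le> 2 + 2 * C" using cI by linarith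
  define B where "B i = {x \<in> Z i. x - f1 i \<notin> F \<and> x - f2 i \<notin> F}" for i
  have lost: "{0..L + l} - isum F E'' \<subseteq> Hl \<union> (\<lambda>y. y + L) ` Hr \<union> (\<Union>i\<in>I. B i)"
  proof
    fix x assume x: "x \<in> {0..L + l} - isum F E''"
    have nF: "x - a \<notin> F" if "a \<in> E''" for a
    proof
      assume "x - a \<in> F"
      then have "x - a + a \<in> isum F E''" using that by (rule isumI)
      then show False using x by simp
    qed
    have x0: "x \<notin> F" "x - L \<notin> F" using nF[of 0] nF[of L] by (auto simp: E''_def)
    consider "x < T" | "x > L + l - T" | "T \<le> x" "x \<le> L + l - T" by linarith
    then show "x \<in> Hl \<union> (\<lambda>y. y + L) ` Hr \<union> (\<Union>i\<in>I. B i)"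
    proof cases
      case 1
      then show ?thesis using x x0 \<sigma> by (auto simp: Hl_def H_def T_def)
    next
      case 2
      then have "x - L \<in> Hr" using x x0 \<sigma> by (auto simp: Hr_def H_def T_def)
      then have "x - L + L \<in> (\<lambda>y. y + L) ` Hr" by (rule imageI)
      then show ?thesis by simp
    next
      case 3
      define i where "i = (x - T) div \<sigma>"
      have "0 \<le> i" using 3 \<sigma> by (simp add: i_def pos_imp_zdiv_nonneg_iff)
      moreover have "i \<le> (L + l) div \<sigma>" unfolding i_def using 3 \<sigma> by (intro zdiv_mono1) (auto simp: T_def)
      ultimately have iI: "i \<in> I" by (simp add: I_def)
      have "x \<in> B i" using 3 iI nF by (auto simp: B_def Z_def i_def E''_def)
      then show ?thesis using iI by blast
    qed
  qed
  have fB: "finite (B i)" for i by (rule finite_subset[of _ "{T..L + l - T}"]) (auto simp: B_def Z_def)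
  have cB: "card (\<Union>i\<in>I. B i) \<le> card Hc"
  proof -
    have "3 * \<sigma> * int (\<Sum>i\<in>I. card (B i)) = (\<Sum>i\<in>I. 3 * \<sigma> * int (card (B i)))" by (simp add: sum_distrib_left)
    also have "\<dots> \<le> (\<Sum>i\<in>I. int (card Hc) * int (card H))" using f12 by (intro sum_mono) (auto simp: B_def)
    also have "\<dots> = int (card Hc) * (int (card I) * int (card H))" by simp
    also have "\<dots> \<le> int (card Hc) * (C * int (card H))" using cI by (intro mult_left_mono mult_right_mono) auto
    also have "\<dots> \<le> int (card Hc) * \<sigma>" using C(2) hH by (intro mult_left_mono) auto
    also have "\<dots> \<le> 3 * \<sigma> * int (card Hc)" using \<sigma> by simp
    finally have "int (\<Sum>i\<in>I. card (B i)) \<le> int (card Hc)" 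
      using mult_le_cancel_left_pos[of "3 * \<sigma>"] \<sigma> by simp
    then have "(\<Sum>i\<in>I. card (B i)) \<le> card Hc" by linarith
    then show ?thesis using card_UN_le[OF fI, of B] by linarith
  qed
  have fl: "finite (Hl \<union> (\<lambda>y. y + L) ` Hr \<union> (\<Union>i\<in>I. B i))" using fH fI fB by (auto simp: Hl_def Hr_def)
  have "card ({0..L + l} - isum F E'') \<le> card (Hl \<union> (\<lambda>y. y + L) ` Hr \<union> (\<Union>i\<in>I. B i))" by (rule card_mono[OF fl lost])
  also have "\<dots> \<le> card Hl + card ((\<lambda>y. y + L) ` Hr) + card (\<Union>i\<in>I. B i)"
    by (intro order_trans[OF card_Un_le] add_mono card_Un_le order_refl)
  also have "\<dots> \<le> card H" using cB cH by (simp add: card_shift)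
  finally have 1: "card ({0..L + l} - isum F E'') \<le> card H" .
  have "card {0..L + l} \<le> card (({0..L + l} - isum F E'') \<union> isum F E'')"
    using fF fE'' by (intro card_mono) (auto intro: finite_isum)
  also have "\<dots> \<le> card ({0..L + l} - isum F E'') + card (isum F E'')" by (rule card_Un_le)
  finally have "int (card {0..L + l}) \<le> int (card H) + int (card (isum F E''))" using 1 by linarith
  then have "L + int (card F) \<le> int (card (isum F E''))" using hH Ll by simp
  then show ?thesis using E''E cE'' by blast
qed

text \<open>If \<open>E\<close> is at most slightly larger than \<open>F\<close>, three translates
  suffice. Otherwise \<open>E\<close> is long compared with \<sigma>, a hundredth of
  \<open>l\<close>, and the number of its holes decides between a net and the dense case. Since
  \<open>L \<le> R * l\<close>, there are boundedly many blocks of length \<sigma>, and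
  \<open>C\<close> is a bound for their number.\<close>

lemma few_translates:
  fixes R :: int
  assumes R: "R \<ge> 1"
  defines "C \<equiv> 102 * R + 105"
  assumes fE: "finite E" and E: "0 \<in> E" "L \<in> E" "\<And>e. e \<in> E \<Longrightarrow> 0 \<le> e \<and> e \<le> L"
    and F: "F \<subseteq> {0..l}" and l: "10000 \<le> l" and dense: "102 * C * (l + 1 - int (card F)) \<le> l"
    and LR: "L \<le> R * l"
  shows "\<exists>E''\<subseteq>E. int (card E'') \<le> 2 + 2 * C \<and> card E + card F \<le> card (isum F E'') + 1"
proof -
  have fF: "finite F" using F finite_subset by blast
  have EL: "E \<subseteq> {0..L}" using E(3) by auto
  have L0: "L \<ge> 0" using E by blast
  have cEL: "int (card E) \<le> L + 1" using card_mono[OF _ EL] L0 by simp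
  have C0: "C \<ge> 207" using R by (simp add: C_def)
  define h where "h = l + 1 - int (card F)"
  have "card F \<le> card {0..l}" using F by (intro card_mono) auto
  then have h0: "h \<ge> 0" using l by (simp add: h_def)
  show ?thesis
  proof (cases "card E \<le> card F + 1")
    case True
    show ?thesis
    proof (cases "L = 0")
      case True
      then have "E = {0}" using E by force
      moreover have "isum F {0} = F" by (force simp: isum_def)
      ultimately show ?thesis using C0 by (intro exI[of _ "{0}"]) auto
    next
      case False
      then have "0 < L" using L0 by simp
      then have "\<exists>b\<in>E. card F + card E \<le> card (isum F {0, L, b}) + 1"
        using True E(3) by (intro three_translates[OF fE fF E(1,2)])
      then obtain b where b: "b \<in> E" "card F + card E \<le> card (isum F {0, L, b}) + 1" by blast
      have "card {0, L, b} \<le> 3" by (simp add: card_insert_if)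
      then show ?thesis using b E C0 by (intro exI[of _ "{0, L, b}"]) auto
    qed
  next
    case False
    define \<sigma> where "\<sigma> = l div 100"
    have ls: "100 * \<sigma> \<le> l" "l < 100 * \<sigma> + 100" "\<sigma> \<ge> 100" using l by (auto simp: \<sigma>_def)
    have l101: "l \<le> 101 * \<sigma>" using ls by linarith
    have "102 * (C * h) \<le> 102 * \<sigma>" using dense l101 ls by (simp add: h_def)
    then have Ch: "C * h \<le> \<sigma>" by simp
    have "h \<le> C * h" using h0 C0 mult_right_mono[of 1 C h] by simp
    then have hs: "h \<le> \<sigma>" using Ch by linarith
    have LF: "L \<ge> int (card F) + 1" using False cEL by linarith
    then have Ls: "6 * \<sigma> \<le> L" using hs ls by (simp add: h_def)
    have "R * l \<le> R * (101 * \<sigma>)" using l101 R by (intro mult_left_mono) auto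
    then have L2: "L \<le> (101 * R) * \<sigma>" using LR by (simp add: mult_ac)
    have "L div \<sigma> \<le> 101 * R" using L2 ls by (metis int_div_less_self div_le_mono2 zdiv_mono1 nonzero_mult_div_cancel_right less_le_trans zero_less_numeral not_less_iff_gr_or_eq)
    have "(L + l) div \<sigma> \<le> 101 * R + 101"
    proof -
      have "L + l \<le> (101 * R + 101) * \<sigma>" using L2 l101 by (simp add: algebra_simps)
      then have "(L + l) div \<sigma> \<le> ((101 * R + 101) * \<sigma>) div \<sigma>" using ls by (intro zdiv_mono1) auto
      then show ?thesis using ls by simp
    qed
    then have C2: "(L + l) div \<sigma> + 1 \<le> C" "L div \<sigma> + 1 \<le> C" using \<open>L div \<sigma> \<le> 101 * R\<close> R by (simp_all add: C_def)
    show ?thesis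
    proof (cases "3 * \<sigma> \<le> L + 1 - int (card E)")
      case True
      have "\<exists>E''\<subseteq>E. int (card E'') \<le> C \<and> int (card E) + l \<le> int (card (isum F E''))"
        by (rule net_translates[OF fE E F _ ls(1) True C2(2)]) (use ls Ch in \<open>auto simp: h_def\<close>)
      then obtain E'' where "E'' \<subseteq> E" "int (card E'') \<le> C" "int (card E) + l \<le> int (card (isum F E''))" by blast
      then show ?thesis using h0 C0 by (intro exI[of _ E'']) (auto simp: h_def)
    next
      case False
      have "\<exists>E''\<subseteq>E. int (card E'') \<le> 2 + 2 * C \<and> L + int (card F) \<le> int (card (isum F E''))"
        by (rule dense_translates[OF fE E F _ ls(1) Ls _ C2(1)]) (use ls Ch False in \<open>auto simp: h_def\<close>)
      then obtain E'' where "E'' \<subseteq> E" "int (card E'') \<le> 2 + 2 * C" "L + int (card F) \<le> int (card (isum F E''))" by blast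
      then show ?thesis using cEL by (intro exI[of _ E'']) auto
    qed
  qed
qed

section \<open>Dense subsets of two intervals\<close>

context zp
begin

text \<open>What the theorem claims for one pair of sizes, with \<open>+ 1\<close> on the right in
  place of a natural-number subtraction. It can be pulled back along translations and dilations, so
  the intervals may be taken to start at 0.\<close>

definition good :: "int set \<Rightarrow> int set \<Rightarrow> nat \<Rightarrow> nat \<Rightarrow> bool" where
  "good A B c1 c2 \<longleftrightarrow> (\<exists>A' B'. A' \<subseteq> A \<and> B' \<subseteq> B \<and> card A' = c1 \<and> card B' = c2 \<and>
    card A + card B \<le> card (sm A' B') + 1)"

lemma good_swap: "good B A c2 c1 \<Longrightarrow> good A B c1 c2"
proof -
  assume "good B A c2 c1"
  then obtain B' A' where "B' \<subseteq> B" "A' \<subseteq> A" "card B' = c2" "card A' = c1" "card B + card A \<le> card (sm B' A') + 1"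
    unfolding good_def by blast
  then show ?thesis unfolding good_def by (intro exI[of _ A'] exI[of _ B']) (simp add: sm_commute[of A' B'])
qed

lemma sm_tr: "A \<subseteq> G \<Longrightarrow> B \<subseteq> G \<Longrightarrow> sm (tr s A) (tr s' B) = tr (s + s') (sm A B)"
proof (rule Set.set_eqI)
  fix x assume A: "A \<subseteq> G" and B: "B \<subseteq> G"
  have "rr (tr s A) (tr s' B) x = rr A B (x - s' - s)"
    by (simp add: rr_tr_right[OF tr_sub B] rr_tr_left[OF A])
  also have "\<dots> = rr A B ((x - (s + s')) mod p)" by (simp add: algebra_simps)
  finally have "rr (tr s A) (tr s' B) x = rr A B ((x - (s + s')) mod p)" .
  then show "x \<in> sm (tr s A) (tr s' B) \<longleftrightarrow> x \<in> tr (s + s') (sm A B)"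
    unfolding mem_sm_iff[OF tr_sub tr_sub] tr_def[of "s + s'"] using mem_sm_iff[OF A B] by auto
qed

lemma good_tr:
  assumes A: "A \<subseteq> G" and B: "B \<subseteq> G" and g: "good (tr s A) (tr s' B) c1 c2"
  shows "good A B c1 c2"
proof -
  obtain A' B' where h: "A' \<subseteq> tr s A" "B' \<subseteq> tr s' B" "card A' = c1" "card B' = c2"
    "card (tr s A) + card (tr s' B) \<le> card (sm A' B') + 1" using g unfolding good_def by blast
  have G: "A' \<subseteq> G" "B' \<subseteq> G" using h(1,2) tr_sub by blast+
  have "tr (- s) A' \<subseteq> A" using tr_mono[OF h(1), of "- s"] tr_0[OF A] by (simp add: tr_tr)
  moreover have "tr (- s') B' \<subseteq> B" using tr_mono[OF h(2), of "- s'"] tr_0[OF B] by (simp add: tr_tr)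
  moreover have "card (sm (tr (- s) A') (tr (- s') B')) = card (sm A' B')" by (simp add: sm_tr[OF G] card_tr)
  ultimately show ?thesis
    unfolding good_def using h G by (intro exI[of _ "tr (- s) A'"] exI[of _ "tr (- s') B'"]) (simp add: card_tr A B)
qed

lemma good_dil:
  assumes k: "\<not> p dvd k" and A: "A \<subseteq> G" and B: "B \<subseteq> G" and g: "good (dil k A) (dil k B) c1 c2"
  shows "good A B c1 c2"
proof -
  obtain A' B' where h: "A' \<subseteq> dil k A" "B' \<subseteq> dil k B" "card A' = c1" "card B' = c2"
    "card (dil k A) + card (dil k B) \<le> card (sm A' B') + 1" using g unfolding good_def by blast
  obtain A1 B1 where 1: "A1 \<subseteq> A" "A' = dil k A1" "B1 \<subseteq> B" "B' = dil k B1"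
    using h(1,2) unfolding dil_def subset_image_iff by blast
  have G: "A1 \<subseteq> G" "B1 \<subseteq> G" using 1 A B by auto
  show ?thesis unfolding good_def
    using 1 h G A B by (intro exI[of _ A1] exI[of _ B1]) (simp add: sm_dil card_dil[OF k])
qed

text \<open>\<open>k\<close> bounds both the deficit and the room left in each of the two sets, so
  an added pair pays for itself. Once the deficit is gone, the sets are enlarged arbitrarily to
  their exact sizes.\<close>

lemma good_fill:
  assumes A: "A \<subseteq> G" and B: "B \<subseteq> G" and p1: "int (card A + card B) \<le> p" and ne: "A \<noteq> {}" "B \<noteq> {}"
    and c: "c1 \<le> card A" "c2 \<le> card B"
  shows "A' \<subseteq> A \<Longrightarrow> B' \<subseteq> B \<Longrightarrow> card A' + k \<le> c1 \<Longrightarrow> card B' + k \<le> c2 \<Longrightarrow>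
    card A + card B \<le> card (sm A' B') + 1 + k \<Longrightarrow> good A B c1 c2"
proof (induction k arbitrary: A' B')
  case 0
  have fA: "finite A" and fB: "finite B" using A B finite_sub_G by auto
  obtain A'' where A'': "A' \<subseteq> A''" "A'' \<subseteq> A" "card A'' = c1"
    using obtain_subset_with_card_n exists_subset_between[of A' c1 A] 0 c fA by auto
  obtain B'' where B'': "B' \<subseteq> B''" "B'' \<subseteq> B" "card B'' = c2"
    using exists_subset_between[of B' c2 B] 0 c fB by auto
  have "card (sm A' B') \<le> card (sm A'' B'')" by (rule card_mono[OF finite_sm sm_mono[OF A''(1) B''(1)]])
  then show ?case unfolding good_def using A'' B'' 0 by (intro exI[of _ A''] exI[of _ B'']) auto
next
  case (Suc k)
  show ?case
  proof (cases "card A + card B \<le> card (sm A' B') + 1 + k")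
    case True
    then show ?thesis using Suc by (intro Suc.IH[of A' B']) auto
  next
    case False
    have "min p (int (card A + card B) - 1) \<le> int (card (sm A B))" by (rule cauchy_davenport[OF A ne(1) B ne(2)])
    then have "card (sm A' B') < card (sm A B)" using False p1 by linarith
    then have "\<not> sm A B \<subseteq> sm A' B'" using card_mono[OF finite_sm, of "sm A B"] by (metis not_less)
    then obtain a b where ab: "a \<in> A" "b \<in> B" "(a + b) mod p \<notin> sm A' B'" by (auto simp: sm_def)
    have fA: "finite A'" and fB: "finite B'" using A B Suc.prems finite_sub_G by (meson finite_subset)+
    have "insert ((a + b) mod p) (sm A' B') \<subseteq> sm (insert a A') (insert b B')"
      using sm_mono[of A' "insert a A'" B' "insert b B'"] sm_I[of a "insert a A'" b "insert b B'"] by auto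
    then have "card (insert ((a + b) mod p) (sm A' B')) \<le> card (sm (insert a A') (insert b B'))"
      by (rule card_mono[OF finite_sm])
    then have "card (sm A' B') + 1 \<le> card (sm (insert a A') (insert b B'))" using ab(3) by simp
    moreover have "card (insert a A') \<le> card A' + 1" "card (insert b B') \<le> card B' + 1"
      using card_insert_le_m1[of "card A' + 1" A' a] card_insert_le_m1[of "card B' + 1" B' b] by simp_all
    ultimately show ?thesis using Suc.prems ab by (intro Suc.IH[of "insert a A'" "insert b B'"]) auto
  qed
qed

text \<open>Subtracting the least element of the class and dividing by \<open>q\<close> turns the
  claim into \<open>few_translates\<close>; scaling back by \<open>q\<close> preserves all
  cardinalities.\<close>

lemma residue_class_translates:
  fixes q s r C R l NI :: int
  assumes R: "R \<ge> 1" and C: "C = 102 * R + 105"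
    and q: "q > 0" and Fs: "F \<subseteq> {0..l}" "10000 \<le> l" "102 * C * (l + 1 - int (card F)) \<le> l"
    and Ar: "Ar \<subseteq> {0..<NI}" "Ar \<noteq> {}" "\<And>a. a \<in> Ar \<Longrightarrow> a mod q = r" and NI: "NI div q \<le> R * l"
  shows "\<exists>A''\<subseteq>Ar. int (card A'') \<le> 2 + 2 * C \<and> card Ar + card F \<le> card (isum A'' ((\<lambda>y. q * y + s) ` F)) + 1"
proof -
  have fAr: "finite Ar" using Ar finite_subset by blast
  define m where "m = Min Ar"
  have m: "m \<in> Ar" "\<And>a. a \<in> Ar \<Longrightarrow> m \<le> a" using Min_in[OF fAr Ar(2)] Min_le[OF fAr] unfolding m_def by blast+
  define E where "E = (\<lambda>a. (a - m) div q) ` Ar"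
  have dv: "a = q * ((a - m) div q) + m" if "a \<in> Ar" for a
  proof -
    have "q dvd a - m" using Ar(3)[OF that] Ar(3)[OF m(1)] mod_eq_dvd_iff by metis
    then show ?thesis by simp
  qed
  have "inj_on (\<lambda>a. (a - m) div q) Ar" by (rule inj_onI) (metis dv)
  then have cE: "card E = card Ar" unfolding E_def by (rule card_image)
  have fE: "finite E" using fAr by (simp add: E_def)
  have E0: "0 \<in> E" using m(1) by (force simp: E_def)
  define L where "L = Max E"
  have L: "L \<in> E" "\<And>e. e \<in> E \<Longrightarrow> e \<le> L" using E0 Max_in[OF fE] Max_ge[OF fE] unfolding L_def by blast+
  have Epos: "0 \<le> e" if "e \<in> E" for e using that m(2) q by (auto simp: E_def pos_imp_zdiv_nonneg_iff)
  have "L \<le> NI div q"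
  proof -
    obtain a where "a \<in> Ar" "L = (a - m) div q" using L(1) by (auto simp: E_def)
    moreover have "0 \<le> m" using m(1) Ar(1) by auto
    ultimately show ?thesis using Ar(1) q by (auto intro!: zdiv_mono1)
  qed
  then have "\<exists>E''\<subseteq>E. int (card E'') \<le> 2 + 2 * (102 * R + 105) \<and> card E + card F \<le> card (isum F E'') + 1"
    using NI L Epos Fs by (intro few_translates[OF R fE E0 L(1) _ Fs(1,2)]) (auto simp: C)
  then obtain E'' where E'': "E'' \<subseteq> E" "int (card E'') \<le> 2 + 2 * C" "card E + card F \<le> card (isum F E'') + 1"
    unfolding C by blast
  define A'' where "A'' = (\<lambda>e. q * e + m) ` E''"
  have "A'' \<subseteq> Ar"
  proof
    fix x assume "x \<in> A''"
    then obtain e where e: "e \<in> E" "x = q * e + m" using E''(1) by (auto simp: A''_def)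
    then obtain a where "a \<in> Ar" "e = (a - m) div q" by (auto simp: E_def)
    then show "x \<in> Ar" using dv e by metis
  qed
  moreover have "card A'' \<le> card E''" unfolding A''_def by (rule card_image_le) (use E''(1) fE finite_subset in blast)
  moreover have "isum A'' ((\<lambda>y. q * y + s) ` F) = (\<lambda>x. q * x + (m + s)) ` isum F E''"
  proof (intro equalityI subsetI)
    fix x assume "x \<in> isum A'' ((\<lambda>y. q * y + s) ` F)"
    then obtain e y where ey: "e \<in> E''" "y \<in> F" "x = (q * e + m) + (q * y + s)" by (auto simp: isum_def A''_def)
    then have "x = q * (y + e) + (m + s)" by (simp add: algebra_simps)
    then show "x \<in> (\<lambda>x. q * x + (m + s)) ` isum F E''" using isumI[OF ey(2,1)] by blast
  next
    fix x assume "x \<in> (\<lambda>x. q * x + (m + s)) ` isum F E''"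
    then obtain y e where ey: "y \<in> F" "e \<in> E''" "x = q * (y + e) + (m + s)" by (auto simp: isum_def)
    then have "x = (q * e + m) + (q * y + s)" by (simp add: algebra_simps)
    then show "x \<in> isum A'' ((\<lambda>y. q * y + s) ` F)" using isumI[of "q * e + m" A'' "q * y + s" "(\<lambda>y. q * y + s) ` F"] ey(1,2) unfolding A''_def by blast
  qed
  moreover have "card ((\<lambda>x. q * x + (m + s)) ` isum F E'') = card (isum F E'')"
    using q by (intro card_image) (auto simp: inj_on_def)
  ultimately show ?thesis using E'' cE by (intro exI[of _ A'']) auto
qed

lemma sm_eq_isum:
  assumes "A \<subseteq> {0..<NI}" "B \<subseteq> {0..<NJ}" "NI + NJ \<le> p"
  shows "sm A B = isum A B"
proof -
  have "(a + b) mod p = a + b" if "a \<in> A" "b \<in> B" for a b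
  proof (rule mod_pos_pos_trivial)
    have "0 \<le> a" "a < NI" "0 \<le> b" "b < NJ" using that assms(1,2) by auto
    then show "0 \<le> a + b" "a + b < p" using assms(3) by linarith+
  qed
  then show ?thesis unfolding sm_def isum_def by (intro image_cong) auto
qed

text \<open>Let \<open>Bs\<close> be a residue class of \<open>B\<close> of at least average size.
  Each class of \<open>A\<close> needs only boundedly many elements to produce as many sums with
  \<open>Bs\<close> as Cauchy-Davenport promises, and different classes of \<open>A\<close> give
  disjoint classes of sums. Classes modulo \<open>q\<close> that \<open>A\<close> avoids would leave
  a loss of \<open>card F\<close> each; there a random choice supplies the sums. Altogether
  \<open>card A + q * card F\<close> is missed by at most \<open>q\<close>, and
  \<open>q * card F\<close> is at least \<open>card B\<close>.\<close>

lemma core_sum: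
  fixes NI NJ q R C :: int and c1 c2 :: nat
  assumes A: "A \<subseteq> {0..<NI}" and B: "B \<subseteq> {0..<NJ}" and NN: "NI + NJ \<le> p" and R: "R \<ge> 1" and C: "C = 204 * R + 105"
    and rat: "NI \<le> R * NJ" "NJ \<le> R * NI" and q: "q \<ge> 1" "500 * C * q \<le> NJ" "500 * q \<le> NI"
    and dB: "500 * C * (NJ - int (card B)) \<le> NJ"
    and hol: "40 * ((NI - int (card A)) + (NJ - int (card B)) + 2) \<le> NI" "40 * ((NI - int (card A)) + (NJ - int (card B)) + 2) \<le> NJ"
    and c: "c1 \<le> card A" "c2 \<le> card B" "768 * R * max NI NJ \<le> int c1 * int c2"
  shows "\<exists>A' B'. A' \<subseteq> A \<and> B' \<subseteq> B \<and> int (card A') \<le> (2 + 2 * C) * q + int c1 \<and>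
    int (card B') \<le> NJ div q + 1 + int c2 \<and> int (card A + card B) \<le> int (card (sm A' B')) + q"
proof -
  have fA: "finite A" and fB: "finite B" using A B finite_subset by auto
  have C0: "C \<ge> 309" using R C by simp
  have Cq: "C * q \<ge> 309 * q" "q \<le> C * q" using C0 q by (auto simp: mult_right_mono mult_le_cancel_right1)
  have N0: "NI > 0" "NJ > 0" using q Cq by linarith+
  have cA: "int (card A) \<le> NI" "int (card B) \<le> NJ" using card_mono[OF _ A] card_mono[OF _ B] N0 by auto
  have AG: "A \<subseteq> G" "B \<subseteq> G" using A B NN N0 by auto
  have q0: "q > 0" using q by simp
  define cl where "cl S i = {x \<in> S. x mod q = i}" for S i
  have cl_sum: "(\<Sum>i\<in>{0..<q}. card (cl S i)) = card S" if "finite S" for S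
  proof -
    have "(\<Sum>i\<in>{0..<q}. card (cl S i)) = card (\<Union>i\<in>{0..<q}. cl S i)"
      by (rule card_UN_disjoint[symmetric]) (use that in \<open>auto simp: cl_def\<close>)
    also have "(\<Union>i\<in>{0..<q}. cl S i) = S" using q0 by (auto simp: cl_def)
    finally show ?thesis .
  qed
  have "\<exists>s\<in>{0..<q}. (\<Sum>i\<in>{0..<q}. card (cl B i)) \<le> card {0..<q} * card (cl B s)"
    by (rule ex_ge_average) (use q0 in auto)
  then obtain s where s: "s \<in> {0..<q}" "card B \<le> card {0..<q} * card (cl B s)" using cl_sum[OF fB] by auto
  define Bs where "Bs = cl B s"
  have sB: "int (card B) \<le> q * int (card Bs)"
  proof -
    have "int (card B) \<le> int (card {0..<q} * card Bs)" using s(2) by (simp only: Bs_def of_nat_le_iff)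
    then show ?thesis using q0 by simp
  qed
  have Bs: "Bs \<subseteq> B" "\<And>b. b \<in> Bs \<Longrightarrow> b = q * (b div q) + s"
    by (auto simp: Bs_def cl_def) 
  define F where "F = (\<lambda>b. b div q) ` Bs"
  have BsF: "Bs = (\<lambda>y. q * y + s) ` F" using Bs(2) by (force simp: F_def image_image)
  have "inj_on (\<lambda>b. b div q) Bs" by (rule inj_onI) (metis Bs(2))
  then have cF: "card F = card Bs" unfolding F_def by (rule card_image)
  define l where "l = NJ div q"
  have "q * l + NJ mod q = NJ" unfolding l_def by (rule mult_div_mod_eq)
  then have ql: "q * l \<le> NJ" "NJ < q * l + q"
    using pos_mod_sign[OF q0, of NJ] pos_mod_bound[OF q0, of NJ] by linarith+
  have Fl: "F \<subseteq> {0..l}"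
  proof
    fix y assume "y \<in> F"
    then obtain b where "b \<in> Bs" "y = b div q" by (auto simp: F_def)
    then show "y \<in> {0..l}" using B Bs(1) q0 by (auto simp: l_def pos_imp_zdiv_nonneg_iff intro!: zdiv_mono1)
  qed
  have lC: "l \<ge> 500 * C"
    using q(2) q0 unfolding l_def by (metis div_mult_self_is_m mult.commute zdiv_mono1 nonzero_mult_div_cancel_right not_less_iff_gr_or_eq)
  have hF: "102 * C * (l + 1 - int (card F)) \<le> l"
  proof -
    define h where "h = NJ - int (card B)"
    have "q * (500 * C * (l - int (card F))) \<le> q * (l + 1)"
    proof -
      have "q * (l - int (card F)) \<le> h" using ql sB cF by (simp add: h_def algebra_simps)
      then have "500 * C * (q * (l - int (card F))) \<le> 500 * C * h" using C0 by (intro mult_left_mono) auto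
      also have "\<dots> \<le> q * l + q" using dB ql by (simp add: h_def)
      finally show ?thesis by (simp add: algebra_simps)
    qed
    then have "500 * C * (l - int (card F)) \<le> l + 1" using q0 by simp
    then have "500 * (C * (l - int (card F))) \<le> l + 1" by simp
    then have "102 * (C * (l - int (card F))) + 102 * C \<le> l" using lC C0 by linarith
    then show ?thesis by (simp add: algebra_simps)
  qed
  have l0: "10000 \<le> l" using lC C0 by linarith
  have NIl: "NI div q \<le> (2 * R) * l"
  proof -
    have "NI \<le> R * (q * l + q)" using rat(1) ql(2) R mult_left_mono[of NJ "q * l + q" R] by linarith
    also have "\<dots> \<le> R * (q * l + q * l)" using R q0 l0 by (intro mult_left_mono add_mono) auto
    also have "\<dots> = (2 * R * l) * q" by (simp add: algebra_simps)
    finally have "NI div q \<le> ((2 * R * l) * q) div q" using q0 by (intro zdiv_mono1) auto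
    then show ?thesis using q0 by simp
  qed
  define NE where "NE = {r \<in> {0..<q}. cl A r \<noteq> {}}"
  have fNE: "finite NE" by (rule finite_subset[of _ "{0..<q}"]) (auto simp: NE_def)
  have "\<exists>f. \<forall>r\<in>NE. f r \<subseteq> cl A r \<and> int (card (f r)) \<le> 2 + 2 * C \<and> card (cl A r) + card F \<le> card (isum (f r) Bs) + 1"
  proof (rule bchoice, rule ballI)
    fix r assume r: "r \<in> NE"
    have "\<exists>A''\<subseteq>cl A r. int (card A'') \<le> 2 + 2 * C \<and> card (cl A r) + card F \<le> card (isum A'' ((\<lambda>y. q * y + s) ` F)) + 1"
    proof (rule residue_class_translates[OF _ _ q0 Fl l0 hF _ _ _ NIl])
      show "2 * R \<ge> 1" "C = 102 * (2 * R) + 105" using R C by auto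
    qed (use r A in \<open>auto simp: NE_def cl_def\<close>)
    then show "\<exists>A''. A'' \<subseteq> cl A r \<and> int (card A'') \<le> 2 + 2 * C \<and> card (cl A r) + card F \<le> card (isum A'' Bs) + 1"
      unfolding BsF by blast
  qed
  then obtain f where f: "\<And>r. r \<in> NE \<Longrightarrow> f r \<subseteq> cl A r" "\<And>r. r \<in> NE \<Longrightarrow> int (card (f r)) \<le> 2 + 2 * C"
      "\<And>r. r \<in> NE \<Longrightarrow> card (cl A r) + card F \<le> card (isum (f r) Bs) + 1" by blast
  define A1 where "A1 = (\<Union>r\<in>NE. f r)"
  have A1: "A1 \<subseteq> A" using f(1) by (auto simp: A1_def cl_def)
  have cNE: "int (card NE) \<le> q"
  proof -
    have "card NE \<le> card {0..<q}" by (rule card_mono) (auto simp: NE_def)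
    then show ?thesis using q0 by simp
  qed
  have cA1: "int (card A1) \<le> (2 + 2 * C) * q"
  proof -
    have "card A1 \<le> (\<Sum>r\<in>NE. card (f r))" unfolding A1_def by (rule card_UN_le[OF fNE])
    then have "int (card A1) \<le> (\<Sum>r\<in>NE. int (card (f r)))" by (simp flip: of_nat_sum)
    also have "\<dots> \<le> (\<Sum>r\<in>NE. 2 + 2 * C)" by (rule sum_mono) (rule f(2))
    also have "\<dots> = int (card NE) * (2 + 2 * C)" by simp
    also have "\<dots> \<le> q * (2 + 2 * C)" using cNE C0 by (intro mult_right_mono) auto
    finally show ?thesis by (simp add: mult.commute)
  qed
  have cBs: "int (card Bs) \<le> NJ div q + 1"
  proof -
    have "card F \<le> card {0..l}" using Fl by (intro card_mono) auto
    then show ?thesis using cF l0 by (simp add: l_def)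
  qed
  define S1 where "S1 = isum A1 Bs"
  have S1mod: "\<exists>r\<in>NE. (x - s) mod q = r" if "x \<in> S1" for x
  proof -
    obtain r a b where rab: "r \<in> NE" "a \<in> f r" "b \<in> Bs" "x = a + b" using \<open>x \<in> S1\<close> by (auto simp: S1_def isum_def A1_def)
    have "a mod q = r" using f(1)[OF rab(1)] rab(2) by (auto simp: cl_def)
    moreover have "b mod q = s" using rab(3) by (simp add: Bs_def cl_def)
    moreover have "(x - s) mod q = (a mod q + b mod q - s) mod q" unfolding rab(4) by (metis mod_add_eq mod_diff_left_eq)
    ultimately have "(x - s) mod q = r mod q" by simp
    then show ?thesis using rab(1) by (auto simp: NE_def)
  qed
  have cS1: "int (card S1) \<ge> int (card A) + int (card NE) * (int (card F) - 1)"
  proof -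
    have dis: "isum (f r) Bs \<inter> isum (f r') Bs = {}" if rr: "r \<in> NE" "r' \<in> NE" "r \<noteq> r'" for r r'
    proof (rule ccontr)
      assume "\<not> ?thesis"
      then obtain a b a' b' where h: "a \<in> f r" "b \<in> Bs" "a' \<in> f r'" "b' \<in> Bs" "a + b = a' + b'"
        by (auto simp: isum_def)
      have "a mod q = r" "a' mod q = r'" using f(1)[OF rr(1)] f(1)[OF rr(2)] h by (auto simp: cl_def)
      moreover have "b mod q = b' mod q" using h by (simp add: Bs_def cl_def)
      moreover have "(a + b - b) mod q = (a' + b' - b') mod q" using h(5) \<open>b mod q = b' mod q\<close> by (metis mod_diff_cong)
      ultimately show False using rr(3) by simp
    qed
    have fin: "finite (isum (f r) Bs)" if "r \<in> NE" for r
      using f(1)[OF that] fA fB Bs(1) by (intro finite_isum) (auto simp: cl_def intro: finite_subset)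
    have "(\<Sum>r\<in>NE. card (isum (f r) Bs)) = card (\<Union>r\<in>NE. isum (f r) Bs)"
      by (rule card_UN_disjoint[symmetric]) (use fNE fin dis in auto)
    also have "(\<Union>r\<in>NE. isum (f r) Bs) = S1" by (auto simp: S1_def A1_def isum_def)
    finally have e: "(\<Sum>r\<in>NE. card (isum (f r) Bs)) = card S1" .
    have "(\<Sum>r\<in>NE. card (cl A r)) = card A"
    proof -
      have "(\<Sum>r\<in>NE. card (cl A r)) = (\<Sum>r\<in>{0..<q}. card (cl A r))"
        by (rule sum.mono_neutral_left) (auto simp: NE_def)
      then show ?thesis using cl_sum[OF fA] by simp
    qed
    then have "int (card A) + int (card NE) * (int (card F) - 1) = (\<Sum>r\<in>NE. int (card (cl A r)) + (int (card F) - 1))"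
      by (simp add: sum.distrib flip: of_nat_sum)
    also have "\<dots> \<le> (\<Sum>r\<in>NE. int (card (isum (f r) Bs)))"
    proof (rule sum_mono)
      fix r assume "r \<in> NE"
      then show "int (card (cl A r)) + (int (card F) - 1) \<le> int (card (isum (f r) Bs))" using f(3)[of r] by linarith
    qed
    also have "\<dots> = int (card S1)" using e by (simp flip: of_nat_sum)
    finally show ?thesis .
  qed
  define u where "u = q - int (card NE)"
  have u0: "u \<ge> 0" using cNE by (simp add: u_def)
  define ER where "ER = {0..<q} - NE"
  have cER: "int (card ER) = u"
  proof -
    have "card ER = card {0..<q} - card NE" unfolding ER_def by (rule card_Diff_subset[OF fNE]) (auto simp: NE_def)
    then show ?thesis using cNE q0 by (simp add: u_def of_nat_diff)
  qed
  define D where "D = min NI NJ"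
  \<comment> \<open>Sums at distance at least \<open>z\<close> from both ends have at least
    \<open>z\<close> representations in the full intervals. The holes of the two sets destroy only
    few of them, which leaves \<open>D / 16\<close>.\<close>
  define z where "z = D div 8"
  have z: "8 * z \<le> D" "D \<le> 8 * z + 7" by (simp_all add: z_def)
  \<comment> \<open>the sums missed because \<open>A\<close> avoids the residue classes \<open>ER\<close>; all of them are popular\<close>
  define Wt where "Wt = {x \<in> {z..<NI + NJ - z}. (x - s) mod q \<in> ER}"
  have "500 * q \<le> NJ" using q(2) Cq(2) by (simp only: mult.assoc)
  then have Dq: "500 * q \<le> D" using q(3) by (simp add: D_def)
  have hD: "40 * ((NI - int (card A)) + (NJ - int (card B)) + 2) \<le> D" using hol by (simp add: D_def)
  have WG: "Wt \<subseteq> G" using NN z Dq q0 by (auto simp: Wt_def)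
  have rrW: "real_of_int D / 16 \<le> rr A B x" if "x \<in> Wt" for x
  proof -
    have x: "z \<le> x" "x < NI + NJ - z" using that by (auto simp: Wt_def)
    define P where "P = {max 0 (x - NJ + 1)..min x (NI - 1)}"
    have DD: "D \<le> NI" "D \<le> NJ" by (auto simp: D_def)
    have zz: "z \<le> NI" "z \<le> NJ" "z \<ge> 0" using z Dq q0 DD by linarith+
    have "z \<le> min x (NI - 1) - max 0 (x - NJ + 1) + 1" using x zz by linarith
    then have cP: "z \<le> int (card P)" by (simp add: P_def)
    have "P \<subseteq> {a \<in> A. (x - a) mod p \<in> B} \<union> (({0..<NI} - A) \<union> (\<lambda>b. x - b) ` ({0..<NJ} - B))"
    proof
      fix a assume a: "a \<in> P"
      then have "0 \<le> a" "a < NI" "0 \<le> x - a" "x - a < NJ" by (auto simp: P_def)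
      moreover from this have "(x - a) mod p = x - a" using NN N0 by (intro mod_pos_pos_trivial) auto
      moreover have "a = x - (x - a)" by simp
      ultimately show "a \<in> {a \<in> A. (x - a) mod p \<in> B} \<union> (({0..<NI} - A) \<union> (\<lambda>b. x - b) ` ({0..<NJ} - B))"
        by (cases "a \<in> A"; cases "x - a \<in> B") (auto intro!: image_eqI[of a _ "x - a"])
    qed
    then have "card P \<le> card ({a \<in> A. (x - a) mod p \<in> B} \<union> (({0..<NI} - A) \<union> (\<lambda>b. x - b) ` ({0..<NJ} - B)))"
      by (rule card_mono[rotated]) (use fA in auto)
    also have "\<dots> \<le> rr A B x + (card ({0..<NI} - A) + card ((\<lambda>b. x - b) ` ({0..<NJ} - B)))"
      unfolding rr_def by (intro order_trans[OF card_Un_le] add_mono card_Un_le order_refl)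
    also have "card ((\<lambda>b. x - b) ` ({0..<NJ} - B)) \<le> card ({0..<NJ} - B)" by (rule card_image_le) auto
    finally have "int (card P) \<le> int (rr A B x) + (int (card ({0..<NI} - A)) + int (card ({0..<NJ} - B)))" by linarith
    moreover have "int (card ({0..<NI} - A)) = NI - int (card A)" "int (card ({0..<NJ} - B)) = NJ - int (card B)"
      using card_Diff_subset[OF fA A] card_Diff_subset[OF fB B] cA N0 by (auto simp: of_nat_diff)
    ultimately have "z \<le> int (rr A B x) + (NI - int (card A)) + (NJ - int (card B))" using cP by linarith
    then have "D \<le> 16 * int (rr A B x)" using hD z by (simp add: algebra_simps)
    then show ?thesis by linarith
  qed
  have cWt: "u * (NI + NJ - 2 * z - q) \<le> q * int (card Wt)"
  proof -
    define Lg where "Lg = NI + NJ - 2 * z"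
    define k where "k = Lg div q"
    have "q * k + Lg mod q = Lg" unfolding k_def by (rule mult_div_mod_eq)
    then have kq: "Lg - q \<le> q * k" "q * k \<le> Lg"
      using pos_mod_sign[OF q0, of Lg] pos_mod_bound[OF q0, of Lg] by linarith+
    have Lg0: "Lg \<ge> 0" using z Dq q0 by (auto simp: Lg_def D_def)
    have k0: "k \<ge> 0" using Lg0 q0 by (simp add: k_def pos_imp_zdiv_nonneg_iff)
    define g where "g = (\<lambda>(r, i). z + (r + s - z) mod q + q * i)"
    have inj: "inj_on g (ER \<times> {0..<k})"
    proof (rule inj_onI)
      fix P Q assume PQ: "P \<in> ER \<times> {0..<k}" "Q \<in> ER \<times> {0..<k}" "g P = g Q"
      obtain r i r' j where e: "P = (r, i)" "Q = (r', j)" by (cases P, cases Q) auto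
      have eq: "(r + s - z) mod q + q * i = (r' + s - z) mod q + q * j" using PQ(3) by (simp add: g_def e)
      then have "((r + s - z) mod q + q * i) mod q = ((r' + s - z) mod q + q * j) mod q" by simp
      then have m: "(r + s - z) mod q = (r' + s - z) mod q" by simp
      have "r + s - z = r' + s - z" by (rule mod_eq_imp_eq[OF m]) (use PQ e in \<open>auto simp: ER_def\<close>)
      then have "r = r'" by simp
      moreover have "i = j" using eq m q0 by simp
      ultimately show "P = Q" using e by simp
    qed
    have "g ` (ER \<times> {0..<k}) \<subseteq> Wt"
    proof
      fix x assume "x \<in> g ` (ER \<times> {0..<k})"
      then obtain r i where ri: "r \<in> ER" "0 \<le> i" "i < k" "x = z + (r + s - z) mod q + q * i" by (auto simp: g_def)
      have m: "0 \<le> (r + s - z) mod q" "(r + s - z) mod q < q" using q0 by simp_all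
      have "q * i \<le> q * (k - 1)" using ri(3) q0 by (intro mult_left_mono) auto
      then have "q * i \<le> q * k - q" by (simp add: right_diff_distrib)
      moreover have "0 \<le> q * i" using ri(2) q0 by simp
      ultimately have "x < z + q * k" "z \<le> x" using m ri(4) by linarith+
      then have "x \<in> {z..<NI + NJ - z}" using kq by (simp add: Lg_def)
      moreover have "(x - s) mod q = r"
      proof -
        have "(x - s) mod q = (z + (r + s - z) - s) mod q" 
        proof -
          have "x - s = (r + s - z) mod q + (z - s) + q * i" unfolding ri(4) by simp
          then have "(x - s) mod q = ((r + s - z) mod q + (z - s)) mod q" by (metis mod_mult_self2)
          also have "\<dots> = ((r + s - z) + (z - s)) mod q" by (rule mod_add_left_eq)
          finally show ?thesis by (simp add: algebra_simps)
        qed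
        then show ?thesis using ri(1) by (simp add: ER_def)
      qed
      ultimately show "x \<in> Wt" using ri(1) by (simp add: Wt_def)
    qed
    moreover have "finite Wt" using WG finite_sub_G by blast
    ultimately have "card (ER \<times> {0..<k}) \<le> card Wt" using card_image[OF inj] card_mono by metis
    then have "card ER * nat k \<le> card Wt" by (simp add: card_cartesian_product)
    then have "int (card ER * nat k) \<le> int (card Wt)" by (simp only: of_nat_le_iff)
    then have "int (card ER) * k \<le> int (card Wt)" using k0 by simp
    then have "q * (u * k) \<le> q * int (card Wt)" using cER q0 by simp
    moreover have "u * (Lg - q) \<le> u * (q * k)" using kq u0 by (intro mult_left_mono) auto
    ultimately show ?thesis by (simp add: Lg_def mult_ac)
  qed
  have "D \<le> NI" "D \<le> NJ" by (simp_all add: D_def)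
  then have "card A \<noteq> 0" "card B \<noteq> 0" using hD N0 cA by auto
  then have ne: "A \<noteq> {}" "B \<noteq> {}" by auto
  define t where "t = real_of_int D / 16"
  have t0: "t > 0" using Dq q0 by (simp add: t_def)
  define m where "m = real c1 * real c2 * t / (real (card A) * real (card B))"
  have ab: "real (card A) > 0" "real (card B) > 0" using ne fA fB by (auto simp: card_gt_0_iff)
  \<comment> \<open>With \<open>48 * R\<close> the random choice misses at most the proportion
    \<open>1 / (16 * R)\<close> of the popular sums. An avoided class contains about
    \<open>(NI + NJ - 2 * z) / q\<close> of these, while only \<open>card F\<close>, about
    \<open>NJ / q\<close>, have to be found; the ratio bound \<open>R\<close> makes the surplus
    cover the loss.\<close>
  have m48: "m \<ge> 48 * R"
  proof -
    have "real (card A) * real (card B) \<le> real_of_int NI * real_of_int NJ" using cA by (intro mult_mono) auto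
    also have "\<dots> = real_of_int D * real_of_int (max NI NJ)" by (auto simp: D_def min_def max_def)
    finally have 1: "48 * R * (real (card A) * real (card B)) \<le> 48 * R * (real_of_int D * real_of_int (max NI NJ))"
      using R by (intro mult_left_mono) auto
    have "real_of_int (768 * R * max NI NJ) \<le> real_of_int (int c1 * int c2)" using c(3) by (simp only: of_int_le_iff)
    then have "768 * R * real_of_int (max NI NJ) \<le> real c1 * real c2" by simp
    then have "(768 * R * real_of_int (max NI NJ)) * t \<le> real c1 * real c2 * t" using t0 by (intro mult_right_mono) auto
    then have "48 * R * (real (card A) * real (card B)) \<le> real c1 * real c2 * t" using 1 by (simp add: t_def mult_ac)
    then show ?thesis using ab by (simp add: m_def le_divide_eq)
  qed
  obtain A2 B2 where AB2: "A2 \<subseteq> A" "B2 \<subseteq> B" "card A2 \<le> c1" "card B2 \<le> c2"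
      "m / (m + 3) * ((\<Sum>x\<in>Wt. min t (real (rr A B x))) / t) \<le> real (card (sm A2 B2 \<inter> Wt))"
    using random_subsets_truncated[OF AG WG c(1,2) ne t0] unfolding m_def by blast
  have "(\<Sum>x\<in>Wt. min t (real (rr A B x))) = (\<Sum>x\<in>Wt. t)" using rrW by (intro sum.cong) (auto simp: t_def min_def)
  then have g1: "m / (m + 3) * real (card Wt) \<le> real (card (sm A2 B2 \<inter> Wt))" using AB2(5) t0 by simp
  have gain: "real_of_int (u * int (card F)) \<le> real (card (sm A2 B2 \<inter> Wt))"
  proof -
    define I where "I = real_of_int NI"
    define J where "J = real_of_int NJ"
    define Q where "Q = real_of_int q"
    define RR where "RR = real_of_int R"
    have pos: "I > 0" "J > 0" "Q > 0" "RR \<ge> 1" using N0 q0 R by (simp_all add: I_def J_def Q_def RR_def)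
    have JI: "J \<le> RR * I" using rat(2) unfolding J_def RR_def I_def by (metis of_int_le_iff of_int_mult)
    have IQ: "500 * Q \<le> I" using q(3) unfolding Q_def I_def by linarith
    define X where "X = I + J - 2 * real_of_int z - Q"
    have X: "X \<ge> J + 7/10 * I"
    proof -
      have "8 * z \<le> NI" using z by (simp add: D_def)
      then have "8 * real_of_int z \<le> I" unfolding I_def by linarith
      then show ?thesis using IQ pos unfolding X_def by linarith
    qed
    have "1 - 1 / (16 * RR) \<le> m / (m + 3)"
    proof -
      have "48 * RR \<le> m" using m48 by (simp add: RR_def)
      then have "3 / m \<le> 1 / (16 * RR)" using pos by (simp add: field_simps)
      moreover have "1 - 3 / m \<le> m / (m + 3)" using \<open>48 * RR \<le> m\<close> pos by (simp add: field_simps)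
      ultimately show ?thesis by linarith
    qed
    then have "(1 - 1 / (16 * RR)) * real (card Wt) \<le> m / (m + 3) * real (card Wt)" by (intro mult_right_mono) auto
    then have 1: "(1 - 1 / (16 * RR)) * real (card Wt) \<le> real (card (sm A2 B2 \<inter> Wt))" using g1 by linarith
    have "real_of_int (u * (NI + NJ - 2 * z - q)) \<le> real_of_int (q * int (card Wt))" using cWt by (simp only: of_int_le_iff)
    then have 2: "real_of_int u * X \<le> Q * real (card Wt)" by (simp add: X_def I_def J_def Q_def)
    have r16: "0 \<le> 1 - 1 / (16 * RR)" using pos by simp
    have "(1 - 1 / (16 * RR)) * (real_of_int u * X) \<le> (1 - 1 / (16 * RR)) * (Q * real (card Wt))"
      using 2 r16 by (intro mult_left_mono) auto
    then have 3: "real_of_int u * ((1 - 1 / (16 * RR)) * X) \<le> Q * ((1 - 1 / (16 * RR)) * real (card Wt))"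
      by (simp add: mult_ac)
    have 4: "J + Q \<le> (1 - 1 / (16 * RR)) * X"
    proof -
      have "(1 - 1 / (16 * RR)) * (J + 7/10 * I) \<le> (1 - 1 / (16 * RR)) * X" using X r16 by (intro mult_left_mono) auto
      moreover have "(1 - 1 / (16 * RR)) * (J + 7/10 * I) = J + 7/10 * I - (J / RR) / 16 - (7/10) * (I / RR) / 16"
        using pos by (simp add: field_simps)
      moreover have "J / RR \<le> I" "I / RR \<le> I" using JI pos by (simp_all add: field_simps)
      ultimately show ?thesis using IQ pos by argo
    qed
    have "real_of_int q * real_of_int (int (card F)) \<le> J + Q"
    proof -
      have "q * int (card F) \<le> q * (l + 1)" using cBs cF q0 by (intro mult_left_mono) (auto simp: l_def)
      also have "\<dots> \<le> NJ + q" using ql by (simp add: algebra_simps)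
      finally have "real_of_int (q * int (card F)) \<le> real_of_int (NJ + q)" by (simp only: of_int_le_iff)
      then show ?thesis by (simp add: J_def Q_def)
    qed
    then have "Q * real (card F) \<le> (1 - 1 / (16 * RR)) * X" using 4 by (simp add: Q_def)
    then have "real_of_int u * (Q * real (card F)) \<le> real_of_int u * ((1 - 1 / (16 * RR)) * X)" using u0 by (intro mult_left_mono) auto
    then have "Q * (real_of_int u * real (card F)) \<le> Q * ((1 - 1 / (16 * RR)) * real (card Wt))" using 3 by (simp add: mult_ac)
    then have "real_of_int u * real (card F) \<le> (1 - 1 / (16 * RR)) * real (card Wt)" using pos by simp
    then show ?thesis using 1 by simp
  qed
  have S1: "S1 = sm A1 Bs" unfolding S1_def by (rule sm_eq_isum[symmetric, OF order_trans[OF A1 A] order_trans[OF Bs(1) B] NN])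
  have disj: "S1 \<inter> (sm A2 B2 \<inter> Wt) = {}" using S1mod by (force simp: Wt_def ER_def)
  have "S1 \<union> (sm A2 B2 \<inter> Wt) \<subseteq> sm (A1 \<union> A2) (Bs \<union> B2)" unfolding S1 by (auto simp: sm_def)
  then have "card (S1 \<union> (sm A2 B2 \<inter> Wt)) \<le> card (sm (A1 \<union> A2) (Bs \<union> B2))" by (rule card_mono[OF finite_sm])
  moreover have "card (S1 \<union> (sm A2 B2 \<inter> Wt)) = card S1 + card (sm A2 B2 \<inter> Wt)"
    using disj by (intro card_Un_disjoint) (auto simp: S1)
  ultimately have "int (card S1) + int (card (sm A2 B2 \<inter> Wt)) \<le> int (card (sm (A1 \<union> A2) (Bs \<union> B2)))" by linarith
  moreover have "u * int (card F) \<le> int (card (sm A2 B2 \<inter> Wt))" using gain by linarith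
  moreover have "int (card NE) * (int (card F) - 1) + u * int (card F) = q * int (card F) - int (card NE)"
    by (simp add: u_def algebra_simps)
  ultimately have fin: "int (card A + card B) \<le> int (card (sm (A1 \<union> A2) (Bs \<union> B2))) + q"
    using cS1 sB[folded cF] cNE by linarith
  have "int (card (A1 \<union> A2)) \<le> (2 + 2 * C) * q + int c1" using card_Un_le[of A1 A2] cA1 AB2(3) by linarith
  moreover have "int (card (Bs \<union> B2)) \<le> NJ div q + 1 + int c2" using card_Un_le[of Bs B2] cBs AB2(4) by linarith
  ultimately show ?thesis using A1 AB2 Bs(1) fin by (intro exI[of _ "A1 \<union> A2"] exI[of _ "Bs \<union> B2"]) auto
qed

end

section \<open>Elements outside the intervals\<close>

context zp
begin

text \<open>Sampling at truncation level \<open>card S\<close>, which truncates nothing because no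
  count exceeds the size of the first set. What remains is the mean number of elements that the
  translates of \<open>B\<close> have in \<open>W\<close>.\<close>

lemma average_gain:
  fixes z :: real
  assumes S: "S \<subseteq> G" "S \<noteq> {}" and B: "B \<subseteq> G" "B \<noteq> {}" and W: "W \<subseteq> G"
    and z: "\<And>a. a \<in> S \<Longrightarrow> z \<le> real (card (tr a B \<inter> W))" and c: "c1 \<le> card S" "c2 \<le> card B"
  defines "m \<equiv> real c1 * real c2 / real (card B)"
  shows "\<exists>A' B'. A' \<subseteq> S \<and> B' \<subseteq> B \<and> card A' \<le> c1 \<and> card B' \<le> c2 \<and> m / (m + 3) * z \<le> real (card (sm A' B' \<inter> W))"
proof -
  define t where "t = real (card S)"
  have t0: "t > 0" using S finite_sub_G by (simp add: t_def card_gt_0_iff)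
  have b0: "real (card B) > 0" using B finite_sub_G by (simp add: card_gt_0_iff)
  have mm: "real c1 * real c2 * t / (t * real (card B)) = m" using t0 b0 by (simp add: m_def)
  obtain A' B' where h: "A' \<subseteq> S" "B' \<subseteq> B" "card A' \<le> c1" "card B' \<le> c2"
      "m / (m + 3) * ((\<Sum>x\<in>W. min t (real (rr S B x))) / t) \<le> real (card (sm A' B' \<inter> W))"
    using random_subsets_truncated[OF S(1) B(1) W c S(2) B(2) t0] unfolding t_def[symmetric] mm by blast
  have "(\<Sum>x\<in>W. min t (real (rr S B x))) = (\<Sum>x\<in>W. real (rr S B x))"
    using rr_le[OF S(1)] by (intro sum.cong refl min_absorb2) (simp add: t_def)
  also have "\<dots> = (\<Sum>a\<in>S. real (card (tr a B \<inter> W)))" using sum_rr_pairs[OF S(1) B(1) W] by (simp flip: of_nat_sum)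
  also have "\<dots> \<ge> (\<Sum>a\<in>S. z)" by (rule sum_mono) (rule z)
  finally have "t * z \<le> (\<Sum>x\<in>W. min t (real (rr S B x)))" by (simp add: t_def)
  then have "z \<le> (\<Sum>x\<in>W. min t (real (rr S B x))) / t" using t0 by (simp add: field_simps)
  moreover have "0 \<le> m / (m + 3)" by (simp add: m_def)
  ultimately have "m / (m + 3) * z \<le> m / (m + 3) * ((\<Sum>x\<in>W. min t (real (rr S B x))) / t)" by (rule mult_left_mono)
  then show ?thesis using h by (intro exI[of _ A'] exI[of _ B']) auto
qed

text \<open>An element at distance at least \<open>w\<close> from \<open>{0..<NI}\<close>, measured
  around the circle on both sides, carries a piece of length \<open>w\<close> of
  \<open>{0..<NJ}\<close> into the gap behind \<open>NI + NJ\<close>, which no sum of the main parts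
  reaches.\<close>

lemma outlier_gain:
  fixes NI NJ w h :: int
  assumes S: "S \<subseteq> G" "S \<noteq> {}" "\<And>a. a \<in> S \<Longrightarrow> NI + w \<le> a \<and> a < p - w" and B: "B \<subseteq> {0..<NJ}" "B \<noteq> {}"
    and hB: "NJ - int (card B) \<le> h" and N: "0 \<le> NI" "0 \<le> w" "w \<le> NJ" "w \<le> p - NI - NJ"
    and c: "c1 \<le> card S" "c2 \<le> card B" "3 * card B \<le> c1 * c2"
  shows "\<exists>A' B'. A' \<subseteq> S \<and> B' \<subseteq> B \<and> card A' \<le> c1 \<and> card B' \<le> c2 \<and>
    w - h \<le> 2 * int (card (sm A' B' \<inter> {NI + NJ..<p}))"
proof -
  have BG: "B \<subseteq> G" using B N by auto
  have fB: "finite B" using BG finite_sub_G by auto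
  have z: "real_of_int (w - h) \<le> real (card (tr a B \<inter> {NI + NJ..<p}))" if a: "a \<in> S" for a
  proof -
    define lo where "lo = max 0 (NI + NJ - a)"
    define hi where "hi = min NJ (p - a)"
    define P where "P = {lo..<hi}"
    have aG: "0 \<le> a" "a < p" "NI + w \<le> a" "a < p - w" using a S by auto
    have "w \<le> hi - lo" unfolding hi_def lo_def using aG N by linarith
    then have cP: "w \<le> int (card P)" by (simp add: P_def)
    have "P \<subseteq> {0..<NJ}" by (auto simp: P_def lo_def hi_def)
    then have "P \<subseteq> (P \<inter> B) \<union> ({0..<NJ} - B)" by auto
    then have "card P \<le> card (P \<inter> B) + card ({0..<NJ} - B)"
      by (meson card_Un_le card_mono finite_Diff finite_Int finite_UnI finite_atLeastLessThan_int fB le_trans)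
    moreover have "int (card ({0..<NJ} - B)) = NJ - int (card B)"
      using card_Diff_subset[OF fB B(1)] card_mono[OF _ B(1)] N by (auto simp: of_nat_diff)
    ultimately have 1: "w - h \<le> int (card (P \<inter> B))" using cP hB by linarith
    have "(\<lambda>b. a + b) ` (P \<inter> B) \<subseteq> tr a B \<inter> {NI + NJ..<p}"
    proof
      fix x assume "x \<in> (\<lambda>b. a + b) ` (P \<inter> B)"
      then obtain b where b: "b \<in> P" "b \<in> B" "x = a + b" by auto
      then have "NI + NJ \<le> x" "x < p" "0 \<le> x" using aG by (auto simp: P_def lo_def hi_def)
      moreover have "(x - a) mod p = b" using b BG by auto
      ultimately show "x \<in> tr a B \<inter> {NI + NJ..<p}" using b by (auto simp: tr_def)
    qed
    then have "card ((\<lambda>b. a + b) ` (P \<inter> B)) \<le> card (tr a B \<inter> {NI + NJ..<p})" by (intro card_mono) auto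
    moreover have "card ((\<lambda>b. a + b) ` (P \<inter> B)) = card (P \<inter> B)" by (rule card_image) (simp add: inj_on_def)
    ultimately show ?thesis using 1 by linarith
  qed
  have WG: "{NI + NJ..<p} \<subseteq> G" using N by auto
  define m where "m = real c1 * real c2 / real (card B)"
  obtain A' B' where h: "A' \<subseteq> S" "B' \<subseteq> B" "card A' \<le> c1" "card B' \<le> c2"
      "m / (m + 3) * real_of_int (w - h) \<le> real (card (sm A' B' \<inter> {NI + NJ..<p}))"
    using average_gain[OF S(1,2) BG B(2) WG z c(1,2)] unfolding m_def by blast
  have "w - h \<le> 2 * int (card (sm A' B' \<inter> {NI + NJ..<p}))"
  proof (cases "w - h \<ge> 0")
    case True
    have b0: "real (card B) > 0" using B fB by (simp add: card_gt_0_iff)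
    have "real (3 * card B) \<le> real (c1 * c2)" using c(3) by (simp only: of_nat_le_iff)
    then have "m \<ge> 3" using b0 by (simp add: m_def field_simps)
    then have "1 / 2 \<le> m / (m + 3)" by (simp add: field_simps)
    then have hh: "1 / 2 * real_of_int (w - h) \<le> m / (m + 3) * real_of_int (w - h)" using True by (intro mult_right_mono) auto
    have "real_of_int (w - h) \<le> 2 * real (card (sm A' B' \<inter> {NI + NJ..<p}))" using order_trans[OF hh h(5)] by simp
    then show ?thesis by linarith
  qed linarith
  then show ?thesis using h by blast
qed

text \<open>The main parts have all their sums below \<open>NI + NJ\<close>, so sums in the
  remaining gap are new and may pay for the deficit \<open>q\<close> and for every element outside
  the intervals.\<close>

lemma combine_outliers:
  fixes NI NJ q :: int
  assumes A: "A \<subseteq> G" and B: "B \<subseteq> G" and N: "0 \<le> NI" "0 \<le> NJ" "NI + NJ \<le> p"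
    and 1: "A1 \<subseteq> A \<inter> {0..<NI}" "B1 \<subseteq> B \<inter> {0..<NJ}"
      "int (card (A \<inter> {0..<NI}) + card (B \<inter> {0..<NJ})) \<le> int (card (sm A1 B1)) + q"
    and g: "q + int (card (A - {0..<NI})) + int (card (B - {0..<NJ})) \<le> int (card (sm A2 B2 \<inter> {NI + NJ..<p}))"
  shows "card A + card B \<le> card (sm (A1 \<union> A2) (B1 \<union> B2))"
proof -
  have fA: "finite A" and fB: "finite B" using A B finite_sub_G by auto
  have "sm A1 B1 \<subseteq> {0..<NI + NJ}"
  proof
    fix x assume "x \<in> sm A1 B1"
    then obtain a b where ab: "a \<in> A1" "b \<in> B1" "x = (a + b) mod p" by (auto simp: sm_def)
    then have "0 \<le> a" "a < NI" "0 \<le> b" "b < NJ" using 1 by auto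
    then have "0 \<le> a + b" "a + b < NI + NJ" by auto
    moreover from this have "(a + b) mod p = a + b" using N by (intro mod_pos_pos_trivial) auto
    ultimately show "x \<in> {0..<NI + NJ}" using ab by simp
  qed
  then have "sm A1 B1 \<inter> (sm A2 B2 \<inter> {NI + NJ..<p}) = {}" by force
  then have "card (sm A1 B1 \<union> (sm A2 B2 \<inter> {NI + NJ..<p})) = card (sm A1 B1) + card (sm A2 B2 \<inter> {NI + NJ..<p})"
    by (intro card_Un_disjoint) auto
  moreover have "sm A1 B1 \<union> (sm A2 B2 \<inter> {NI + NJ..<p}) \<subseteq> sm (A1 \<union> A2) (B1 \<union> B2)" by (auto simp: sm_def)
  then have "card (sm A1 B1 \<union> (sm A2 B2 \<inter> {NI + NJ..<p})) \<le> card (sm (A1 \<union> A2) (B1 \<union> B2))"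
    by (rule card_mono[OF finite_sm])
  moreover have "card A = card (A \<inter> {0..<NI}) + card (A - {0..<NI})" "card B = card (B \<inter> {0..<NJ}) + card (B - {0..<NJ})"
    by (rule card_Int_Diff[OF fA], rule card_Int_Diff[OF fB])
  ultimately show ?thesis using 1(3) g by linarith
qed

text \<open>Every element of \<open>B\<close> outside the interval has to contribute one sum outside
  the hull \<open>H\<close> of the main sums, whose complement is a gap of length \<gamma>. Elements
  close to either end of the interval do so with an extreme element of \<open>A0\<close>. For the
  remaining ones a long piece of the translate of \<open>A0\<close> falls into the gap, so sampling
  in \<open>A0\<close> finds enough new sums for all of them at once.\<close>

lemma few_outliers:
  fixes NI NJ q z :: int and c :: nat
  assumes A: "A \<subseteq> G" and B: "B \<subseteq> G" and N: "0 \<le> NI" "0 \<le> NJ" "NI + NJ \<le> p"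
    and ne: "A \<inter> {0..<NI} \<noteq> {}" "B \<inter> {0..<NJ} \<noteq> {}"
  defines "A0 \<equiv> A \<inter> {0..<NI}" and "B0 \<equiv> B \<inter> {0..<NJ}" and "S \<equiv> B - {0..<NJ}"
  assumes 1: "A1 \<subseteq> A0" "B1 \<subseteq> B0" "int (card A0 + card B0) \<le> int (card (sm A1 B1)) + q"
    and z: "0 \<le> z" "z + (NI - int (card A0)) + int (card S) \<le> int (card A0)"
      "2 * (z + (NI - int (card A0)) + int (card S)) \<le> p - NI - NJ"
    and c: "c \<le> card A0" "6 * int (card A0) \<le> int c * z" "2 * int (card S) \<le> z"
  shows "\<exists>A' B'. A' \<subseteq> A \<and> B' \<subseteq> B \<and> card A' \<le> card A1 + 2 + c \<and> card B' \<le> card B1 + card S \<and>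
    int (card A0 + card B) \<le> int (card (sm A' B')) + q"
proof -
  have fA: "finite A" and fB: "finite B" using A B finite_sub_G by auto
  have fA0: "finite A0" and fB0: "finite B0" and fS: "finite S" using fA fB by (auto simp: A0_def B0_def S_def)
  have A0G: "A0 \<subseteq> G" and SG: "S \<subseteq> G" using A B by (auto simp: A0_def S_def)
  have A0ne: "A0 \<noteq> {}" and B0ne: "B0 \<noteq> {}" using ne by (auto simp: A0_def B0_def)
  define am where "am = Min A0"
  define aM where "aM = Max A0"
  define bm where "bm = Min B0"
  define bM where "bM = Max B0"
  have am: "am \<in> A0" "\<And>a. a \<in> A0 \<Longrightarrow> am \<le> a" using Min_in[OF fA0 A0ne] Min_le[OF fA0] unfolding am_def by blast+
  have aM: "aM \<in> A0" "\<And>a. a \<in> A0 \<Longrightarrow> a \<le> aM" using Max_in[OF fA0 A0ne] Max_ge[OF fA0] unfolding aM_def by blast+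
  have bm: "bm \<in> B0" "\<And>a. a \<in> B0 \<Longrightarrow> bm \<le> a" using Min_in[OF fB0 B0ne] Min_le[OF fB0] unfolding bm_def by blast+
  have bM: "bM \<in> B0" "\<And>a. a \<in> B0 \<Longrightarrow> a \<le> bM" using Max_in[OF fB0 B0ne] Max_ge[OF fB0] unfolding bM_def by blast+
  have rng: "0 \<le> am" "am \<le> aM" "aM < NI" "0 \<le> bm" "bm \<le> bM" "bM < NJ" using am aM bm bM by (auto simp: A0_def B0_def)
  define \<gamma> where "\<gamma> = p - 1 - ((aM + bM) - (am + bm))"
  have \<gamma>: "p - NI - NJ \<le> \<gamma>" using rng by (simp add: \<gamma>_def)
  define H where "H = {am + bm..aM + bM}"
  have out: "y mod p \<in> G - H" if y: "aM + bM < y" "y \<le> aM + bM + \<gamma>" for y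
  proof (cases "y < p")
    case True
    then have "y mod p = y" using y rng by (intro mod_pos_pos_trivial) auto
    then show ?thesis using y rng True by (auto simp: H_def)
  next
    case False
    have "(y - p) mod p = y - p" using y rng N False by (intro mod_pos_pos_trivial) (auto simp: \<gamma>_def)
    then have "y mod p = y - p" by simp
    then show ?thesis using y rng N False by (auto simp: H_def \<gamma>_def)
  qed
  have uniq: "y = y'" if "aM + bM < y" "y \<le> aM + bM + \<gamma>" "aM + bM < y'" "y' \<le> aM + bM + \<gamma>" "y mod p = y' mod p" for y y'
    using that rng by (intro mod_eq_imp_eq[OF that(5)]) (auto simp: \<gamma>_def)
  \<comment> \<open>Adding \<open>aM\<close> to \<open>S1\<close> hits the lower half of the gap behind \<open>aM + bM\<close>, adding \<open>am\<close> to \<open>S3\<close> the upper half.\<close>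
  define S1 where "S1 = {b \<in> S. 2 * (b - bM) \<le> \<gamma>}"
  define S3 where "S3 = {b \<in> S. \<gamma> < 2 * (b - bM - (aM - am))}"
  define S2 where "S2 = S - (S1 \<union> S3)"
  define f where "f b = (if b \<in> S1 then aM + b else am + b)" for b
  have Sb: "bM < b" "b < p" if "b \<in> S" for b using that rng B by (auto simp: S_def)
  have frng: "aM + bM < f b" "f b \<le> aM + bM + \<gamma>" if b: "b \<in> S1 \<union> S3" for b
  proof -
    have bS: "b \<in> S" using b by (auto simp: S1_def S3_def)
    have g0: "\<gamma> \<ge> 0" using \<gamma> N by simp
    show "aM + bM < f b"
    proof (cases "b \<in> S1")
      case True then show ?thesis using Sb[OF bS] by (simp add: f_def)
    next
      case False
      then have "\<gamma> < 2 * (b - bM - (aM - am))" using b by (auto simp: S3_def)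
      then show ?thesis using False g0 by (simp add: f_def)
    qed
    show "f b \<le> aM + bM + \<gamma>"
    proof (cases "b \<in> S1")
      case True
      then have "2 * (b - bM) \<le> \<gamma>" by (simp add: S1_def)
      then show ?thesis using True g0 by (simp add: f_def)
    next
      case False
      then show ?thesis using Sb[OF bS] rng by (simp add: f_def \<gamma>_def)
    qed
  qed
  define T where "T = (\<lambda>b. f b mod p) ` (S1 \<union> S3)"
  have injT: "inj_on (\<lambda>b. f b mod p) (S1 \<union> S3)"
  proof (rule inj_onI)
    fix b b' assume b: "b \<in> S1 \<union> S3" "b' \<in> S1 \<union> S3" "f b mod p = f b' mod p"
    have e: "f b = f b'" by (rule uniq[OF frng[OF b(1)] frng[OF b(2)] b(3)])
    show "b = b'"
    proof (cases "b \<in> S1"; cases "b' \<in> S1")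
      assume "b \<in> S1" "b' \<notin> S1"
      then have "2 * (b - bM) \<le> \<gamma>" "\<gamma> < 2 * (b' - bM - (aM - am))" "aM + b = am + b'" using b e by (auto simp: S1_def S3_def f_def)
      then show ?thesis by (simp add: algebra_simps)
    next
      assume "b \<notin> S1" "b' \<in> S1"
      then have "2 * (b' - bM) \<le> \<gamma>" "\<gamma> < 2 * (b - bM - (aM - am))" "am + b = aM + b'" using b e by (auto simp: S1_def S3_def f_def)
      then show ?thesis by (simp add: algebra_simps)
    qed (use e in \<open>auto simp: f_def\<close>)
  qed
  have cT: "card T = card (S1 \<union> S3)" unfolding T_def by (rule card_image[OF injT])
  have fT: "finite T" using fS by (auto simp: T_def S1_def S3_def)
  have TG: "T \<subseteq> G - H" using out frng by (auto simp: T_def)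
  have S13: "S1 \<union> S3 \<subseteq> S" "S2 \<subseteq> S" by (auto simp: S1_def S3_def S2_def)
  have cS: "card S = card (S1 \<union> S3) + card S2"
  proof -
    have "card S2 = card S - card (S1 \<union> S3)" unfolding S2_def using S13 fS by (intro card_Diff_subset) (auto intro: finite_subset)
    then show ?thesis using card_mono[OF fS S13(1)] by simp
  qed
  define W where "W = G - H - T"
  have WG: "W \<subseteq> G" by (auto simp: W_def)
  have good: "real_of_int z \<le> real (card (tr b A0 \<inter> W))" if b: "b \<in> S2" for b
  proof -
    define t where "t = b - bM"
    have t: "\<gamma> < 2 * t" "2 * (t - (aM - am)) \<le> \<gamma>" using b by (auto simp: S2_def S1_def S3_def t_def)
    define P where "P = {max am (aM - t + 1)..min aM (aM - t + \<gamma>)}"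
    define k where "k = z + (NI - int (card A0)) + int (card S)"
    have "A0 \<subseteq> {am..aM}" using am aM by auto
    then have "card A0 \<le> card {am..aM}" by (intro card_mono) auto
    then have cA0: "int (card A0) \<le> aM - am + 1" using rng by simp
    have "card A0 \<le> card {0..<NI}" by (intro card_mono) (auto simp: A0_def)
    then have cA0N: "int (card A0) \<le> NI" using N by simp
    have k: "0 \<le> k" "k \<le> aM - am + 1" "2 * k \<le> \<gamma>" using z cA0 \<gamma> cA0N by (auto simp: k_def)
    have "2 * t \<le> \<gamma> + 2 * aM - 2 * am" using t(2) by (simp add: algebra_simps)
    then have "k \<le> aM - t + \<gamma> - am + 1" "k \<le> t" "k \<le> \<gamma>" using k t by linarith+
    then have "k \<le> min aM (aM - t + \<gamma>) - max am (aM - t + 1) + 1" using k(2) unfolding min_def max_def by simp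
    then have cP: "k \<le> int (card P)" by (simp add: P_def)
    have "P \<subseteq> {0..<NI}" using rng by (auto simp: P_def)
    then have "P \<subseteq> (P \<inter> A0) \<union> ({0..<NI} - A0)" by auto
    then have "card P \<le> card ((P \<inter> A0) \<union> ({0..<NI} - A0))" by (rule card_mono[rotated]) (use fA0 in auto)
    also have "\<dots> \<le> card (P \<inter> A0) + card ({0..<NI} - A0)" by (rule card_Un_le)
    finally have "card P \<le> card (P \<inter> A0) + card ({0..<NI} - A0)" .
    moreover have "int (card ({0..<NI} - A0)) = NI - int (card A0)"
      using card_Diff_subset[OF fA0, of "{0..<NI}"] cA0N N by (auto simp: A0_def of_nat_diff)
    ultimately have c1: "z + int (card S) \<le> int (card (P \<inter> A0))" using cP by (simp add: k_def)
    define Q where "Q = (\<lambda>a. (a + b) mod p) ` (P \<inter> A0)"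
    have "inj_on (\<lambda>a. (a + b) mod p) (P \<inter> A0)"
    proof (rule inj_onI)
      fix a a' assume a: "a \<in> P \<inter> A0" "a' \<in> P \<inter> A0" "(a + b) mod p = (a' + b) mod p"
      have "a \<in> G" "a' \<in> G" using a A0G by blast+
      then have "a + b = a' + b" by (intro mod_eq_imp_eq[OF a(3)]) auto
      then show "a = a'" by simp
    qed
    then have cQ: "card Q = card (P \<inter> A0)" unfolding Q_def by (rule card_image)
    have "Q - T \<subseteq> tr b A0 \<inter> W"
    proof
      fix x assume x: "x \<in> Q - T"
      then obtain a where a: "a \<in> P" "a \<in> A0" "x = (a + b) mod p" by (auto simp: Q_def)
      have "aM + bM < a + b" "a + b \<le> aM + bM + \<gamma>" using a by (auto simp: P_def t_def)
      then have "x \<in> G - H" using out a by simp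
      moreover have "x \<in> tr b A0" using mod_add_in_tr[OF A0G a(2)] a by simp
      ultimately show "x \<in> tr b A0 \<inter> W" using x by (auto simp: W_def)
    qed
    then have "card (Q - T) \<le> card (tr b A0 \<inter> W)" by (intro card_mono) auto
    moreover have "card Q - card T \<le> card (Q - T)" by (rule diff_card_le_card_Diff[OF fT])
    ultimately have "z \<le> int (card (tr b A0 \<inter> W))" using c1 cQ cT cS by linarith
    then show ?thesis by linarith
  qed
  have "\<exists>A2 B2. A2 \<subseteq> A0 \<and> B2 \<subseteq> S2 \<and> card A2 \<le> c \<and> card S2 \<le> card (sm B2 A2 \<inter> W)"
  proof (cases "S2 = {}")
    case True
    then show ?thesis by (intro exI[of _ "{}"]) auto
  next
    case False
    have S2G: "S2 \<subseteq> G" using S13 SG by auto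
    define m where "m = real (card S2) * real c / real (card A0)"
    obtain B2 A2 where h: "B2 \<subseteq> S2" "A2 \<subseteq> A0" "card A2 \<le> c" "m / (m + 3) * real_of_int z \<le> real (card (sm B2 A2 \<inter> W))"
      using average_gain[OF S2G False A0G A0ne WG good order_refl c(1)] unfolding m_def by blast
    have a0: "real (card A0) > 0" using A0ne fA0 by (simp add: card_gt_0_iff)
    have m0: "m \<ge> 0" by (simp add: m_def)
    \<comment> \<open>For \<open>m \<le> 3\<close> the proportion is at least \<open>m / 6\<close>,
      which grows linearly with \<open>card S2\<close>. For larger \<open>m\<close> at least half of
      \<open>z\<close> sums are found, and \<open>2 * card S \<le> z\<close>.\<close>
    have "real (card S2) \<le> m / (m + 3) * real_of_int z"
    proof (cases "m \<le> 3")
      case True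
      have "real_of_int (6 * int (card A0)) \<le> real_of_int (int c * z)" using c(2) by (simp only: of_int_le_iff)
      then have "6 * real (card A0) \<le> real c * real_of_int z" by simp
      then have "real (card S2) * (6 * real (card A0)) \<le> real (card S2) * (real c * real_of_int z)" by (rule mult_left_mono) simp
      then have "real (card S2) \<le> m / 6 * real_of_int z" using a0 by (simp add: m_def field_simps)
      also have "m / 6 \<le> m / (m + 3)" using m0 True by (intro divide_left_mono) auto
      then have "m / 6 * real_of_int z \<le> m / (m + 3) * real_of_int z" using z(1) by (intro mult_right_mono) auto
      finally show ?thesis .
    next
      case False
      then have "1 / 2 \<le> m / (m + 3)" by (simp add: field_simps)
      then have "1 / 2 * real_of_int z \<le> m / (m + 3) * real_of_int z" using z(1) by (intro mult_right_mono) auto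
      moreover have "real (card S2) \<le> 1 / 2 * real_of_int z"
      proof -
        have "2 * int (card S2) \<le> z" using c(3) cS by linarith
        then show ?thesis by linarith
      qed
      ultimately show ?thesis by linarith
    qed
    then have "card S2 \<le> card (sm B2 A2 \<inter> W)" using h(4) by linarith
    then show ?thesis using h by blast
  qed
  then obtain A2 B2 where 2: "A2 \<subseteq> A0" "B2 \<subseteq> S2" "card A2 \<le> c" "card S2 \<le> card (sm B2 A2 \<inter> W)" by blast
  define A' where "A' = A1 \<union> {am, aM} \<union> A2"
  define B' where "B' = B1 \<union> S"
  have "sm A1 B1 \<subseteq> H"
  proof
    fix x assume "x \<in> sm A1 B1"
    then obtain a b where ab: "a \<in> A0" "b \<in> B0" "x = (a + b) mod p" using 1 by (auto simp: sm_def)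
    have "am + bm \<le> a + b" "a + b \<le> aM + bM" using am(2)[OF ab(1)] aM(2)[OF ab(1)] bm(2)[OF ab(2)] bM(2)[OF ab(2)] by auto
    moreover from this have "(a + b) mod p = a + b" using N rng by (intro mod_pos_pos_trivial) auto
    ultimately show "x \<in> H" using ab by (simp add: H_def)
  qed
  then have d: "sm A1 B1 \<inter> (T \<union> (sm B2 A2 \<inter> W)) = {}" "T \<inter> (sm B2 A2 \<inter> W) = {}" using TG by (auto simp: W_def)
  have "T \<subseteq> sm A' B'"
  proof
    fix x assume "x \<in> T"
    then obtain b where b: "b \<in> S1 \<union> S3" "x = f b mod p" by (auto simp: T_def)
    then have "b \<in> B'" using S13 by (auto simp: B'_def)
    moreover have "am \<in> A'" "aM \<in> A'" by (auto simp: A'_def)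
    ultimately show "x \<in> sm A' B'" using b sm_I by (auto simp: f_def)
  qed
  moreover have "sm A1 B1 \<subseteq> sm A' B'" by (rule sm_mono) (auto simp: A'_def B'_def)
  moreover have "sm B2 A2 \<subseteq> sm A' B'" unfolding sm_commute[of B2] by (rule sm_mono) (use 2 S13 in \<open>auto simp: A'_def B'_def\<close>)
  ultimately have "sm A1 B1 \<union> (T \<union> (sm B2 A2 \<inter> W)) \<subseteq> sm A' B'" by blast
  then have "card (sm A1 B1 \<union> (T \<union> (sm B2 A2 \<inter> W))) \<le> card (sm A' B')" by (rule card_mono[OF finite_sm])
  moreover have "card (sm A1 B1 \<union> (T \<union> (sm B2 A2 \<inter> W))) = card (sm A1 B1) + (card T + card (sm B2 A2 \<inter> W))"
    using d fT by (simp add: card_Un_disjoint)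
  moreover have "card B = card B0 + card S" unfolding B0_def S_def by (rule card_Int_Diff[OF fB])
  ultimately have fin: "int (card A0 + card B) \<le> int (card (sm A' B')) + q" using 1(3) 2(4) cT cS by linarith
  have "card A' \<le> card (A1 \<union> {am, aM}) + card A2" unfolding A'_def by (rule card_Un_le)
  also have "card (A1 \<union> {am, aM}) \<le> card A1 + card {am, aM}" by (rule card_Un_le)
  also have "card {am, aM} \<le> 2" by (simp add: card_insert_if)
  finally have cA': "card A' \<le> card A1 + 2 + c" using 2(3) by simp
  have "card B' \<le> card B1 + card S" unfolding B'_def by (rule card_Un_le)
  moreover have "A' \<subseteq> A" using 1 2 am aM by (auto simp: A'_def A0_def)
  moreover have "B' \<subseteq> B" using 1 by (auto simp: B'_def B0_def S_def)
  ultimately show ?thesis using cA' fin by blast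
qed

text \<open>Here \<open>core_sum\<close> gets an eighth of \<open>c1\<close> and \<open>c2\<close>
  for its random part, and its residue-class part fits into another eighth. A quarter of each size
  is consumed, which leaves room for outliers and repairs.\<close>

lemma dense_core:
  fixes \<alpha> \<eta> n :: real and R C NI NJ :: int and c1 c2 :: nat
  assumes A: "A \<subseteq> {0..<NI}" and B: "B \<subseteq> {0..<NJ}" and NN: "NI + NJ \<le> p" and \<alpha>: "0 < \<alpha>" "\<alpha> \<le> 1" and n: "0 < n"
    and R: "4 \<le> \<alpha> * R" and C: "C = 204 * R + 105" and \<eta>: "0 < \<eta>" "3000 * real_of_int C * \<eta> \<le> \<alpha>"
    and NI: "\<alpha> * n \<le> 2 * NI" "NI \<le> 2 * n" and NJ: "\<alpha> * n \<le> 2 * NJ" "NJ \<le> 2 * n"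
    and hol: "NI - real (card A) \<le> 3 * (\<eta> * n)" "NJ - real (card B) \<le> 3 * (\<eta> * n)"
    and c: "c1 \<le> 8 * card A" "c2 \<le> 8 * card B" "real c1 \<le> n" "real c2 \<le> n" "1000000 * real_of_int C * n \<le> \<eta> * real c1 * real c2"
  defines "q \<equiv> \<lfloor>\<eta> * real c1 / 100\<rfloor>"
  shows "\<exists>A' B'. A' \<subseteq> A \<and> B' \<subseteq> B \<and> real (card A') \<le> real c1 / 4 \<and> real (card B') \<le> real c2 / 4 \<and>
    int (card A + card B) \<le> int (card (sm A' B')) + q"
proof -
  define c where "c = real_of_int C"
  define r where "r = real_of_int R"
  define X where "X = \<eta> * n"
  have r4: "r \<ge> 4"
  proof -
    have "0 < r"
    proof (rule ccontr)
      assume "\<not> 0 < r"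
      then have "\<alpha> * r \<le> 0" using \<alpha> by (intro mult_nonneg_nonpos) auto
      then show False using R by (simp add: r_def)
    qed
    then have "\<alpha> * r \<le> 1 * r" using \<alpha> by (intro mult_right_mono) auto
    then show ?thesis using R by (simp add: r_def)
  qed
  then have R4: "R \<ge> 4" by (simp add: r_def)
  have cr: "c = 204 * r + 105" by (simp add: c_def r_def C)
  then have c309: "c \<ge> 900" using r4 by simp
  have X0: "X > 0" using \<eta> n by (simp add: X_def)
  have Xa: "3000 * (c * X) \<le> \<alpha> * n"
    using mult_right_mono[OF \<eta>(2) less_imp_le[OF n]] by (simp add: X_def c_def mult_ac)
  have cX: "900 * X \<le> c * X" using c309 X0 by (intro mult_right_mono) auto
  have ec1: "1000000 * c \<le> \<eta> * real c1"
  proof -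
    have "\<eta> * real c1 * real c2 \<le> \<eta> * real c1 * n" using c(4) \<eta> by (intro mult_left_mono) auto
    then have "1000000 * c * n \<le> \<eta> * real c1 * n" using c(5) by (simp add: c_def)
    then show ?thesis using n by simp
  qed
  have ec2: "1000000 * c \<le> \<eta> * real c2"
  proof -
    have "\<eta> * real c2 * real c1 \<le> \<eta> * real c2 * n" using c(3) \<eta> by (intro mult_left_mono) auto
    then have "1000000 * c * n \<le> \<eta> * real c2 * n" using c(5) by (simp add: c_def mult_ac)
    then show ?thesis using n by simp
  qed
  have \<eta>1: "\<eta> \<le> 1" 
  proof -
    have "900 * \<eta> \<le> c * \<eta>" using c309 \<eta> by (intro mult_right_mono) auto
    then show ?thesis using \<eta> \<alpha> unfolding c_def by linarith
  qed
  have c12: "real c1 \<ge> 1000000 * c" "real c2 \<ge> 1000000 * c"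
    using ec1 ec2 mult_right_mono[OF \<eta>1, of "real c1"] mult_right_mono[OF \<eta>1, of "real c2"] by auto
  have eX: "\<eta> * real c1 \<le> X" using c(3) \<eta> by (simp add: X_def)
  then have Xb: "1000000 * c \<le> X" using ec1 by linarith
  define Q where "Q = real_of_int q"
  have Q: "Q \<le> \<eta> * real c1 / 100" "\<eta> * real c1 / 100 < Q + 1" unfolding Q_def q_def by linarith+
  then have Q2: "\<eta> * real c1 / 200 \<le> Q" using ec1 c309 by linarith
  have q1: "q \<ge> 1"
  proof -
    have "Q > 0" using Q2 ec1 c309 by linarith
    then show ?thesis by (simp add: Q_def)
  qed
  have QX: "100 * Q \<le> X" using Q eX by linarith
  have "c * (100 * Q) \<le> c * X" using QX c309 by (intro mult_left_mono) auto
  then have cQ: "100 * (c * Q) \<le> c * X" by simp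
  have RI: "NI \<le> R * NJ"
  proof -
    have "2 * n \<le> (\<alpha> * n / 2) * r" using mult_right_mono[OF R less_imp_le[OF n]] by (simp add: r_def mult_ac)
    also have "\<dots> \<le> NJ * r" using NJ r4 by (intro mult_right_mono) auto
    finally have "real_of_int NI \<le> real_of_int (R * NJ)" using NI by (simp add: r_def mult_ac)
    then show ?thesis by (simp only: of_int_le_iff)
  qed
  have RJ: "NJ \<le> R * NI"
  proof -
    have "2 * n \<le> (\<alpha> * n / 2) * r" using mult_right_mono[OF R less_imp_le[OF n]] by (simp add: r_def mult_ac)
    also have "\<dots> \<le> NI * r" using NI r4 by (intro mult_right_mono) auto
    finally have "real_of_int NJ \<le> real_of_int (R * NI)" using NJ by (simp add: r_def mult_ac)
    then show ?thesis by (simp only: of_int_le_iff)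
  qed
  have q2: "500 * C * q \<le> NJ"
  proof -
    have "500 * (c * Q) \<le> NJ" using cQ Xa NJ(1) X0 cX by linarith
    then have "real_of_int (500 * C * q) \<le> real_of_int NJ" by (simp add: c_def Q_def)
    then show ?thesis by (simp only: of_int_le_iff)
  qed
  have q3: "500 * q \<le> NI"
  proof -
    have "500 * Q \<le> NI" using QX cX Xa X0 NI(1) by linarith
    then have "real_of_int (500 * q) \<le> real_of_int NI" by (simp add: Q_def)
    then show ?thesis by (simp only: of_int_le_iff)
  qed
  have dB: "500 * C * (NJ - int (card B)) \<le> NJ"
  proof -
    have "500 * c * (NJ - real (card B)) \<le> 500 * c * (3 * X)" using hol(2) c309 by (intro mult_left_mono) (auto simp: X_def)
    also have "\<dots> \<le> NJ" using Xa NJ by simp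
    finally have "real_of_int (500 * C * (NJ - int (card B))) \<le> real_of_int NJ" by (simp add: c_def)
    then show ?thesis by (simp only: of_int_le_iff)
  qed
  define t where "t = (NI - int (card A)) + (NJ - int (card B)) + 2"
  have "real_of_int t \<le> 6 * X + 2" using hol by (simp add: t_def X_def)
  then have "40 * real_of_int t \<le> NI" "40 * real_of_int t \<le> NJ" using Xb c309 Xa cX NI NJ by linarith+
  then have tt: "40 * t \<le> NI" "40 * t \<le> NJ" by linarith+
  have d8: "c1 div 8 \<le> card A" "c2 div 8 \<le> card B" using c by auto
  have cc: "768 * R * max NI NJ \<le> int (c1 div 8) * int (c2 div 8)"
  proof -
    have "c1 < 8 * (c1 div 8) + 8" "c2 < 8 * (c2 div 8) + 8" by simp_all
    then have "real c1 / 16 \<le> real (c1 div 8)" "real c2 / 16 \<le> real (c2 div 8)" using c12 c309 by linarith+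
    then have "real c1 / 16 * (real c2 / 16) \<le> real (c1 div 8) * real (c2 div 8)" by (intro mult_mono) auto
    moreover have "768 * r * real_of_int (max NI NJ) \<le> 768 * r * (2 * n)" using NI NJ r4 by (intro mult_left_mono) auto
    moreover have "768 * r * (2 * n) \<le> real c1 / 16 * (real c2 / 16)"
    proof -
      have "r * n \<le> c * n" using cr n r4 by (intro mult_right_mono) auto
      moreover have "\<eta> * (real c1 * real c2) \<le> 1 * (real c1 * real c2)" using \<eta>1 by (intro mult_right_mono) auto
      then have "1000000 * (c * n) \<le> real c1 * real c2" using c(5) by (simp add: c_def mult_ac)
      moreover have "900 * n \<le> c * n" using c309 n by (intro mult_right_mono) auto
      moreover have "768 * r * (2 * n) = 1536 * (r * n)" "real c1 / 16 * (real c2 / 16) = (real c1 * real c2) / 256" by simp_all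
      ultimately show ?thesis using n by linarith
    qed
    moreover have "real_of_int (768 * R * max NI NJ) = 768 * r * real_of_int (max NI NJ)"
      by (simp only: r_def of_int_mult of_int_numeral)
    moreover have "real_of_int (int (c1 div 8) * int (c2 div 8)) = real (c1 div 8) * real (c2 div 8)"
      by (simp only: of_int_mult of_int_of_nat_eq)
    ultimately have "real_of_int (768 * R * max NI NJ) \<le> real_of_int (int (c1 div 8) * int (c2 div 8))" by linarith
    then show ?thesis by (simp only: of_int_le_iff)
  qed
  obtain A' B' where h: "A' \<subseteq> A" "B' \<subseteq> B" "int (card A') \<le> (2 + 2 * C) * q + int (c1 div 8)"
      "int (card B') \<le> NJ div q + 1 + int (c2 div 8)" "int (card A + card B) \<le> int (card (sm A' B')) + q"
    using core_sum[OF A B NN _ C RI RJ q1 q2 q3 dB tt[unfolded t_def] d8 cc] R4 by auto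
  have "real_of_int (int (card A')) \<le> real_of_int ((2 + 2 * C) * q + int (c1 div 8))" using h(3) by (simp only: of_int_le_iff)
  then have "real (card A') \<le> 2 * Q + 2 * (c * Q) + real (c1 div 8)" by (simp add: c_def Q_def algebra_simps)
  moreover have "c * Q \<le> real c1 / 200"
  proof -
    have "c * Q \<le> c * (\<eta> * real c1 / 100)" using Q c309 by (intro mult_left_mono) auto
    also have "\<dots> = (c * \<eta>) * real c1 / 100" by simp
    also have "\<dots> \<le> 1 / 3000 * real c1 / 100" using \<eta> \<alpha> by (intro divide_right_mono mult_right_mono) (auto simp: c_def)
    finally show ?thesis by simp
  qed
  moreover have "Q \<le> real c1 / 100" using Q mult_right_mono[OF \<eta>1, of "real c1"] by simp
  moreover have "real (c1 div 8) \<le> real c1 / 8" "real (c2 div 8) \<le> real c2 / 8" by linarith+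
  ultimately have cA: "real (card A') \<le> real c1 / 4" by linarith
  have "real_of_int (NJ div q) \<le> real c2 / 16"
  proof -
    have "real_of_int (NJ div q) \<le> NJ / Q" unfolding Q_def by (rule real_of_int_div4)
    also have "\<dots> \<le> 2 * n / Q" using NJ q1 by (intro divide_right_mono) (auto simp: Q_def)
    also have "\<dots> \<le> real c2 / 16"
    proof -
      have "900 * n \<le> c * n" using c309 n by (intro mult_right_mono) auto
      then have "1000000 * n \<le> \<eta> * real c1 * real c2" using c(5) n unfolding c_def by linarith
      then have "2 * n \<le> (\<eta> * real c1 / 200) * (real c2 / 16)" using n by (simp add: field_simps)
      also have "\<dots> \<le> Q * (real c2 / 16)" using Q2 by (intro mult_right_mono) auto
      finally show ?thesis using q1 by (simp add: Q_def field_simps)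
    qed
    finally show ?thesis .
  qed
  then have "real (card B') \<le> real c2 / 4" using h(4) c12 c309 \<open>real (c2 div 8) \<le> real c2 / 8\<close> by linarith
  then show ?thesis using h cA by blast
qed

text \<open>Widening the interval by \<open>w\<close> on both sides, realised as a shift by
  \<open>w\<close> with length \<open>N + 2 * w\<close>, leaves outside only the elements far from
  the original interval.\<close>

lemma card_tr_outside:
  assumes A: "A \<subseteq> G" and w: "0 \<le> w" and N: "0 \<le> N"
  shows "card (tr w A - {0..<N + 2 * w}) \<le> card {a \<in> A. N + w \<le> a \<and> a < p - w}"
proof -
  have "tr w A - {0..<N + 2 * w} \<subseteq> (\<lambda>a. a + w) ` {a \<in> A. N + w \<le> a \<and> a < p - w}"
  proof
    fix x assume x: "x \<in> tr w A - {0..<N + 2 * w}"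
    then have h: "(x - w) mod p \<in> A" "0 \<le> x" "x < p" "N + 2 * w \<le> x" by (auto simp: tr_def)
    moreover have "(x - w) mod p = x - w" using h w N by (intro mod_pos_pos_trivial) auto
    ultimately show "x \<in> (\<lambda>a. a + w) ` {a \<in> A. N + w \<le> a \<and> a < p - w}" by (intro image_eqI[of x _ "x - w"]) auto
  qed
  moreover have "finite {a \<in> A. N + w \<le> a \<and> a < p - w}" using finite_sub_G[OF A] by simp
  ultimately show ?thesis by (meson card_image_le card_mono finite_imageI le_trans)
qed

text \<open>The number of elements at distance at least \<open>w\<close> from the intervals decides.
  If one set has at least a sixteenth of its prescribed size of them, sampling among these yields
  nearly \<open>X / 2\<close> sums in the gap, more than all outliers and \<open>q\<close> together.
  Otherwise the intervals are widened by \<open>w\<close>: all remaining outliers of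
  \<open>B\<close> are put into \<open>B'\<close>, and those of \<open>A\<close> are left to
  \<open>good_fill\<close>. That repair is bounded in terms of \<open>c1\<close> and is paid by both
  sets, whence the assumption \<open>c1 \<le> c2\<close>.\<close>

lemma near_intervals_good:
  fixes \<alpha> \<beta> \<eta> n :: real and R C NI NJ :: int and c1 c2 :: nat
  assumes A: "A \<subseteq> G" and B: "B \<subseteq> G" and \<alpha>: "0 < \<alpha>" "\<alpha> \<le> 1" and \<beta>: "0 < \<beta>" "\<beta> \<le> 1"
    and R: "4 \<le> \<alpha> * R" and C: "C = 204 * R + 105" and \<eta>: "0 < \<eta>" "3000 * real_of_int C * \<eta> \<le> \<alpha> * \<beta>"
    and n: "real (card A) \<le> n" "real (card B) \<le> n" "\<alpha> * n \<le> real (card A)" "\<alpha> * n \<le> real (card B)"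
    and pp: "real (card A) + real (card B) \<le> (1 - \<beta>) * p" and N: "0 \<le> NI" "0 \<le> NJ"
    and I: "real (card (A - {0..<NI})) \<le> \<eta> * n / 40" "NI \<le> real (card A) + \<eta> * n / 40"
    and J: "real (card (B - {0..<NJ})) \<le> \<eta> * n / 40" "NJ \<le> real (card B) + \<eta> * n / 40"
    and c: "1 \<le> c1" "c1 \<le> card A" "c2 \<le> card B" "c1 \<le> c2" "1000000 * real_of_int C * n \<le> \<eta> * real c1 * real c2"
  shows "good A B c1 c2"
proof -
  have fA: "finite A" and fB: "finite B" using A B finite_sub_G by auto
  define cc where "cc = real_of_int C"
  define X where "X = \<eta> * n"
  define U where "U = \<alpha> * \<beta> * n"
  have n0: "n > 0" using c n by linarith
  have ab: "\<alpha> * \<beta> \<le> \<alpha>" using \<alpha> \<beta> by (simp add: mult_left_le)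
  have Ua: "U \<le> \<alpha> * n" unfolding U_def using ab n0 by (intro mult_right_mono) auto
  have Un: "\<alpha> * n \<le> n" using \<alpha> n0 by simp
  have cAp: "real (card A) \<le> p"
  proof -
    have "card A \<le> card G" by (rule card_mono) (use A in auto)
    then show ?thesis using p_gt1 by simp
  qed
  have Up: "U \<le> \<beta> * p"
  proof -
    have "\<beta> * (\<alpha> * n) \<le> \<beta> * p" using \<beta> n cAp by (intro mult_left_mono) auto
    then show ?thesis by (simp add: U_def mult_ac)
  qed
  have c900: "cc \<ge> 900"
  proof -
    have r0: "0 < real_of_int R"
    proof (rule ccontr)
      assume "\<not> 0 < real_of_int R"
      then have "\<alpha> * R \<le> 0" using \<alpha> by (intro mult_nonneg_nonpos) auto
      then show False using R by simp
    qed
    then have "\<alpha> * R \<le> 1 * real_of_int R" using \<alpha> by (intro mult_right_mono) auto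
    then show ?thesis using R by (simp add: cc_def C)
  qed
  have X0: "X > 0" using \<eta> n0 by (simp add: X_def)
  have "3000 * (cc * X) \<le> U"
    using mult_right_mono[OF \<eta>(2) less_imp_le[OF n0]] by (simp add: X_def U_def cc_def mult_ac)
  moreover have "900 * X \<le> cc * X" using c900 X0 by (intro mult_right_mono) auto
  ultimately have XU: "2700000 * X \<le> U" by linarith
  have \<eta>a: "3000 * real_of_int C * \<eta> \<le> \<alpha>" using \<eta> ab by linarith
  have \<eta>1: "\<eta> \<le> 1"
  proof -
    have "900 * \<eta> \<le> cc * \<eta>" using c900 \<eta> by (intro mult_right_mono) auto
    then show ?thesis using \<eta>a \<eta>(1) \<alpha>(2) unfolding cc_def by linarith
  qed
  have cn: "real c1 \<le> n" "real c2 \<le> n" using c n by linarith+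
  have ec1: "1000000 * cc \<le> \<eta> * real c1"
  proof -
    have "\<eta> * real c1 * real c2 \<le> \<eta> * real c1 * n" using cn \<eta> by (intro mult_left_mono) auto
    then have "1000000 * cc * n \<le> \<eta> * real c1 * n" using c(5) unfolding cc_def by linarith
    then show ?thesis using n0 by simp
  qed
  have ec: "\<eta> * real c1 \<le> real c1" using mult_right_mono[OF \<eta>1, of "real c1"] by simp
  have c1b: "real c1 \<ge> 1000000" "real c2 \<ge> 1000000" using ec ec1 c900 c(4) by linarith+
  have eX: "\<eta> * real c1 \<le> X" using cn \<eta> by (simp add: X_def)
  have Xb: "X \<ge> 1000000" using eX ec1 c900 by linarith
  define w where "w = \<lfloor>X\<rfloor>"
  have w: "real_of_int w \<le> X" "X < real_of_int w + 1" unfolding w_def by linarith+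
  have w0: "0 \<le> w" using X0 by (simp add: w_def)
  define q where "q = \<lfloor>\<eta> * real c1 / 100\<rfloor>"
  have q: "real_of_int q \<le> \<eta> * real c1 / 100" unfolding q_def by linarith
  have q0: "0 \<le> q" using \<eta> by (simp add: q_def)
  have I1: "\<eta> * n / 40 = X / 40" by (simp add: X_def)
  have gap: "real (card A) + real (card B) + U \<le> p" using pp Up by (simp add: algebra_simps)
  have cA: "card A = card (A \<inter> {0..<NI}) + card (A - {0..<NI})" by (rule card_Int_Diff[OF fA])
  have cB: "card B = card (B \<inter> {0..<NJ}) + card (B - {0..<NJ})" by (rule card_Int_Diff[OF fB])
  have NIl: "real (card (A \<inter> {0..<NI})) \<le> NI"
  proof -
    have "card (A \<inter> {0..<NI}) \<le> card {0..<NI}" by (rule card_mono) auto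
    then show ?thesis using N by simp
  qed
  have NJl: "real (card (B \<inter> {0..<NJ})) \<le> NJ"
  proof -
    have "card (B \<inter> {0..<NJ}) \<le> card {0..<NJ}" by (rule card_mono) auto
    then show ?thesis using N by simp
  qed
  have NI2: "real (card A) - X / 40 \<le> NI" "NI \<le> real (card A) + X / 40" using I cA NIl unfolding I1 by linarith+
  have NJ2: "real (card B) - X / 40 \<le> NJ" "NJ \<le> real (card B) + X / 40" using J cB NJl unfolding I1 by linarith+
  define SA where "SA = {a \<in> A. NI + w \<le> a \<and> a < p - w}"
  define SB where "SB = {b \<in> B. NJ + w \<le> b \<and> b < p - w}"
  have SG: "SA \<subseteq> G" "SB \<subseteq> G" using A B by (auto simp: SA_def SB_def)
  have p1: "int (card A + card B) \<le> p" using gap XU X0 by linarith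
  have ne: "A \<noteq> {}" "B \<noteq> {}" using c by auto
  have d8: "real c1 / 16 \<le> real (c1 div 8)" "real c2 / 16 \<le> real (c2 div 8)" "real c1 / 32 \<le> real (c1 div 16)" "real c2 / 32 \<le> real (c2 div 16)"
  proof -
    have "c1 < 8 * (c1 div 8) + 8" "c2 < 8 * (c2 div 8) + 8" "c1 < 16 * (c1 div 16) + 16" "c2 < 16 * (c2 div 16) + 16" by simp_all
    then show "real c1 / 16 \<le> real (c1 div 8)" "real c2 / 16 \<le> real (c2 div 8)" "real c1 / 32 \<le> real (c1 div 16)" "real c2 / 32 \<le> real (c2 div 16)"
      using c1b by linarith+
  qed
  have u8: "real (c1 div 8) \<le> real c1 / 8" "real (c2 div 8) \<le> real c2 / 8" "real (c1 div 16) \<le> real c1 / 16" "real (c2 div 16) \<le> real c2 / 16"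
    by linarith+
  have ccn: "1000000 * n \<le> real c1 * real c2"
  proof -
    have "900 * n \<le> cc * n" using c900 n0 by (intro mult_right_mono) auto
    moreover have "\<eta> * (real c1 * real c2) \<le> 1 * (real c1 * real c2)" using \<eta>1 by (intro mult_right_mono) auto
    ultimately show ?thesis using c(5) n0 unfolding cc_def by linarith
  qed
  show ?thesis
  proof (cases "c1 \<le> 16 * card SA \<or> c2 \<le> 16 * card SB")
    case True
    have NN: "NI + NJ + w \<le> p"
    proof -
      have "real_of_int (NI + NJ + w) \<le> p" using NI2 NJ2 w gap XU X0 by simp
      then show ?thesis by linarith
    qed
    have "\<exists>A1 B1. A1 \<subseteq> A \<inter> {0..<NI} \<and> B1 \<subseteq> B \<inter> {0..<NJ} \<and> real (card A1) \<le> real c1 / 4 \<and> real (card B1) \<le> real c2 / 4 \<and>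
      int (card (A \<inter> {0..<NI}) + card (B \<inter> {0..<NJ})) \<le> int (card (sm A1 B1)) + q"
      unfolding q_def
    proof (rule dense_core[OF _ _ _ \<alpha> n0 R C \<eta>(1) \<eta>a])
      show "NI + NJ \<le> p" using NN w0 by linarith
      show "\<alpha> * n \<le> 2 * NI" "NI \<le> 2 * n" "\<alpha> * n \<le> 2 * NJ" "NJ \<le> 2 * n" using NI2 NJ2 n XU Ua Un X0 unfolding of_int_mult of_int_numeral by linarith+
      show "NI - real (card (A \<inter> {0..<NI})) \<le> 3 * (\<eta> * n)" "NJ - real (card (B \<inter> {0..<NJ})) \<le> 3 * (\<eta> * n)"
        using NI2 NJ2 I J cA cB X0 unfolding I1 X_def[symmetric] by linarith+
      show "c1 \<le> 8 * card (A \<inter> {0..<NI})" "c2 \<le> 8 * card (B \<inter> {0..<NJ})"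
        using c(2,3) cA cB I(1) J(1) n XU Ua X0 unfolding I1 by linarith+
    qed (use cn c(5) in auto)
    then obtain A1 B1 where 1: "A1 \<subseteq> A \<inter> {0..<NI}" "B1 \<subseteq> B \<inter> {0..<NJ}" "real (card A1) \<le> real c1 / 4" "real (card B1) \<le> real c2 / 4"
      "int (card (A \<inter> {0..<NI}) + card (B \<inter> {0..<NJ})) \<le> int (card (sm A1 B1)) + q" by blast
    have "\<exists>A2 B2. A2 \<subseteq> A \<and> B2 \<subseteq> B \<and> real (card A2) \<le> real c1 / 8 \<and> real (card B2) \<le> real c2 / 8 \<and>
      q + int (card (A - {0..<NI})) + int (card (B - {0..<NJ})) \<le> int (card (sm A2 B2 \<inter> {NI + NJ..<p}))"
      using True
    proof
      assume h: "c1 \<le> 16 * card SA"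
      have b0: "real (card (B \<inter> {0..<NJ})) > 0" using J(1) cB n XU Ua X0 unfolding I1 by linarith
      have "\<exists>A' B'. A' \<subseteq> SA \<and> B' \<subseteq> B \<inter> {0..<NJ} \<and> card A' \<le> c1 div 16 \<and> card B' \<le> c2 div 8 \<and>
        w - (NJ - int (card (B \<inter> {0..<NJ}))) \<le> 2 * int (card (sm A' B' \<inter> {NI + NJ..<p}))"
      proof (rule outlier_gain[OF SG(1) _ _ _ _ order_refl N(1) w0])
        have "card SA > 0" using h c(1) by (cases "card SA") auto
        then show "SA \<noteq> {}" by auto
        show "NI + w \<le> a \<and> a < p - w" if "a \<in> SA" for a using that by (simp add: SA_def)
        show "B \<inter> {0..<NJ} \<noteq> {}" using b0 by auto
        show "w \<le> NJ" using NJ2 w n XU Ua X0 by linarith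
        show "w \<le> p - NI - NJ" using NN by linarith
        show "c1 div 16 \<le> card SA" using h by simp
        have "real (c2 div 8) \<le> real (card (B \<inter> {0..<NJ}))" using u8 c(3) cB J(1) n XU Ua X0 unfolding I1 by linarith
        then show "c2 div 8 \<le> card (B \<inter> {0..<NJ})" by linarith
        have "real c1 / 32 * (real c2 / 16) \<le> real (c1 div 16) * real (c2 div 8)" using d8 by (intro mult_mono) auto
        then have "3 * real (card (B \<inter> {0..<NJ})) \<le> real (c1 div 16) * real (c2 div 8)" using ccn cB n n0 by simp
        then have "real (3 * card (B \<inter> {0..<NJ})) \<le> real ((c1 div 16) * (c2 div 8))" by simp
        then show "3 * card (B \<inter> {0..<NJ}) \<le> (c1 div 16) * (c2 div 8)" by (simp only: of_nat_le_iff)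
      qed auto
      then obtain A2 B2 where 2: "A2 \<subseteq> SA" "B2 \<subseteq> B \<inter> {0..<NJ}" "card A2 \<le> c1 div 16" "card B2 \<le> c2 div 8"
        "w - (NJ - int (card (B \<inter> {0..<NJ}))) \<le> 2 * int (card (sm A2 B2 \<inter> {NI + NJ..<p}))" by blast
      have "X - 1 - X / 20 \<le> 2 * real (card (sm A2 B2 \<inter> {NI + NJ..<p}))" using 2(5) w NJ2 cB J(1) unfolding I1 by linarith
      then have "q + int (card (A - {0..<NI})) + int (card (B - {0..<NJ})) \<le> int (card (sm A2 B2 \<inter> {NI + NJ..<p}))"
        using q eX Xb I(1) J(1) unfolding I1 by linarith
      moreover have "real (card A2) \<le> real c1 / 8" "real (card B2) \<le> real c2 / 8" using 2(3,4) u8 by linarith+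
      moreover have "A2 \<subseteq> A" "B2 \<subseteq> B" using 2 by (auto simp: SA_def)
      ultimately show ?thesis by blast
    next
      assume h: "c2 \<le> 16 * card SB"
      have b0: "real (card (A \<inter> {0..<NI})) > 0" using I(1) cA n XU Ua X0 unfolding I1 by linarith
      have "\<exists>A' B'. A' \<subseteq> SB \<and> B' \<subseteq> A \<inter> {0..<NI} \<and> card A' \<le> c2 div 16 \<and> card B' \<le> c1 div 8 \<and>
        w - (NI - int (card (A \<inter> {0..<NI}))) \<le> 2 * int (card (sm A' B' \<inter> {NJ + NI..<p}))"
      proof (rule outlier_gain[OF SG(2) _ _ _ _ order_refl N(2) w0])
        have "card SB > 0" using h c(1,4) by (cases "card SB") auto
        then show "SB \<noteq> {}" by auto
        show "NJ + w \<le> a \<and> a < p - w" if "a \<in> SB" for a using that by (simp add: SB_def)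
        show "A \<inter> {0..<NI} \<noteq> {}" using b0 by auto
        show "w \<le> NI" using NI2 w n XU Ua X0 by linarith
        show "w \<le> p - NJ - NI" using NN by linarith
        show "c2 div 16 \<le> card SB" using h by simp
        have "real (c1 div 8) \<le> real (card (A \<inter> {0..<NI}))" using u8 c(2) cA I(1) n XU Ua X0 unfolding I1 by linarith
        then show "c1 div 8 \<le> card (A \<inter> {0..<NI})" by linarith
        have "real c2 / 32 * (real c1 / 16) \<le> real (c2 div 16) * real (c1 div 8)" using d8 by (intro mult_mono) auto
        then have "3 * real (card (A \<inter> {0..<NI})) \<le> real (c2 div 16) * real (c1 div 8)" using ccn cA n n0 by (simp add: mult_ac)
        then have "real (3 * card (A \<inter> {0..<NI})) \<le> real ((c2 div 16) * (c1 div 8))" by simp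
        then show "3 * card (A \<inter> {0..<NI}) \<le> (c2 div 16) * (c1 div 8)" by (simp only: of_nat_le_iff)
      qed auto
      then obtain B2 A2 where 2: "B2 \<subseteq> SB" "A2 \<subseteq> A \<inter> {0..<NI}" "card B2 \<le> c2 div 16" "card A2 \<le> c1 div 8"
        "w - (NI - int (card (A \<inter> {0..<NI}))) \<le> 2 * int (card (sm A2 B2 \<inter> {NI + NJ..<p}))"
        unfolding sm_commute[of A2] by (metis add.commute sm_commute)
      have "X - 1 - X / 20 \<le> 2 * real (card (sm A2 B2 \<inter> {NI + NJ..<p}))" using 2(5) w NI2 cA I(1) unfolding I1 by linarith
      then have "q + int (card (A - {0..<NI})) + int (card (B - {0..<NJ})) \<le> int (card (sm A2 B2 \<inter> {NI + NJ..<p}))"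
        using q eX Xb I(1) J(1) unfolding I1 by linarith
      moreover have "real (card A2) \<le> real c1 / 8" "real (card B2) \<le> real c2 / 8" using 2(3,4) u8 by linarith+
      moreover have "A2 \<subseteq> A" "B2 \<subseteq> B" using 2 by (auto simp: SB_def)
      ultimately show ?thesis by blast
    qed
    then obtain A2 B2 where 2: "A2 \<subseteq> A" "B2 \<subseteq> B" "real (card A2) \<le> real c1 / 8" "real (card B2) \<le> real c2 / 8"
      "q + int (card (A - {0..<NI})) + int (card (B - {0..<NJ})) \<le> int (card (sm A2 B2 \<inter> {NI + NJ..<p}))" by blast
    have "NI + NJ \<le> p" using NN w0 by linarith
    then have "card A + card B \<le> card (sm (A1 \<union> A2) (B1 \<union> B2))" by (rule combine_outliers[OF A B N _ 1(1,2,5) 2(5)])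
    then show ?thesis
      using 1 2 card_Un_le[of A1 A2] card_Un_le[of B1 B2]
      by (intro good_fill[OF A B p1 ne c(2,3), of "A1 \<union> A2" "B1 \<union> B2" 0]) auto
  next
    case False
    define A'' where "A'' = tr w A"
    define B'' where "B'' = tr w B"
    define MI where "MI = NI + 2 * w"
    define MJ where "MJ = NJ + 2 * w"
    have AG: "A'' \<subseteq> G" "B'' \<subseteq> G" by (simp_all add: A''_def B''_def)
    have cAB: "card A'' = card A" "card B'' = card B" using A B by (simp_all add: A''_def B''_def card_tr)
    have oA: "card (A'' - {0..<MI}) \<le> card SA" unfolding A''_def MI_def SA_def by (rule card_tr_outside[OF A w0 N(1)])
    have oB: "card (B'' - {0..<MJ}) \<le> card SB" unfolding B''_def MJ_def SB_def by (rule card_tr_outside[OF B w0 N(2)])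
    have "card SA \<le> card (A - {0..<NI})" using fA w0 by (intro card_mono) (auto simp: SA_def)
    then have oA2: "real (card (A'' - {0..<MI})) \<le> X / 40" using oA I(1) unfolding I1 by linarith
    have "card SB \<le> card (B - {0..<NJ})" using fB w0 by (intro card_mono) (auto simp: SB_def)
    then have oB2: "real (card (B'' - {0..<MJ})) \<le> X / 40" using oB J(1) unfolding I1 by linarith
    define A0 where "A0 = A'' \<inter> {0..<MI}"
    define B0 where "B0 = B'' \<inter> {0..<MJ}"
    have cA0: "card A = card A0 + card (A'' - {0..<MI})"
      unfolding cAB(1)[symmetric] A0_def by (rule card_Int_Diff) (simp add: A''_def)
    have cB0: "card B = card B0 + card (B'' - {0..<MJ})"
      unfolding cAB(2)[symmetric] B0_def by (rule card_Int_Diff) (simp add: B''_def)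
    have M: "real_of_int MI = NI + 2 * real_of_int w" "real_of_int MJ = NJ + 2 * real_of_int w" by (simp_all add: MI_def MJ_def)
    have M0: "0 \<le> MI" "0 \<le> MJ" using N w0 by (simp_all add: MI_def MJ_def)
    have MMr: "real_of_int MI + real_of_int MJ + U / 2 \<le> p" using M NI2 NJ2 w gap XU X0 by linarith
    then have MM: "MI + MJ \<le> p" using XU X0 by linarith
    have "\<exists>A1 B1. A1 \<subseteq> A0 \<and> B1 \<subseteq> B0 \<and> real (card A1) \<le> real c1 / 4 \<and> real (card B1) \<le> real c2 / 4 \<and>
      int (card A0 + card B0) \<le> int (card (sm A1 B1)) + q"
      unfolding q_def
    proof (rule dense_core[OF _ _ MM \<alpha> n0 R C \<eta>(1) \<eta>a])
      show "\<alpha> * n \<le> 2 * MI" "MI \<le> 2 * n" "\<alpha> * n \<le> 2 * MJ" "MJ \<le> 2 * n" using M w NI2 NJ2 n XU Ua Un X0 Xb unfolding of_int_mult of_int_numeral by linarith+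
      show "MI - real (card A0) \<le> 3 * (\<eta> * n)" "MJ - real (card B0) \<le> 3 * (\<eta> * n)"
        using M w NI2 NJ2 oA2 oB2 cA0 cB0 X0 unfolding X_def[symmetric] by linarith+
      show "c1 \<le> 8 * card A0" "c2 \<le> 8 * card B0"
        using c(2,3) cA0 cB0 oA2 oB2 n XU Ua X0 by linarith+
    qed (use cn c(5) in \<open>auto simp: A0_def B0_def\<close>)
    then obtain A1 B1 where 1: "A1 \<subseteq> A0" "B1 \<subseteq> B0" "real (card A1) \<le> real c1 / 4" "real (card B1) \<le> real c2 / 4"
      "int (card A0 + card B0) \<le> int (card (sm A1 B1)) + q" by blast
    define z where "z = \<lfloor>U / 16\<rfloor>"
    have z: "real_of_int z \<le> U / 16" "U / 16 < real_of_int z + 1" unfolding z_def by linarith+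
    have U0: "U / 32 \<le> real_of_int z" using z XU Xb by linarith
    have "\<exists>A' B'. A' \<subseteq> A'' \<and> B' \<subseteq> B'' \<and> card A' \<le> card A1 + 2 + c1 div 8 \<and> card B' \<le> card B1 + card (B'' - {0..<MJ}) \<and>
      int (card A0 + card B'') \<le> int (card (sm A' B')) + q"
    proof (rule few_outliers[OF AG M0 MM, folded A0_def B0_def, OF _ _ 1(1,2,5)])
      have "real (card A0) > 0" "real (card B0) > 0" using cA0 cB0 oA2 oB2 n XU Ua X0 by linarith+
      then show "A0 \<noteq> {}" "B0 \<noteq> {}" by auto
      show "0 \<le> z" using U0 XU X0 by linarith
      show "z + (MI - int (card A0)) + int (card (B'' - {0..<MJ})) \<le> int (card A0)"
        using z M w NI2 cA0 oA2 oB2 XU X0 n Ua by linarith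
      show "2 * (z + (MI - int (card A0)) + int (card (B'' - {0..<MJ}))) \<le> p - MI - MJ"
      proof -
        define y where "y = z + (MI - int (card A0)) + int (card (B'' - {0..<MJ}))"
        have "y \<le> U / 4" using z M w NI2 cA0 oA2 oB2 XU X0 by (simp add: y_def)
        then have "2 * y \<le> p - MI - MJ" using MMr by linarith
        then show ?thesis by (simp add: y_def)
      qed
      have "real (c1 div 8) \<le> real (card A0)" using u8 c(2) cA0 oA2 n XU Ua X0 by linarith
      then show "c1 div 8 \<le> card A0" by linarith
      show "6 * int (card A0) \<le> int (c1 div 8) * z"
      proof -
        have "real c1 / 16 * (U / 32) \<le> real (c1 div 8) * real_of_int z" using d8 U0 XU X0 by (intro mult_mono) auto
        moreover have "1000000 * n \<le> real c1 * U"
        proof -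
          have "900 * n \<le> cc * n" using c900 n0 by (intro mult_right_mono) auto
          moreover have "1000000 * cc * n \<le> (\<eta> * real c1) * n" using ec1 n0 by (intro mult_right_mono) auto
          moreover have "real c1 * X \<le> real c1 * U" using XU X0 by (intro mult_left_mono) auto
          moreover have "real c1 * X = (\<eta> * real c1) * n" by (simp add: X_def)
          ultimately show ?thesis using n0 by linarith
        qed
        moreover have "real c1 / 16 * (U / 32) = real c1 * U / 512" by simp
        moreover have "real (card A0) \<le> n" using cA0 n by linarith
        ultimately have "6 * real (card A0) \<le> real (c1 div 8) * real_of_int z" using n0 by linarith
        then have "real_of_int (6 * int (card A0)) \<le> real_of_int (int (c1 div 8) * z)" by simp
        then show ?thesis by (simp only: of_int_le_iff)
      qed
      show "2 * int (card (B'' - {0..<MJ})) \<le> z" using oB2 U0 XU X0 by linarith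
    qed
    then obtain A' B' where 2: "A' \<subseteq> A''" "B' \<subseteq> B''" "card A' \<le> card A1 + 2 + c1 div 8" "card B' \<le> card B1 + card (B'' - {0..<MJ})"
      "int (card A0 + card B'') \<le> int (card (sm A' B')) + q" by blast
    \<comment> \<open>What is left to the repair: one sum for each element of \<open>A''\<close>
      outside its interval, and the deficit \<open>q\<close> of the main parts.\<close>
    define k where "k = card (A'' - {0..<MI}) + nat q"
    have kr: "real k \<le> real c1 / 16 + real c1 / 100"
    proof -
      have "real k = real (card (A'' - {0..<MI})) + real_of_int q" using q0 by (simp add: k_def)
      moreover have "real (card SA) \<le> real c1 / 16" using False by linarith
      ultimately show ?thesis using oA q ec by linarith
    qed
    have "good A'' B'' c1 c2"
    proof (rule good_fill[OF AG, where A' = A' and B' = B' and k = k])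
      show "int (card A'' + card B'') \<le> p" using p1 cAB by simp
      show "A'' \<noteq> {}" "B'' \<noteq> {}" using cAB ne fA fB by auto
      show "c1 \<le> card A''" "c2 \<le> card B''" using cAB c by auto
      show "card A' + k \<le> c1" using 2(3) 1(3) u8 kr c1b by linarith
      have "real (card SB) \<le> real c2 / 16" using False by linarith
      then show "card B' + k \<le> c2" using 2(4) 1(4) oB kr c1b c(4) by linarith
      show "card A'' + card B'' \<le> card (sm A' B') + 1 + k" using 2(5) cA0 cAB q0 unfolding k_def by linarith
    qed (use 2 in auto)
    then show ?thesis unfolding A''_def B''_def by (rule good_tr[OF A B])
  qed
qed

end

section \<open>Conclusion\<close>

context zp
begin

text \<open>The conclusion of \<open>structure_explicit\<close> with its constants as parameters, so
  that \<delta> and \<open>n0\<close> can be fixed before the prime is chosen.\<close>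

definition structured :: "real \<Rightarrow> real \<Rightarrow> real \<Rightarrow> real \<Rightarrow> bool" where
  "structured \<alpha> \<epsilon> \<delta> n0 \<longleftrightarrow> (\<forall>X Y t e. X \<subseteq> G \<longrightarrow> Y \<subseteq> G \<longrightarrow> card X \<le> card Y \<longrightarrow> int (2 * card X + card Y) \<le> p \<longrightarrow>
    \<alpha> * card Y \<le> card X \<longrightarrow> pol t X Y \<le> t * (card X + card Y + e) \<longrightarrow> t > 0 \<longrightarrow> real t \<le> \<delta> * card Y \<longrightarrow>
    real e \<le> \<delta> * card Y \<longrightarrow> n0 \<le> card Y \<longrightarrow>
    (\<exists>k s N. \<not> p dvd k \<and> 0 \<le> N \<and> N \<le> p \<and> real (card (tr s (dil k Y) - {0..<N})) \<le> \<epsilon> * card Y \<and>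
      real_of_int N \<le> (1 + \<epsilon>) * card Y))"

lemma rr_dil:
  assumes k: "\<not> p dvd k" and X: "X \<subseteq> G" and Y: "Y \<subseteq> G"
  shows "rr (dil k X) (dil k Y) (k * y) = rr X Y y"
proof -
  obtain l where kl: "(k * l) mod p = 1" using ex_inverse[OF k] by blast
  have e: "(l * ((k * y - a) mod p)) mod p = (y - (l * a) mod p) mod p" for a
  proof -
    have "(l * ((k * y - a) mod p)) mod p = ((k * (l * y)) mod p - l * a) mod p" by (simp add: mod_simps algebra_simps)
    also have "\<dots> = (y mod p - l * a) mod p" by (simp only: mult_inverse_mod[OF kl])
    finally show ?thesis by (simp add: mod_simps)
  qed
  have "{a \<in> dil k X. (k * y - a) mod p \<in> dil k Y} = dil k {a \<in> X. (y - a) mod p \<in> Y}"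
  proof (rule Set.set_eqI)
    fix a
    have "{a \<in> X. (y - a) mod p \<in> Y} \<subseteq> G" using X by auto
    then show "a \<in> {a \<in> dil k X. (k * y - a) mod p \<in> dil k Y} \<longleftrightarrow> a \<in> dil k {a \<in> X. (y - a) mod p \<in> Y}"
      using p_gt1 by (simp add: mem_dil[OF kl X] mem_dil[OF kl Y] mem_dil[OF kl] e)
  qed
  then show ?thesis unfolding rr_def using card_dil[OF k, of "{a \<in> X. (y - a) mod p \<in> Y}"] X by auto
qed

lemma pol_dil:
  assumes k: "\<not> p dvd k" and X: "X \<subseteq> G" and Y: "Y \<subseteq> G"
  shows "pol t (dil k X) (dil k Y) = pol t X Y"
proof -
  have "dil k G = G" by (rule card_subset_eq) (simp_all add: card_dil[OF k])
  then have "(\<Sum>x\<in>G. min t (rr (dil k X) (dil k Y) x)) = (\<Sum>x\<in>(\<lambda>y. (k * y) mod p) ` G. min t (rr (dil k X) (dil k Y) x))"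
    by (simp add: dil_def)
  also have "\<dots> = (\<Sum>y\<in>G. min t (rr (dil k X) (dil k Y) ((k * y) mod p)))"
    by (subst sum.reindex[OF inj_dil[OF k]]) simp
  also have "\<dots> = (\<Sum>y\<in>G. min t (rr X Y y))" unfolding rr_mod rr_dil[OF k X Y] ..
  finally show ?thesis by (simp add: pol_def)
qed

text \<open>Sampling reaches \<open>pol t A B / t\<close> sums up to the factor
  \<open>m / (m + 3)\<close>, and for a pair that is not good this is at most
  \<open>card A + card B\<close>. A large \<open>cc\<close> makes \<open>m\<close> large and turns
  the factor into the additive error \<open>\<delta> * n\<close>.\<close>

lemma not_good_pol:
  fixes n cc \<delta> :: real
  assumes A: "A \<subseteq> G" and B: "B \<subseteq> G" and ne: "A \<noteq> {}" "B \<noteq> {}" and p1: "int (card A + card B) \<le> p"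
    and c: "c1 \<le> card A" "c2 \<le> card B" "cc * n \<le> real c1 * real c2" and n: "real (card A) \<le> n" "real (card B) \<le> n"
    and ng: "\<not> good A B c1 c2" and t: "t > 0" "6 * n \<le> cc * \<delta> * real t" and pos: "0 < cc" "0 < \<delta>"
  shows "real (pol t A B) \<le> real t * (real (card A) + real (card B) + \<delta> * n)"
proof -
  have fA: "finite A" and fB: "finite B" using A B finite_sub_G by auto
  have ab: "real (card A) > 0" "real (card B) > 0" using ne fA fB by (auto simp: card_gt_0_iff)
  have n0: "n > 0" using ab n by linarith
  have t0: "real t > 0" using t by simp
  define m where "m = real c1 * real c2 * real t / (real (card A) * real (card B))"
  obtain A' B' where h: "A' \<subseteq> A" "B' \<subseteq> B" "card A' \<le> c1" "card B' \<le> c2"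
      "m / (m + 3) * ((\<Sum>x\<in>G. min (real t) (real (rr A B x))) / real t) \<le> real (card (sm A' B' \<inter> G))"
    using random_subsets_truncated[OF A B order_refl c(1,2) ne t0] unfolding m_def by blast
  have "(\<Sum>x\<in>G. min (real t) (real (rr A B x))) = real (pol t A B)" by (simp add: pol_def of_nat_min)
  moreover have "sm A' B' \<inter> G = sm A' B'" using sm_sub by blast
  ultimately have h5: "m / (m + 3) * (real (pol t A B) / real t) \<le> real (card (sm A' B'))" using h(5) by simp
  have "\<not> card A + card B \<le> card (sm A' B') + 1 + 0"
  proof
    assume a: "card A + card B \<le> card (sm A' B') + 1 + 0"
    have "good A B c1 c2" by (rule good_fill[OF A B p1 ne c(1,2) h(1,2) _ _ a]) (use h in auto)
    then show False using ng by simp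
  qed
  then have sml: "real (card (sm A' B')) \<le> real (card A) + real (card B)" by linarith
  have "0 < cc * n * real t" using pos n0 t0 by simp
  also have "\<dots> \<le> real c1 * real c2 * real t" using c(3) t0 by (intro mult_right_mono) auto
  finally have m0: "m > 0" using ab by (simp add: m_def)
  define q where "q = real (pol t A B) / real t"
  define s where "s = real (card A) + real (card B)"
  have "m / (m + 3) * q \<le> s" using h5 sml by (simp add: q_def s_def)
  then have "q * m \<le> s * (m + 3)" using m0 by (simp add: field_simps)
  then have "q \<le> s + 3 * s / m" using m0 by (simp add: field_simps)
  moreover have "3 * s / m \<le> \<delta> * n"
  proof -
    have "3 * s * (real (card A) * real (card B)) \<le> 3 * (2 * n) * (n * n)"
      using n ab n0 by (intro mult_mono) (auto simp: s_def)
    also have "\<dots> = (6 * n) * (n * n)" by simp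
    also have "\<dots> \<le> (cc * \<delta> * real t) * (n * n)" using t(2) n0 by (intro mult_right_mono) auto
    also have "\<dots> = (cc * n) * (\<delta> * n * real t)" by simp
    also have "\<dots> \<le> (real c1 * real c2) * (\<delta> * n * real t)" using c(3) pos n0 t0 by (intro mult_right_mono) auto
    also have "\<dots> = \<delta> * n * (real c1 * real c2 * real t)" by simp
    also have "\<dots> = \<delta> * n * m * (real (card A) * real (card B))" using ab by (simp add: m_def)
    finally have "3 * s \<le> \<delta> * n * m" using ab by (simp add: mult_le_cancel_right)
    then show ?thesis using m0 by (simp add: field_simps)
  qed
  ultimately have "q \<le> s + \<delta> * n" by linarith
  then show ?thesis using t0 by (simp add: q_def s_def field_simps)
qed

text \<open>
  The uncrossing argument needs a set \<open>X\<close> with \<open>2|X| + |Y| \<le> p\<close>. If \<open>A\<close> is too large for this, the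
  negated set of unpopular sums takes its place: \<open>A\<close>, \<open>B\<close> and this set play symmetric roles.
\<close>

lemma pol_complement:
  assumes A: "A \<subseteq> G" and B: "B \<subseteq> G" and U: "U \<subseteq> G" "\<And>x. x \<in> U \<Longrightarrow> rr A B x \<le> t'"
  shows "int (pol t (dil (- 1) U) A) \<le> int t * (p - int (card B)) + int (card U * t')"
proof -
  have k: "\<not> p dvd - 1" using p_gt1 by (simp add: zdvd_not_zless)
  have kl: "(- 1 * - 1) mod p = 1" using p_gt1 by simp
  define N where "N = dil (- 1) B"
  define C where "C = dil (- 1) U"
  have NG: "N \<subseteq> G" and CG: "C \<subseteq> G" by (simp_all add: N_def C_def)
  have cN: "card N = card B" unfolding N_def by (rule card_dil[OF k B])
  have fU: "finite U" and fA: "finite A" using U A finite_sub_G by auto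
  \<comment> \<open>An equation \<open>- b = a + (- x)\<close> with \<open>x\<close> in
    \<open>U\<close> says \<open>x = a + b\<close>. The representations of \<open>- b\<close> thus
    correspond to the sums with \<open>b\<close> that are unpopular.\<close>
  have le: "rr C A (- b) \<le> card (tr b A \<inter> U)" for b
  proof -
    have iff: "(- b - a) mod p \<in> C \<longleftrightarrow> (a + b) mod p \<in> U" for a
    proof -
      have "(- 1 * ((- b - a) mod p)) mod p = (a + b) mod p" by (simp add: mod_simps algebra_simps)
      then show ?thesis unfolding C_def mem_dil[OF kl U(1)] using mod_simps p_gt1 by simp
    qed
    define Q where "Q = {a \<in> A. (- b - a) mod p \<in> C}"
    have QA: "Q \<subseteq> A" by (auto simp: Q_def)
    have "(\<lambda>a. (a + b) mod p) ` Q \<subseteq> tr b A \<inter> U" using mod_add_in_tr[OF A] iff by (auto simp: Q_def)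
    then have "card ((\<lambda>a. (a + b) mod p) ` Q) \<le> card (tr b A \<inter> U)" by (intro card_mono) auto
    moreover have "inj_on (\<lambda>a. (a + b) mod p) Q"
    proof (rule inj_onI)
      fix a a' assume a: "a \<in> Q" "a' \<in> Q" "(a + b) mod p = (a' + b) mod p"
      have "a \<in> G" "a' \<in> G" using a QA A by blast+
      then have "a + b = a' + b" by (intro mod_eq_imp_eq[OF a(3)]) auto
      then show "a = a'" by simp
    qed
    ultimately have "card Q \<le> card (tr b A \<inter> U)" by (simp add: card_image)
    then show ?thesis unfolding rr_commute[OF CG A] by (simp add: rr_def Q_def)
  qed
  have "(\<Sum>x\<in>N. rr C A x) = (\<Sum>b\<in>B. rr C A ((- 1 * b) mod p))"
    unfolding N_def dil_def by (subst sum.reindex[OF inj_on_subset[OF inj_dil[OF k] B]]) simp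
  also have "\<dots> = (\<Sum>b\<in>B. rr C A (- b))" unfolding rr_mod by simp
  also have "\<dots> \<le> (\<Sum>b\<in>B. card (tr b A \<inter> U))" by (rule sum_mono) (rule le)
  also have "\<dots> = (\<Sum>x\<in>U. rr B A x)" by (rule sum_rr_pairs[OF B A U(1), symmetric])
  also have "\<dots> \<le> (\<Sum>x\<in>U. t')" using U(2) by (intro sum_mono) (simp add: rr_commute[OF B A])
  finally have 1: "(\<Sum>x\<in>N. rr C A x) \<le> card U * t'" by simp
  \<comment> \<open>Only the \<open>p - card B\<close> values outside \<open>- B\<close> are charged
    with the full level \<open>t\<close>. On \<open>- B\<close> all counts together are the
    representations of elements of \<open>U\<close>, at most \<open>t'\<close> for each.\<close>
  have "pol t C A = (\<Sum>x\<in>G - N. min t (rr C A x)) + (\<Sum>x\<in>N. min t (rr C A x))"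
    unfolding pol_def by (rule sum.subset_diff[OF NG]) simp
  also have "\<dots> \<le> (\<Sum>x\<in>G - N. t) + (\<Sum>x\<in>N. rr C A x)" by (intro add_mono sum_mono) auto
  finally have "pol t C A \<le> card (G - N) * t + card U * t'" using 1 by simp
  then have "int (pol t C A) \<le> int (card (G - N)) * int t + int (card U * t')" by (metis of_nat_add of_nat_le_iff of_nat_mult)
  moreover have "int (card (G - N)) = p - int (card B)"
  proof -
    have "card (G - N) = card G - card N" by (rule card_Diff_subset) (use NG finite_sub_G in auto)
    moreover have "card N \<le> card G" using NG by (intro card_mono) auto
    ultimately show ?thesis using cN p_gt1 by (simp add: of_nat_diff)
  qed
  ultimately show ?thesis by (simp add: C_def mult.commute)
qed

text \<open>Let \<open>g\<close> be the number of residues that remain beyond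
  \<open>card A + card B\<close>. If \<open>card A \<le> g\<close>, the structural statement applies
  to \<open>A\<close> and \<open>B\<close> directly and gives an interval for \<open>B\<close>.
  Otherwise it applies to about \<open>g\<close> negated unpopular sums, paired with
  \<open>A\<close>, and gives an interval for \<open>A\<close>. The other set follows by
  \<open>other_interval\<close> in both cases.\<close>

lemma near_interval_pair:
  fixes \<alpha> \<beta> \<epsilon> \<delta> \<delta>0 n n0 :: real
  assumes \<alpha>: "0 < \<alpha>" "\<alpha> \<le> 1" and \<beta>: "0 < \<beta>" "\<beta> \<le> 1" and \<epsilon>: "0 < \<epsilon>" "40 * \<epsilon> \<le> \<alpha> * \<beta>"
    and st: "structured (min \<alpha> (\<beta> / 2)) \<epsilon> \<delta>0 n0" and \<delta>: "0 < \<delta>" "4 * \<delta> \<le> \<delta>0 * \<alpha>" "\<delta> \<le> \<beta> / 2" "\<delta> \<le> \<epsilon>" "0 < \<delta>0"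
    and A: "A \<subseteq> G" and B: "B \<subseteq> G" and AB: "card A \<le> card B" "n = real (card B)" "\<alpha> * n \<le> real (card A)"
    and pp: "real (card A) + real (card B) \<le> (1 - \<beta>) * p"
    and pol: "real (pol t A B) \<le> real t * (real (card A) + real (card B) + \<delta> * n)" and t: "t > 0" "real t \<le> \<delta>\<^sup>2 * n / 4"
    and big: "4 \<le> \<delta>\<^sup>2 * n" "n0 \<le> \<alpha> * n" "1 \<le> \<epsilon> * n"
  shows "\<exists>k s s' NI NJ. \<not> p dvd k \<and> 0 \<le> NI \<and> 0 \<le> NJ \<and>
    real (card (tr s (dil k A) - {0..<NI})) \<le> 14 * \<epsilon> * n \<and> real_of_int NI \<le> card A + 14 * \<epsilon> * n \<and>
    real (card (tr s' (dil k B) - {0..<NJ})) \<le> 14 * \<epsilon> * n \<and> real_of_int NJ \<le> card B + 14 * \<epsilon> * n"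
proof -
  have fA: "finite A" and fB: "finite B" using A B finite_sub_G by auto
  have n_pos: "n > 0"
  proof (rule ccontr)
    assume "\<not> 0 < n"
    then have "n = 0" using AB(2) by simp
    then show False using big by simp
  qed
  have \<delta>1: "\<delta> \<le> 1 / 2" using \<delta> \<beta> by linarith
  have t\<delta>: "real t \<le> \<delta> * n"
  proof -
    have "\<delta>\<^sup>2 \<le> \<delta> * 1" unfolding power2_eq_square using \<delta> \<delta>1 by (intro mult_left_mono) auto
    then have "\<delta>\<^sup>2 * n \<le> \<delta> * n" using n_pos by (intro mult_right_mono) auto
    moreover have "0 \<le> \<delta> * n" using \<delta> n_pos by simp
    ultimately show ?thesis using t by linarith
  qed
  have \<epsilon>n: "\<delta> * n \<le> \<epsilon> * n" using \<delta> n_pos by simp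
  have ab: "\<alpha> * \<beta> \<le> \<alpha>" using \<alpha> \<beta> by (simp add: mult_left_le)
  have e20: "20 * \<epsilon> * n \<le> \<alpha> * n" using \<epsilon> ab n_pos by (intro mult_right_mono) auto
  have nA: "real (card A) \<le> n" using AB by simp
  have ep: "real (card A) + real (card B) + \<epsilon> * n < p"
  proof -
    have "(40 * \<epsilon>) * n \<le> (\<alpha> * \<beta>) * n" using \<epsilon> n_pos by (intro mult_right_mono) auto
    also have "\<dots> = \<beta> * (\<alpha> * n)" by simp
    also have "\<dots> \<le> \<beta> * p"
    proof -
      have "card A \<le> card G" by (rule card_mono) (use A in auto)
      then have "real (card A) \<le> p" using p_gt1 by simp
      then show ?thesis using \<beta> AB by (intro mult_left_mono) auto
    qed
    finally have "40 * (\<epsilon> * n) \<le> \<beta> * p" by simp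
    moreover have "0 < \<epsilon> * n" using \<epsilon> n_pos by simp
    moreover have "real (card A) + real (card B) + \<beta> * p \<le> p" using pp by (simp add: algebra_simps)
    ultimately show ?thesis by linarith
  qed
  have pol\<epsilon>: "real (pol t A B) \<le> real t * (card A + card B + \<epsilon> * n)"
  proof -
    have "real t * (real (card A) + real (card B) + \<delta> * n) \<le> real t * (card A + card B + \<epsilon> * n)"
      using \<epsilon>n by (intro mult_left_mono) auto
    then show ?thesis using pol by linarith
  qed
  have t\<epsilon>: "real t \<le> \<epsilon> * n" using t\<delta> \<epsilon>n by linarith
  have weak: "3 * \<epsilon> * n \<le> 14 * \<epsilon> * n" "\<epsilon> * n \<le> 14 * \<epsilon> * n" using \<epsilon> n_pos by simp_all
  define g where "g = p - int (card A) - int (card B)"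
  show ?thesis
  proof (cases "int (card A) \<le> g")
    case True
    define e where "e = nat \<lceil>\<delta> * n\<rceil>"
    have dn: "0 \<le> \<delta> * n" using \<delta> n_pos by simp
    have "4 \<le> \<delta> * n"
    proof -
      have "\<delta>\<^sup>2 * n \<le> \<delta> * n" using \<delta> \<delta>1 n_pos by (intro mult_right_mono) (auto simp: power2_eq_square mult_left_le)
      then show ?thesis using big by linarith
    qed
    moreover have "real e = of_int \<lceil>\<delta> * n\<rceil>" using dn by (simp add: e_def)
    ultimately have e: "\<delta> * n \<le> real e" "real e \<le> 2 * (\<delta> * n)" by linarith+
    have d0: "4 * (\<delta> * n) \<le> \<delta>0 * n"
    proof -
      have "\<delta>0 * \<alpha> \<le> \<delta>0 * 1" using \<alpha> \<delta> by (intro mult_left_mono) auto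
      then have "4 * \<delta> \<le> \<delta>0" using \<delta> by linarith
      then have "(4 * \<delta>) * n \<le> \<delta>0 * n" using n_pos by (intro mult_right_mono) auto
      then show ?thesis by simp
    qed
    have "\<exists>k s N. \<not> p dvd k \<and> 0 \<le> N \<and> N \<le> p \<and> real (card (tr s (dil k B) - {0..<N})) \<le> \<epsilon> * card B \<and>
      real_of_int N \<le> (1 + \<epsilon>) * card B"
    proof (rule st[unfolded structured_def, rule_format, of A B t e, OF A B AB(1)])
      show "int (2 * card A + card B) \<le> p" using True by (simp add: g_def)
      have "min \<alpha> (\<beta> / 2) * n \<le> \<alpha> * n" using n_pos by (intro mult_right_mono) auto
      then show "min \<alpha> (\<beta> / 2) * real (card B) \<le> real (card A)" using AB by simp
      have "real t * (real (card A) + real (card B) + \<delta> * n) \<le> real t * (real (card A) + real (card B) + real e)"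
        using e by (intro mult_left_mono) auto
      then have "real (pol t A B) \<le> real (t * (card A + card B + e))" using pol by simp
      then show "pol t A B \<le> t * (card A + card B + e)" by (simp only: of_nat_le_iff)
      show "real t \<le> \<delta>0 * real (card B)" "real e \<le> \<delta>0 * real (card B)" using t\<delta> e d0 dn AB(2) by auto
      show "n0 \<le> real (card B)" using big AB(1-3) by linarith
    qed (use t in auto)
    then obtain k s N where k: "\<not> p dvd k" "0 \<le> N" "N \<le> p" "real (card (tr s (dil k B) - {0..<N})) \<le> \<epsilon> * n"
        "real_of_int N \<le> (1 + \<epsilon>) * n" using AB(2) by auto
    define B' where "B' = tr s (dil k B)"
    have cB': "card B' = card B" unfolding B'_def by (simp add: card_tr card_dil[OF k(1) B])
    have cA': "card (dil k A) = card A" by (rule card_dil[OF k(1) A])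
    have pe: "pol t (dil k A) B' = pol t A B" unfolding B'_def by (simp add: pol_tr_right pol_dil[OF k(1) A B])
    have NB: "real_of_int N \<le> card B + \<epsilon> * n" using k(5) AB(2) by (simp add: algebra_simps)
    have "\<exists>s N'. 0 \<le> N' \<and> N' \<le> p \<and> real (card (tr s (dil k A) - {0..<N'})) \<le> 14 * \<epsilon> * n \<and>
      real_of_int N' \<le> card (dil k A) + 3 * \<epsilon> * n"
    proof (rule other_interval[of "dil k A" B' N \<epsilon> n t])
      show "real (card (B' - {0..<N})) \<le> \<epsilon> * n" using k(4) by (simp add: B'_def)
      show "real_of_int N \<le> card B' + \<epsilon> * n" using NB cB' by simp
      show "real (pol t (dil k A) B') \<le> real t * (card (dil k A) + card B' + \<epsilon> * n)" using pol\<epsilon> pe cA' cB' by simp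
      show "20 * \<epsilon> * n \<le> card (dil k A)" "20 * \<epsilon> * n \<le> card B'" using e20 AB nA cA' cB' by linarith+
      show "card (dil k A) + card B' + \<epsilon> * n < real_of_int p" using ep cA' cB' by simp
    qed (use k t t\<epsilon> big in \<open>auto simp: B'_def\<close>)
    then obtain s' N' where N': "0 \<le> N'" "real (card (tr s' (dil k A) - {0..<N'})) \<le> 14 * \<epsilon> * n" "real_of_int N' \<le> card A + 3 * \<epsilon> * n"
      using cA' by auto
    have "real_of_int N' \<le> card A + 14 * \<epsilon> * n" using N'(3) weak by linarith
    moreover have "real_of_int N \<le> card B + 14 * \<epsilon> * n" using NB weak by linarith
    moreover have "real (card (tr s (dil k B) - {0..<N})) \<le> 14 * \<epsilon> * n" using k(4) weak by linarith
    ultimately show ?thesis using k(1,2) N'(1,2) by blast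
  next
    case False
    define U where "U = {x \<in> G. rr A B x < t}"
    have UG: "U \<subseteq> G" by (auto simp: U_def)
    have g: "\<beta> * p \<le> g" using pp by (simp add: g_def algebra_simps)
    have "card B \<le> card G" by (rule card_mono) (use B in auto)
    then have np: "n \<le> p" using p_gt1 AB(2) by simp
    have gb: "\<beta> * n \<le> g"
    proof -
      have "\<beta> * n \<le> \<beta> * p" using np \<beta> by (intro mult_left_mono) auto
      then show ?thesis using g by linarith
    qed
    have cU: "g - \<delta> * n \<le> real (card U)"
    proof -
      have "t * card {x \<in> G. t \<le> rr A B x} \<le> pol t A B" by (rule card_popular)
      then have "real (t * card {x \<in> G. t \<le> rr A B x}) \<le> real (pol t A B)" by (simp only: of_nat_le_iff)
      then have "real t * real (card {x \<in> G. t \<le> rr A B x}) \<le> real t * (real (card A) + real (card B) + \<delta> * n)" using pol by simp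
      then have 1: "real (card {x \<in> G. t \<le> rr A B x}) \<le> real (card A) + real (card B) + \<delta> * n" using t by simp
      have "U = G - {x \<in> G. t \<le> rr A B x}" by (auto simp: U_def)
      moreover have "finite {x \<in> G. t \<le> rr A B x}" by (rule finite_subset[of _ G]) auto
      ultimately have "card U = card G - card {x \<in> G. t \<le> rr A B x}" using card_Diff_subset[of "{x \<in> G. t \<le> rr A B x}" G] by blast
      moreover have "card {x \<in> G. t \<le> rr A B x} \<le> card G" by (rule card_mono) auto
      ultimately have "real (card U) = real_of_int p - real (card {x \<in> G. t \<le> rr A B x})" using p_gt1 by (simp add: of_nat_diff)
      then show ?thesis using 1 by (simp add: g_def)
    qed
    have g0: "0 \<le> g" using gb \<beta> n_pos by (smt (verit) mult_pos_pos of_int_0_le_iff)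
    \<comment> \<open>There are at least \<open>g - \<delta> * n\<close> unpopular sums. Cutting
      their number off at \<open>g\<close>, which here is below \<open>card A\<close> and
      \<open>card B\<close>, secures \<open>2 * card X + card A \<le> p\<close>.\<close>
    obtain V where V: "V \<subseteq> U" "card V = min (card U) (nat g)"
      by (meson min.cobounded1 obtain_subset_with_card_n)
    have VG: "V \<subseteq> G" using V UG by blast
    have cV: "g - \<delta> * n \<le> real (card V)" "int (card V) \<le> g" using V(2) cU g0 \<delta> n_pos by (auto simp: min_def)
    define X where "X = dil (- 1) V"
    have k1: "\<not> p dvd - 1" using p_gt1 by (simp add: zdvd_not_zless)
    have cX: "card X = card V" unfolding X_def by (rule card_dil[OF k1 VG])
    have XG: "X \<subseteq> G" by (simp add: X_def)
    \<comment> \<open>The truncation level of the new pair. The old level \<open>t\<close> is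
      smaller by a factor of order \<delta>, so the unpopular representations add at most
      \<open>\<delta> * n\<close> to the error per unit of \<open>t2\<close>.\<close>
    define t2 where "t2 = nat \<lfloor>\<delta> * n\<rfloor>"
    have dn4: "4 \<le> \<delta> * n"
    proof -
      have "\<delta>\<^sup>2 * n \<le> \<delta> * n" using \<delta> \<delta>1 n_pos by (intro mult_right_mono) (auto simp: power2_eq_square mult_left_le)
      then show ?thesis using big by linarith
    qed
    then have "real t2 = of_int \<lfloor>\<delta> * n\<rfloor>" by (simp add: t2_def)
    then have t2: "real t2 \<le> \<delta> * n" "\<delta> * n / 2 \<le> real t2" using dn4 by linarith+
    define e where "e = nat \<lceil>2 * (\<delta> * n)\<rceil>"
    have "real e = of_int \<lceil>2 * (\<delta> * n)\<rceil>" using dn4 by (simp add: e_def)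
    then have e: "2 * (\<delta> * n) \<le> real e" "real e \<le> 4 * (\<delta> * n)" using dn4 by linarith+
    have d0: "4 * (\<delta> * n) \<le> \<delta>0 * real (card A)"
    proof -
      have "(4 * \<delta>) * n \<le> (\<delta>0 * \<alpha>) * n" using \<delta> n_pos by (intro mult_right_mono) auto
      also have "\<dots> = \<delta>0 * (\<alpha> * n)" by simp
      also have "\<dots> \<le> \<delta>0 * real (card A)" using AB \<delta> by (intro mult_left_mono) auto
      finally show ?thesis by simp
    qed
    have "\<exists>k s N. \<not> p dvd k \<and> 0 \<le> N \<and> N \<le> p \<and> real (card (tr s (dil k A) - {0..<N})) \<le> \<epsilon> * card A \<and>
      real_of_int N \<le> (1 + \<epsilon>) * card A"
    proof (rule st[unfolded structured_def, rule_format, of X A t2 e, OF XG A])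
      show "card X \<le> card A" using cX cV(2) False by linarith
      show "int (2 * card X + card A) \<le> p" using cX cV(2) False AB(1) by (simp add: g_def)
      have "min \<alpha> (\<beta> / 2) * real (card A) \<le> \<beta> / 2 * n" using nA \<beta> by (intro mult_mono) auto
      moreover have "\<beta> / 2 * n \<le> g - \<delta> * n"
      proof -
        have "\<delta> * n \<le> \<beta> / 2 * n" using \<delta> n_pos by (intro mult_right_mono) auto
        then show ?thesis using gb by linarith
      qed
      ultimately show "min \<alpha> (\<beta> / 2) * real (card A) \<le> real (card X)" using cV(1) cX by linarith
      have "int (pol t2 X A) \<le> int t2 * (p - int (card B)) + int (card V * t)"
        unfolding X_def by (rule pol_complement[OF A B VG]) (use V in \<open>auto simp: U_def\<close>)
      then have "real_of_int (int (pol t2 X A)) \<le> real_of_int (int t2 * (p - int (card B)) + int (card V * t))" by (simp only: of_int_le_iff)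
      then have 1: "real (pol t2 X A) \<le> real t2 * (p - real (card B)) + real (card V) * real t" by simp
      have "real (card V) * real t \<le> n * (\<delta>\<^sup>2 * n / 4)"
      proof (rule mult_mono)
        show "real (card V) \<le> n" using cV(2) False nA by linarith
      qed (use t n_pos in auto)
      also have "\<dots> = (\<delta> * n / 2) * (\<delta> * n / 2)" by (simp add: power2_eq_square)
      also have "\<dots> \<le> real t2 * (\<delta> * n)" using t2 dn4 by (intro mult_mono) auto
      finally have 2: "real (card V) * real t \<le> real t2 * (\<delta> * n)" .
      have "real t2 * (p - real (card B)) \<le> real t2 * (real (card X) + real (card A) + \<delta> * n)"
        using cV(1) cX by (intro mult_left_mono) (auto simp: g_def)
      then have "real (pol t2 X A) \<le> real t2 * (real (card X) + real (card A) + 2 * (\<delta> * n))" using 1 2 by (simp add: algebra_simps)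
      also have "\<dots> \<le> real t2 * (real (card X) + real (card A) + real e)" using e by (intro mult_left_mono) auto
      finally have "real (pol t2 X A) \<le> real (t2 * (card X + card A + e))" by simp
      then show "pol t2 X A \<le> t2 * (card X + card A + e)" by (simp only: of_nat_le_iff)
      show "0 < t2" using t2 dn4 by linarith
      show "real t2 \<le> \<delta>0 * real (card A)" "real e \<le> \<delta>0 * real (card A)" using t2 e d0 dn4 by linarith+
      show "n0 \<le> real (card A)" using big AB(3) by linarith
    qed
    then obtain k s N where k: "\<not> p dvd k" "0 \<le> N" "N \<le> p" "real (card (tr s (dil k A) - {0..<N})) \<le> \<epsilon> * card A"
        "real_of_int N \<le> (1 + \<epsilon>) * card A" by blast
    have eA: "\<epsilon> * card A \<le> \<epsilon> * n" using nA \<epsilon> by (intro mult_left_mono) auto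
    define A' where "A' = tr s (dil k A)"
    have cA': "card A' = card A" unfolding A'_def by (simp add: card_tr card_dil[OF k(1) A])
    have cB': "card (dil k B) = card B" by (rule card_dil[OF k(1) B])
    have "pol t (dil k B) A' = pol t B A" unfolding A'_def by (simp add: pol_tr_right pol_dil[OF k(1) B A])
    then have pe: "pol t (dil k B) A' = pol t A B" using pol_commute[OF A B] by simp
    have NA: "real_of_int N \<le> card A + \<epsilon> * n" using k(5) eA by (simp add: algebra_simps)
    have "\<exists>s N'. 0 \<le> N' \<and> N' \<le> p \<and> real (card (tr s (dil k B) - {0..<N'})) \<le> 14 * \<epsilon> * n \<and>
      real_of_int N' \<le> card (dil k B) + 3 * \<epsilon> * n"
    proof (rule other_interval[of "dil k B" A' N \<epsilon> n t])
      show "real (card (A' - {0..<N})) \<le> \<epsilon> * n" using k(4) eA by (simp add: A'_def)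
      show "real_of_int N \<le> card A' + \<epsilon> * n" using NA cA' by simp
      show "real (pol t (dil k B) A') \<le> real t * (card (dil k B) + card A' + \<epsilon> * n)"
        using pol\<epsilon> pe cA' cB' by (simp add: add.commute)
      show "20 * \<epsilon> * n \<le> card (dil k B)" "20 * \<epsilon> * n \<le> card A'" using e20 AB nA cA' cB' by linarith+
      show "card (dil k B) + card A' + \<epsilon> * n < real_of_int p" using ep cA' cB' by simp
    qed (use k t t\<epsilon> big in \<open>auto simp: A'_def\<close>)
    then obtain s' N' where N': "0 \<le> N'" "real (card (tr s' (dil k B) - {0..<N'})) \<le> 14 * \<epsilon> * n" "real_of_int N' \<le> card B + 3 * \<epsilon> * n"
      using cB' by auto
    have "real_of_int N' \<le> card B + 14 * \<epsilon> * n" using N'(3) weak by linarith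
    moreover have "real_of_int N \<le> card A + 14 * \<epsilon> * n" using NA weak by linarith
    moreover have "real (card (tr s (dil k A) - {0..<N})) \<le> 14 * \<epsilon> * n" using k(4) eA weak by linarith
    ultimately show ?thesis using k(1,2) N'(1,2) by blast
  qed
qed

text \<open>The constant \<open>cc\<close> also excludes small sets: \<open>c1 * c2\<close> is at
  most \<open>n * n\<close>, so \<open>cc * n \<le> c1 * c2\<close> forces
  \<open>cc \<le> n\<close>, and every condition that some quantity be large compared with a
  constant follows from this.\<close>

lemma large_product_good_ordered:
  fixes \<alpha> \<beta> \<eta> \<epsilon> \<delta> \<delta>0 n0 cc :: real and R C :: int
  assumes \<alpha>: "0 < \<alpha>" "\<alpha> \<le> 1" and \<beta>: "0 < \<beta>" "\<beta> \<le> 1"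
    and R: "4 \<le> \<alpha> * R" and C: "C = 204 * R + 105" "0 < C" and \<eta>: "0 < \<eta>" "3000 * real_of_int C * \<eta> \<le> \<alpha> * \<beta>"
    and \<epsilon>: "\<epsilon> = \<eta> / 560"
    and st: "structured (min \<alpha> (\<beta> / 2)) \<epsilon> \<delta>0 n0" and \<delta>: "0 < \<delta>" "4 * \<delta> \<le> \<delta>0 * \<alpha>" "\<delta> \<le> \<beta> / 2" "\<delta> \<le> \<epsilon>" "0 < \<delta>0"
    and cc: "0 < cc" "1000000 * real_of_int C \<le> cc * \<eta>" "48 \<le> cc * \<delta>^3" "8 \<le> \<delta>\<^sup>2 * cc" "n0 \<le> \<alpha> * cc" "1 \<le> \<epsilon> * cc"
    and A: "A \<subseteq> G" and B: "B \<subseteq> G" and AB: "card A \<le> card B" "\<alpha> * real (card B) \<le> real (card A)"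
    and pp: "real (card A) + real (card B) \<le> (1 - \<beta>) * p"
    and c: "1 \<le> c1" "c1 \<le> card A" "1 \<le> c2" "c2 \<le> card B" "cc * real (card B) \<le> real c1 * real c2"
  shows "good A B c1 c2"
proof (rule ccontr)
  assume ng: "\<not> good A B c1 c2"
  define n where "n = real (card B)"
  have ne: "A \<noteq> {}" "B \<noteq> {}" using c by auto
  have n0: "n > 0" using c by (simp add: n_def)
  have nA: "real (card A) \<le> n" using AB by (simp add: n_def)
  have ccn: "cc \<le> n"
  proof -
    have "real c1 * real c2 \<le> n * n" using c nA by (intro mult_mono) (auto simp: n_def)
    then have "cc * n \<le> n * n" using c(5) by (simp add: n_def)
    then show ?thesis using n0 by simp
  qed
  have p1: "int (card A + card B) \<le> p"
  proof -
    have "0 \<le> \<beta> * p" using \<beta> p_gt1 by simp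
    then have "real (card A) + real (card B) \<le> p" using pp by (simp add: algebra_simps)
    then show ?thesis by linarith
  qed
  \<comment> \<open>Of order \<open>\<delta>\<^sup>2 * n\<close>: small enough for the passage to
    the negated unpopular sums, yet large enough that sampling with \<open>cc\<close> has error at
    most \<open>\<delta> * n\<close>.\<close>
  define t where "t = nat \<lfloor>\<delta>\<^sup>2 * n / 4\<rfloor>"
  have d2: "8 \<le> \<delta>\<^sup>2 * n" using cc(4) mult_left_mono[OF ccn, of "\<delta>\<^sup>2"] by simp
  then have "real t = of_int \<lfloor>\<delta>\<^sup>2 * n / 4\<rfloor>" by (simp add: t_def)
  then have t: "real t \<le> \<delta>\<^sup>2 * n / 4" "\<delta>\<^sup>2 * n / 8 \<le> real t" using d2 by linarith+
  have t0: "t > 0" using t d2 by linarith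
  have t6: "6 * n \<le> cc * \<delta> * real t"
  proof -
    have "6 * n \<le> (cc * \<delta>^3 / 8) * n" using cc(3) n0 by (intro mult_right_mono) auto
    also have "\<dots> = cc * \<delta> * (\<delta>\<^sup>2 * n / 8)" by (simp add: power2_eq_square power3_eq_cube)
    also have "\<dots> \<le> cc * \<delta> * real t" using t cc \<delta> by (intro mult_left_mono) auto
    finally show ?thesis .
  qed
  have pol: "real (pol t A B) \<le> real t * (real (card A) + real (card B) + \<delta> * n)"
    by (rule not_good_pol[OF A B ne p1 c(2,4) _ nA _ ng t0 t6 cc(1) \<delta>(1)]) (use c(5) in \<open>auto simp: n_def\<close>)
  have \<epsilon>0: "0 < \<epsilon>" using \<eta> \<epsilon> by simp
  have \<epsilon>40: "40 * \<epsilon> \<le> \<alpha> * \<beta>"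
  proof -
    have "1 * \<eta> \<le> real_of_int C * \<eta>" using C \<eta> by (intro mult_right_mono) auto
    then show ?thesis using \<eta> \<epsilon> by linarith
  qed
  have big: "4 \<le> \<delta>\<^sup>2 * n" "n0 \<le> \<alpha> * n" "1 \<le> \<epsilon> * n"
    using d2 cc mult_left_mono[OF ccn, of \<alpha>] mult_left_mono[OF ccn, of \<epsilon>] \<alpha> \<epsilon>0 by linarith+
  obtain k s s' NI NJ where k: "\<not> p dvd k" "0 \<le> NI" "0 \<le> NJ"
    "real (card (tr s (dil k A) - {0..<NI})) \<le> 14 * \<epsilon> * n" "real_of_int NI \<le> card A + 14 * \<epsilon> * n"
    "real (card (tr s' (dil k B) - {0..<NJ})) \<le> 14 * \<epsilon> * n" "real_of_int NJ \<le> card B + 14 * \<epsilon> * n"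
    using near_interval_pair[OF \<alpha> \<beta> \<epsilon>0 \<epsilon>40 st \<delta> A B AB(1) n_def AB(2)[folded n_def] pp pol t0 t(1) big] by blast
  have 14: "14 * \<epsilon> * n = \<eta> * n / 40" by (simp add: \<epsilon>)
  define A' where "A' = tr s (dil k A)"
  define B' where "B' = tr s' (dil k B)"
  have G: "A' \<subseteq> G" "B' \<subseteq> G" by (simp_all add: A'_def B'_def)
  have cA: "card A' = card A" "card B' = card B"
    unfolding A'_def B'_def by (simp_all add: card_tr card_dil[OF k(1)] A B)
  have kA: "real (card (A' - {0..<NI})) \<le> \<eta> * n / 40" "real_of_int NI \<le> real (card A') + \<eta> * n / 40"
    "real (card (B' - {0..<NJ})) \<le> \<eta> * n / 40" "real_of_int NJ \<le> real (card B') + \<eta> * n / 40"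
    using k(4-7) cA unfolding 14 A'_def[symmetric] B'_def[symmetric] by simp_all
  have sz: "real (card A') \<le> n" "real (card B') \<le> n" "\<alpha> * n \<le> real (card A')" "\<alpha> * n \<le> real (card B')"
    using cA nA AB by (simp_all add: n_def)
  have pp': "real (card A') + real (card B') \<le> (1 - \<beta>) * p" "real (card B') + real (card A') \<le> (1 - \<beta>) * p" using pp cA by simp_all
  have cpr: "1000000 * real_of_int C * n \<le> \<eta> * real c1 * real c2" "1000000 * real_of_int C * n \<le> \<eta> * real c2 * real c1"
  proof -
    have "1000000 * real_of_int C * n \<le> cc * \<eta> * n" using cc(2) n0 by (intro mult_right_mono) auto
    also have "\<dots> = \<eta> * (cc * n)" by simp
    also have "\<dots> \<le> \<eta> * (real c1 * real c2)" using c(5) \<eta> by (intro mult_left_mono) (auto simp: n_def)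
    finally show "1000000 * real_of_int C * n \<le> \<eta> * real c1 * real c2" "1000000 * real_of_int C * n \<le> \<eta> * real c2 * real c1"
      by (simp_all add: mult_ac)
  qed
  have "good A' B' c1 c2"
  \<comment> \<open>The construction wants the smaller prescribed size first. This order is
    independent of which set is larger, and the sets may be exchanged.\<close>
  proof (cases "c1 \<le> c2")
    case True
    then show ?thesis
      using c cA by (intro near_intervals_good[OF G \<alpha> \<beta> R C(1) \<eta> sz pp'(1) k(2,3) kA _ _ _ _ cpr(1)]) auto
  next
    case False
    then have "good B' A' c2 c1"
      using c cA by (intro near_intervals_good[OF G(2,1) \<alpha> \<beta> R C(1) \<eta> sz(2,1,4,3) pp'(2) k(3,2) kA(3,4,1,2) _ _ _ _ cpr(2)]) auto
    then show ?thesis by (rule good_swap)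
  qed
  then have "good (dil k A) (dil k B) c1 c2" unfolding A'_def B'_def by (rule good_tr[OF dil_sub dil_sub])
  then have "good A B c1 c2" by (rule good_dil[OF k(1) A B])
  then show False using ng by simp
qed

lemma set_add_residue_ring: "A <+>\<^bsub>residue_ring p\<^esub> B = sm A B"
  by (auto simp: set_add_def' residue_ring_def sm_def)

end

text \<open>The number \<open>j\<close> of uncrossing steps depends only on \<alpha> and \<epsilon>,
  hence so do \<delta> and \<open>n0\<close>; this is where uniformity in \<open>p\<close> is
  secured.\<close>

lemma structured_exists:
  assumes "0 < \<alpha>" "\<alpha> \<le> 1" "0 < \<epsilon>" "\<epsilon> \<le> 1 / 2"
  shows "\<exists>\<delta> n0. 0 < \<delta> \<and> (\<forall>p. zp p \<longrightarrow> zp.structured p \<alpha> \<epsilon> \<delta> n0)"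
proof -
  define \<eta>1 where "\<eta>1 = \<alpha>\<^sup>2 * \<epsilon> * (\<epsilon> / 40) / 100"
  have "0 < \<epsilon> / 40 * \<eta>1 / 200" using assms by (simp add: \<eta>1_def)
  then obtain j where j: "(3 / 4 :: real) ^ j < \<epsilon> / 40 * \<eta>1 / 200" using real_arch_pow_inv[of "\<epsilon> / 40 * \<eta>1 / 200" "3 / 4"] by auto
  define \<delta> where "\<delta> = kap \<alpha> j ^ 4 / (400 * 2 ^ j)"
  have "zp.structured p \<alpha> \<epsilon> \<delta> (24 / (kap \<alpha> j)\<^sup>2 + 2 / \<eta>1)" if "zp p" for p
    unfolding zp.structured_def[OF that] \<delta>_def \<eta>1_def
    using zp.structure_explicit[OF that assms less_imp_le[OF j[unfolded \<eta>1_def]]] by blast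
  moreover have "\<delta> > 0" using kap_bounds[of \<alpha> j] assms by (simp add: \<delta>_def)
  ultimately show ?thesis by blast
qed

lemma large_product_good:
  fixes \<alpha> \<beta> :: real
  assumes \<alpha>: "0 < \<alpha>" "\<alpha> \<le> 1" and \<beta>: "0 < \<beta>" "\<beta> \<le> 1"
  shows "\<exists>c>0. \<forall>p A B c1 c2. zp p \<longrightarrow> A \<subseteq> {0..<p} \<longrightarrow> B \<subseteq> {0..<p} \<longrightarrow>
    \<alpha> * real (card B) \<le> real (card A) \<longrightarrow> \<alpha> * real (card A) \<le> real (card B) \<longrightarrow>
    real (card A) + real (card B) \<le> (1 - \<beta>) * real_of_int p \<longrightarrow>
    1 \<le> c1 \<longrightarrow> c1 \<le> card A \<longrightarrow> 1 \<le> c2 \<longrightarrow> c2 \<le> card B \<longrightarrow>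
    c * real (max (card A) (card B)) \<le> real c1 * real c2 \<longrightarrow> zp.good p A B c1 c2"
proof -
  define R where "R = \<lceil>4 / \<alpha>\<rceil>"
  have "4 / \<alpha> \<le> R" unfolding R_def by (rule le_of_int_ceiling)
  then have R: "4 \<le> \<alpha> * R" using \<alpha> by (simp add: field_simps)
  have R0: "R > 0" using \<alpha> by (simp add: R_def)
  define C where "C = 204 * R + 105"
  have C0: "C > 0" using R0 by (simp add: C_def)
  define \<eta> where "\<eta> = \<alpha> * \<beta> / (3000 * real_of_int C)"
  have \<eta>: "0 < \<eta>" "3000 * real_of_int C * \<eta> \<le> \<alpha> * \<beta>" using \<alpha> \<beta> C0 by (auto simp: \<eta>_def)
  define \<epsilon> where "\<epsilon> = \<eta> / 560"
  have e0: "0 < \<epsilon>" using \<eta> by (simp add: \<epsilon>_def)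
  have "\<alpha> * \<beta> \<le> 1" using \<alpha> \<beta> by (simp add: mult_le_one)
  moreover have "1 * \<eta> \<le> real_of_int C * \<eta>" using C0 \<eta> by (intro mult_right_mono) auto
  ultimately have e2: "\<epsilon> \<le> 1 / 2" using \<eta> unfolding \<epsilon>_def by linarith
  have "0 < min \<alpha> (\<beta> / 2)" "min \<alpha> (\<beta> / 2) \<le> 1" using \<alpha> \<beta> by auto
  then obtain \<delta>0 n0 where st: "0 < \<delta>0" "\<And>p. zp p \<Longrightarrow> zp.structured p (min \<alpha> (\<beta> / 2)) \<epsilon> \<delta>0 n0"
    using structured_exists[of "min \<alpha> (\<beta> / 2)" \<epsilon>] e0 e2 by blast
  define \<delta> where "\<delta> = min (\<delta>0 * \<alpha> / 4) (min (\<beta> / 2) \<epsilon>)"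
  have \<delta>: "0 < \<delta>" "4 * \<delta> \<le> \<delta>0 * \<alpha>" "\<delta> \<le> \<beta> / 2" "\<delta> \<le> \<epsilon>" using st(1) \<alpha> \<beta> e0 by (auto simp: \<delta>_def)
  \<comment> \<open>The summands are the thresholds imposed in turn by the construction, the
    sampling, the truncation level and the structural statement. All are nonnegative, so their sum
    dominates each of them.\<close>
  define cc where "cc = 1000000 * real_of_int C / \<eta> + 48 / \<delta>^3 + 8 / \<delta>\<^sup>2 + \<bar>n0\<bar> / \<alpha> + 1 / \<epsilon>"
  have pos: "0 < 1000000 * real_of_int C / \<eta>" "0 < 48 / \<delta>^3" "0 < 8 / \<delta>\<^sup>2" "0 \<le> \<bar>n0\<bar> / \<alpha>" "0 < 1 / \<epsilon>"
    using C0 \<eta> \<delta> \<alpha> e0 by auto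
  have cc: "0 < cc" "1000000 * real_of_int C / \<eta> \<le> cc" "48 / \<delta>^3 \<le> cc" "8 / \<delta>\<^sup>2 \<le> cc" "\<bar>n0\<bar> / \<alpha> \<le> cc" "1 / \<epsilon> \<le> cc"
    using pos unfolding cc_def by linarith+
  have "1000000 * real_of_int C \<le> cc * \<eta>" using cc(2) \<eta> by (simp add: field_simps)
  moreover have "48 \<le> cc * \<delta>^3" using cc(3) \<delta> by (simp add: field_simps)
  moreover have "8 \<le> \<delta>\<^sup>2 * cc" using cc(4) \<delta> by (simp add: field_simps)
  moreover have "\<bar>n0\<bar> \<le> \<alpha> * cc" using cc(5) \<alpha> by (simp add: field_simps)
  then have "n0 \<le> \<alpha> * cc" by linarith
  moreover have "1 \<le> \<epsilon> * cc" using cc(6) e0 by (simp add: field_simps)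
  ultimately have cc': "1000000 * real_of_int C \<le> cc * \<eta>" "48 \<le> cc * \<delta>^3" "8 \<le> \<delta>\<^sup>2 * cc" "n0 \<le> \<alpha> * cc" "1 \<le> \<epsilon> * cc" by blast+
  show ?thesis
  proof (intro exI[of _ cc] conjI allI impI)
    fix p A B c1 c2
    assume h: "zp p" "A \<subseteq> {0..<p}" "B \<subseteq> {0..<p}" "\<alpha> * real (card B) \<le> real (card A)" "\<alpha> * real (card A) \<le> real (card B)"
      "real (card A) + real (card B) \<le> (1 - \<beta>) * real_of_int p" "1 \<le> c1" "c1 \<le> card A" "1 \<le> c2" "c2 \<le> card B"
      "cc * real (max (card A) (card B)) \<le> real c1 * real c2"
    note L = zp.large_product_good_ordered[OF h(1) \<alpha> \<beta> R C_def C0 \<eta> \<epsilon>_def st(2)[OF h(1)] \<delta> st(1) cc(1) cc']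
    show "zp.good p A B c1 c2"
    proof (cases "card A \<le> card B")
      case True
      show ?thesis by (rule L[OF h(2,3) True h(4,6-10)]) (use h(11) True in \<open>simp add: max_def\<close>)
    next
      case False
      have "zp.good p B A c2 c1"
        by (rule L[OF h(3,2) _ h(5) _ h(9,10,7,8)]) (use h(6,11) False in \<open>simp_all add: max_def mult.commute add.commute\<close>)
      then show ?thesis by (rule zp.good_swap[OF h(1)])
    qed
  qed (rule cc(1))
qed

theorem theorem1:
  fixes \<alpha> \<beta> :: real
  assumes "\<alpha> > 0" and "\<beta> > 0"
  shows "\<exists>c::real. c > 0 \<and>
    (\<forall>p::nat. prime p \<longrightarrow>
      (\<forall>A B. A \<subseteq> carrier (residue_ring (int p)) \<longrightarrow>
             B \<subseteq> carrier (residue_ring (int p)) \<longrightarrow>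
             A \<noteq> {} \<longrightarrow> B \<noteq> {} \<longrightarrow>
             \<alpha> * real (card B) \<le> real (card A) \<longrightarrow>
             real (card A) \<le> inverse \<alpha> * real (card B) \<longrightarrow>
             real (card A) + real (card B) \<le> (1 - \<beta>) * real p \<longrightarrow>
        (\<forall>c\<^sub>1 c\<^sub>2 :: nat.
             1 \<le> c\<^sub>1 \<longrightarrow> c\<^sub>1 \<le> card A \<longrightarrow>
             1 \<le> c\<^sub>2 \<longrightarrow> c\<^sub>2 \<le> card B \<longrightarrow>
             real c\<^sub>1 * real c\<^sub>2 \<ge> c * real (max (card A) (card B)) \<longrightarrow>
          (\<exists>A' B'. A' \<subseteq> A \<and> B' \<subseteq> B \<and> card A' = c\<^sub>1 \<and> card B' = c\<^sub>2 \<and>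
             card (A' <+>\<^bsub>residue_ring (int p)\<^esub> B') \<ge> card A + card B - 1))))"
proof -
  \<comment> \<open>Lowering \<alpha> and \<beta> to at most 1 only weakens the hypotheses, while
    the later estimates use both bounds.\<close>
  define \<alpha>' where "\<alpha>' = min \<alpha> 1"
  define \<beta>' where "\<beta>' = min \<beta> 1"
  have ab: "0 < \<alpha>'" "\<alpha>' \<le> 1" "0 < \<beta>'" "\<beta>' \<le> 1" "\<alpha>' \<le> \<alpha>" "\<beta>' \<le> \<beta>" using assms by (auto simp: \<alpha>'_def \<beta>'_def)
  obtain c :: real where c: "c > 0" and good: "\<And>p A B c1 c2. zp p \<Longrightarrow> A \<subseteq> {0..<p} \<Longrightarrow> B \<subseteq> {0..<p} \<Longrightarrow>
    \<alpha>' * real (card B) \<le> real (card A) \<Longrightarrow> \<alpha>' * real (card A) \<le> real (card B) \<Longrightarrow>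
    real (card A) + real (card B) \<le> (1 - \<beta>') * real_of_int p \<Longrightarrow>
    1 \<le> c1 \<Longrightarrow> c1 \<le> card A \<Longrightarrow> 1 \<le> c2 \<Longrightarrow> c2 \<le> card B \<Longrightarrow>
    c * real (max (card A) (card B)) \<le> real c1 * real c2 \<Longrightarrow> zp.good p A B c1 c2"
    using large_product_good[OF ab(1-4)] by blast
  show ?thesis
  proof (intro exI[of _ c] conjI allI impI, rule c)
    fix p c1 c2 :: nat and A B :: "int set"
    assume h: "prime p" "A \<subseteq> carrier (residue_ring (int p))" "B \<subseteq> carrier (residue_ring (int p))"
      "\<alpha> * real (card B) \<le> real (card A)" "real (card A) \<le> inverse \<alpha> * real (card B)"
      "real (card A) + real (card B) \<le> (1 - \<beta>) * real p"
      "1 \<le> c1" "c1 \<le> card A" "1 \<le> c2" "c2 \<le> card B" "c * real (max (card A) (card B)) \<le> real c1 * real c2"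
    have z: "zp (int p)" using h(1) by unfold_locales simp
    have AB: "A \<subseteq> {0..<int p}" "B \<subseteq> {0..<int p}" using h(2,3) by (auto simp: residue_ring_def)
    have 1: "\<alpha>' * real (card B) \<le> real (card A)" using mult_right_mono[OF ab(5), of "real (card B)"] h(4) by simp
    have "\<alpha> * real (card A) \<le> real (card B)" using h(5) assms by (simp add: field_simps)
    then have 2: "\<alpha>' * real (card A) \<le> real (card B)" using mult_right_mono[OF ab(5), of "real (card A)"] by simp
    have "(1 - \<beta>) * real p \<le> (1 - \<beta>') * real p" using ab by (intro mult_right_mono) auto
    then have 3: "real (card A) + real (card B) \<le> (1 - \<beta>') * real_of_int (int p)" using h(6) by simp
    obtain A' B' where "A' \<subseteq> A" "B' \<subseteq> B" "card A' = c1" "card B' = c2" "card A + card B \<le> card (zp.sm (int p) A' B') + 1"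
      using good[OF z AB 1 2 3 h(7-11)] unfolding zp.good_def[OF z] by blast
    then show "\<exists>A' B'. A' \<subseteq> A \<and> B' \<subseteq> B \<and> card A' = c1 \<and> card B' = c2 \<and>
      card A + card B - 1 \<le> card (A' <+>\<^bsub>residue_ring (int p)\<^esub> B')"
      unfolding zp.set_add_residue_ring[OF z] by (intro exI[of _ A'] exI[of _ B']) simp
  qed
qed

end
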